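(* Let $k$ be a field of characteristic $0$ and let $H$ be a cocommutative Hopf algebra over $k$. If $M$ is a modular crossed module over $H$ with trivial coaction, i.e. $\rho(m)=m\otimes1$ for all $m\in M$, then for every $n\ge0$ $$\mathrm{HC}_n(H,M)\simeq\bigoplus_{i\ge0}\mathrm{Tor}^H_{n-2i}(k,M).$$
   Context: $\otimes=\otimes_k$; $H$ has comultiplication $\Delta(h)=\sum h_{(1)}\otimes h_{(2)}$, counit $\varepsilon$, antipode $S$. A crossed module over $H$ is a left $H$-module $M$ which is also a right $H$-comodule via $\rho(m)=\sum m_{\langle0\rangle}\otimes m_{\langle1\rangle}\in M\otimes H$ such that $\rho(hm)=\sum h_{(2)}m_{\langle0\rangle}\otimes h_{(3)}m_{\langle1\rangle}S(h_{(1)})$. It is modular if $\sum m_{\langle1\rangle}m_{\langle0\rangle}=m$ for all $m$. For a modular crossed module $M$ over $H$, $Z_*(H,M)$ is the cyclic object with $Z_n(H,M)=H^{\otimes(n+1)}\otimes_HM$, where $H^{\otimes(n+1)}$ is a right $H$-module by the diagonal action, faces $\delta_i((h^0,\ldots,h^n)\otimes_Hm)=\varepsilon(h^i)(h^0,\ldots,\widehat{h^i},\ldots,h^n)\otimes_Hm$, degeneracies $\sigma_i((h^0,\ldots,h^n)\otimes_Hm)=(h^0,\ldots,\Delta(h^i),\ldots,h^n)\otimes_Hm$, and cyclic operator $\tau_n((h^0,\ldots,h^n)\otimes_Hm)=\sum(h^nm_{\langle1\rangle},h^0,\ldots,h^{n-1})\otimes_Hm_{\langle0\rangle}$. $\mathrm{HC}_*(H,M)$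 is its cyclic homology (homology of the total complex of the Tsygan double complex). $k$ is the trivial right $H$-module via $\varepsilon$, and $\mathrm{Tor}_j=0$ for $j<0$. *)

theory Defs
  imports "HOL-Algebra.Module" "HOL-Algebra.AbelCoset"
begin

text \<open>
  Vector spaces over the field \<open>K\<close> are \<^const>\<open>module\<close> records; the components
  \<open>mult\<close> and \<open>one\<close> of a record only used as a vector space are irrelevant.
\<close>

section \<open>Linear maps, quotients, direct sums, free modules\<close>

definition linear_maps ::
    "'k ring \<Rightarrow> ('k, 'v, 'a) module_scheme \<Rightarrow> ('k, 'w, 'b) module_scheme \<Rightarrow> ('v \<Rightarrow> 'w) set" where
  "linear_maps K V W = {f \<in> carrier V \<rightarrow> carrier W.
      (\<forall>x \<in> carrier V. \<forall>y \<in> carrier V. f (x \<oplus>\<^bsub>V\<^esub> y) = f x \<oplus>\<^bsub>W\<^esub> f y) \<and>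
      (\<forall>a \<in> carrier K. \<forall>x \<in> carrier V. f (a \<odot>\<^bsub>V\<^esub> x) = a \<odot>\<^bsub>W\<^esub> f x)}"

definition linearly_isomorphic ::
    "'k ring \<Rightarrow> ('k, 'v, 'a) module_scheme \<Rightarrow> ('k, 'w, 'b) module_scheme \<Rightarrow> bool" where
  "linearly_isomorphic K V W \<longleftrightarrow>
     (\<exists>f \<in> linear_maps K V W. bij_betw f (carrier V) (carrier W))"

definition lin_span :: "'k ring \<Rightarrow> ('k, 'v, 'a) module_scheme \<Rightarrow> 'v set \<Rightarrow> 'v set" where
  "lin_span K V S = \<Inter>{N. submodule N K V \<and> S \<subseteq> N}"

definition quotient_module ::
    "('k, 'v, 'a) module_scheme \<Rightarrow> 'v set \<Rightarrow> ('k, 'v set) module" where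
  "quotient_module V N =
     \<lparr>carrier = a_rcosets\<^bsub>V\<^esub> N, mult = undefined, one = undefined,
      zero = N, add = set_add V,
      smult = (\<lambda>a C. \<Union>x\<in>C. N +>\<^bsub>V\<^esub> (a \<odot>\<^bsub>V\<^esub> x))\<rparr>"

definition zero_module :: "('k, 'v) module" where
  "zero_module =
     \<lparr>carrier = {undefined}, mult = undefined, one = undefined,
      zero = undefined, add = (\<lambda>_ _. undefined), smult = (\<lambda>_ _. undefined)\<rparr>"

definition direct_sum :: "'i set \<Rightarrow> ('i \<Rightarrow> ('k, 'v) module) \<Rightarrow> ('k, 'i \<Rightarrow> 'v) module" where
  "direct_sum I V =
     \<lparr>carrier = {f \<in> (\<Pi>\<^sub>E i\<in>I. carrier (V i)). finite {i \<in> I. f i \<noteq> \<zero>\<^bsub>V i\<^esub>}},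
      mult = undefined, one = undefined,
      zero = (\<lambda>i\<in>I. \<zero>\<^bsub>V i\<^esub>),
      add = (\<lambda>f g. \<lambda>i\<in>I. f i \<oplus>\<^bsub>V i\<^esub> g i),
      smult = (\<lambda>a f. \<lambda>i\<in>I. a \<odot>\<^bsub>V i\<^esub> f i)\<rparr>"

definition fin_supp :: "('r, 'a) ring_scheme \<Rightarrow> 'x set \<Rightarrow> ('x \<Rightarrow> 'r) set" where
  "fin_supp R X =
     {f. (\<forall>x \<in> X. f x \<in> carrier R) \<and> (\<forall>x. x \<notin> X \<longrightarrow> f x = \<zero>\<^bsub>R\<^esub>) \<and> finite {x. f x \<noteq> \<zero>\<^bsub>R\<^esub>}}"

definition free_module :: "'k ring \<Rightarrow> 'x set \<Rightarrow> ('k, 'x \<Rightarrow> 'k) module" where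
  "free_module K X =
     \<lparr>carrier = fin_supp K X, mult = undefined, one = undefined,
      zero = (\<lambda>_. \<zero>\<^bsub>K\<^esub>), add = (\<lambda>f g x. f x \<oplus>\<^bsub>K\<^esub> g x),
      smult = (\<lambda>a f x. a \<otimes>\<^bsub>K\<^esub> f x)\<rparr>"

definition generator :: "'k ring \<Rightarrow> 'x \<Rightarrow> 'x \<Rightarrow> 'k" where
  "generator K x = (\<lambda>y. if y = x then \<one>\<^bsub>K\<^esub> else \<zero>\<^bsub>K\<^esub>)"

text \<open>
  Sweedler sums. Every tensor product below is a quotient of a free module on a set \<open>X\<close> of
  symbols (tuples). For \<open>u\<close> in such a quotient, \<open>sweedler K W F u\<close> writes \<open>u\<close> as a
  combination of classes of symbols and returns the same combination of the values \<open>F x\<close>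
  in \<open>W\<close>. It is the linear map out of the quotient induced by \<open>F\<close>, independent of the chosen
  representative, as soon as \<open>F\<close> respects the relations that define the quotient.
\<close>

definition sweedler ::
    "'k ring \<Rightarrow> ('k, 'w, 'b) module_scheme \<Rightarrow> ('x \<Rightarrow> 'w) \<Rightarrow> ('x \<Rightarrow> 'k) set \<Rightarrow> 'w" where
  "sweedler K W F u =
     (let f = (SOME f. f \<in> u) in \<Oplus>\<^bsub>W\<^esub>x\<in>{x. f x \<noteq> \<zero>\<^bsub>K\<^esub>}. f x \<odot>\<^bsub>W\<^esub> F x)"


section \<open>Tensor products over the field\<close>

definition bilinear_relations ::
    "'k ring \<Rightarrow> ('k, 'v, 'a) module_scheme \<Rightarrow> ('k, 'w, 'b) module_scheme \<Rightarrow> ('v \<times> 'w \<Rightarrow> 'k) set" where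
  "bilinear_relations K V W =
     (let F = free_module K (carrier V \<times> carrier W); g = generator K in
       {g (x \<oplus>\<^bsub>V\<^esub> x', y) \<ominus>\<^bsub>F\<^esub> (g (x, y) \<oplus>\<^bsub>F\<^esub> g (x', y)) | x x' y.
          x \<in> carrier V \<and> x' \<in> carrier V \<and> y \<in> carrier W} \<union>
       {g (x, y \<oplus>\<^bsub>W\<^esub> y') \<ominus>\<^bsub>F\<^esub> (g (x, y) \<oplus>\<^bsub>F\<^esub> g (x, y')) | x y y'.
          x \<in> carrier V \<and> y \<in> carrier W \<and> y' \<in> carrier W} \<union>
       {g (a \<odot>\<^bsub>V\<^esub> x, y) \<ominus>\<^bsub>F\<^esub> a \<odot>\<^bsub>F\<^esub> g (x, y) | a x y.
          a \<in> carrier K \<and> x \<in> carrier V \<and> y \<in> carrier W} \<union>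
       {g (x, a \<odot>\<^bsub>W\<^esub> y) \<ominus>\<^bsub>F\<^esub> a \<odot>\<^bsub>F\<^esub> g (x, y) | a x y.
          a \<in> carrier K \<and> x \<in> carrier V \<and> y \<in> carrier W})"

definition tensor_null ::
    "'k ring \<Rightarrow> ('k, 'v, 'a) module_scheme \<Rightarrow> ('k, 'w, 'b) module_scheme \<Rightarrow> ('v \<times> 'w \<Rightarrow> 'k) set" where
  "tensor_null K V W =
     lin_span K (free_module K (carrier V \<times> carrier W)) (bilinear_relations K V W)"

definition tensor ::
    "'k ring \<Rightarrow> ('k, 'v, 'a) module_scheme \<Rightarrow> ('k, 'w, 'b) module_scheme
      \<Rightarrow> ('k, ('v \<times> 'w \<Rightarrow> 'k) set) module" where
  "tensor K V W = quotient_module (free_module K (carrier V \<times> carrier W)) (tensor_null K V W)"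

definition pure_tensor ::
    "'k ring \<Rightarrow> ('k, 'v, 'a) module_scheme \<Rightarrow> ('k, 'w, 'b) module_scheme
      \<Rightarrow> 'v \<Rightarrow> 'w \<Rightarrow> ('v \<times> 'w \<Rightarrow> 'k) set" where
  "pure_tensor K V W x y =
     tensor_null K V W +>\<^bsub>free_module K (carrier V \<times> carrier W)\<^esub> generator K (x, y)"

text \<open>
  The tensor powers of \<open>V\<close>, unlike the iterated binary tensor product, have to live in
  one type for all exponents: symbols are lists \<open>[v\<^sub>1, \<dots>, v\<^sub>n]\<close> instead of nested pairs.
\<close>

definition tuples :: "('k, 'v, 'a) module_scheme \<Rightarrow> nat \<Rightarrow> 'v list set" where
  "tuples V n = {xs. length xs = n \<and> set xs \<subseteq> carrier V}"

definition multilinear_relations ::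
    "'k ring \<Rightarrow> ('k, 'v, 'a) module_scheme \<Rightarrow> nat \<Rightarrow> ('v list \<Rightarrow> 'k) set" where
  "multilinear_relations K V n =
     (let F = free_module K (tuples V n); g = generator K in
       {g (xs[i := x \<oplus>\<^bsub>V\<^esub> y]) \<ominus>\<^bsub>F\<^esub> (g (xs[i := x]) \<oplus>\<^bsub>F\<^esub> g (xs[i := y])) | xs i x y.
          xs \<in> tuples V n \<and> i < n \<and> x \<in> carrier V \<and> y \<in> carrier V} \<union>
       {g (xs[i := a \<odot>\<^bsub>V\<^esub> x]) \<ominus>\<^bsub>F\<^esub> a \<odot>\<^bsub>F\<^esub> g (xs[i := x]) | xs i a x.
          xs \<in> tuples V n \<and> i < n \<and> a \<in> carrier K \<and> x \<in> carrier V})"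

definition tensor_power_null ::
    "'k ring \<Rightarrow> ('k, 'v, 'a) module_scheme \<Rightarrow> nat \<Rightarrow> ('v list \<Rightarrow> 'k) set" where
  "tensor_power_null K V n =
     lin_span K (free_module K (tuples V n)) (multilinear_relations K V n)"

definition tensor_power ::
    "'k ring \<Rightarrow> ('k, 'v, 'a) module_scheme \<Rightarrow> nat \<Rightarrow> ('k, ('v list \<Rightarrow> 'k) set) module" where
  "tensor_power K V n = quotient_module (free_module K (tuples V n)) (tensor_power_null K V n)"

definition pure_power ::
    "'k ring \<Rightarrow> ('k, 'v, 'a) module_scheme \<Rightarrow> 'v list \<Rightarrow> ('v list \<Rightarrow> 'k) set" where
  "pure_power K V xs =
     tensor_power_null K V (length xs) +>\<^bsub>free_module K (tuples V (length xs))\<^esub> generator K xs"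


section \<open>Hopf algebras\<close>

record ('k, 'h) hopf = "('k, 'h) module" +
  comult :: "'h \<Rightarrow> ('h list \<Rightarrow> 'k) set"
  counit :: "'h \<Rightarrow> 'k"
  antipode :: "'h \<Rightarrow> 'h"

definition comult_at :: "'k ring \<Rightarrow> ('k, 'h) hopf \<Rightarrow> nat \<Rightarrow> 'h list \<Rightarrow> ('h list \<Rightarrow> 'k) set" where
  "comult_at K H i xs =
     sweedler K (tensor_power K H (Suc (length xs)))
       (\<lambda>ys. pure_power K H (take i xs @ ys @ drop (Suc i) xs)) (comult H (xs ! i))"

definition power_mult ::
    "'k ring \<Rightarrow> ('k, 'h) hopf \<Rightarrow> nat
      \<Rightarrow> ('h list \<Rightarrow> 'k) set \<Rightarrow> ('h list \<Rightarrow> 'k) set \<Rightarrow> ('h list \<Rightarrow> 'k) set" where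
  "power_mult K H n s t =
     sweedler K (tensor_power K H n)
       (\<lambda>xs. sweedler K (tensor_power K H n)
          (\<lambda>ys. pure_power K H (map2 (\<lambda>x y. x \<otimes>\<^bsub>H\<^esub> y) xs ys)) t) s"

locale hopf_algebra = field K + ring H + module K H
  for K :: "'k ring" and H :: "('k, 'h) hopf" +
  assumes smult_mult_left:
      "\<lbrakk>a \<in> carrier K; x \<in> carrier H; y \<in> carrier H\<rbrakk>
        \<Longrightarrow> (a \<odot>\<^bsub>H\<^esub> x) \<otimes>\<^bsub>H\<^esub> y = a \<odot>\<^bsub>H\<^esub> (x \<otimes>\<^bsub>H\<^esub> y)"
    and smult_mult_right:
      "\<lbrakk>a \<in> carrier K; x \<in> carrier H; y \<in> carrier H\<rbrakk>
        \<Longrightarrow> x \<otimes>\<^bsub>H\<^esub> (a \<odot>\<^bsub>H\<^esub> y) = a \<odot>\<^bsub>H\<^esub> (x \<otimes>\<^bsub>H\<^esub> y)"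
    and comult_linear: "comult H \<in> linear_maps K H (tensor_power K H 2)"
    and comult_mult:
      "\<lbrakk>x \<in> carrier H; y \<in> carrier H\<rbrakk>
        \<Longrightarrow> comult H (x \<otimes>\<^bsub>H\<^esub> y) = power_mult K H 2 (comult H x) (comult H y)"
    and comult_one: "comult H \<one>\<^bsub>H\<^esub> = pure_power K H [\<one>\<^bsub>H\<^esub>, \<one>\<^bsub>H\<^esub>]"
    and counit_closed: "x \<in> carrier H \<Longrightarrow> counit H x \<in> carrier K"
    and counit_add:
      "\<lbrakk>x \<in> carrier H; y \<in> carrier H\<rbrakk>
        \<Longrightarrow> counit H (x \<oplus>\<^bsub>H\<^esub> y) = counit H x \<oplus>\<^bsub>K\<^esub> counit H y"
    and counit_smult:
      "\<lbrakk>a \<in> carrier K; x \<in> carrier H\<rbrakk> \<Longrightarrow> counit H (a \<odot>\<^bsub>H\<^esub> x) = a \<otimes>\<^bsub>K\<^esub> counit H x"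
    and counit_mult:
      "\<lbrakk>x \<in> carrier H; y \<in> carrier H\<rbrakk>
        \<Longrightarrow> counit H (x \<otimes>\<^bsub>H\<^esub> y) = counit H x \<otimes>\<^bsub>K\<^esub> counit H y"
    and counit_one: "counit H \<one>\<^bsub>H\<^esub> = \<one>\<^bsub>K\<^esub>"
    and coassociative:
      "x \<in> carrier H \<Longrightarrow>
        sweedler K (tensor_power K H 3) (comult_at K H 0) (comult H x) =
        sweedler K (tensor_power K H 3) (comult_at K H 1) (comult H x)"
    and counit_left:
      "x \<in> carrier H \<Longrightarrow> sweedler K H (\<lambda>xs. counit H (xs ! 0) \<odot>\<^bsub>H\<^esub> (xs ! 1)) (comult H x) = x"
    and counit_right:
      "x \<in> carrier H \<Longrightarrow> sweedler K H (\<lambda>xs. counit H (xs ! 1) \<odot>\<^bsub>H\<^esub> (xs ! 0)) (comult H x) = x"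
    and antipode_linear: "antipode H \<in> linear_maps K H H"
    and antipode_left:
      "x \<in> carrier H \<Longrightarrow>
        sweedler K H (\<lambda>xs. antipode H (xs ! 0) \<otimes>\<^bsub>H\<^esub> (xs ! 1)) (comult H x) = counit H x \<odot>\<^bsub>H\<^esub> \<one>\<^bsub>H\<^esub>"
    and antipode_right:
      "x \<in> carrier H \<Longrightarrow>
        sweedler K H (\<lambda>xs. (xs ! 0) \<otimes>\<^bsub>H\<^esub> antipode H (xs ! 1)) (comult H x) = counit H x \<odot>\<^bsub>H\<^esub> \<one>\<^bsub>H\<^esub>"

definition cocommutative :: "'k ring \<Rightarrow> ('k, 'h) hopf \<Rightarrow> bool" where
  "cocommutative K H \<longleftrightarrow>
     (\<forall>x \<in> carrier H.
        sweedler K (tensor_power K H 2) (\<lambda>xs. pure_power K H (rev xs)) (comult H x) = comult H x)"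

text \<open>\<open>iterated_comult K H n h\<close> is \<open>\<Sum> h\<^sub>1 \<otimes> \<cdots> \<otimes> h\<^sub>n\<^sub>+\<^sub>1\<close> in the \<open>(n+1)\<close>-st tensor power.\<close>

primrec iterated_comult :: "'k ring \<Rightarrow> ('k, 'h) hopf \<Rightarrow> nat \<Rightarrow> 'h \<Rightarrow> ('h list \<Rightarrow> 'k) set" where
  "iterated_comult K H 0 h = pure_power K H [h]"
| "iterated_comult K H (Suc n) h =
     sweedler K (tensor_power K H (Suc (Suc n))) (comult_at K H 0) (iterated_comult K H n h)"


section \<open>Modules over the Hopf algebra\<close>

record ('k, 'h, 'x) right_module = "('k, 'x) module" +
  ract :: "'x \<Rightarrow> 'h \<Rightarrow> 'x"

record ('k, 'h, 'm) crossed = "('k, 'm) module" +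
  lact :: "'h \<Rightarrow> 'm \<Rightarrow> 'm"
  coact :: "'m \<Rightarrow> ('m \<times> 'h \<Rightarrow> 'k) set"

locale right_hmodule = module K X
  for K :: "'k ring" and H :: "('k, 'h) hopf" and X :: "('k, 'h, 'x) right_module" +
  assumes ract_linear_left:
      "h \<in> carrier H \<Longrightarrow> (\<lambda>x. ract X x h) \<in> linear_maps K X X"
    and ract_linear_right:
      "x \<in> carrier X \<Longrightarrow> ract X x \<in> linear_maps K H X"
    and ract_one: "x \<in> carrier X \<Longrightarrow> ract X x \<one>\<^bsub>H\<^esub> = x"
    and ract_mult:
      "\<lbrakk>x \<in> carrier X; g \<in> carrier H; h \<in> carrier H\<rbrakk>
        \<Longrightarrow> ract X x (g \<otimes>\<^bsub>H\<^esub> h) = ract X (ract X x g) h"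

text \<open>
  The last axiom reads \<open>\<rho>(hm) = \<Sum> h\<^sub>2 m\<^sub>0 \<otimes> h\<^sub>3 m\<^sub>1 S(h\<^sub>1)\<close>; the lists
  \<open>[h\<^sub>1, h\<^sub>2, h\<^sub>3]\<close> are indexed from \<open>0\<close>.
\<close>

locale crossed_module = module K M
  for K :: "'k ring" and H :: "('k, 'h) hopf" and M :: "('k, 'h, 'm) crossed" +
  assumes lact_linear_right:
      "h \<in> carrier H \<Longrightarrow> lact M h \<in> linear_maps K M M"
    and lact_linear_left:
      "m \<in> carrier M \<Longrightarrow> (\<lambda>h. lact M h m) \<in> linear_maps K H M"
    and lact_one: "m \<in> carrier M \<Longrightarrow> lact M \<one>\<^bsub>H\<^esub> m = m"
    and lact_mult:
      "\<lbrakk>g \<in> carrier H; h \<in> carrier H; m \<in> carrier M\<rbrakk>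
        \<Longrightarrow> lact M (g \<otimes>\<^bsub>H\<^esub> h) m = lact M g (lact M h m)"
    and coact_linear: "coact M \<in> linear_maps K M (tensor K M H)"
    and coact_coassociative:
      "m \<in> carrier M \<Longrightarrow>
        sweedler K (tensor K M (tensor_power K H 2))
          (\<lambda>(m0, h). sweedler K (tensor K M (tensor_power K H 2))
             (\<lambda>(m00, h'). pure_tensor K M (tensor_power K H 2) m00 (pure_power K H [h', h]))
             (coact M m0))
          (coact M m) =
        sweedler K (tensor K M (tensor_power K H 2))
          (\<lambda>(m0, h). pure_tensor K M (tensor_power K H 2) m0 (comult H h)) (coact M m)"
    and coact_counit:
      "m \<in> carrier M \<Longrightarrow> sweedler K M (\<lambda>(m0, h). counit H h \<odot>\<^bsub>M\<^esub> m0) (coact M m) = m"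
    and coact_lact:
      "\<lbrakk>h \<in> carrier H; m \<in> carrier M\<rbrakk> \<Longrightarrow>
        coact M (lact M h m) =
        sweedler K (tensor K M H)
          (\<lambda>hs. sweedler K (tensor K M H)
             (\<lambda>(m0, m1). pure_tensor K M H (lact M (hs ! 1) m0)
                ((hs ! 2) \<otimes>\<^bsub>H\<^esub> m1 \<otimes>\<^bsub>H\<^esub> antipode H (hs ! 0)))
             (coact M m))
          (iterated_comult K H 2 h)"

definition modular :: "'k ring \<Rightarrow> ('k, 'h, 'm) crossed \<Rightarrow> bool" where
  "modular K M \<longleftrightarrow> (\<forall>m \<in> carrier M. sweedler K M (\<lambda>(m0, m1). lact M m1 m0) (coact M m) = m)"

definition trivial_coaction :: "'k ring \<Rightarrow> ('k, 'h) hopf \<Rightarrow> ('k, 'h, 'm) crossed \<Rightarrow> bool" where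
  "trivial_coaction K H M \<longleftrightarrow> (\<forall>m \<in> carrier M. coact M m = pure_tensor K M H m \<one>\<^bsub>H\<^esub>)"

definition trivial_right_module :: "'k ring \<Rightarrow> ('k, 'h) hopf \<Rightarrow> ('k, 'h, 'k) right_module" where
  "trivial_right_module K H =
     \<lparr>carrier = carrier K, mult = undefined, one = undefined,
      zero = \<zero>\<^bsub>K\<^esub>, add = (\<lambda>x y. x \<oplus>\<^bsub>K\<^esub> y), smult = (\<lambda>a x. a \<otimes>\<^bsub>K\<^esub> x),
      ract = (\<lambda>x h. x \<otimes>\<^bsub>K\<^esub> counit H h)\<rparr>"

definition diagonal_power ::
    "'k ring \<Rightarrow> ('k, 'h) hopf \<Rightarrow> nat \<Rightarrow> ('k, 'h, ('h list \<Rightarrow> 'k) set) right_module" where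
  "diagonal_power K H n =
     module.extend (tensor_power K H (Suc n))
       \<lparr>ract = (\<lambda>t h. power_mult K H (Suc n) t (iterated_comult K H n h))\<rparr>"

text \<open>The tensor product \<open>X \<otimes>\<^sub>H M\<close>; the comodule structure of \<open>M\<close> plays no role.\<close>

definition balanced_null ::
    "'k ring \<Rightarrow> ('k, 'h) hopf \<Rightarrow> ('k, 'h, 'x) right_module \<Rightarrow> ('k, 'h, 'm) crossed
      \<Rightarrow> ('x \<times> 'm \<Rightarrow> 'k) set" where
  "balanced_null K H X M =
     (let F = free_module K (carrier X \<times> carrier M) in
       lin_span K F
         (bilinear_relations K X M \<union>
          {generator K (ract X x h, m) \<ominus>\<^bsub>F\<^esub> generator K (x, lact M h m) | x h m.
             x \<in> carrier X \<and> h \<in> carrier H \<and> m \<in> carrier M}))"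

definition balanced_tensor ::
    "'k ring \<Rightarrow> ('k, 'h) hopf \<Rightarrow> ('k, 'h, 'x) right_module \<Rightarrow> ('k, 'h, 'm) crossed
      \<Rightarrow> ('k, ('x \<times> 'm \<Rightarrow> 'k) set) module" where
  "balanced_tensor K H X M =
     quotient_module (free_module K (carrier X \<times> carrier M)) (balanced_null K H X M)"

definition pure_balanced ::
    "'k ring \<Rightarrow> ('k, 'h) hopf \<Rightarrow> ('k, 'h, 'x) right_module \<Rightarrow> ('k, 'h, 'm) crossed
      \<Rightarrow> 'x \<Rightarrow> 'm \<Rightarrow> ('x \<times> 'm \<Rightarrow> 'k) set" where
  "pure_balanced K H X M x m =
     balanced_null K H X M +>\<^bsub>free_module K (carrier X \<times> carrier M)\<^esub> generator K (x, m)"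

definition balanced_map ::
    "'k ring \<Rightarrow> ('k, 'h) hopf \<Rightarrow> ('k, 'h, 'y) right_module \<Rightarrow> ('k, 'h, 'm) crossed
      \<Rightarrow> ('x \<Rightarrow> 'y) \<Rightarrow> ('x \<times> 'm \<Rightarrow> 'k) set \<Rightarrow> ('y \<times> 'm \<Rightarrow> 'k) set" where
  "balanced_map K H Y M f =
     sweedler K (balanced_tensor K H Y M) (\<lambda>(x, m). pure_balanced K H Y M (f x) m)"


section \<open>Homology of complexes and Tor\<close>

text \<open>
  A complex is given by modules \<open>C n\<close> and differentials \<open>d n\<close> from \<open>C n\<close> to
  \<open>C (n - 1)\<close>, for \<open>n \<ge> 1\<close>; the value \<open>d 0\<close> is never used.
\<close>

definition cycles :: "(nat \<Rightarrow> ('k, 'v) module) \<Rightarrow> (nat \<Rightarrow> 'v \<Rightarrow> 'v) \<Rightarrow> nat \<Rightarrow> 'v set" where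
  "cycles C d n = {x \<in> carrier (C n). n > 0 \<longrightarrow> d n x = \<zero>\<^bsub>C (n - 1)\<^esub>}"

definition homology ::
    "(nat \<Rightarrow> ('k, 'v) module) \<Rightarrow> (nat \<Rightarrow> 'v \<Rightarrow> 'v) \<Rightarrow> nat \<Rightarrow> ('k, 'v set) module" where
  "homology C d n =
     quotient_module ((C n)\<lparr>carrier := cycles C d n\<rparr>) (d (Suc n) ` carrier (C (Suc n)))"

definition right_linear_maps ::
    "'k ring \<Rightarrow> ('k, 'h) hopf \<Rightarrow> ('k, 'h, 'x) right_module \<Rightarrow> ('k, 'h, 'y) right_module
      \<Rightarrow> ('x \<Rightarrow> 'y) set" where
  "right_linear_maps K H X Y = {f \<in> linear_maps K X Y.
      \<forall>x \<in> carrier X. \<forall>h \<in> carrier H. f (ract X x h) = ract Y (f x) h}"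

definition free_right_module ::
    "('k, 'h) hopf \<Rightarrow> 'x set \<Rightarrow> ('k, 'h, 'x \<Rightarrow> 'h) right_module" where
  "free_right_module H X =
     \<lparr>carrier = fin_supp H X, mult = undefined, one = undefined,
      zero = (\<lambda>_. \<zero>\<^bsub>H\<^esub>), add = (\<lambda>f g x. f x \<oplus>\<^bsub>H\<^esub> g x), smult = (\<lambda>a f x. a \<odot>\<^bsub>H\<^esub> f x),
      ract = (\<lambda>f h x. f x \<otimes>\<^bsub>H\<^esub> h)\<rparr>"

text \<open>
  Projective means: direct summand of a free module. A basis indexed by elements of \<open>P\<close>
  itself suffices, because \<open>P\<close> is a quotient of the free module on its carrier.
\<close>

definition projective_right ::
    "'k ring \<Rightarrow> ('k, 'h) hopf \<Rightarrow> ('k, 'h, 'p) right_module \<Rightarrow> bool" where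
  "projective_right K H P \<longleftrightarrow> right_hmodule K H P \<and>
     (\<exists>(X :: 'p set). \<exists>i \<in> right_linear_maps K H P (free_right_module H X).
        \<exists>r \<in> right_linear_maps K H (free_right_module H X) P. \<forall>x \<in> carrier P. r (i x) = x)"

definition projective_resolution ::
    "'k ring \<Rightarrow> ('k, 'h) hopf \<Rightarrow> ('k, 'h, 'a) right_module
      \<Rightarrow> (nat \<Rightarrow> ('k, 'h, 'p) right_module) \<Rightarrow> (nat \<Rightarrow> 'p \<Rightarrow> 'p) \<Rightarrow> ('p \<Rightarrow> 'a) \<Rightarrow> bool" where
  "projective_resolution K H A P d e \<longleftrightarrow>
     (\<forall>n. projective_right K H (P n)) \<and>
     (\<forall>n. d (Suc n) \<in> right_linear_maps K H (P (Suc n)) (P n)) \<and>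
     e \<in> right_linear_maps K H (P 0) A \<and>
     e ` carrier (P 0) = carrier A \<and>
     {x \<in> carrier (P 0). e x = \<zero>\<^bsub>A\<^esub>} = d 1 ` carrier (P 1) \<and>
     (\<forall>n. {x \<in> carrier (P (Suc n)). d (Suc n) x = \<zero>\<^bsub>P n\<^esub>} = d (Suc (Suc n)) ` carrier (P (Suc (Suc n))))"

text \<open>
  \<open>Tor K H P d M j\<close> is \<open>Tor\<^sub>j(A, M)\<close> computed with the projective resolution \<open>(P, d)\<close>
  of the right module \<open>A\<close>, for an integer \<open>j\<close>.
\<close>

definition Tor ::
    "'k ring \<Rightarrow> ('k, 'h) hopf \<Rightarrow> (nat \<Rightarrow> ('k, 'h, 'p) right_module) \<Rightarrow> (nat \<Rightarrow> 'p \<Rightarrow> 'p)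
      \<Rightarrow> ('k, 'h, 'm) crossed \<Rightarrow> int \<Rightarrow> ('k, ('p \<times> 'm \<Rightarrow> 'k) set set) module" where
  "Tor K H P d M j =
     (if j < 0 then zero_module
      else homology (\<lambda>n. balanced_tensor K H (P n) M)
             (\<lambda>n. balanced_map K H (P (n - 1)) M (d n)) (nat j))"


section \<open>Cyclic homology\<close>

text \<open>In degree \<open>n\<close>: the module, the faces and degeneracies, and the cyclic operator.\<close>

record ('k, 'v) cyclic_object =
  obj :: "nat \<Rightarrow> ('k, 'v) module"
  face :: "nat \<Rightarrow> nat \<Rightarrow> 'v \<Rightarrow> 'v"
  degen :: "nat \<Rightarrow> nat \<Rightarrow> 'v \<Rightarrow> 'v"
  cyc :: "nat \<Rightarrow> 'v \<Rightarrow> 'v"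

definition signed :: "('k, 'v) module \<Rightarrow> nat \<Rightarrow> 'v \<Rightarrow> 'v" where
  "signed V i x = (if even i then x else \<ominus>\<^bsub>V\<^esub> x)"

definition hochschild_b :: "('k, 'v) cyclic_object \<Rightarrow> nat \<Rightarrow> 'v \<Rightarrow> 'v" where
  "hochschild_b Z q x = (\<Oplus>\<^bsub>obj Z (q - 1)\<^esub>i\<in>{..q}. signed (obj Z (q - 1)) i (face Z q i x))"

definition hochschild_b' :: "('k, 'v) cyclic_object \<Rightarrow> nat \<Rightarrow> 'v \<Rightarrow> 'v" where
  "hochschild_b' Z q x = (\<Oplus>\<^bsub>obj Z (q - 1)\<^esub>i\<in>{..<q}. signed (obj Z (q - 1)) i (face Z q i x))"

definition signed_cyc :: "('k, 'v) cyclic_object \<Rightarrow> nat \<Rightarrow> 'v \<Rightarrow> 'v" where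
  "signed_cyc Z q x = signed (obj Z q) q (cyc Z q x)"

definition cyclic_norm :: "('k, 'v) cyclic_object \<Rightarrow> nat \<Rightarrow> 'v \<Rightarrow> 'v" where
  "cyclic_norm Z q x = (\<Oplus>\<^bsub>obj Z q\<^esub>j\<in>{..q}. (signed_cyc Z q ^^ j) x)"

text \<open>
  The Tsygan double complex has the module of degree \<open>q\<close> in every position \<open>(p, q)\<close> with
  \<open>p, q \<ge> 0\<close>. The vertical differential is \<open>b\<close> in the even and \<open>-b'\<close> in the odd columns,
  the horizontal one from column \<open>p\<close> to column \<open>p - 1\<close> is \<open>1 - t\<close> for odd and the norm
  \<open>N\<close> for even \<open>p\<close>.
\<close>

definition tsygan_vertical :: "('k, 'v) cyclic_object \<Rightarrow> nat \<Rightarrow> nat \<Rightarrow> 'v \<Rightarrow> 'v" where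
  "tsygan_vertical Z p q x =
     (if even p then hochschild_b Z q x else \<ominus>\<^bsub>obj Z (q - 1)\<^esub> hochschild_b' Z q x)"

definition tsygan_horizontal :: "('k, 'v) cyclic_object \<Rightarrow> nat \<Rightarrow> nat \<Rightarrow> 'v \<Rightarrow> 'v" where
  "tsygan_horizontal Z p q x =
     (if even p then cyclic_norm Z q x else x \<ominus>\<^bsub>obj Z q\<^esub> signed_cyc Z q x)"

definition tsygan_total :: "('k, 'v) cyclic_object \<Rightarrow> nat \<Rightarrow> ('k, nat \<Rightarrow> 'v) module" where
  "tsygan_total Z n = direct_sum {..n} (\<lambda>p. obj Z (n - p))"

definition tsygan_differential ::
    "('k, 'v) cyclic_object \<Rightarrow> nat \<Rightarrow> (nat \<Rightarrow> 'v) \<Rightarrow> nat \<Rightarrow> 'v" where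
  "tsygan_differential Z n f =
     (\<lambda>p\<in>{..n - 1}. tsygan_vertical Z p (n - p) (f p)
        \<oplus>\<^bsub>obj Z (n - 1 - p)\<^esub> tsygan_horizontal Z (Suc p) (n - 1 - p) (f (Suc p)))"

definition cyclic_homology ::
    "('k, 'v) cyclic_object \<Rightarrow> nat \<Rightarrow> ('k, (nat \<Rightarrow> 'v) set) module" where
  "cyclic_homology Z n = homology (tsygan_total Z) (tsygan_differential Z) n"


section \<open>The cyclic object of a modular crossed module\<close>

definition power_face ::
    "'k ring \<Rightarrow> ('k, 'h) hopf \<Rightarrow> nat \<Rightarrow> nat \<Rightarrow> ('h list \<Rightarrow> 'k) set \<Rightarrow> ('h list \<Rightarrow> 'k) set" where
  "power_face K H n i =
     sweedler K (tensor_power K H n)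
       (\<lambda>hs. counit H (hs ! i) \<odot>\<^bsub>tensor_power K H n\<^esub>
          pure_power K H (take i hs @ drop (Suc i) hs))"

definition power_degen ::
    "'k ring \<Rightarrow> ('k, 'h) hopf \<Rightarrow> nat \<Rightarrow> nat \<Rightarrow> ('h list \<Rightarrow> 'k) set \<Rightarrow> ('h list \<Rightarrow> 'k) set" where
  "power_degen K H n i = sweedler K (tensor_power K H (Suc (Suc n))) (comult_at K H i)"

definition crossed_cyc ::
    "'k ring \<Rightarrow> ('k, 'h) hopf \<Rightarrow> ('k, 'h, 'm) crossed \<Rightarrow> nat
      \<Rightarrow> (('h list \<Rightarrow> 'k) set \<times> 'm \<Rightarrow> 'k) set \<Rightarrow> (('h list \<Rightarrow> 'k) set \<times> 'm \<Rightarrow> 'k) set" where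
  "crossed_cyc K H M n =
     (let Z = balanced_tensor K H (diagonal_power K H n) M in
       sweedler K Z (\<lambda>(t, m).
         sweedler K Z (\<lambda>hs.
           sweedler K Z (\<lambda>(m0, m1).
             pure_balanced K H (diagonal_power K H n) M
               (pure_power K H ((last hs \<otimes>\<^bsub>H\<^esub> m1) # butlast hs)) m0)
           (coact M m)) t))"

definition crossed_cyclic_object ::
    "'k ring \<Rightarrow> ('k, 'h) hopf \<Rightarrow> ('k, 'h, 'm) crossed
      \<Rightarrow> ('k, (('h list \<Rightarrow> 'k) set \<times> 'm \<Rightarrow> 'k) set) cyclic_object" where
  "crossed_cyclic_object K H M =
     \<lparr>obj = (\<lambda>n. balanced_tensor K H (diagonal_power K H n) M),
      face = (\<lambda>n i. balanced_map K H (diagonal_power K H (n - 1)) M (power_face K H n i)),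
      degen = (\<lambda>n i. balanced_map K H (diagonal_power K H (Suc n)) M (power_degen K H n i)),
      cyc = crossed_cyc K H M\<rparr>"

definition HC ::
    "'k ring \<Rightarrow> ('k, 'h) hopf \<Rightarrow> ('k, 'h, 'm) crossed \<Rightarrow> nat
      \<Rightarrow> ('k, (nat \<Rightarrow> (('h list \<Rightarrow> 'k) set \<times> 'm \<Rightarrow> 'k) set) set) module" where
  "HC K H M n = cyclic_homology (crossed_cyclic_object K H M) n"

end

theory Submission
  imports Defs "HOL-Combinatorics.Transposition"
begin

text \<open>
  Because the coaction is trivial, the cyclic operator of \<open>Z\<^sub>*(H, M)\<close> is induced by the rotation
  \<open>h\<^sup>0 \<otimes> \<cdots> \<otimes> h\<^sup>n \<mapsto> h\<^sup>n \<otimes> h\<^sup>0 \<otimes> \<cdots> \<otimes> h\<^sup>n\<^sup>-\<^sup>1\<close> of the tensor power (\<open>crossed_cyc_eq\<close>). By cocommutativity the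
  iterated coproduct is invariant under permutations of its factors (\<open>iter_transpose\<close>), so the rotation commutes
  with the diagonal action of \<open>H\<close>. The tensor powers of \<open>H\<close> therefore form a cyclic object \<open>C\<close> in right
  \<open>H\<close>-modules, and \<open>Z\<^sub>*(H, M)\<close> is \<open>C \<otimes>\<^sub>H M\<close>. As \<open>- \<otimes>\<^sub>H M\<close> is additive, the complex that computes
  \<open>HC\<^sub>*(H, M)\<close> is \<open>Tot \<otimes>\<^sub>H M\<close>, where \<open>Tot\<close> is the total complex of the Tsygan double complex of \<open>C\<close>, a complex
  of right \<open>H\<close>-modules (\<open>TR_homology\<close>).
  
  The modules of \<open>Tot\<close> are projective: untwisting, \<open>v \<otimes> h = \<Sum> (v S(h\<^sub>1) \<otimes> 1) h\<^sub>2\<close>, identifies the diagonal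
  module \<open>H\<^sup>\<otimes>\<^sup>n \<otimes> H\<close> with the free module on the vector space \<open>H\<^sup>\<otimes>\<^sup>n\<close> (\<open>untwist\<close>, \<open>liftable_C_Suc\<close>).
  The homology of \<open>Tot\<close> is known: prepending \<open>1\<close> to a tensor is an extra degeneracy, which contracts the odd
  columns and leaves of each even column the augmentation \<open>\<epsilon>\<close> onto \<open>k\<close>. So \<open>Tot\<close> resolves the complex that is \<open>k\<close>
  in even degrees, \<open>0\<close> in odd degrees, and has zero differential (\<open>Tot_exact\<close>, \<open>TR_resolution\<close>).
  
  For a projective resolution \<open>P\<close> of \<open>k\<close>, the sum over \<open>i \<ge> 0\<close> of the shifts of \<open>P\<close> by \<open>2i\<close> is a second projective
  resolution of the same complex (\<open>QR_resolution\<close>). Two such resolutions are homotopy equivalent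
  (\<open>comparison_map\<close>, \<open>null_homotopy\<close>), and homotopy equivalences survive \<open>- \<otimes>\<^sub>H M\<close>
  (\<open>bal_resolutions_iso\<close>). The homology of the tensored sum of shifts is
  \<open>\<Oplus>\<^sub>i Tor\<^sub>n\<^sub>-\<^sub>2\<^sub>i(k, M)\<close> (\<open>homology_shifts\<close>).
  
  Projectivity is used in one form throughout: an \<open>H\<close>-linear relation that is total on the module contains the
  graph of an \<open>H\<close>-linear map (\<open>liftable\<close>). Choosing lifts that satisfy several equations at once then needs no
  auxiliary kernels or pullbacks.
\<close>

section \<open>Linear maps\<close>

lemma (in abelian_group) a_inv_zero [simp]: "\<ominus> \<zero> = \<zero>"
  by (rule minus_equality) auto

lemma (in abelian_group) minus_zero [simp]: "x \<in> carrier G \<Longrightarrow> x \<ominus> \<zero> = x"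
  by (simp add: a_minus_def)

lemma (in abelian_group) minus_eq_zero_iff [simp]:
  "x \<in> carrier G \<Longrightarrow> y \<in> carrier G \<Longrightarrow> x \<ominus> y = \<zero> \<longleftrightarrow> x = y"
  using add.inv_solve_right'[of "\<zero>" x y] by (auto simp: a_minus_def)

locale linear_map = V: module K V + W: module K W
  for K :: "'k ring" and V :: "('k, 'v, 'a) module_scheme" and W :: "('k, 'w, 'b) module_scheme" +
  fixes f :: "'v \<Rightarrow> 'w"
  assumes lin: "f \<in> linear_maps K V W"
begin

lemma closed [simp]: "x \<in> carrier V \<Longrightarrow> f x \<in> carrier W"
  using lin by (auto simp: linear_maps_def)

lemma add [simp]: "x \<in> carrier V \<Longrightarrow> y \<in> carrier V \<Longrightarrow> f (x \<oplus>\<^bsub>V\<^esub> y) = f x \<oplus>\<^bsub>W\<^esub> f y"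
  using lin by (auto simp: linear_maps_def)

lemma smult [simp]: "a \<in> carrier K \<Longrightarrow> x \<in> carrier V \<Longrightarrow> f (a \<odot>\<^bsub>V\<^esub> x) = a \<odot>\<^bsub>W\<^esub> f x"
  using lin by (auto simp: linear_maps_def)

lemma zero [simp]: "f \<zero>\<^bsub>V\<^esub> = \<zero>\<^bsub>W\<^esub>"
proof -
  have "f (\<zero>\<^bsub>K\<^esub> \<odot>\<^bsub>V\<^esub> \<zero>\<^bsub>V\<^esub>) = \<zero>\<^bsub>K\<^esub> \<odot>\<^bsub>W\<^esub> f \<zero>\<^bsub>V\<^esub>" by (rule smult) auto
  then show ?thesis by simp
qed

lemma minus [simp]: "x \<in> carrier V \<Longrightarrow> f (\<ominus>\<^bsub>V\<^esub> x) = \<ominus>\<^bsub>W\<^esub> f x"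
  using add[of x "\<ominus>\<^bsub>V\<^esub> x"] W.minus_equality[of "f (\<ominus>\<^bsub>V\<^esub> x)" "f x"]
  by (simp add: V.r_neg W.a_comm)

lemma diff [simp]: "x \<in> carrier V \<Longrightarrow> y \<in> carrier V \<Longrightarrow> f (x \<ominus>\<^bsub>V\<^esub> y) = f x \<ominus>\<^bsub>W\<^esub> f y"
  by (simp add: a_minus_def)

lemma finsum: "g \<in> A \<rightarrow> carrier V \<Longrightarrow> f (\<Oplus>\<^bsub>V\<^esub>i\<in>A. g i) = (\<Oplus>\<^bsub>W\<^esub>i\<in>A. f (g i))"
proof (induction A rule: infinite_finite_induct)
  case (insert x F)
  then have "g \<in> F \<rightarrow> carrier V" "g x \<in> carrier V" by auto
  moreover from this have "(\<lambda>i. f (g i)) \<in> F \<rightarrow> carrier W" by (auto intro: closed)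
  ultimately
  show ?case using insert by (simp add: V.finsum_insert W.finsum_insert)
qed auto

end

lemma linear_mapsI:
  assumes "\<And>x. x \<in> carrier V \<Longrightarrow> f x \<in> carrier W"
    and "\<And>x y. x \<in> carrier V \<Longrightarrow> y \<in> carrier V \<Longrightarrow> f (x \<oplus>\<^bsub>V\<^esub> y) = f x \<oplus>\<^bsub>W\<^esub> f y"
    and "\<And>a x. a \<in> carrier K \<Longrightarrow> x \<in> carrier V \<Longrightarrow> f (a \<odot>\<^bsub>V\<^esub> x) = a \<odot>\<^bsub>W\<^esub> f x"
  shows "f \<in> linear_maps K V W"
  using assms by (auto simp: linear_maps_def)

lemma linear_closed: "f \<in> linear_maps K V W \<Longrightarrow> x \<in> carrier V \<Longrightarrow> f x \<in> carrier W"
  by (auto simp: linear_maps_def)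

lemma linear_add:
  "f \<in> linear_maps K V W \<Longrightarrow> x \<in> carrier V \<Longrightarrow> y \<in> carrier V \<Longrightarrow> f (x \<oplus>\<^bsub>V\<^esub> y) = f x \<oplus>\<^bsub>W\<^esub> f y"
  by (auto simp: linear_maps_def)

lemma linear_smult:
  "f \<in> linear_maps K V W \<Longrightarrow> a \<in> carrier K \<Longrightarrow> x \<in> carrier V \<Longrightarrow> f (a \<odot>\<^bsub>V\<^esub> x) = a \<odot>\<^bsub>W\<^esub> f x"
  by (auto simp: linear_maps_def)

lemma linear_comp:
  "f \<in> linear_maps K U V \<Longrightarrow> g \<in> linear_maps K V W \<Longrightarrow> (\<lambda>x. g (f x)) \<in> linear_maps K U W"
  by (auto simp: linear_maps_def Pi_def)

lemma linear_id: "(\<lambda>x. x) \<in> linear_maps K V V"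
  by (auto simp: linear_maps_def)

lemma linear_cong:
  assumes "module K V" "\<And>x. x \<in> carrier V \<Longrightarrow> f x = g x" "g \<in> linear_maps K V W"
  shows "f \<in> linear_maps K V W"
proof -
  interpret V: module K V by fact
  show ?thesis using assms(2,3) by (auto simp: linear_maps_def)
qed

lemma linear_zero: "module K W \<Longrightarrow> (\<lambda>x. \<zero>\<^bsub>W\<^esub>) \<in> linear_maps K V W"
proof -
  assume "module K W"
  then interpret W: module K W .
  show ?thesis by (auto simp: linear_maps_def)
qed

lemma linear_plus:
  assumes "module K W" "f \<in> linear_maps K V W" "g \<in> linear_maps K V W"
  shows "(\<lambda>x. f x \<oplus>\<^bsub>W\<^esub> g x) \<in> linear_maps K V W"
proof -
  interpret W: module K W by fact
  show ?thesis using assms(2,3)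
    by (auto simp: linear_maps_def W.a_ac W.smult_r_distr Pi_def)
qed

lemma linear_scale:
  assumes "module K W" "f \<in> linear_maps K V W" "c \<in> carrier K"
  shows "(\<lambda>x. c \<odot>\<^bsub>W\<^esub> f x) \<in> linear_maps K V W"
proof -
  interpret W: module K W by fact
  show ?thesis using assms(2,3)
    by (auto simp: linear_maps_def W.smult_r_distr Pi_def W.smult_assoc1[symmetric] W.R.m_comm)
qed

lemma linear_uminus:
  assumes "module K W" "f \<in> linear_maps K V W"
  shows "(\<lambda>x. \<ominus>\<^bsub>W\<^esub> f x) \<in> linear_maps K V W"
proof -
  interpret W: module K W by fact
  show ?thesis using assms(2)
    by (auto simp: linear_maps_def W.minus_add W.smult_r_minus Pi_def)
qed

lemma linear_minus:
  assumes "module K W" "f \<in> linear_maps K V W" "g \<in> linear_maps K V W"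
  shows "(\<lambda>x. f x \<ominus>\<^bsub>W\<^esub> g x) \<in> linear_maps K V W"
  unfolding a_minus_def by (intro linear_plus linear_uminus assms)

lemma linear_finsum:
  assumes W: "module K W" and A: "finite A" and f: "\<And>i. i \<in> A \<Longrightarrow> f i \<in> linear_maps K V W"
  shows "(\<lambda>x. \<Oplus>\<^bsub>W\<^esub>i\<in>A. f i x) \<in> linear_maps K V W"
proof -
  interpret W: module K W by fact
  have cl: "i \<in> A \<Longrightarrow> x \<in> carrier V \<Longrightarrow> f i x \<in> carrier W" for i x
    by (rule linear_closed[OF f])
  show ?thesis
  proof (rule linear_mapsI)
    fix x assume x: "x \<in> carrier V"
    show "(\<Oplus>\<^bsub>W\<^esub>i\<in>A. f i x) \<in> carrier W" by (rule W.finsum_closed) (simp add: cl x)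
  next
    fix x y assume xy: "x \<in> carrier V" "y \<in> carrier V"
    have "(\<Oplus>\<^bsub>W\<^esub>i\<in>A. f i (x \<oplus>\<^bsub>V\<^esub> y)) = (\<Oplus>\<^bsub>W\<^esub>i\<in>A. f i x \<oplus>\<^bsub>W\<^esub> f i y)"
      by (rule W.finsum_cong'[OF refl]) (simp_all add: cl xy linear_add[OF f])
    then show "(\<Oplus>\<^bsub>W\<^esub>i\<in>A. f i (x \<oplus>\<^bsub>V\<^esub> y)) = (\<Oplus>\<^bsub>W\<^esub>i\<in>A. f i x) \<oplus>\<^bsub>W\<^esub> (\<Oplus>\<^bsub>W\<^esub>i\<in>A. f i y)"
      by (simp add: W.finsum_addf cl xy)
  next
    fix c x assume cx: "c \<in> carrier K" "x \<in> carrier V"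
    have "(\<Oplus>\<^bsub>W\<^esub>i\<in>A. f i (c \<odot>\<^bsub>V\<^esub> x)) = (\<Oplus>\<^bsub>W\<^esub>i\<in>A. c \<odot>\<^bsub>W\<^esub> f i x)"
      by (rule W.finsum_cong'[OF refl]) (simp_all add: cl cx linear_smult[OF f])
    then show "(\<Oplus>\<^bsub>W\<^esub>i\<in>A. f i (c \<odot>\<^bsub>V\<^esub> x)) = c \<odot>\<^bsub>W\<^esub> (\<Oplus>\<^bsub>W\<^esub>i\<in>A. f i x)"
      by (simp add: W.finsum_smult_ldistr cl cx A)
  qed
qed

lemma linear_eq_kernel:
  assumes "module K V" "module K W" "f \<in> linear_maps K V W"
  shows "submodule {x \<in> carrier V. f x = \<zero>\<^bsub>W\<^esub>} K V"
proof -
  interpret f: linear_map K V W f by (intro linear_map.intro linear_map_axioms.intro assms)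
  show ?thesis by (rule f.V.submoduleI) auto
qed

section \<open>Quotients\<close>

locale quotient_space = module K V + N: submodule N K V
  for K :: "'k ring" and V :: "('k, 'v, 'a) module_scheme" and N :: "'v set"
begin

abbreviation Q where "Q \<equiv> quotient_module V N"
definition proj where "proj x = N +>\<^bsub>V\<^esub> x"

lemma N_abelian_subgroup: "abelian_subgroup N V"
  by (rule abelian_subgroupI3[OF _ M.abelian_group_axioms]) (rule additive_subgroup.intro, rule N.subgroup_axioms)

interpretation N': abelian_subgroup N V by (rule N_abelian_subgroup)

lemma carrier_Q: "carrier Q = proj ` carrier V"
  by (auto simp: quotient_module_def A_RCOSETS_def' proj_def)

lemma zero_Q: "\<zero>\<^bsub>Q\<^esub> = proj \<zero>\<^bsub>V\<^esub>"
  using M.a_coset_add_zero[of N] N.subset by (simp add: quotient_module_def proj_def)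

lemma proj_eq_iff:
  assumes x: "x \<in> carrier V" and y: "y \<in> carrier V"
  shows "proj x = proj y \<longleftrightarrow> x \<ominus>\<^bsub>V\<^esub> y \<in> N"
proof -
  have m: "x \<in> N +>\<^bsub>V\<^esub> y \<longleftrightarrow> x \<ominus>\<^bsub>V\<^esub> y \<in> N"
    unfolding a_minus_def by (rule N'.a_rcos_module[OF y x])
  show ?thesis unfolding proj_def
  proof
    assume "N +>\<^bsub>V\<^esub> x = N +>\<^bsub>V\<^esub> y"
    then have "x \<in> N +>\<^bsub>V\<^esub> y" using N'.a_rcos_self[OF x] by simp
    then show "x \<ominus>\<^bsub>V\<^esub> y \<in> N" using m by simp
  next
    assume "x \<ominus>\<^bsub>V\<^esub> y \<in> N"
    then have "x \<in> N +>\<^bsub>V\<^esub> y" using m by simp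
    then show "N +>\<^bsub>V\<^esub> x = N +>\<^bsub>V\<^esub> y" using N'.a_repr_independence'[OF _ y] by simp
  qed
qed

lemma proj_self: "x \<in> carrier V \<Longrightarrow> x \<in> proj x"
  by (simp add: proj_def N'.a_rcos_self)

lemma in_projD: "y \<in> proj x \<Longrightarrow> x \<in> carrier V \<Longrightarrow> y \<in> carrier V \<and> proj y = proj x"
  unfolding proj_def using N'.a_elemrcos_carrier N'.a_repr_independence' by blast

lemma add_Q: "x \<in> carrier V \<Longrightarrow> y \<in> carrier V \<Longrightarrow> proj x \<oplus>\<^bsub>Q\<^esub> proj y = proj (x \<oplus>\<^bsub>V\<^esub> y)"
  by (simp add: quotient_module_def proj_def N'.a_rcos_sum)

lemma smult_Q: assumes "a \<in> carrier K" "x \<in> carrier V"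
  shows "a \<odot>\<^bsub>Q\<^esub> proj x = proj (a \<odot>\<^bsub>V\<^esub> x)"
proof -
  have "proj (a \<odot>\<^bsub>V\<^esub> y) = proj (a \<odot>\<^bsub>V\<^esub> x)" if "y \<in> proj x" for y
  proof -
    have y: "y \<in> carrier V" "proj y = proj x" using in_projD[OF that assms(2)] by auto
    then have "y \<ominus>\<^bsub>V\<^esub> x \<in> N" using proj_eq_iff assms by auto
    then have "a \<odot>\<^bsub>V\<^esub> (y \<ominus>\<^bsub>V\<^esub> x) \<in> N" using assms by auto
    also have "a \<odot>\<^bsub>V\<^esub> (y \<ominus>\<^bsub>V\<^esub> x) = a \<odot>\<^bsub>V\<^esub> y \<ominus>\<^bsub>V\<^esub> a \<odot>\<^bsub>V\<^esub> x"
      using y assms by (simp add: a_minus_def smult_r_distr smult_r_minus)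
    finally show ?thesis using proj_eq_iff y assms by auto
  qed
  then have "(\<Union>y\<in>proj x. proj (a \<odot>\<^bsub>V\<^esub> y)) = proj (a \<odot>\<^bsub>V\<^esub> x)"
    using proj_self[OF assms(2)] by blast
  then show ?thesis by (simp add: quotient_module_def proj_def)
qed

lemma module_Q: "module K Q"
proof (rule moduleI)
  show "cring K" by (rule R.cring_axioms)
  show "abelian_group Q"
  proof (rule abelian_groupI)
    fix x assume "x \<in> carrier Q"
    then obtain u where u: "u \<in> carrier V" "x = proj u" by (auto simp: carrier_Q)
    then have "proj (\<ominus>\<^bsub>V\<^esub> u) \<oplus>\<^bsub>Q\<^esub> x = \<zero>\<^bsub>Q\<^esub>" by (simp add: add_Q zero_Q M.l_neg)
    then show "\<exists>y\<in>carrier Q. y \<oplus>\<^bsub>Q\<^esub> x = \<zero>\<^bsub>Q\<^esub>" using u by (auto simp: carrier_Q)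
  qed (auto simp: carrier_Q add_Q zero_Q M.a_ac)
qed (auto simp: carrier_Q add_Q smult_Q smult_l_distr smult_r_distr smult_assoc1)

lemma proj_linear: "proj \<in> linear_maps K V Q"
  by (rule linear_mapsI) (auto simp: carrier_Q add_Q smult_Q)

lemma proj_zero_iff: "x \<in> carrier V \<Longrightarrow> proj x = \<zero>\<^bsub>Q\<^esub> \<longleftrightarrow> x \<in> N"
  using proj_eq_iff[of x "\<zero>\<^bsub>V\<^esub>"] by (simp add: zero_Q)

end

lemma linearly_isomorphic_trans:
  assumes "linearly_isomorphic K U V" "linearly_isomorphic K V W"
  shows "linearly_isomorphic K U W"
proof -
  obtain f g where "f \<in> linear_maps K U V" "bij_betw f (carrier U) (carrier V)"
    "g \<in> linear_maps K V W" "bij_betw g (carrier V) (carrier W)"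
    using assms by (auto simp: linearly_isomorphic_def)
  then have "(\<lambda>x. g (f x)) \<in> linear_maps K U W" "bij_betw (\<lambda>x. g (f x)) (carrier U) (carrier W)"
    using linear_comp bij_betw_trans[of f _ _ g] by (auto simp: comp_def)
  then show ?thesis unfolding linearly_isomorphic_def by blast
qed

text \<open>
  The isomorphisms between homology modules below all come from this form of the first isomorphism theorem:
  a surjection from the cycles whose kernel consists of the boundaries.
\<close>

lemma linearly_isomorphic_quotient:
  assumes V: "module K V" and W: "module K W" and f: "f \<in> linear_maps K V W"
    and surj: "f ` carrier V = carrier W" and N: "N = {x \<in> carrier V. f x = \<zero>\<^bsub>W\<^esub>}"
  shows "linearly_isomorphic K (quotient_module V N) W"
proof -
  have "submodule N K V" unfolding N by (rule linear_eq_kernel[OF V W f])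
  with V interpret quotient_space K V N by (rule quotient_space.intro)
  interpret f: linear_map K V W f by (intro linear_map.intro linear_map_axioms.intro V W f)
  have mem: "u \<in> N \<longleftrightarrow> u \<in> carrier V \<and> f u = \<zero>\<^bsub>W\<^esub>" for u by (simp only: N mem_Collect_eq)
  define g where "g C = f (SOME x. x \<in> C)" for C
  have inj: "f x = f y \<longleftrightarrow> proj x = proj y" if "x \<in> carrier V" "y \<in> carrier V" for x y
    using that by (simp add: proj_eq_iff mem)
  have g: "g (proj x) = f x" if "x \<in> carrier V" for x
  proof -
    have "(SOME y. y \<in> proj x) \<in> proj x" using proj_self[OF that] by (rule someI)
    then show ?thesis using in_projD[OF _ that] inj that by (auto simp: g_def)
  qed
  have "g \<in> linear_maps K Q W"
    by (rule linear_mapsI) (auto simp: carrier_Q g add_Q smult_Q)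
  moreover have "bij_betw g (carrier Q) (carrier W)"
    unfolding bij_betw_def using inj surj by (auto simp: inj_on_def carrier_Q g image_image)
  ultimately show ?thesis by (auto simp: linearly_isomorphic_def)
qed

section \<open>Presentations by generators and relations\<close>

definition single :: "('r, 'a) ring_scheme \<Rightarrow> 'x \<Rightarrow> 'r \<Rightarrow> 'x \<Rightarrow> 'r" where
  "single R x a = (\<lambda>y. if y = x then a else \<zero>\<^bsub>R\<^esub>)"

text \<open>
  The additive extension to finitely supported functions of a family of additive maps \<open>F x\<close>, one for each
  \<open>x\<close>. Coefficients may lie in the field (free vector spaces) or in \<open>H\<close> (free right modules), whence the
  general form.
\<close>

definition fin_ext ::
    "('r, 'a) ring_scheme \<Rightarrow> ('w, 'b) ring_scheme \<Rightarrow> ('x \<Rightarrow> 'r \<Rightarrow> 'w) \<Rightarrow> ('x \<Rightarrow> 'r) \<Rightarrow> 'w" where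
  "fin_ext R W F u = (\<Oplus>\<^bsub>W\<^esub>x\<in>{x. u x \<noteq> \<zero>\<^bsub>R\<^esub>}. F x (u x))"

lemma single_fin_supp: "x \<in> X \<Longrightarrow> a \<in> carrier R \<Longrightarrow> \<zero>\<^bsub>R\<^esub> \<in> carrier R \<Longrightarrow> single R x a \<in> fin_supp R X"
  by (auto simp: fin_supp_def single_def)

lemma fin_supp_value: "u \<in> fin_supp R X \<Longrightarrow> \<zero>\<^bsub>R\<^esub> \<in> carrier R \<Longrightarrow> u x \<in> carrier R"
  by (cases "x \<in> X") (auto simp: fin_supp_def)

lemma (in abelian_group) fin_supp_plus:
  assumes "u \<in> fin_supp G X" "v \<in> fin_supp G X"
  shows "(\<lambda>x. u x \<oplus> v x) \<in> fin_supp G X"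
proof -
  have "finite {x. u x \<oplus> v x \<noteq> \<zero>}"
    by (rule finite_subset[of _ "{x. u x \<noteq> \<zero>} \<union> {x. v x \<noteq> \<zero>}"]) (use assms in \<open>auto simp: fin_supp_def\<close>)
  then show ?thesis using assms by (simp add: fin_supp_def)
qed

locale fin_ext_loc = R: abelian_group R + W: abelian_group W
  for R :: "('r, 'a) ring_scheme" and W :: "('w, 'b) ring_scheme" and X :: "'x set"
    and F :: "'x \<Rightarrow> 'r \<Rightarrow> 'w" +
  assumes F_closed: "\<And>x a. x \<in> X \<Longrightarrow> a \<in> carrier R \<Longrightarrow> F x a \<in> carrier W"
    and F_add: "\<And>x a b. x \<in> X \<Longrightarrow> a \<in> carrier R \<Longrightarrow> b \<in> carrier R \<Longrightarrow>
      F x (a \<oplus>\<^bsub>R\<^esub> b) = F x a \<oplus>\<^bsub>W\<^esub> F x b"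
begin

lemma F_zero: "x \<in> X \<Longrightarrow> F x \<zero>\<^bsub>R\<^esub> = \<zero>\<^bsub>W\<^esub>"
  using F_add[of x "\<zero>\<^bsub>R\<^esub>" "\<zero>\<^bsub>R\<^esub>"] F_closed[of x "\<zero>\<^bsub>R\<^esub>"] W.add.l_cancel_one' by force

lemma fin_ext_eq:
  assumes "u \<in> fin_supp R X" "{x. u x \<noteq> \<zero>\<^bsub>R\<^esub>} \<subseteq> S" "finite S" "S \<subseteq> X"
  shows "fin_ext R W F u = (\<Oplus>\<^bsub>W\<^esub>x\<in>S. F x (u x))"
  unfolding fin_ext_def
  by (rule W.add.finprod_mono_neutral_cong_left)
     (use assms F_zero F_closed in \<open>auto simp: fin_supp_def\<close>)

lemma supp: "u \<in> fin_supp R X \<Longrightarrow> finite {x. u x \<noteq> \<zero>\<^bsub>R\<^esub>}" "u \<in> fin_supp R X \<Longrightarrow> {x. u x \<noteq> \<zero>\<^bsub>R\<^esub>} \<subseteq> X"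
  by (auto simp: fin_supp_def)

lemma fin_ext_closed: "u \<in> fin_supp R X \<Longrightarrow> fin_ext R W F u \<in> carrier W"
  unfolding fin_ext_def using F_closed by (intro W.finsum_closed) (auto simp: fin_supp_def)

lemma fin_ext_add:
  assumes u: "u \<in> fin_supp R X" and v: "v \<in> fin_supp R X"
  shows "fin_ext R W F (\<lambda>x. u x \<oplus>\<^bsub>R\<^esub> v x) = fin_ext R W F u \<oplus>\<^bsub>W\<^esub> fin_ext R W F v"
proof -
  let ?S = "{x. u x \<noteq> \<zero>\<^bsub>R\<^esub>} \<union> {x. v x \<noteq> \<zero>\<^bsub>R\<^esub>}"
  have S: "finite ?S" "?S \<subseteq> X" using u v by (auto simp: fin_supp_def)
  have cl: "u x \<in> carrier R" "v x \<in> carrier R" for x using u v by (simp_all add: fin_supp_value)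
  have SX: "x \<in> ?S \<Longrightarrow> x \<in> X" for x using S(2) by blast
  have uF: "x \<in> ?S \<Longrightarrow> F x (u x) \<in> carrier W" and vF: "x \<in> ?S \<Longrightarrow> F x (v x) \<in> carrier W" for x
    using F_closed[OF SX] cl by blast+
  have "fin_ext R W F (\<lambda>x. u x \<oplus>\<^bsub>R\<^esub> v x) = (\<Oplus>\<^bsub>W\<^esub>x\<in>?S. F x (u x \<oplus>\<^bsub>R\<^esub> v x))"
    by (rule fin_ext_eq[OF R.fin_supp_plus[OF u v] _ S]) auto
  also have "\<dots> = (\<Oplus>\<^bsub>W\<^esub>x\<in>?S. F x (u x) \<oplus>\<^bsub>W\<^esub> F x (v x))"
    by (rule W.finsum_cong'[OF refl]) (simp add: Pi_def uF vF del: Un_iff, rule F_add[OF SX cl])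
  also have "\<dots> = (\<Oplus>\<^bsub>W\<^esub>x\<in>?S. F x (u x)) \<oplus>\<^bsub>W\<^esub> (\<Oplus>\<^bsub>W\<^esub>x\<in>?S. F x (v x))"
    by (rule W.finsum_addf) (simp_all add: Pi_def uF vF del: Un_iff)
  also have "\<dots> = fin_ext R W F u \<oplus>\<^bsub>W\<^esub> fin_ext R W F v"
    using fin_ext_eq[OF u _ S] fin_ext_eq[OF v _ S] by simp
  finally show ?thesis .
qed

lemma fin_ext_single:
  assumes "x \<in> X" "a \<in> carrier R"
  shows "fin_ext R W F (single R x a) = F x a"
proof -
  have "fin_ext R W F (single R x a) = (\<Oplus>\<^bsub>W\<^esub>y\<in>{x}. F y (single R x a y))"
    by (rule fin_ext_eq) (use assms in \<open>auto simp: single_fin_supp, auto simp: single_def split: if_splits\<close>)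
  also have "\<dots> = F x a" using assms F_closed by (simp add: single_def W.finsum_insert)
  finally show ?thesis .
qed

end

lemma fin_supp_induct [consumes 2, case_names zero single add]:
  assumes R: "abelian_group R" and u: "u \<in> fin_supp R X"
    and zero: "P (\<lambda>x. \<zero>\<^bsub>R\<^esub>)"
    and single: "\<And>x a. x \<in> X \<Longrightarrow> a \<in> carrier R \<Longrightarrow> P (single R x a)"
    and add: "\<And>u v. u \<in> fin_supp R X \<Longrightarrow> v \<in> fin_supp R X \<Longrightarrow> P u \<Longrightarrow> P v \<Longrightarrow> P (\<lambda>x. u x \<oplus>\<^bsub>R\<^esub> v x)"
  shows "P u"
proof -
  interpret R: abelian_group R by fact
  have "\<forall>u \<in> fin_supp R X. {x. u x \<noteq> \<zero>\<^bsub>R\<^esub>} = S \<longrightarrow> P u" if "finite S" for S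
    using that
  proof (induction S)
    case empty
    have "P u" if "{x. u x \<noteq> \<zero>\<^bsub>R\<^esub>} = {}" for u
    proof -
      have "u = (\<lambda>x. \<zero>\<^bsub>R\<^esub>)" using that by auto
      then show ?thesis using zero by simp
    qed
    then show ?case by auto
  next
    case (insert y S)
    show ?case
    proof (intro ballI impI)
      fix u assume u: "u \<in> fin_supp R X" "{x. u x \<noteq> \<zero>\<^bsub>R\<^esub>} = insert y S"
      have y: "y \<in> X" "u y \<in> carrier R" using u by (auto simp: fin_supp_def)
      define v where "v = u(y := \<zero>\<^bsub>R\<^esub>)"
      have vs: "{x. v x \<noteq> \<zero>\<^bsub>R\<^esub>} = S" using u(2) insert.hyps(2) by (auto simp: v_def)
      have v: "v \<in> fin_supp R X"
      proof -
        have "finite {x. v x \<noteq> \<zero>\<^bsub>R\<^esub>}" using vs insert.hyps by simp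
        then show ?thesis using u by (auto simp: fin_supp_def v_def)
      qed
      have "P (\<lambda>x. single R y (u y) x \<oplus>\<^bsub>R\<^esub> v x)"
        using insert.IH v vs y single by (intro add) (auto simp: single_fin_supp)
      also have "(\<lambda>x. single R y (u y) x \<oplus>\<^bsub>R\<^esub> v x) = u"
      proof
        fix x
        have "u x \<in> carrier R" using u(1) by (cases "x \<in> X") (auto simp: fin_supp_def)
        then show "single R y (u y) x \<oplus>\<^bsub>R\<^esub> v x = u x" by (auto simp: single_def v_def)
      qed
      finally show "P u" .
    qed
  qed
  then show ?thesis using u by (auto simp: fin_supp_def)
qed

lemma free_module_simps [simp]:
  "carrier (free_module K X) = fin_supp K X" "\<zero>\<^bsub>free_module K X\<^esub> = (\<lambda>_. \<zero>\<^bsub>K\<^esub>)"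
  "f \<oplus>\<^bsub>free_module K X\<^esub> g = (\<lambda>x. f x \<oplus>\<^bsub>K\<^esub> g x)" "a \<odot>\<^bsub>free_module K X\<^esub> f = (\<lambda>x. a \<otimes>\<^bsub>K\<^esub> f x)"
  by (simp_all add: free_module_def)

lemma free_module_module:
  assumes "cring K" shows "module K (free_module K X)"
proof -
  interpret K: cring K by fact
  have cl: "u \<in> fin_supp K X \<Longrightarrow> u x \<in> carrier K" for u x by (cases "x \<in> X") (auto simp: fin_supp_def)
  have sm: "(\<lambda>x. a \<otimes>\<^bsub>K\<^esub> u x) \<in> fin_supp K X" if "a \<in> carrier K" "u \<in> fin_supp K X" for a u
  proof -
    have "finite {x. a \<otimes>\<^bsub>K\<^esub> u x \<noteq> \<zero>\<^bsub>K\<^esub>}"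
      by (rule finite_subset[of _ "{x. u x \<noteq> \<zero>\<^bsub>K\<^esub>}"]) (use that in \<open>auto simp: fin_supp_def\<close>)
    then show ?thesis using that by (auto simp: fin_supp_def)
  qed
  have z0: "(\<lambda>x. \<zero>\<^bsub>K\<^esub>) \<in> fin_supp K X" by (auto simp: fin_supp_def)
  have ad: "(\<lambda>x. u x \<oplus>\<^bsub>K\<^esub> v x) \<in> fin_supp K X" if "u \<in> fin_supp K X" "v \<in> fin_supp K X" for u v
    using that by (rule K.fin_supp_plus)
  show ?thesis
  proof (rule moduleI)
    show "cring K" by fact
    show "abelian_group (free_module K X)"
    proof (rule abelian_groupI)
      fix u assume u: "u \<in> carrier (free_module K X)"
      then show "\<exists>y\<in>carrier (free_module K X). y \<oplus>\<^bsub>free_module K X\<^esub> u = \<zero>\<^bsub>free_module K X\<^esub>"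
        using sm[of "\<ominus>\<^bsub>K\<^esub> \<one>\<^bsub>K\<^esub>" u] cl[of u]
        by (intro bexI[of _ "\<lambda>x. (\<ominus>\<^bsub>K\<^esub> \<one>\<^bsub>K\<^esub>) \<otimes>\<^bsub>K\<^esub> u x"]) (auto simp: K.l_minus K.l_neg)
    qed (auto simp: ad cl K.a_ac z0)
  qed (auto simp: sm ad cl K.l_distr K.r_distr K.m_assoc)
qed

lemma lin_span_submodule: 
  assumes V: "module K V" and S: "S \<subseteq> carrier V"
  shows "submodule (lin_span K V S) K V" "S \<subseteq> lin_span K V S"
proof -
  interpret V: module K V by fact
  have C: "submodule (carrier V) K V" by (rule V.carrier_is_submodule)
  have zero: "\<zero>\<^bsub>V\<^esub> \<in> N" if "submodule N K V" for N
    using subgroup.one_closed[OF submodule.axioms(1)[OF that]] by simp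
  show "submodule (lin_span K V S) K V"
  proof (rule V.submoduleI)
    show "lin_span K V S \<subseteq> carrier V" using C S by (auto simp: lin_span_def)
    show "\<zero>\<^bsub>V\<^esub> \<in> lin_span K V S" using zero by (simp add: lin_span_def)
    show "\<ominus>\<^bsub>V\<^esub> x \<in> lin_span K V S" if "x \<in> lin_span K V S" for x
      using that V.submoduleE(3) by (simp add: lin_span_def)
    show "x \<oplus>\<^bsub>V\<^esub> y \<in> lin_span K V S" if "x \<in> lin_span K V S" "y \<in> lin_span K V S" for x y
      using that V.submoduleE(5) by (simp add: lin_span_def)
    show "a \<odot>\<^bsub>V\<^esub> x \<in> lin_span K V S" if "a \<in> carrier K" "x \<in> lin_span K V S" for a x
      using that V.submoduleE(4) by (simp add: lin_span_def)
  qed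
  show "S \<subseteq> lin_span K V S" by (auto simp: lin_span_def)
qed

lemma lin_span_least: "submodule N K V \<Longrightarrow> S \<subseteq> N \<Longrightarrow> lin_span K V S \<subseteq> N"
  unfolding lin_span_def by (rule Inter_lower) simp

locale presentation = cring K for K :: "'k ring" +
  fixes X :: "'x set" and Rel :: "('x \<Rightarrow> 'k) set"
  assumes Rel: "Rel \<subseteq> fin_supp K X"
begin

abbreviation Fr where "Fr \<equiv> free_module K X"
abbreviation Nl where "Nl \<equiv> lin_span K Fr Rel"
abbreviation pres where "pres \<equiv> quotient_module Fr Nl"
definition cls where "cls x = Nl +>\<^bsub>Fr\<^esub> generator K x"

sublocale Fr: module K Fr by (rule free_module_module) (rule cring_axioms)

sublocale Qs: quotient_space K Fr Nl
  by (rule quotient_space.intro[OF Fr.module_axioms lin_span_submodule(1)[OF Fr.module_axioms]])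
    (simp add: Rel)

sublocale Q: module K pres by (rule Qs.module_Q)

lemma generator_single: "generator K x = single K x \<one>\<^bsub>K\<^esub>"
  by (simp add: generator_def single_def)

lemma generator_closed: "x \<in> X \<Longrightarrow> generator K x \<in> fin_supp K X"
  unfolding generator_single by (rule single_fin_supp) simp_all

lemma cls_proj: "cls x = Qs.proj (generator K x)" by (simp add: cls_def Qs.proj_def)

lemma cls_closed [simp]: "x \<in> X \<Longrightarrow> cls x \<in> carrier pres"
  unfolding cls_proj Qs.carrier_Q by (rule imageI) (simp add: generator_closed)

abbreviation lext :: "('k, 'w, 'b) module_scheme \<Rightarrow> ('x \<Rightarrow> 'w) \<Rightarrow> ('x \<Rightarrow> 'k) \<Rightarrow> 'w" where
  "lext W F \<equiv> fin_ext K W (\<lambda>x a. a \<odot>\<^bsub>W\<^esub> F x)"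

lemma fin_ext_loc: assumes "module K W" "F \<in> X \<rightarrow> carrier W"
  shows "fin_ext_loc K W X (\<lambda>x a. a \<odot>\<^bsub>W\<^esub> F x)"
proof -
  interpret W: module K W by fact
  have F: "x \<in> X \<Longrightarrow> F x \<in> carrier W" for x using assms(2) by blast
  show ?thesis
    by (intro fin_ext_loc.intro fin_ext_loc_axioms.intro abelian_group_axioms W.abelian_group_axioms)
      (simp_all add: F W.smult_l_distr)
qed

lemma lext_linear:
  assumes W: "module K W" and F: "F \<in> X \<rightarrow> carrier W"
  shows "lext W F \<in> linear_maps K Fr W"
proof -
  interpret W: module K W by fact
  interpret fin_ext_loc K W X "\<lambda>x a. a \<odot>\<^bsub>W\<^esub> F x" by (rule fin_ext_loc[OF W F])
  have cl: "u \<in> fin_supp K X \<Longrightarrow> u x \<in> carrier K" for u x by (simp add: fin_supp_value)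
  have F': "x \<in> X \<Longrightarrow> F x \<in> carrier W" for x using F by blast
  show ?thesis
  proof (rule linear_mapsI)
    fix a u assume a: "a \<in> carrier K" and "u \<in> carrier Fr"
    then have u: "u \<in> fin_supp K X" and au: "(\<lambda>x. a \<otimes>\<^bsub>K\<^esub> u x) \<in> fin_supp K X"
      using Fr.smult_closed[of a u] by auto
    let ?S = "{x. u x \<noteq> \<zero>\<^bsub>K\<^esub>}"
    have "lext W F (\<lambda>x. a \<otimes>\<^bsub>K\<^esub> u x) = (\<Oplus>\<^bsub>W\<^esub>x\<in>?S. (a \<otimes>\<^bsub>K\<^esub> u x) \<odot>\<^bsub>W\<^esub> F x)"
      by (rule fin_ext_eq[OF au]) (use supp[OF u] a in auto)
    also have "\<dots> = (\<Oplus>\<^bsub>W\<^esub>x\<in>?S. a \<odot>\<^bsub>W\<^esub> (u x \<odot>\<^bsub>W\<^esub> F x))"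
      by (rule W.finsum_cong'[OF refl])
        (use supp[OF u] a cl[OF u] F' in \<open>simp_all add: W.smult_assoc1 subset_eq\<close>)
    also have "\<dots> = a \<odot>\<^bsub>W\<^esub> lext W F u"
      unfolding fin_ext_def
      by (rule W.finsum_smult_ldistr[symmetric]) (use supp[OF u] a cl[OF u] F' in \<open>simp_all add: subset_eq\<close>)
    finally show "lext W F (a \<odot>\<^bsub>Fr\<^esub> u) = a \<odot>\<^bsub>W\<^esub> lext W F u" by simp
  qed (auto simp: fin_ext_closed fin_ext_add)
qed

lemma lext_generator:
  assumes W: "module K W" and F: "F \<in> X \<rightarrow> carrier W" and x: "x \<in> X"
  shows "lext W F (generator K x) = F x"
proof -
  interpret W: module K W by fact
  interpret fin_ext_loc K W X "\<lambda>x a. a \<odot>\<^bsub>W\<^esub> F x" by (rule fin_ext_loc[OF W F])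
  have "F x \<in> carrier W" using F x by blast
  then show ?thesis using fin_ext_single[OF x, of "\<one>\<^bsub>K\<^esub>"] by (simp add: generator_single)
qed

text \<open>
  The function \<open>sweedler\<close> evaluates the linear extension of \<open>F\<close> at an arbitrary representative of the class. If
  the extension kills the relations, the result depends on the class alone, which is the universal property of a
  presentation.
\<close>

lemma sweedler_universal:
  assumes W: "module K W" and F: "F \<in> X \<rightarrow> carrier W"
    and rel: "\<And>r. r \<in> Rel \<Longrightarrow> lext W F r = \<zero>\<^bsub>W\<^esub>"
  shows sweedler_linear: "sweedler K W F \<in> linear_maps K pres W"
    and sweedler_cls: "x \<in> X \<Longrightarrow> sweedler K W F (cls x) = F x"
proof -
  interpret W: module K W by fact
  interpret l: linear_map K Fr W "lext W F"
    by (intro linear_map.intro linear_map_axioms.intro Fr.module_axioms W lext_linear F)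
  have "Nl \<subseteq> {u \<in> carrier Fr. lext W F u = \<zero>\<^bsub>W\<^esub>}"
    by (rule lin_span_least[OF linear_eq_kernel[OF Fr.module_axioms W lext_linear[OF W F]]])
       (use rel Rel in auto)
  then have 0: "lext W F u = \<zero>\<^bsub>W\<^esub>" if "u \<in> Nl" for u using that by auto
  have *: "lext W F u = lext W F v" if "u \<in> Qs.proj v" "v \<in> fin_supp K X" for u v
  proof -
    have v: "v \<in> carrier Fr" using that(2) by simp
    have u: "u \<in> carrier Fr" "Qs.proj u = Qs.proj v" using Qs.in_projD[OF that(1) v] by blast+
    then have "lext W F (u \<ominus>\<^bsub>Fr\<^esub> v) = \<zero>\<^bsub>W\<^esub>" using Qs.proj_eq_iff[OF u(1) v] 0 by blast
    then have "lext W F u \<ominus>\<^bsub>W\<^esub> lext W F v = \<zero>\<^bsub>W\<^esub>" using l.diff[OF u(1) v] by (simp only:)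
    then show ?thesis using l.closed[OF u(1)] l.closed[OF v] W.minus_eq_zero_iff by blast
  qed
  have sw: "sweedler K W F (Qs.proj u) = lext W F u" if "u \<in> fin_supp K X" for u
  proof -
    have "(SOME f. f \<in> Qs.proj u) \<in> Qs.proj u" by (rule someI[of _ u]) (use Qs.proj_self that in simp)
    from *[OF this that] show ?thesis by (simp add: sweedler_def Let_def fin_ext_def)
  qed
  show "sweedler K W F \<in> linear_maps K pres W"
  proof (rule linear_mapsI)
    fix x y assume "x \<in> carrier pres" "y \<in> carrier pres"
    then obtain u v where uv: "u \<in> carrier Fr" "v \<in> carrier Fr" "x = Qs.proj u" "y = Qs.proj v"
      by (auto simp: Qs.carrier_Q)
    then have "u \<oplus>\<^bsub>Fr\<^esub> v \<in> fin_supp K X" using Fr.a_closed by fastforce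
    with uv show "sweedler K W F (x \<oplus>\<^bsub>pres\<^esub> y) = sweedler K W F x \<oplus>\<^bsub>W\<^esub> sweedler K W F y"
      using l.add[OF uv(1,2)] by (simp add: Qs.add_Q[OF uv(1,2)] sw del: l.add)
  next
    fix a x assume a: "a \<in> carrier K" and "x \<in> carrier pres"
    then obtain u where u: "u \<in> carrier Fr" "x = Qs.proj u" by (auto simp: Qs.carrier_Q)
    then have "a \<odot>\<^bsub>Fr\<^esub> u \<in> fin_supp K X" using Fr.smult_closed[OF a] by fastforce
    with u a show "sweedler K W F (a \<odot>\<^bsub>pres\<^esub> x) = a \<odot>\<^bsub>W\<^esub> sweedler K W F x"
      using l.smult[OF a u(1)] by (simp add: Qs.smult_Q[OF a u(1)] sw del: l.smult)
  qed (use sw l.closed in \<open>auto simp: Qs.carrier_Q\<close>)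
  show "sweedler K W F (cls x) = F x" if "x \<in> X"
    using that by (simp add: cls_proj sw generator_closed lext_generator W F)
qed

lemma sweedler_cong:
  assumes W: "module K W" and G: "G \<in> X \<rightarrow> carrier W"
    and u: "u \<in> carrier pres" and eq: "\<And>x. x \<in> X \<Longrightarrow> F x = G x"
  shows "sweedler K W F u = sweedler K W G u"
proof -
  interpret W: module K W by fact
  obtain v where v: "v \<in> carrier Fr" "u = Qs.proj v" using u by (auto simp: Qs.carrier_Q)
  have "(SOME f. f \<in> u) \<in> u" using Qs.proj_self v by (metis someI)
  then have w: "(SOME f. f \<in> u) \<in> fin_supp K X"
    using Qs.in_projD[of "SOME f. f \<in> u" v] v by (simp only: free_module_simps)
  show ?thesis
    unfolding sweedler_def Let_def
  proof (rule W.finsum_cong'[OF refl])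
    have X: "x \<in> X" "(SOME f. f \<in> u) x \<in> carrier K"
      if "x \<in> {x. (SOME f. f \<in> u) x \<noteq> \<zero>\<^bsub>K\<^esub>}" for x
      using w that unfolding fin_supp_def by blast+
    show "(\<lambda>x. (SOME f. f \<in> u) x \<odot>\<^bsub>W\<^esub> G x) \<in> {x. (SOME f. f \<in> u) x \<noteq> \<zero>\<^bsub>K\<^esub>} \<rightarrow> carrier W"
      using X G by (intro funcsetI W.smult_closed) blast+
    show "(SOME f. f \<in> u) i \<odot>\<^bsub>W\<^esub> F i = (SOME f. f \<in> u) i \<odot>\<^bsub>W\<^esub> G i"
      if "i \<in> {x. (SOME f. f \<in> u) x \<noteq> \<zero>\<^bsub>K\<^esub>}" for i
      using eq[OF X(1)[OF that]] by simp
  qed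
qed

lemma pres_induct [consumes 1, case_names cls add smult]:
  assumes "u \<in> carrier pres" and "\<And>x. x \<in> X \<Longrightarrow> P (cls x)"
    and "\<And>u v. u \<in> carrier pres \<Longrightarrow> v \<in> carrier pres \<Longrightarrow> P u \<Longrightarrow> P v \<Longrightarrow> P (u \<oplus>\<^bsub>pres\<^esub> v)"
    and "\<And>a u. a \<in> carrier K \<Longrightarrow> u \<in> carrier pres \<Longrightarrow> P u \<Longrightarrow> P (a \<odot>\<^bsub>pres\<^esub> u)"
    and zero: "P \<zero>\<^bsub>pres\<^esub>"
  shows "P u"
proof -
  obtain v where v: "v \<in> fin_supp K X" "u = Qs.proj v" using assms(1) by (auto simp: Qs.carrier_Q)
  from abelian_group_axioms v(1) have "P (Qs.proj v)"
  proof (induction rule: fin_supp_induct)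
    case zero
    then show ?case using assms(5) by (simp add: Qs.zero_Q)
  next
    case (single x a)
    have "single K x a = a \<odot>\<^bsub>Fr\<^esub> generator K x" using single by (auto simp: single_def generator_def)
    then have "Qs.proj (single K x a) = a \<odot>\<^bsub>pres\<^esub> cls x"
      using single Qs.smult_Q[of a "generator K x"] by (simp add: cls_proj generator_closed)
    then show ?case using single assms(2,4) by simp
  next
    case (add u v)
    then show ?case using assms(3)[of "Qs.proj u" "Qs.proj v"] Qs.add_Q[of u v]
      by (auto simp: Qs.carrier_Q)
  qed
  then show ?thesis using v by simp
qed

lemma pres_eqI:
  assumes W: "module K W" and "f \<in> linear_maps K pres W" "g \<in> linear_maps K pres W"
    and eq: "\<And>x. x \<in> X \<Longrightarrow> f (cls x) = g (cls x)" and u: "u \<in> carrier pres"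
  shows "f u = g u"
proof -
  interpret f: linear_map K pres W f by (intro linear_map.intro linear_map_axioms.intro W assms Q.module_axioms)
  interpret g: linear_map K pres W g by (intro linear_map.intro linear_map_axioms.intro W assms Q.module_axioms)
  show ?thesis using u by (induction rule: pres_induct) (auto simp: eq)
qed

end

text \<open>
  The operations of a free module are pointwise; from here on relations are compared through linear maps,
  and the pointwise form would hide the record operations on which linearity rewrites.
\<close>

declare free_module_simps(2-4) [simp del]

context presentation
begin

lemma proj_rel: "r \<in> Rel \<Longrightarrow> Qs.proj r = \<zero>\<^bsub>pres\<^esub>"
  using lin_span_submodule(2)[OF Fr.module_axioms, of Rel] Rel Qs.proj_zero_iff[of r]
  by (simp add: subset_eq)

lemma
  assumes "x \<in> X" "y \<in> X" "z \<in> X" "a \<in> carrier K"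
  shows rel_closed_add: "generator K x \<ominus>\<^bsub>Fr\<^esub> (generator K y \<oplus>\<^bsub>Fr\<^esub> generator K z) \<in> fin_supp K X"
    and rel_closed_smult: "generator K x \<ominus>\<^bsub>Fr\<^esub> a \<odot>\<^bsub>Fr\<^esub> generator K y \<in> fin_supp K X"
    and rel_closed_eq: "generator K x \<ominus>\<^bsub>Fr\<^esub> generator K y \<in> fin_supp K X"
proof -
  have g: "generator K x \<in> carrier Fr" "generator K y \<in> carrier Fr" "generator K z \<in> carrier Fr"
    using generator_closed assms by simp_all
  show "generator K x \<ominus>\<^bsub>Fr\<^esub> (generator K y \<oplus>\<^bsub>Fr\<^esub> generator K z) \<in> fin_supp K X"
    "generator K x \<ominus>\<^bsub>Fr\<^esub> a \<odot>\<^bsub>Fr\<^esub> generator K y \<in> fin_supp K X"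
    "generator K x \<ominus>\<^bsub>Fr\<^esub> generator K y \<in> fin_supp K X"
    using Fr.minus_closed[OF g(1) Fr.a_closed[OF g(2,3)]]
      Fr.minus_closed[OF g(1) Fr.smult_closed[OF assms(4) g(2)]] Fr.minus_closed[OF g(1,2)]
    by (simp_all only: free_module_simps(1))
qed

text \<open>
  The three shapes in which relations occur in the definitions of tensor products: additivity, homogeneity
  and balancing.
\<close>

lemma
  assumes W: "module K W" and l: "l \<in> linear_maps K Fr W"
    and x: "x \<in> X" and y: "y \<in> X" and z: "z \<in> X" and a: "a \<in> carrier K"
  shows linear_rel_add: "l (generator K x \<ominus>\<^bsub>Fr\<^esub> (generator K y \<oplus>\<^bsub>Fr\<^esub> generator K z)) = \<zero>\<^bsub>W\<^esub> \<longleftrightarrow>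
      l (generator K x) = l (generator K y) \<oplus>\<^bsub>W\<^esub> l (generator K z)"
    and linear_rel_smult: "l (generator K x \<ominus>\<^bsub>Fr\<^esub> a \<odot>\<^bsub>Fr\<^esub> generator K y) = \<zero>\<^bsub>W\<^esub> \<longleftrightarrow>
      l (generator K x) = a \<odot>\<^bsub>W\<^esub> l (generator K y)"
    and linear_rel_eq: "l (generator K x \<ominus>\<^bsub>Fr\<^esub> generator K y) = \<zero>\<^bsub>W\<^esub> \<longleftrightarrow>
      l (generator K x) = l (generator K y)"
proof -
  interpret l: linear_map K Fr W l by (intro linear_map.intro linear_map_axioms.intro Fr.module_axioms W l)
  have g: "generator K x \<in> carrier Fr" "generator K y \<in> carrier Fr" "generator K z \<in> carrier Fr"
    using generator_closed x y z by simp_all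
  note c = l.closed[OF g(1)] l.closed[OF g(2)] l.closed[OF g(3)]
  show "l (generator K x \<ominus>\<^bsub>Fr\<^esub> (generator K y \<oplus>\<^bsub>Fr\<^esub> generator K z)) = \<zero>\<^bsub>W\<^esub> \<longleftrightarrow>
      l (generator K x) = l (generator K y) \<oplus>\<^bsub>W\<^esub> l (generator K z)"
    unfolding l.diff[OF g(1) Fr.a_closed[OF g(2,3)]] l.add[OF g(2,3)]
    by (rule l.W.minus_eq_zero_iff) (simp_all add: c)
  show "l (generator K x \<ominus>\<^bsub>Fr\<^esub> a \<odot>\<^bsub>Fr\<^esub> generator K y) = \<zero>\<^bsub>W\<^esub> \<longleftrightarrow>
      l (generator K x) = a \<odot>\<^bsub>W\<^esub> l (generator K y)"
    unfolding l.diff[OF g(1) Fr.smult_closed[OF a g(2)]] l.smult[OF a g(2)]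
    by (rule l.W.minus_eq_zero_iff) (simp_all add: c a)
  show "l (generator K x \<ominus>\<^bsub>Fr\<^esub> generator K y) = \<zero>\<^bsub>W\<^esub> \<longleftrightarrow> l (generator K x) = l (generator K y)"
    unfolding l.diff[OF g(1,2)] by (rule l.W.minus_eq_zero_iff) (simp_all add: c)
qed

lemmas cls_rel =
  linear_rel_add[OF Q.module_axioms Qs.proj_linear, folded cls_proj]
  linear_rel_smult[OF Q.module_axioms Qs.proj_linear, folded cls_proj]
  linear_rel_eq[OF Q.module_axioms Qs.proj_linear, folded cls_proj]

lemma
  assumes W: "module K W" and F: "F \<in> X \<rightarrow> carrier W"
    and x: "x \<in> X" and y: "y \<in> X" and z: "z \<in> X" and a: "a \<in> carrier K"
  shows lext_rel_add: "F x = F y \<oplus>\<^bsub>W\<^esub> F z \<Longrightarrow>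
      lext W F (generator K x \<ominus>\<^bsub>Fr\<^esub> (generator K y \<oplus>\<^bsub>Fr\<^esub> generator K z)) = \<zero>\<^bsub>W\<^esub>"
    and lext_rel_smult: "F x = a \<odot>\<^bsub>W\<^esub> F y \<Longrightarrow>
      lext W F (generator K x \<ominus>\<^bsub>Fr\<^esub> a \<odot>\<^bsub>Fr\<^esub> generator K y) = \<zero>\<^bsub>W\<^esub>"
    and lext_rel_eq: "F x = F y \<Longrightarrow> lext W F (generator K x \<ominus>\<^bsub>Fr\<^esub> generator K y) = \<zero>\<^bsub>W\<^esub>"
  using linear_rel_add[OF W lext_linear[OF W F] x y z a] linear_rel_smult[OF W lext_linear[OF W F] x y z a]
    linear_rel_eq[OF W lext_linear[OF W F] x y z a]
  by (simp_all only: lext_generator[OF W F] x y z)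

end

section \<open>Tensor powers\<close>

lemma tuples_update: "xs \<in> tuples V n \<Longrightarrow> x \<in> carrier V \<Longrightarrow> xs[i := x] \<in> tuples V n"
  using set_update_subset_insert[of xs i x] by (auto simp: tuples_def)

definition multilinear ::
    "'k ring \<Rightarrow> ('k, 'v, 'a) module_scheme \<Rightarrow> nat \<Rightarrow> ('k, 'w, 'b) module_scheme \<Rightarrow> ('v list \<Rightarrow> 'w) \<Rightarrow> bool" where
  "multilinear K V n W F \<longleftrightarrow> (\<forall>xs \<in> tuples V n. F xs \<in> carrier W) \<and>
     (\<forall>xs \<in> tuples V n. \<forall>i<n. (\<lambda>x. F (xs[i := x])) \<in> linear_maps K V W)"

lemma multilinearI:
  assumes "\<And>xs. xs \<in> tuples V n \<Longrightarrow> F xs \<in> carrier W"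
    and "\<And>xs i. xs \<in> tuples V n \<Longrightarrow> i < n \<Longrightarrow> (\<lambda>x. F (xs[i := x])) \<in> linear_maps K V W"
  shows "multilinear K V n W F"
  using assms by (simp add: multilinear_def)

lemma multilinear_closed: "multilinear K V n W F \<Longrightarrow> xs \<in> tuples V n \<Longrightarrow> F xs \<in> carrier W"
  by (simp add: multilinear_def)

lemma multilinear_slot:
  "multilinear K V n W F \<Longrightarrow> xs \<in> tuples V n \<Longrightarrow> i < n \<Longrightarrow> (\<lambda>x. F (xs[i := x])) \<in> linear_maps K V W"
  by (simp add: multilinear_def)

lemma multilinear_comp:
  assumes "multilinear K V n W F" "f \<in> linear_maps K W U"
  shows "multilinear K V n U (\<lambda>xs. f (F xs))"
  by (intro multilinearI linear_closed[OF assms(2)] multilinear_closed[OF assms(1)]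
      linear_comp[OF multilinear_slot[OF assms(1)] assms(2)])

lemma multilinear_relationsE:
  assumes "r \<in> multilinear_relations K V n"
  obtains (add) xs i x y where "xs \<in> tuples V n" "i < n" "x \<in> carrier V" "y \<in> carrier V"
      "r = generator K (xs[i := x \<oplus>\<^bsub>V\<^esub> y]) \<ominus>\<^bsub>free_module K (tuples V n)\<^esub>
        (generator K (xs[i := x]) \<oplus>\<^bsub>free_module K (tuples V n)\<^esub> generator K (xs[i := y]))"
    | (smult) xs i a x where "xs \<in> tuples V n" "i < n" "a \<in> carrier K" "x \<in> carrier V"
      "r = generator K (xs[i := a \<odot>\<^bsub>V\<^esub> x]) \<ominus>\<^bsub>free_module K (tuples V n)\<^esub>
        a \<odot>\<^bsub>free_module K (tuples V n)\<^esub> generator K (xs[i := x])"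
  using assms unfolding multilinear_relations_def Let_def by blast

locale tensor_powers = V: module K V for K :: "'k ring" and V :: "('k, 'v, 'a) module_scheme"
begin

abbreviation T where "T n \<equiv> tensor_power K V n"
abbreviation pure where "pure xs \<equiv> pure_power K V xs"

lemma presentation_power: "presentation K (tuples V n) (multilinear_relations K V n)"
proof (intro presentation.intro presentation_axioms.intro V.R.cring_axioms)
  interpret P: presentation K "tuples V n" "{}"
    by (intro presentation.intro presentation_axioms.intro V.R.cring_axioms) simp
  note u = tuples_update
  show "multilinear_relations K V n \<subseteq> fin_supp K (tuples V n)"
  proof
    fix r assume "r \<in> multilinear_relations K V n"
    then show "r \<in> fin_supp K (tuples V n)"
    proof (cases rule: multilinear_relationsE)
      case (add xs i x y)
      show ?thesis unfolding add(5) by (rule P.rel_closed_add[OF u u u V.R.zero_closed]) (use add in simp_all)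
    next
      case (smult xs i a x)
      show ?thesis unfolding smult(5) by (rule P.rel_closed_smult[OF u u u]) (use smult in simp_all)
    qed
  qed
qed

lemma T_pres: "T n = quotient_module (free_module K (tuples V n))
    (lin_span K (free_module K (tuples V n)) (multilinear_relations K V n))"
  by (simp add: tensor_power_def tensor_power_null_def)

lemma pure_cls: "length xs = n \<Longrightarrow> pure xs = presentation.cls K (tuples V n) (multilinear_relations K V n) xs"
  by (auto simp: pure_power_def presentation.cls_def[OF presentation_power] tensor_power_null_def)

lemma T_module: "module K (T n)"
proof -
  interpret P: presentation K "tuples V n" "multilinear_relations K V n" by (rule presentation_power)
  show ?thesis unfolding T_pres by (rule P.Q.module_axioms)
qed

lemma pure_closed: "xs \<in> tuples V n \<Longrightarrow> pure xs \<in> carrier (T n)"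
proof -
  interpret P: presentation K "tuples V n" "multilinear_relations K V n" by (rule presentation_power)
  assume "xs \<in> tuples V n"
  then show ?thesis unfolding T_pres using pure_cls[of xs n] P.cls_closed[of xs] by (simp add: tuples_def)
qed

lemma pure_multilinear: "multilinear K V n (T n) (pure_power K V)"
proof (rule multilinearI)
  interpret P: presentation K "tuples V n" "multilinear_relations K V n" by (rule presentation_power)
  fix xs i assume xs: "xs \<in> tuples V n" and i: "i < n"
  have cls: "pure (xs[i := x]) = P.cls (xs[i := x])" for x
    using xs by (intro pure_cls) (simp add: tuples_def)
  note u = tuples_update[OF xs]
  show "(\<lambda>x. pure (xs[i := x])) \<in> linear_maps K V (T n)"
  proof (rule linear_mapsI)
    fix x y assume xy: "x \<in> carrier V" "y \<in> carrier V"
    have "generator K (xs[i := x \<oplus>\<^bsub>V\<^esub> y]) \<ominus>\<^bsub>P.Fr\<^esub> (generator K (xs[i := x]) \<oplus>\<^bsub>P.Fr\<^esub> generator K (xs[i := y]))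
        \<in> multilinear_relations K V n"
      unfolding multilinear_relations_def Let_def using xs i xy by blast
    from P.proj_rel[OF this] show "pure (xs[i := x \<oplus>\<^bsub>V\<^esub> y]) = pure (xs[i := x]) \<oplus>\<^bsub>T n\<^esub> pure (xs[i := y])"
      unfolding cls T_pres using P.cls_rel(1)[OF u u u V.R.zero_closed] xy by simp
  next
    fix a x assume ax: "a \<in> carrier K" "x \<in> carrier V"
    have "generator K (xs[i := a \<odot>\<^bsub>V\<^esub> x]) \<ominus>\<^bsub>P.Fr\<^esub> a \<odot>\<^bsub>P.Fr\<^esub> generator K (xs[i := x])
        \<in> multilinear_relations K V n"
      unfolding multilinear_relations_def Let_def using xs i ax by blast
    from P.proj_rel[OF this] show "pure (xs[i := a \<odot>\<^bsub>V\<^esub> x]) = a \<odot>\<^bsub>T n\<^esub> pure (xs[i := x])"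
      unfolding cls T_pres using P.cls_rel(2)[OF u u xs ax(1)] ax by simp
  qed (rule pure_closed, rule u)
qed (rule pure_closed)

lemma
  assumes W: "module K W" and F: "multilinear K V n W F"
  shows ext_linear: "sweedler K W F \<in> linear_maps K (T n) W"
    and ext_pure: "xs \<in> tuples V n \<Longrightarrow> sweedler K W F (pure xs) = F xs"
proof -
  interpret P: presentation K "tuples V n" "multilinear_relations K V n" by (rule presentation_power)
  have F': "F \<in> tuples V n \<rightarrow> carrier W" using multilinear_closed[OF F] by simp
  have rel: "P.lext W F r = \<zero>\<^bsub>W\<^esub>" if "r \<in> multilinear_relations K V n" for r
  proof -
    note s = multilinear_slot[OF F] and u = tuples_update
    from that show ?thesis
    proof (cases rule: multilinear_relationsE)
      case (add xs i x y)
      show ?thesis unfolding add(5)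
        by (rule P.lext_rel_add[OF W F' u u u V.R.zero_closed linear_add[OF s]]) (use add in simp_all)
    next
      case (smult xs i a x)
      show ?thesis unfolding smult(5)
        by (rule P.lext_rel_smult[OF W F' u u u _ linear_smult[OF s]]) (use smult in simp_all)
    qed
  qed
  show "sweedler K W F \<in> linear_maps K (T n) W"
    unfolding T_pres by (rule P.sweedler_linear[OF W F' rel])
  show "sweedler K W F (pure xs) = F xs" if "xs \<in> tuples V n"
    using P.sweedler_cls[OF W F' rel that] pure_cls[of xs n] that by (simp add: tuples_def)
qed

lemma T_eqI:
  assumes "module K W" "f \<in> linear_maps K (T n) W" "g \<in> linear_maps K (T n) W"
    and "\<And>xs. xs \<in> tuples V n \<Longrightarrow> f (pure xs) = g (pure xs)" and "u \<in> carrier (T n)"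
  shows "f u = g u"
proof -
  interpret P: presentation K "tuples V n" "multilinear_relations K V n" by (rule presentation_power)
  show ?thesis
    using P.pres_eqI[of W f g u] assms pure_cls by (simp add: T_pres tuples_def)
qed

lemma ext_cong:
  assumes W: "module K W" and F: "multilinear K V n W F"
    and "u \<in> carrier (T n)" "\<And>xs. xs \<in> tuples V n \<Longrightarrow> G xs = F xs"
  shows "sweedler K W G u = sweedler K W F u"
proof -
  interpret P: presentation K "tuples V n" "multilinear_relations K V n" by (rule presentation_power)
  have F': "F \<in> tuples V n \<rightarrow> carrier W" using multilinear_closed[OF F] by simp
  show ?thesis
    using P.sweedler_cong[OF W F', of u G] assms(3,4) by (simp add: T_pres)
qed

end

section \<open>Balanced tensor products\<close>

definition bilinear ::
    "'k ring \<Rightarrow> ('k, 'v, 'a) module_scheme \<Rightarrow> ('k, 'u, 'b) module_scheme \<Rightarrow> ('k, 'w, 'c) module_scheme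
      \<Rightarrow> ('v \<Rightarrow> 'u \<Rightarrow> 'w) \<Rightarrow> bool" where
  "bilinear K V U W F \<longleftrightarrow> (\<forall>x \<in> carrier V. F x \<in> linear_maps K U W) \<and>
     (\<forall>y \<in> carrier U. (\<lambda>x. F x y) \<in> linear_maps K V W)"

lemma bilinearI:
  assumes "\<And>x. x \<in> carrier V \<Longrightarrow> F x \<in> linear_maps K U W"
    and "\<And>y. y \<in> carrier U \<Longrightarrow> (\<lambda>x. F x y) \<in> linear_maps K V W"
  shows "bilinear K V U W F"
  using assms by (simp add: bilinear_def)

lemma bilinear_left: "bilinear K V U W F \<Longrightarrow> y \<in> carrier U \<Longrightarrow> (\<lambda>x. F x y) \<in> linear_maps K V W"
  by (simp add: bilinear_def)

lemma bilinear_right: "bilinear K V U W F \<Longrightarrow> x \<in> carrier V \<Longrightarrow> F x \<in> linear_maps K U W"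
  by (simp add: bilinear_def)

lemma bilinear_closed: "bilinear K V U W F \<Longrightarrow> x \<in> carrier V \<Longrightarrow> y \<in> carrier U \<Longrightarrow> F x y \<in> carrier W"
  by (rule linear_closed[OF bilinear_right])

lemma bilinear_comp:
  assumes "bilinear K V U W F" "f \<in> linear_maps K W Z"
  shows "bilinear K V U Z (\<lambda>x y. f (F x y))"
proof (rule bilinearI)
  show "(\<lambda>y. f (F x y)) \<in> linear_maps K U Z" if "x \<in> carrier V" for x
    by (rule linear_comp[OF bilinear_right[OF assms(1) that] assms(2)])
  show "(\<lambda>x. f (F x y)) \<in> linear_maps K V Z" if "y \<in> carrier U" for y
    by (rule linear_comp[OF bilinear_left[OF assms(1) that] assms(2)])
qed

lemma bilinear_relationsE:
  assumes "r \<in> bilinear_relations K V U"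
  obtains (add_left) x x' y where "x \<in> carrier V" "x' \<in> carrier V" "y \<in> carrier U"
      "r = generator K (x \<oplus>\<^bsub>V\<^esub> x', y) \<ominus>\<^bsub>free_module K (carrier V \<times> carrier U)\<^esub>
        (generator K (x, y) \<oplus>\<^bsub>free_module K (carrier V \<times> carrier U)\<^esub> generator K (x', y))"
    | (add_right) x y y' where "x \<in> carrier V" "y \<in> carrier U" "y' \<in> carrier U"
      "r = generator K (x, y \<oplus>\<^bsub>U\<^esub> y') \<ominus>\<^bsub>free_module K (carrier V \<times> carrier U)\<^esub>
        (generator K (x, y) \<oplus>\<^bsub>free_module K (carrier V \<times> carrier U)\<^esub> generator K (x, y'))"
    | (smult_left) a x y where "a \<in> carrier K" "x \<in> carrier V" "y \<in> carrier U"
      "r = generator K (a \<odot>\<^bsub>V\<^esub> x, y) \<ominus>\<^bsub>free_module K (carrier V \<times> carrier U)\<^esub>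
        a \<odot>\<^bsub>free_module K (carrier V \<times> carrier U)\<^esub> generator K (x, y)"
    | (smult_right) a x y where "a \<in> carrier K" "x \<in> carrier V" "y \<in> carrier U"
      "r = generator K (x, a \<odot>\<^bsub>U\<^esub> y) \<ominus>\<^bsub>free_module K (carrier V \<times> carrier U)\<^esub>
        a \<odot>\<^bsub>free_module K (carrier V \<times> carrier U)\<^esub> generator K (x, y)"
  using assms unfolding bilinear_relations_def Let_def by blast

lemma bilinear_relations_closed:
  assumes V: "module K V" and U: "module K U"
  shows "bilinear_relations K V U \<subseteq> fin_supp K (carrier V \<times> carrier U)"
proof -
  interpret V: module K V by fact
  interpret U: module K U by fact
  interpret P: presentation K "carrier V \<times> carrier U" "{}"
    by (intro presentation.intro presentation_axioms.intro V.R.cring_axioms) simp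
  show ?thesis
  proof
    fix r assume "r \<in> bilinear_relations K V U"
    then show "r \<in> fin_supp K (carrier V \<times> carrier U)"
    proof (cases rule: bilinear_relationsE)
      case (add_left x x' y)
      show ?thesis unfolding add_left(4)
        by (rule P.rel_closed_add[OF _ _ _ V.R.zero_closed]) (use add_left in simp_all)
    next
      case (add_right x y y')
      show ?thesis unfolding add_right(4)
        by (rule P.rel_closed_add[OF _ _ _ V.R.zero_closed]) (use add_right in simp_all)
    next
      case (smult_left a x y)
      show ?thesis unfolding smult_left(4)
        by (rule P.rel_closed_smult[where z = "(x, y)"]) (use smult_left in simp_all)
    next
      case (smult_right a x y)
      show ?thesis unfolding smult_right(4)
        by (rule P.rel_closed_smult[where z = "(x, y)"]) (use smult_right in simp_all)
    qed
  qed
qed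

text \<open>
  The tensor product over the field and the balanced tensor product are both presented by the bilinear relations,
  the latter together with the balancing ones. What follows from bilinearity is proved once for both.
\<close>

locale bilinear_presentation = V: module K V + U: module K U + P: presentation K "carrier V \<times> carrier U" Rel
  for K :: "'k ring" and V :: "('k, 'v, 'a) module_scheme" and U :: "('k, 'u, 'b) module_scheme" and Rel +
  assumes bilinear_rel: "bilinear_relations K V U \<subseteq> Rel"
begin

lemma cls_bilinear: "bilinear K V U P.pres (\<lambda>x y. P.cls (x, y))"
proof -
  have z: "r \<in> bilinear_relations K V U \<Longrightarrow> P.Qs.proj r = \<zero>\<^bsub>P.pres\<^esub>" for r
    using bilinear_rel P.proj_rel by blast
  note R = z[unfolded bilinear_relations_def Let_def]
  show ?thesis
  proof (intro bilinearI linear_mapsI)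
    fix x x' y assume *: "x \<in> carrier V" "x' \<in> carrier V" "y \<in> carrier U"
    show "P.cls (x \<oplus>\<^bsub>V\<^esub> x', y) = P.cls (x, y) \<oplus>\<^bsub>P.pres\<^esub> P.cls (x', y)"
      by (rule P.cls_rel(1)[THEN iffD1, OF _ _ _ V.R.zero_closed R])
        (use * in simp, use * in simp, use * in simp, use * in blast)
  next
    fix x x' y assume *: "x \<in> carrier U" "x' \<in> carrier U" "y \<in> carrier V"
    show "P.cls (y, x \<oplus>\<^bsub>U\<^esub> x') = P.cls (y, x) \<oplus>\<^bsub>P.pres\<^esub> P.cls (y, x')"
      by (rule P.cls_rel(1)[THEN iffD1, OF _ _ _ V.R.zero_closed R])
        (use * in simp, use * in simp, use * in simp, use * in blast)
  next
    fix a x y assume *: "a \<in> carrier K" "x \<in> carrier V" "y \<in> carrier U"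
    show "P.cls (a \<odot>\<^bsub>V\<^esub> x, y) = a \<odot>\<^bsub>P.pres\<^esub> P.cls (x, y)"
      by (rule P.cls_rel(2)[where z = "(x, y)", THEN iffD1, OF _ _ _ _ R])
        (use * in simp, use * in simp, use * in simp, use * in simp, use * in blast)
  next
    fix a x y assume *: "a \<in> carrier K" "x \<in> carrier V" "y \<in> carrier U"
    show "P.cls (x, a \<odot>\<^bsub>U\<^esub> y) = a \<odot>\<^bsub>P.pres\<^esub> P.cls (x, y)"
      by (rule P.cls_rel(2)[where z = "(x, y)", THEN iffD1, OF _ _ _ _ R])
        (use * in simp, use * in simp, use * in simp, use * in simp, use * in blast)
  qed simp_all
qed

lemma lext_bilinear:
  assumes W: "module K W" and F: "bilinear K V U W F" and r: "r \<in> bilinear_relations K V U"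
  shows "P.lext W (\<lambda>(x, y). F x y) r = \<zero>\<^bsub>W\<^esub>"
proof -
  have F': "(\<lambda>(x, y). F x y) \<in> carrier V \<times> carrier U \<rightarrow> carrier W"
    using bilinear_closed[OF F] by auto
  note l = bilinear_left[OF F] bilinear_right[OF F]
  from r show ?thesis
  proof (cases rule: bilinear_relationsE)
    case (add_left x x' y)
    show ?thesis unfolding add_left(4)
      by (rule P.lext_rel_add[OF W F' _ _ _ V.R.zero_closed]) (use add_left in \<open>simp_all add: linear_add[OF l(1)]\<close>)
  next
    case (add_right x y y')
    show ?thesis unfolding add_right(4)
      by (rule P.lext_rel_add[OF W F' _ _ _ V.R.zero_closed]) (use add_right in \<open>simp_all add: linear_add[OF l(2)]\<close>)
  next
    case (smult_left a x y)
    show ?thesis unfolding smult_left(4)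
      by (rule P.lext_rel_smult[OF W F', where z = "(x, y)"]) (use smult_left in \<open>simp_all add: linear_smult[OF l(1)]\<close>)
  next
    case (smult_right a x y)
    show ?thesis unfolding smult_right(4)
      by (rule P.lext_rel_smult[OF W F', where z = "(x, y)"]) (use smult_right in \<open>simp_all add: linear_smult[OF l(2)]\<close>)
  qed
qed

end

lemma bilinear_presentation_tensor:
  assumes "module K V" "module K U"
  shows "bilinear_presentation K V U (bilinear_relations K V U)"
  by (intro bilinear_presentation.intro presentation.intro presentation_axioms.intro
      bilinear_presentation_axioms.intro bilinear_relations_closed assms module.axioms(1)[OF assms(1)]) simp

lemma tensor_ext:
  assumes V: "module K V" and U: "module K U" and W: "module K W" and F: "bilinear K V U W F"
    and x: "x \<in> carrier V" and y: "y \<in> carrier U"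
  shows "sweedler K W (\<lambda>(x, y). F x y) (pure_tensor K V U x y) = F x y"
proof -
  interpret B: bilinear_presentation K V U "bilinear_relations K V U"
    by (rule bilinear_presentation_tensor[OF V U])
  have "pure_tensor K V U x y = B.P.cls (x, y)"
    by (simp add: pure_tensor_def tensor_null_def B.P.cls_def)
  moreover have "(\<lambda>(x, y). F x y) \<in> carrier V \<times> carrier U \<rightarrow> carrier W"
    using bilinear_closed[OF F] by auto
  ultimately show ?thesis
    using B.P.sweedler_cls[OF W _ B.lext_bilinear[OF W F], of "(x, y)"] x y by simp
qed

subsection \<open>Right linear maps\<close>

lemma right_linear_mapsI:
  assumes "f \<in> linear_maps K X Y"
    and "\<And>x h. x \<in> carrier X \<Longrightarrow> h \<in> carrier H \<Longrightarrow> f (ract X x h) = ract Y (f x) h"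
  shows "f \<in> right_linear_maps K H X Y"
  using assms by (simp add: right_linear_maps_def)

lemma hlinear_linear: "f \<in> right_linear_maps K H X Y \<Longrightarrow> f \<in> linear_maps K X Y"
  by (simp add: right_linear_maps_def)

lemma hlinear_closed: "f \<in> right_linear_maps K H X Y \<Longrightarrow> x \<in> carrier X \<Longrightarrow> f x \<in> carrier Y"
  by (rule linear_closed[OF hlinear_linear])

lemma hlinear_ract:
  "f \<in> right_linear_maps K H X Y \<Longrightarrow> x \<in> carrier X \<Longrightarrow> h \<in> carrier H \<Longrightarrow> f (ract X x h) = ract Y (f x) h"
  by (simp add: right_linear_maps_def)

lemma hlinear_comp:
  assumes "f \<in> right_linear_maps K H X Y" "g \<in> right_linear_maps K H Y Z"
  shows "(\<lambda>x. g (f x)) \<in> right_linear_maps K H X Z"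
  using assms hlinear_closed[OF assms(1)]
  by (intro right_linear_mapsI linear_comp[of f _ X Y g]) (simp_all add: hlinear_linear hlinear_ract)

lemma hlinear_id: "(\<lambda>x. x) \<in> right_linear_maps K H X X"
  by (intro right_linear_mapsI linear_id refl)

lemma (in right_hmodule) ract_map: "h \<in> carrier H \<Longrightarrow> linear_map K X X (\<lambda>x. ract X x h)"
  by (intro linear_map.intro linear_map_axioms.intro module_axioms ract_linear_left)

lemma (in right_hmodule) ract_closed: "x \<in> carrier X \<Longrightarrow> h \<in> carrier H \<Longrightarrow> ract X x h \<in> carrier X"
  by (rule linear_closed[OF ract_linear_left])

lemma hlinear_zero:
  assumes "right_hmodule K H Y" shows "(\<lambda>x. \<zero>\<^bsub>Y\<^esub>) \<in> right_linear_maps K H X Y"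
proof -
  interpret Y: right_hmodule K H Y by fact
  show ?thesis
    by (intro right_linear_mapsI linear_zero Y.module_axioms linear_map.zero[OF Y.ract_map, symmetric])
qed

lemma hlinear_plus:
  assumes Y: "right_hmodule K H Y" and f: "f \<in> right_linear_maps K H X Y" and g: "g \<in> right_linear_maps K H X Y"
  shows "(\<lambda>x. f x \<oplus>\<^bsub>Y\<^esub> g x) \<in> right_linear_maps K H X Y"
proof -
  interpret Y: right_hmodule K H Y by fact
  show ?thesis
    by (intro right_linear_mapsI linear_plus Y.module_axioms hlinear_linear[OF f] hlinear_linear[OF g])
       (simp add: linear_map.add[OF Y.ract_map] hlinear_closed[OF f] hlinear_closed[OF g]
         hlinear_ract[OF f] hlinear_ract[OF g])
qed

lemma hlinear_uminus:
  assumes Y: "right_hmodule K H Y" and f: "f \<in> right_linear_maps K H X Y"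
  shows "(\<lambda>x. \<ominus>\<^bsub>Y\<^esub> f x) \<in> right_linear_maps K H X Y"
proof -
  interpret Y: right_hmodule K H Y by fact
  show ?thesis
    by (intro right_linear_mapsI linear_uminus Y.module_axioms hlinear_linear[OF f])
       (simp add: linear_map.minus[OF Y.ract_map] hlinear_closed[OF f] hlinear_ract[OF f])
qed

lemma hlinear_finsum:
  assumes Y: "right_hmodule K H Y" and A: "finite A" and f: "\<And>i. i \<in> A \<Longrightarrow> f i \<in> right_linear_maps K H X Y"
  shows "(\<lambda>x. \<Oplus>\<^bsub>Y\<^esub>i\<in>A. f i x) \<in> right_linear_maps K H X Y"
proof -
  interpret Y: right_hmodule K H Y by fact
  show ?thesis
  proof (intro right_linear_mapsI linear_finsum Y.module_axioms A hlinear_linear[OF f])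
    fix x h assume xh: "x \<in> carrier X" "h \<in> carrier H"
    have "(\<Oplus>\<^bsub>Y\<^esub>i\<in>A. f i (ract X x h)) = (\<Oplus>\<^bsub>Y\<^esub>i\<in>A. ract Y (f i x) h)"
      by (rule Y.finsum_cong'[OF refl])
        (simp_all add: xh hlinear_ract[OF f] hlinear_closed[OF f] Y.ract_closed)
    also have "\<dots> = ract Y (\<Oplus>\<^bsub>Y\<^esub>i\<in>A. f i x) h"
      by (rule linear_map.finsum[OF Y.ract_map, symmetric]) (simp_all add: xh hlinear_closed[OF f])
    finally show "(\<Oplus>\<^bsub>Y\<^esub>i\<in>A. f i (ract X x h)) = ract Y (\<Oplus>\<^bsub>Y\<^esub>i\<in>A. f i x) h" .
  qed
qed

subsection \<open>The functor of tensoring with a module\<close>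

context crossed_module
begin

abbreviation bal where "bal X \<equiv> balanced_tensor K H X M"
abbreviation pb where "pb X x m \<equiv> pure_balanced K H X M x m"
abbreviation bmap where "bmap Y f \<equiv> balanced_map K H Y M f"

definition brel where
  "brel X = bilinear_relations K X M \<union>
      {generator K (ract X x h, m) \<ominus>\<^bsub>free_module K (carrier X \<times> carrier M)\<^esub> generator K (x, lact M h m) | x h m.
             x \<in> carrier X \<and> h \<in> carrier H \<and> m \<in> carrier M}"

lemma lact_closed: "h \<in> carrier H \<Longrightarrow> m \<in> carrier M \<Longrightarrow> lact M h m \<in> carrier M"
  by (rule linear_closed[OF lact_linear_right])

lemma bal_pres: "bal X = quotient_module (free_module K (carrier X \<times> carrier M))
    (lin_span K (free_module K (carrier X \<times> carrier M)) (brel X))"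
  by (simp add: balanced_tensor_def balanced_null_def brel_def Let_def)

lemma bilinear_presentation_bal:
  assumes X: "right_hmodule K H X" shows "bilinear_presentation K X M (brel X)"
proof -
  interpret X: right_hmodule K H X by fact
  interpret P: presentation K "carrier X \<times> carrier M" "{}"
    by (intro presentation.intro presentation_axioms.intro R.cring_axioms) simp
  show ?thesis
  proof (intro bilinear_presentation.intro presentation.intro presentation_axioms.intro
      bilinear_presentation_axioms.intro X.module_axioms module_axioms R.cring_axioms)
    have "generator K (ract X x h, m) \<ominus>\<^bsub>P.Fr\<^esub> generator K (x, lact M h m) \<in> fin_supp K (carrier X \<times> carrier M)"
      if "x \<in> carrier X" "h \<in> carrier H" "m \<in> carrier M" for x h m
      by (rule P.rel_closed_eq[where a = "\<zero>\<^bsub>K\<^esub>" and z = "(x, m)"]) (use that X.ract_closed lact_closed in simp_all)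
    then show "brel X \<subseteq> fin_supp K (carrier X \<times> carrier M)"
      unfolding brel_def using bilinear_relations_closed[OF X.module_axioms module_axioms] by blast
  qed (simp add: brel_def)
qed

lemma pb_cls: assumes X: "right_hmodule K H X"
  shows "pb X x m = presentation.cls K (carrier X \<times> carrier M) (brel X) (x, m)"
proof -
  interpret B: bilinear_presentation K X M "brel X" by (rule bilinear_presentation_bal[OF X])
  show ?thesis unfolding pure_balanced_def B.P.cls_def by (simp add: balanced_null_def brel_def Let_def)
qed

lemma bal_module: assumes X: "right_hmodule K H X" shows "module K (bal X)"
proof -
  interpret B: bilinear_presentation K X M "brel X" by (rule bilinear_presentation_bal[OF X])
  show ?thesis unfolding bal_pres by (rule B.P.Q.module_axioms)
qed

lemma pb_bilinear: assumes X: "right_hmodule K H X" shows "bilinear K X M (bal X) (pure_balanced K H X M)"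
proof -
  interpret B: bilinear_presentation K X M "brel X" by (rule bilinear_presentation_bal[OF X])
  show ?thesis using B.cls_bilinear unfolding bal_pres pb_cls[OF X, abs_def] .
qed

lemmas pb_closed = bilinear_closed[OF pb_bilinear]

lemma pb_balanced:
  assumes X: "right_hmodule K H X" and x: "x \<in> carrier X" and h: "h \<in> carrier H" and m: "m \<in> carrier M"
  shows "pb X (ract X x h) m = pb X x (lact M h m)"
proof -
  interpret X: right_hmodule K H X by fact
  interpret B: bilinear_presentation K X M "brel X" by (rule bilinear_presentation_bal[OF X])
  have "generator K (ract X x h, m) \<ominus>\<^bsub>B.P.Fr\<^esub> generator K (x, lact M h m) \<in> brel X"
    unfolding brel_def using x h m by blast
  from B.P.proj_rel[OF this] show ?thesis
    unfolding pb_cls[OF X]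
    using B.P.cls_rel(3)[where x = "(ract X x h, m)" and y = "(x, lact M h m)" and z = "(x, m)" and a = "\<zero>\<^bsub>K\<^esub>"]
      x h m X.ract_closed lact_closed by simp
qed

text \<open>
  The universal property of \<open>X \<otimes>\<^sub>H M\<close>; with \<open>bal_eqI\<close> it determines linear maps by balanced bilinear ones.
\<close>

lemma
  assumes X: "right_hmodule K H X" and W: "module K W" and F: "bilinear K X M W F"
    and bal: "\<And>x h m. x \<in> carrier X \<Longrightarrow> h \<in> carrier H \<Longrightarrow> m \<in> carrier M \<Longrightarrow> F (ract X x h) m = F x (lact M h m)"
  shows bal_ext_linear: "sweedler K W (\<lambda>(x, m). F x m) \<in> linear_maps K (bal X) W"
    and bal_ext_pure: "x \<in> carrier X \<Longrightarrow> m \<in> carrier M \<Longrightarrow> sweedler K W (\<lambda>(x, m). F x m) (pb X x m) = F x m"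
proof -
  interpret X: right_hmodule K H X by fact
  interpret B: bilinear_presentation K X M "brel X" by (rule bilinear_presentation_bal[OF X])
  have F': "(\<lambda>(x, y). F x y) \<in> carrier X \<times> carrier M \<rightarrow> carrier W"
    using bilinear_closed[OF F] by auto
  have rel: "B.P.lext W (\<lambda>(x, m). F x m) r = \<zero>\<^bsub>W\<^esub>" if "r \<in> brel X" for r
    using that unfolding brel_def
  proof (elim UnE CollectE exE conjE)
    fix x h m assume "r = generator K (ract X x h, m) \<ominus>\<^bsub>B.P.Fr\<^esub> generator K (x, lact M h m)"
      and xhm: "x \<in> carrier X" "h \<in> carrier H" "m \<in> carrier M"
    then show ?thesis
      by (simp only:, intro B.P.lext_rel_eq[OF W F', where z = "(x, m)" and a = "\<zero>\<^bsub>K\<^esub>"])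
        (simp_all add: X.ract_closed lact_closed bal)
  qed (rule B.lext_bilinear[OF W F])
  show "sweedler K W (\<lambda>(x, m). F x m) \<in> linear_maps K (bal X) W"
    unfolding bal_pres by (rule B.P.sweedler_linear[OF W F' rel])
  show "sweedler K W (\<lambda>(x, m). F x m) (pb X x m) = F x m" if "x \<in> carrier X" "m \<in> carrier M"
    unfolding pb_cls[OF X] using B.P.sweedler_cls[OF W F' rel, of "(x, m)"] that by simp
qed

lemma bal_eqI:
  assumes X: "right_hmodule K H X" and "module K W" "f \<in> linear_maps K (bal X) W" "g \<in> linear_maps K (bal X) W"
    and "\<And>x m. x \<in> carrier X \<Longrightarrow> m \<in> carrier M \<Longrightarrow> f (pb X x m) = g (pb X x m)" and "u \<in> carrier (bal X)"
  shows "f u = g u"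
proof -
  interpret B: bilinear_presentation K X M "brel X" by (rule bilinear_presentation_bal[OF X])
  show ?thesis
    using B.P.pres_eqI[of W f g u] assms(2-) by (force simp: bal_pres pb_cls[OF X])
qed

lemma
  assumes X: "right_hmodule K H X" and Y: "right_hmodule K H Y" and f: "f \<in> right_linear_maps K H X Y"
  shows bmap_linear: "bmap Y f \<in> linear_maps K (bal X) (bal Y)"
    and bmap_pure: "x \<in> carrier X \<Longrightarrow> m \<in> carrier M \<Longrightarrow> bmap Y f (pb X x m) = pb Y (f x) m"
proof -
  have b: "bilinear K X M (bal Y) (\<lambda>x m. pb Y (f x) m)"
    using linear_comp[OF hlinear_linear[OF f] bilinear_left[OF pb_bilinear[OF Y]]]
      bilinear_right[OF pb_bilinear[OF Y]] hlinear_closed[OF f]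
    by (intro bilinearI) simp_all
  have c: "pb Y (f (ract X x h)) m = pb Y (f x) (lact M h m)"
    if "x \<in> carrier X" "h \<in> carrier H" "m \<in> carrier M" for x h m
    using that hlinear_ract[OF f] hlinear_closed[OF f] pb_balanced[OF Y] by simp
  show "bmap Y f \<in> linear_maps K (bal X) (bal Y)"
    unfolding balanced_map_def by (rule bal_ext_linear[OF X bal_module[OF Y] b c])
  show "bmap Y f (pb X x m) = pb Y (f x) m" if "x \<in> carrier X" "m \<in> carrier M"
    unfolding balanced_map_def by (rule bal_ext_pure[OF X bal_module[OF Y] b c that])
qed

lemmas bmap_closed = linear_closed[OF bmap_linear]

lemma bmap_comp:
  assumes X: "right_hmodule K H X" and Y: "right_hmodule K H Y" and Z: "right_hmodule K H Z"
    and f: "f \<in> right_linear_maps K H X Y" and g: "g \<in> right_linear_maps K H Y Z" and u: "u \<in> carrier (bal X)"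
  shows "bmap Z (\<lambda>x. g (f x)) u = bmap Z g (bmap Y f u)"
  by (rule bal_eqI[OF X bal_module[OF Z] bmap_linear[OF X Z hlinear_comp[OF f g]]
        linear_comp[OF bmap_linear[OF X Y f] bmap_linear[OF Y Z g]] _ u])
     (simp add: bmap_pure[OF X Z hlinear_comp[OF f g]] bmap_pure[OF X Y f] bmap_pure[OF Y Z g]
       hlinear_closed[OF f])

lemma bmap_id:
  assumes X: "right_hmodule K H X" and u: "u \<in> carrier (bal X)"
  shows "bmap X (\<lambda>x. x) u = u"
  by (rule bal_eqI[OF X bal_module[OF X] bmap_linear[OF X X hlinear_id] linear_id _ u])
     (simp add: bmap_pure[OF X X hlinear_id])

lemma bmap_cong:
  assumes X: "right_hmodule K H X" and Y: "right_hmodule K H Y"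
    and f: "f \<in> right_linear_maps K H X Y" and g: "g \<in> right_linear_maps K H X Y"
    and eq: "\<And>x. x \<in> carrier X \<Longrightarrow> f x = g x" and u: "u \<in> carrier (bal X)"
  shows "bmap Y f u = bmap Y g u"
  by (rule bal_eqI[OF X bal_module[OF Y] bmap_linear[OF X Y f] bmap_linear[OF X Y g] _ u])
     (simp add: bmap_pure[OF X Y f] bmap_pure[OF X Y g] eq)

lemma bmap_finsum:
  assumes X: "right_hmodule K H X" and Y: "right_hmodule K H Y" and A: "finite A"
    and f: "\<And>i. i \<in> A \<Longrightarrow> f i \<in> right_linear_maps K H X Y" and u: "u \<in> carrier (bal X)"
  shows "bmap Y (\<lambda>x. \<Oplus>\<^bsub>Y\<^esub>i\<in>A. f i x) u = (\<Oplus>\<^bsub>bal Y\<^esub>i\<in>A. bmap Y (f i) u)"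
proof (rule bal_eqI[OF X bal_module[OF Y] bmap_linear[OF X Y hlinear_finsum[OF Y A f]]
      linear_finsum[OF bal_module[OF Y] A bmap_linear[OF X Y f]] _ u])
  interpret Y: right_hmodule K H Y by fact
  interpret BY: module K "bal Y" by (rule bal_module[OF Y])
  fix x m assume x: "x \<in> carrier X" and m: "m \<in> carrier M"
  have "pb Y (\<Oplus>\<^bsub>Y\<^esub>i\<in>A. f i x) m = (\<Oplus>\<^bsub>bal Y\<^esub>i\<in>A. pb Y (f i x) m)"
    by (rule linear_map.finsum[OF linear_map.intro[OF Y.module_axioms bal_module[OF Y]
            linear_map_axioms.intro[OF bilinear_left[OF pb_bilinear[OF Y] m]]]])
      (simp add: hlinear_closed[OF f] x)
  also have "\<dots> = (\<Oplus>\<^bsub>bal Y\<^esub>i\<in>A. bmap Y (f i) (pb X x m))"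
    by (rule BY.finsum_cong'[OF refl])
      (simp_all add: bmap_pure[OF X Y f] x m pb_closed[OF Y] hlinear_closed[OF f])
  finally show "bmap Y (\<lambda>x. \<Oplus>\<^bsub>Y\<^esub>i\<in>A. f i x) (pb X x m) = (\<Oplus>\<^bsub>bal Y\<^esub>i\<in>A. bmap Y (f i) (pb X x m))"
    by (simp add: bmap_pure[OF X Y hlinear_finsum[OF Y A f]] x m)
qed

lemma bmap_plus:
  assumes X: "right_hmodule K H X" and Y: "right_hmodule K H Y"
    and f: "f \<in> right_linear_maps K H X Y" and g: "g \<in> right_linear_maps K H X Y" and u: "u \<in> carrier (bal X)"
  shows "bmap Y (\<lambda>x. f x \<oplus>\<^bsub>Y\<^esub> g x) u = bmap Y f u \<oplus>\<^bsub>bal Y\<^esub> bmap Y g u"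
  by (rule bal_eqI[OF X bal_module[OF Y] bmap_linear[OF X Y hlinear_plus[OF Y f g]]
        linear_plus[OF bal_module[OF Y] bmap_linear[OF X Y f] bmap_linear[OF X Y g]] _ u])
    (simp add: bmap_pure[OF X Y hlinear_plus[OF Y f g]] bmap_pure[OF X Y f] bmap_pure[OF X Y g]
       linear_add[OF bilinear_left[OF pb_bilinear[OF Y]]] hlinear_closed[OF f] hlinear_closed[OF g])

lemma bmap_uminus:
  assumes X: "right_hmodule K H X" and Y: "right_hmodule K H Y"
    and f: "f \<in> right_linear_maps K H X Y" and u: "u \<in> carrier (bal X)"
  shows "bmap Y (\<lambda>x. \<ominus>\<^bsub>Y\<^esub> f x) u = \<ominus>\<^bsub>bal Y\<^esub> bmap Y f u"
proof (rule bal_eqI[OF X bal_module[OF Y] bmap_linear[OF X Y hlinear_uminus[OF Y f]]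
      linear_uminus[OF bal_module[OF Y] bmap_linear[OF X Y f]] _ u])
  interpret Y: right_hmodule K H Y by fact
  fix x m assume x: "x \<in> carrier X" and m: "m \<in> carrier M"
  have "pb Y (\<ominus>\<^bsub>Y\<^esub> f x) m = \<ominus>\<^bsub>bal Y\<^esub> pb Y (f x) m"
    by (rule linear_map.minus[OF linear_map.intro[OF Y.module_axioms bal_module[OF Y]
            linear_map_axioms.intro[OF bilinear_left[OF pb_bilinear[OF Y] m]]]])
      (simp add: hlinear_closed[OF f] x)
  then show "bmap Y (\<lambda>x. \<ominus>\<^bsub>Y\<^esub> f x) (pb X x m) = \<ominus>\<^bsub>bal Y\<^esub> bmap Y f (pb X x m)"
    by (simp add: bmap_pure[OF X Y hlinear_uminus[OF Y f]] bmap_pure[OF X Y f] x m)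
qed

lemma bmap_zero:
  assumes X: "right_hmodule K H X" and Y: "right_hmodule K H Y" and u: "u \<in> carrier (bal X)"
  shows "bmap Y (\<lambda>x. \<zero>\<^bsub>Y\<^esub>) u = \<zero>\<^bsub>bal Y\<^esub>"
proof -
  interpret Y: right_hmodule K H Y by fact
  interpret BY: module K "bal Y" by (rule bal_module[OF Y])
  show ?thesis
    using bmap_finsum[OF X Y finite.emptyI, of "\<lambda>_ _. undefined" u] u by (simp add: Y.finsum_empty BY.finsum_empty)
qed

end

section \<open>Sweedler calculus in a Hopf algebra\<close>

lemma bilinear_pre:
  assumes B: "bilinear K V U W B" and f: "f \<in> linear_maps K V' V" and g: "g \<in> linear_maps K U' U"
  shows "bilinear K V' U' W (\<lambda>x y. B (f x) (g y))"
proof (rule bilinearI)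
  show "(\<lambda>y. B (f x) (g y)) \<in> linear_maps K U' W" if "x \<in> carrier V'" for x
    by (rule linear_comp[OF g bilinear_right[OF B linear_closed[OF f that]]])
  show "(\<lambda>x. B (f x) (g y)) \<in> linear_maps K V' W" if "y \<in> carrier U'" for y
    by (rule linear_comp[OF f bilinear_left[OF B linear_closed[OF g that]]])
qed

lemma tuples_append: "xs \<in> tuples V m \<Longrightarrow> ys \<in> tuples V n \<Longrightarrow> xs @ ys \<in> tuples V (m + n)"
  by (auto simp: tuples_def)

lemma tuples_nth: "xs \<in> tuples V n \<Longrightarrow> i < n \<Longrightarrow> xs ! i \<in> carrier V"
  by (auto simp: tuples_def)

lemma tuples_take: "xs \<in> tuples V n \<Longrightarrow> i \<le> n \<Longrightarrow> take i xs \<in> tuples V i"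
  by (auto simp: tuples_def dest: in_set_takeD)

lemma tuples_drop: "xs \<in> tuples V n \<Longrightarrow> drop i xs \<in> tuples V (n - i)"
  by (auto simp: tuples_def dest: in_set_dropD)

lemma tuples_length: "xs \<in> tuples V n \<Longrightarrow> length xs = n"
  by (simp add: tuples_def)

context tensor_powers
begin

lemma ext_comp:
  assumes U: "module K U" and W: "module K W" and F: "multilinear K V n U F" and f: "f \<in> linear_maps K U W"
    and u: "u \<in> carrier (T n)"
  shows "f (sweedler K U F u) = sweedler K W (\<lambda>xs. f (F xs)) u"
  by (rule T_eqI[OF W linear_comp[OF ext_linear[OF U F] f] ext_linear[OF W multilinear_comp[OF F f]] _ u])
     (simp add: ext_pure[OF U F] ext_pure[OF W multilinear_comp[OF F f]])

text \<open>
  For nested Sweedler sums: an inner sum depends linearly on the variables of the outer sum, so that the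
  outer summand is again multilinear.
\<close>

lemma ext_param:
  assumes Z: "module K Z" and W: "module K W" and F: "\<And>z. z \<in> carrier Z \<Longrightarrow> multilinear K V n W (F z)"
    and l: "\<And>xs. xs \<in> tuples V n \<Longrightarrow> (\<lambda>z. F z xs) \<in> linear_maps K Z W" and u: "u \<in> carrier (T n)"
  shows "(\<lambda>z. sweedler K W (F z) u) \<in> linear_maps K Z W"
proof (rule linear_mapsI)
  interpret W: module K W by fact
  interpret Z: module K Z by fact
  show "sweedler K W (F z) u \<in> carrier W" if "z \<in> carrier Z" for z
    by (rule linear_closed[OF ext_linear[OF W F[OF that]] u])
  show "sweedler K W (F (z \<oplus>\<^bsub>Z\<^esub> z')) u = sweedler K W (F z) u \<oplus>\<^bsub>W\<^esub> sweedler K W (F z') u"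
    if z: "z \<in> carrier Z" "z' \<in> carrier Z" for z z'
    using z by (intro T_eqI[OF W ext_linear[OF W F] linear_plus[OF W ext_linear[OF W F] ext_linear[OF W F]] _ u])
      (simp_all add: ext_pure[OF W F] linear_add[OF l])
  show "sweedler K W (F (a \<odot>\<^bsub>Z\<^esub> z)) u = a \<odot>\<^bsub>W\<^esub> sweedler K W (F z) u"
    if z: "a \<in> carrier K" "z \<in> carrier Z" for a z
    using z by (intro T_eqI[OF W ext_linear[OF W F] linear_scale[OF W ext_linear[OF W F]] _ u])
      (simp_all add: ext_pure[OF W F] linear_smult[OF l])
qed

lemma pure_embed:
  assumes A: "A \<in> tuples V a" and B: "B \<in> tuples V b" and n: "n = a + m + b"
  shows "multilinear K V m (T n) (\<lambda>ys. pure (A @ ys @ B))"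
proof (rule multilinearI)
  fix ys assume ys: "ys \<in> tuples V m"
  have t: "A @ ys @ B \<in> tuples V n"
    using tuples_append[OF A tuples_append[OF ys B]] by (simp add: n add.assoc)
  then show "pure (A @ ys @ B) \<in> carrier (T n)" by (rule pure_closed)
  fix i assume i: "i < m"
  have "A @ ys[i := x] @ B = (A @ ys @ B)[a + i := x]" for x
    using i tuples_length[OF A] tuples_length[OF ys] by (simp add: list_update_append)
  then show "(\<lambda>x. pure (A @ ys[i := x] @ B)) \<in> linear_maps K V (T n)"
    using multilinear_slot[OF pure_multilinear t, of "a + i"] i n by simp
qed

definition app :: "nat \<Rightarrow> ('v list \<Rightarrow> 'k) set \<Rightarrow> 'v \<Rightarrow> ('v list \<Rightarrow> 'k) set" where
  "app n t y = sweedler K (T (Suc n)) (\<lambda>xs. pure (xs @ [y])) t"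

lemma app_multilinear: "y \<in> carrier V \<Longrightarrow> multilinear K V n (T (Suc n)) (\<lambda>xs. pure (xs @ [y]))"
  using pure_embed[of "[]" 0 "[y]" 1 "Suc n" n] by (simp add: tuples_def)

lemma app_pure: "xs \<in> tuples V n \<Longrightarrow> y \<in> carrier V \<Longrightarrow> app n (pure xs) y = pure (xs @ [y])"
  unfolding app_def by (rule ext_pure[OF T_module app_multilinear])

lemma app_bilinear: "bilinear K (T n) V (T (Suc n)) (app n)"
proof (rule bilinearI)
  show "(\<lambda>t. app n t y) \<in> linear_maps K (T n) (T (Suc n))" if "y \<in> carrier V" for y
    unfolding app_def by (rule ext_linear[OF T_module app_multilinear[OF that]])
  show "app n t \<in> linear_maps K V (T (Suc n))" if "t \<in> carrier (T n)" for t
    unfolding app_def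
  proof (rule ext_param[OF V.module_axioms T_module app_multilinear _ that])
    fix xs assume "xs \<in> tuples V n"
    then show "(\<lambda>y. pure (xs @ [y])) \<in> linear_maps K V (T (Suc n))"
      using multilinear_slot[OF pure_embed[of xs n "[]" 0 "Suc n" 1], of "[\<zero>\<^bsub>V\<^esub>]" 0] by (simp add: tuples_def)
  qed
qed

lemmas app_closed = bilinear_closed[OF app_bilinear]

text \<open>
  With \<open>app\<close> as the pairing, \<open>T (Suc n)\<close> is the tensor product of \<open>T n\<close> and \<open>V\<close>. This is the uniqueness half of the
  universal property; \<open>split\<close> below gives the existence half.
\<close>

lemma T_Suc_eqI:
  assumes W: "module K W" and f: "f \<in> linear_maps K (T (Suc n)) W" and g: "g \<in> linear_maps K (T (Suc n)) W"
    and eq: "\<And>t y. t \<in> carrier (T n) \<Longrightarrow> y \<in> carrier V \<Longrightarrow> f (app n t y) = g (app n t y)"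
    and u: "u \<in> carrier (T (Suc n))"
  shows "f u = g u"
proof (rule T_eqI[OF W f g _ u])
  fix xs assume xs: "xs \<in> tuples V (Suc n)"
  then have "xs = butlast xs @ [last xs]" by (cases xs rule: rev_cases) (auto simp: tuples_def)
  moreover have b: "butlast xs \<in> tuples V n" "last xs \<in> carrier V"
    using xs by (cases xs rule: rev_cases; auto simp: tuples_def)+
  ultimately have "pure xs = app n (pure (butlast xs)) (last xs)" using app_pure by metis
  then show "f (pure xs) = g (pure xs)" using eq[OF pure_closed[OF b(1)] b(2)] by simp
qed

definition split :: "nat \<Rightarrow> ('k, 'w, 'b) module_scheme \<Rightarrow> (('v list \<Rightarrow> 'k) set \<Rightarrow> 'v \<Rightarrow> 'w) \<Rightarrow> ('v list \<Rightarrow> 'k) set \<Rightarrow> 'w" where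
  "split n W B = sweedler K W (\<lambda>xs. B (pure (butlast xs)) (last xs))"

lemma
  assumes W: "module K W" and B: "bilinear K (T n) V W B"
  shows split_linear: "split n W B \<in> linear_maps K (T (Suc n)) W"
    and split_app: "t \<in> carrier (T n) \<Longrightarrow> y \<in> carrier V \<Longrightarrow> split n W B (app n t y) = B t y"
proof -
  have m: "multilinear K V (Suc n) W (\<lambda>xs. B (pure (butlast xs)) (last xs))"
  proof (rule multilinearI)
    fix xs assume "xs \<in> tuples V (Suc n)"
    then obtain zs z where xs: "xs = zs @ [z]" and b: "zs \<in> tuples V n" "z \<in> carrier V"
      by (cases xs rule: rev_cases) (auto simp: tuples_def)
    have len: "length zs = n" using b by (simp add: tuples_def)
    show "B (pure (butlast xs)) (last xs) \<in> carrier W"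
      using bilinear_closed[OF B pure_closed[OF b(1)] b(2)] by (simp add: xs)
    fix i assume "i < Suc n"
    then consider "i = n" | "i < n" by linarith
    then show "(\<lambda>x. B (pure (butlast (xs[i := x]))) (last (xs[i := x]))) \<in> linear_maps K V W"
    proof cases
      case 1
      then have "xs[i := x] = zs @ [x]" for x by (simp add: xs len list_update_append)
      then show ?thesis using bilinear_right[OF B pure_closed[OF b(1)]] by simp
    next
      case 2
      then have "xs[i := x] = zs[i := x] @ [z]" for x by (simp add: xs len list_update_append)
      then show ?thesis
        using linear_comp[OF multilinear_slot[OF pure_multilinear b(1) 2] bilinear_left[OF B b(2)]] by simp
    qed
  qed
  show sl: "split n W B \<in> linear_maps K (T (Suc n)) W"
    unfolding split_def by (rule ext_linear[OF W m])
  show "split n W B (app n t y) = B t y" if t: "t \<in> carrier (T n)" and y: "y \<in> carrier V"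
  proof (rule T_eqI[OF W linear_comp[OF bilinear_left[OF app_bilinear y] sl] bilinear_left[OF B y] _ t])
    fix xs assume "xs \<in> tuples V n"
    then show "split n W B (app n (pure xs) y) = B (pure xs) y"
      using ext_pure[OF W m, of "xs @ [y]"] y by (simp add: app_pure split_def) (simp add: tuples_def)
  qed
qed

end

text \<open>
  The commutative ring as a module over itself, in the shape that \<open>trivial_right_module\<close> has.
\<close>

lemma cring_module:
  assumes "cring K"
  shows "module K (\<lparr>carrier = carrier K, mult = undefined, one = undefined,
      zero = \<zero>\<^bsub>K\<^esub>, add = (\<lambda>x y. x \<oplus>\<^bsub>K\<^esub> y), smult = (\<lambda>a x. a \<otimes>\<^bsub>K\<^esub> x), \<dots> = z\<rparr>)"
proof -
  interpret K: cring K by fact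
  show ?thesis
  proof (rule moduleI)
    show "abelian_group \<lparr>carrier = carrier K, mult = undefined, one = undefined,
      zero = \<zero>\<^bsub>K\<^esub>, add = (\<lambda>x y. x \<oplus>\<^bsub>K\<^esub> y), smult = (\<lambda>a x. a \<otimes>\<^bsub>K\<^esub> x), \<dots> = z\<rparr>"
    proof (rule abelian_groupI)
      fix x assume "x \<in> carrier \<lparr>carrier = carrier K, mult = undefined, one = undefined,
        zero = \<zero>\<^bsub>K\<^esub>, add = (\<lambda>x y. x \<oplus>\<^bsub>K\<^esub> y), smult = (\<lambda>a x. a \<otimes>\<^bsub>K\<^esub> x), \<dots> = z\<rparr>"
      then have "x \<in> carrier K" by simp
      then show "\<exists>y\<in>carrier \<lparr>carrier = carrier K, mult = undefined, one = undefined,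
        zero = \<zero>\<^bsub>K\<^esub>, add = (\<lambda>x y. x \<oplus>\<^bsub>K\<^esub> y), smult = (\<lambda>a x. a \<otimes>\<^bsub>K\<^esub> x), \<dots> = z\<rparr>.
        y \<oplus>\<^bsub>\<lparr>carrier = carrier K, mult = undefined, one = undefined,
        zero = \<zero>\<^bsub>K\<^esub>, add = (\<lambda>x y. x \<oplus>\<^bsub>K\<^esub> y), smult = (\<lambda>a x. a \<otimes>\<^bsub>K\<^esub> x), \<dots> = z\<rparr>\<^esub> x =
        \<zero>\<^bsub>\<lparr>carrier = carrier K, mult = undefined, one = undefined,
        zero = \<zero>\<^bsub>K\<^esub>, add = (\<lambda>x y. x \<oplus>\<^bsub>K\<^esub> y), smult = (\<lambda>a x. a \<otimes>\<^bsub>K\<^esub> x), \<dots> = z\<rparr>\<^esub>"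
        by (intro bexI[of _ "\<ominus>\<^bsub>K\<^esub> x"]) (simp_all add: K.l_neg)
    qed (simp_all add: K.a_ac)
  qed (simp_all add: K.cring_axioms K.l_distr K.r_distr K.m_assoc)
qed

context hopf_algebra
begin

lemma ring_H: "ring H" ..
lemma module_H: "module K H" ..
lemma cring_K: "cring K" ..

sublocale P: tensor_powers K H by (intro tensor_powers.intro module_H)

abbreviation T where "T n \<equiv> tensor_power K H n"
abbreviation pure where "pure xs \<equiv> pure_power K H xs"
abbreviation iter where "iter n h \<equiv> iterated_comult K H n h"

lemma mult_closed: "x \<in> carrier H \<Longrightarrow> y \<in> carrier H \<Longrightarrow> x \<otimes>\<^bsub>H\<^esub> y \<in> carrier H"
  by (rule monoid.m_closed[OF ring.is_monoid[OF ring_H]])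

lemma mult_assoc: "x \<in> carrier H \<Longrightarrow> y \<in> carrier H \<Longrightarrow> z \<in> carrier H \<Longrightarrow>
    x \<otimes>\<^bsub>H\<^esub> y \<otimes>\<^bsub>H\<^esub> z = x \<otimes>\<^bsub>H\<^esub> (y \<otimes>\<^bsub>H\<^esub> z)"
  by (rule monoid.m_assoc[OF ring.is_monoid[OF ring_H]])

lemma one_H: "\<one>\<^bsub>H\<^esub> \<in> carrier H"
  by (rule monoid.one_closed[OF ring.is_monoid[OF ring_H]])

lemma mult_one: "x \<in> carrier H \<Longrightarrow> \<one>\<^bsub>H\<^esub> \<otimes>\<^bsub>H\<^esub> x = x" "x \<in> carrier H \<Longrightarrow> x \<otimes>\<^bsub>H\<^esub> \<one>\<^bsub>H\<^esub> = x"
  using monoid.l_one[OF ring.is_monoid[OF ring_H]] monoid.r_one[OF ring.is_monoid[OF ring_H]] by auto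

lemma mult_bilinear: "bilinear K H H H (\<lambda>x y. x \<otimes>\<^bsub>H\<^esub> y)"
  by (intro bilinearI linear_mapsI)
    (simp_all add: mult_closed smult_mult_left smult_mult_right
      ringE(3)[OF ring_H] ringE(4)[OF ring_H])

lemma counit_scale_linear:
  assumes W: "module K W" and w: "w \<in> carrier W"
  shows "(\<lambda>x. counit H x \<odot>\<^bsub>W\<^esub> w) \<in> linear_maps K H W"
proof -
  interpret W: module K W by fact
  show ?thesis
    by (rule linear_mapsI)
       (simp_all add: counit_closed counit_add counit_smult W.smult_l_distr W.smult_assoc1 w)
qed

lemma counit_bilinear:
  assumes W: "module K W" and g: "g \<in> linear_maps K V W"
  shows "bilinear K H V W (\<lambda>x y. counit H x \<odot>\<^bsub>W\<^esub> g y)" "bilinear K V H W (\<lambda>y x. counit H x \<odot>\<^bsub>W\<^esub> g y)"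
  by (intro bilinearI linear_scale[OF W g] counit_closed counit_scale_linear[OF W] linear_closed[OF g]; assumption)+

lemma comult_closed: "h \<in> carrier H \<Longrightarrow> comult H h \<in> carrier (T 2)"
  by (rule linear_closed[OF comult_linear])

text \<open>
  In Sweedler's notation this is \<open>\<Sum> B(h\<^sub>1, h\<^sub>2)\<close>. The axioms of a Hopf algebra are restated below as rewriting
  rules for such sums with arbitrary bilinear \<open>B\<close>, since in this form they apply inside larger expressions.
\<close>

definition Sw :: "('k, 'w, 'b) module_scheme \<Rightarrow> ('h \<Rightarrow> 'h \<Rightarrow> 'w) \<Rightarrow> 'h \<Rightarrow> 'w" where
  "Sw W B h = sweedler K W (\<lambda>xs. B (xs ! 0) (xs ! 1)) (comult H h)"

lemma tuples2: "xs \<in> tuples H 2 \<Longrightarrow> \<exists>a b. xs = [a, b] \<and> a \<in> carrier H \<and> b \<in> carrier H"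
  by (auto simp: tuples_def numeral_2_eq_2 length_Suc_conv)

lemma tuples3: "xs \<in> tuples H 3 \<Longrightarrow> \<exists>a b c. xs = [a, b, c] \<and> a \<in> carrier H \<and> b \<in> carrier H \<and> c \<in> carrier H"
  by (auto simp: tuples_def numeral_3_eq_3 length_Suc_conv)

lemma tuples_lists: "a \<in> carrier H \<Longrightarrow> [a] \<in> tuples H (Suc 0)"
  "a \<in> carrier H \<Longrightarrow> b \<in> carrier H \<Longrightarrow> [a, b] \<in> tuples H 2"
  "a \<in> carrier H \<Longrightarrow> b \<in> carrier H \<Longrightarrow> c \<in> carrier H \<Longrightarrow> [a, b, c] \<in> tuples H 3"
  by (simp_all add: tuples_def)

lemma multilinear2:
  assumes B: "bilinear K H H W B"
  shows "multilinear K H 2 W (\<lambda>xs. B (xs ! 0) (xs ! 1))"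
proof (rule multilinearI)
  fix xs assume "xs \<in> tuples H 2"
  then obtain a b where ab: "xs = [a, b]" "a \<in> carrier H" "b \<in> carrier H" using tuples2 by blast
  then show "B (xs ! 0) (xs ! 1) \<in> carrier W" using bilinear_closed[OF B] by simp
  fix i :: nat assume "i < 2"
  then have "i = 0 \<or> i = 1" by linarith
  then show "(\<lambda>x. B (xs[i := x] ! 0) (xs[i := x] ! 1)) \<in> linear_maps K H W"
    using ab bilinear_left[OF B, of b] bilinear_right[OF B, of a] by auto
qed

lemma
  assumes W: "module K W" and B: "bilinear K H H W B"
  shows Sw_linear: "Sw W B \<in> linear_maps K H W"
    and Sw_closed: "h \<in> carrier H \<Longrightarrow> Sw W B h \<in> carrier W"
    and Sw_comp: "module K Z \<Longrightarrow> f \<in> linear_maps K W Z \<Longrightarrow> h \<in> carrier H \<Longrightarrow> f (Sw W B h) = Sw Z (\<lambda>x y. f (B x y)) h"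
    and Sw_cong: "h \<in> carrier H \<Longrightarrow> (\<And>x y. x \<in> carrier H \<Longrightarrow> y \<in> carrier H \<Longrightarrow> C x y = B x y) \<Longrightarrow> Sw W C h = Sw W B h"
proof -
  show l: "Sw W B \<in> linear_maps K H W"
    unfolding Sw_def by (rule linear_comp[OF comult_linear P.ext_linear[OF W multilinear2[OF B]]])
  show "Sw W B h \<in> carrier W" if "h \<in> carrier H" by (rule linear_closed[OF l that])
  show "f (Sw W B h) = Sw Z (\<lambda>x y. f (B x y)) h" if "module K Z" "f \<in> linear_maps K W Z" "h \<in> carrier H"
    unfolding Sw_def by (rule P.ext_comp[OF W that(1) multilinear2[OF B] that(2) comult_closed[OF that(3)]])
  show "Sw W C h = Sw W B h" if "h \<in> carrier H" "\<And>x y. x \<in> carrier H \<Longrightarrow> y \<in> carrier H \<Longrightarrow> C x y = B x y"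
    unfolding Sw_def
    by (rule P.ext_cong[OF W multilinear2[OF B] comult_closed[OF that(1)]]) (simp add: that(2) tuples_nth)
qed

lemma Sw_param:
  assumes Z: "module K Z" and W: "module K W"
    and B: "\<And>z. z \<in> carrier Z \<Longrightarrow> bilinear K H H W (B z)"
    and l: "\<And>x y. x \<in> carrier H \<Longrightarrow> y \<in> carrier H \<Longrightarrow> (\<lambda>z. B z x y) \<in> linear_maps K Z W"
    and h: "h \<in> carrier H"
  shows "(\<lambda>z. Sw W (B z) h) \<in> linear_maps K Z W"
  unfolding Sw_def
  by (rule P.ext_param[OF Z W multilinear2[OF B] l comult_closed[OF h]]) (simp_all add: tuples_nth)

lemma Sw_counit:
  assumes W: "module K W" and g: "g \<in> linear_maps K H W" and h: "h \<in> carrier H"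
  shows Sw_counit_left: "Sw W (\<lambda>x y. counit H x \<odot>\<^bsub>W\<^esub> g y) h = g h"
    and Sw_counit_right: "Sw W (\<lambda>x y. counit H y \<odot>\<^bsub>W\<^esub> g x) h = g h"
proof -
  note b = counit_bilinear[OF module_H linear_id]
  have "g (Sw H (\<lambda>x y. counit H x \<odot>\<^bsub>H\<^esub> y) h) = g h" using counit_left[OF h] by (simp add: Sw_def)
  then have "g h = Sw W (\<lambda>x y. g (counit H x \<odot>\<^bsub>H\<^esub> y)) h" by (simp add: Sw_comp[OF module_H b(1) W g h])
  also have "\<dots> = Sw W (\<lambda>x y. counit H x \<odot>\<^bsub>W\<^esub> g y) h"
    by (rule Sw_cong[OF W counit_bilinear(1)[OF W g] h]) (simp add: linear_smult[OF g] counit_closed)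
  finally show "Sw W (\<lambda>x y. counit H x \<odot>\<^bsub>W\<^esub> g y) h = g h" by simp
  have "g (Sw H (\<lambda>x y. counit H y \<odot>\<^bsub>H\<^esub> x) h) = g h" using counit_right[OF h] by (simp add: Sw_def)
  then have "g h = Sw W (\<lambda>x y. g (counit H y \<odot>\<^bsub>H\<^esub> x)) h" by (simp add: Sw_comp[OF module_H b(2) W g h])
  also have "\<dots> = Sw W (\<lambda>x y. counit H y \<odot>\<^bsub>W\<^esub> g x) h"
    by (rule Sw_cong[OF W counit_bilinear(2)[OF W g] h]) (simp add: linear_smult[OF g] counit_closed)
  finally show "Sw W (\<lambda>x y. counit H y \<odot>\<^bsub>W\<^esub> g x) h = g h" by simp
qed

lemma Sw_antipode:
  assumes W: "module K W" and g: "g \<in> linear_maps K H W" and h: "h \<in> carrier H"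
  shows Sw_antipode_left: "Sw W (\<lambda>x y. g (antipode H x \<otimes>\<^bsub>H\<^esub> y)) h = counit H h \<odot>\<^bsub>W\<^esub> g \<one>\<^bsub>H\<^esub>"
    and Sw_antipode_right: "Sw W (\<lambda>x y. g (x \<otimes>\<^bsub>H\<^esub> antipode H y)) h = counit H h \<odot>\<^bsub>W\<^esub> g \<one>\<^bsub>H\<^esub>"
proof -
  note b = bilinear_pre[OF mult_bilinear antipode_linear linear_id]
    bilinear_pre[OF mult_bilinear linear_id antipode_linear]
  show "Sw W (\<lambda>x y. g (antipode H x \<otimes>\<^bsub>H\<^esub> y)) h = counit H h \<odot>\<^bsub>W\<^esub> g \<one>\<^bsub>H\<^esub>"
    using Sw_comp[OF module_H b(1) W g h] antipode_left[OF h]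
    by (simp add: Sw_def linear_smult[OF g] counit_closed h one_H)
  show "Sw W (\<lambda>x y. g (x \<otimes>\<^bsub>H\<^esub> antipode H y)) h = counit H h \<odot>\<^bsub>W\<^esub> g \<one>\<^bsub>H\<^esub>"
    using Sw_comp[OF module_H b(2) W g h] antipode_right[OF h]
    by (simp add: Sw_def linear_smult[OF g] counit_closed h one_H)
qed

lemma Sw_one:
  assumes W: "module K W" and B: "bilinear K H H W B"
  shows "Sw W B \<one>\<^bsub>H\<^esub> = B \<one>\<^bsub>H\<^esub> \<one>\<^bsub>H\<^esub>"
  unfolding Sw_def comult_one using P.ext_pure[OF W multilinear2[OF B], of "[\<one>\<^bsub>H\<^esub>, \<one>\<^bsub>H\<^esub>]"]
  by (simp add: tuples_lists one_H)

subsection \<open>The algebra structure of the tensor powers\<close>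

lemma map2_update: "length xs = length ys \<Longrightarrow> i < length ys \<Longrightarrow>
    map2 f xs (ys[i := y]) = (map2 f xs ys)[i := f (xs ! i) y]"
  "length xs = length ys \<Longrightarrow> i < length xs \<Longrightarrow>
    map2 f (xs[i := x]) ys = (map2 f xs ys)[i := f x (ys ! i)]"
  by (rule nth_equalityI; simp add: nth_list_update)+

abbreviation mult2 where "mult2 xs ys \<equiv> map2 (\<lambda>x y. x \<otimes>\<^bsub>H\<^esub> y) xs ys"

lemma tuples_map2: "xs \<in> tuples H n \<Longrightarrow> ys \<in> tuples H n \<Longrightarrow> mult2 xs ys \<in> tuples H n"
  by (auto simp: tuples_def set_zip intro!: mult_closed)

lemma multilinear_mult_left: "xs \<in> tuples H n \<Longrightarrow> multilinear K H n (T n) (\<lambda>ys. pure (mult2 xs ys))"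
proof (rule multilinearI)
  fix ys assume xs: "xs \<in> tuples H n" and ys: "ys \<in> tuples H n"
  show "pure (mult2 xs ys) \<in> carrier (T n)" by (rule P.pure_closed[OF tuples_map2[OF xs ys]])
  fix i assume i: "i < n"
  have "mult2 xs (ys[i := x]) = (mult2 xs ys)[i := xs ! i \<otimes>\<^bsub>H\<^esub> x]" for x
    by (rule map2_update) (use xs ys i in \<open>simp_all add: tuples_length\<close>)
  then show "(\<lambda>x. pure (mult2 xs (ys[i := x]))) \<in> linear_maps K H (T n)"
    using linear_comp[OF bilinear_right[OF mult_bilinear tuples_nth[OF xs i]]
        multilinear_slot[OF P.pure_multilinear tuples_map2[OF xs ys] i]] by simp
qed

lemma multilinear_mult_right: "ys \<in> tuples H n \<Longrightarrow> multilinear K H n (T n) (\<lambda>xs. pure (mult2 xs ys))"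
proof (rule multilinearI)
  fix xs assume ys: "ys \<in> tuples H n" and xs: "xs \<in> tuples H n"
  show "pure (mult2 xs ys) \<in> carrier (T n)" by (rule P.pure_closed[OF tuples_map2[OF xs ys]])
  fix i assume i: "i < n"
  have "mult2 (xs[i := x]) ys = (mult2 xs ys)[i := x \<otimes>\<^bsub>H\<^esub> ys ! i]" for x
    by (rule map2_update) (use xs ys i in \<open>simp_all add: tuples_length\<close>)
  then show "(\<lambda>x. pure (mult2 (xs[i := x]) ys)) \<in> linear_maps K H (T n)"
    using linear_comp[OF bilinear_left[OF mult_bilinear tuples_nth[OF ys i]]
        multilinear_slot[OF P.pure_multilinear tuples_map2[OF xs ys] i]] by simp
qed

abbreviation pm where "pm n s t \<equiv> power_mult K H n s t"

lemma pm_outer: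
  assumes t: "t \<in> carrier (T n)"
  shows "multilinear K H n (T n) (\<lambda>xs. sweedler K (T n) (\<lambda>ys. pure (mult2 xs ys)) t)"
proof (rule multilinearI)
  fix xs assume xs: "xs \<in> tuples H n"
  show "sweedler K (T n) (\<lambda>ys. pure (mult2 xs ys)) t \<in> carrier (T n)"
    by (rule linear_closed[OF P.ext_linear[OF P.T_module multilinear_mult_left[OF xs]] t])
  fix i assume i: "i < n"
  show "(\<lambda>x. sweedler K (T n) (\<lambda>ys. pure (mult2 (xs[i := x]) ys)) t) \<in> linear_maps K H (T n)"
    by (rule P.ext_param[OF module_H P.T_module multilinear_mult_left[OF tuples_update[OF xs]]
          multilinear_slot[OF multilinear_mult_right xs i] t])
qed

lemma pm_bilinear: "bilinear K (T n) (T n) (T n) (power_mult K H n)"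
proof (rule bilinearI)
  show "(\<lambda>s. pm n s t) \<in> linear_maps K (T n) (T n)" if "t \<in> carrier (T n)" for t
    unfolding power_mult_def by (rule P.ext_linear[OF P.T_module pm_outer[OF that]])
  show "pm n s \<in> linear_maps K (T n) (T n)" if "s \<in> carrier (T n)" for s
    unfolding power_mult_def
    by (rule P.ext_param[OF P.T_module P.T_module pm_outer P.ext_linear[OF P.T_module multilinear_mult_left] that])
qed

lemmas pm_closed = bilinear_closed[OF pm_bilinear]

lemma pm_pure: "xs \<in> tuples H n \<Longrightarrow> ys \<in> tuples H n \<Longrightarrow> pm n (pure xs) (pure ys) = pure (mult2 xs ys)"
  unfolding power_mult_def
  by (simp add: P.ext_pure[OF P.T_module pm_outer[OF P.pure_closed]] P.ext_pure[OF P.T_module multilinear_mult_left])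

lemma T_eqI2:
  assumes W: "module K W" and f: "bilinear K (T m) (T n) W f" and g: "bilinear K (T m) (T n) W g"
    and eq: "\<And>xs ys. xs \<in> tuples H m \<Longrightarrow> ys \<in> tuples H n \<Longrightarrow> f (pure xs) (pure ys) = g (pure xs) (pure ys)"
    and s: "s \<in> carrier (T m)" and t: "t \<in> carrier (T n)"
  shows "f s t = g s t"
proof (rule P.T_eqI[OF W bilinear_left[OF f t] bilinear_left[OF g t] _ s])
  fix xs assume xs: "xs \<in> tuples H m"
  show "f (pure xs) t = g (pure xs) t"
    by (rule P.T_eqI[OF W bilinear_right[OF f P.pure_closed[OF xs]] bilinear_right[OF g P.pure_closed[OF xs]] _ t])
       (rule eq[OF xs])
qed

lemma pm_assoc:
  assumes r: "r \<in> carrier (T n)" and s: "s \<in> carrier (T n)" and t: "t \<in> carrier (T n)"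
  shows "pm n (pm n r s) t = pm n r (pm n s t)"
proof (rule P.T_eqI[OF P.T_module linear_comp[OF bilinear_left[OF pm_bilinear s] bilinear_left[OF pm_bilinear t]]
      bilinear_left[OF pm_bilinear pm_closed[OF s t]] _ r])
  fix xs assume xs: "xs \<in> tuples H n"
  note x = P.pure_closed[OF xs]
  show "pm n (pm n (pure xs) s) t = pm n (pure xs) (pm n s t)"
  proof (rule T_eqI2[OF P.T_module bilinear_pre[OF pm_bilinear bilinear_right[OF pm_bilinear x] linear_id]
        bilinear_comp[OF pm_bilinear bilinear_right[OF pm_bilinear x]] _ s t])
    fix ys zs assume ys: "ys \<in> tuples H n" and zs: "zs \<in> tuples H n"
    have "mult2 (mult2 xs ys) zs = mult2 xs (mult2 ys zs)"
      by (rule nth_equalityI) (use xs ys zs in \<open>simp_all add: tuples_length tuples_nth mult_assoc\<close>)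
    then show "pm n (pm n (pure xs) (pure ys)) (pure zs) = pm n (pure xs) (pm n (pure ys) (pure zs))"
      using xs ys zs by (simp add: pm_pure tuples_map2)
  qed
qed

abbreviation ones where "ones n \<equiv> pure (replicate n \<one>\<^bsub>H\<^esub>)"

lemma ones_tuples: "replicate n \<one>\<^bsub>H\<^esub> \<in> tuples H n" by (auto simp: tuples_def one_H)

lemma pm_one: "t \<in> carrier (T n) \<Longrightarrow> pm n t (ones n) = t"
proof (rule P.T_eqI[OF P.T_module bilinear_left[OF pm_bilinear P.pure_closed[OF ones_tuples]] linear_id])
  fix xs assume xs: "xs \<in> tuples H n"
  have "mult2 xs (replicate n \<one>\<^bsub>H\<^esub>) = xs"
    by (rule nth_equalityI) (use xs in \<open>simp_all add: tuples_length tuples_nth mult_one\<close>)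
  then show "pm n (pure xs) (ones n) = pure xs" using xs by (simp add: pm_pure ones_tuples)
qed

lemma pm_app:
  assumes s: "s \<in> carrier (T n)" and t: "t \<in> carrier (T n)" and x: "x \<in> carrier H" and y: "y \<in> carrier H"
  shows "pm (Suc n) (P.app n s x) (P.app n t y) = P.app n (pm n s t) (x \<otimes>\<^bsub>H\<^esub> y)"
proof (rule T_eqI2[OF P.T_module bilinear_pre[OF pm_bilinear bilinear_left[OF P.app_bilinear x] bilinear_left[OF P.app_bilinear y]]
      bilinear_comp[OF pm_bilinear bilinear_left[OF P.app_bilinear mult_closed[OF x y]]] _ s t])
  fix xs ys assume xs: "xs \<in> tuples H n" and ys: "ys \<in> tuples H n"
  have "xs @ [x] \<in> tuples H (Suc n)" "ys @ [y] \<in> tuples H (Suc n)"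
    using tuples_append[OF xs tuples_lists(1)[OF x]] tuples_append[OF ys tuples_lists(1)[OF y]] by simp_all
  then show "pm (Suc n) (P.app n (pure xs) x) (P.app n (pure ys) y) = P.app n (pm n (pure xs) (pure ys)) (x \<otimes>\<^bsub>H\<^esub> y)"
    using xs ys x y by (simp add: P.app_pure pm_pure tuples_map2 mult_closed tuples_length)
qed

text \<open>
  Sweedler's rule \<open>\<Delta>(xy) = \<Sum> x\<^sub>1 y\<^sub>1 \<otimes> x\<^sub>2 y\<^sub>2\<close>.
\<close>

lemma Sw_mult:
  assumes W: "module K W" and B: "bilinear K H H W B" and x: "x \<in> carrier H" and y: "y \<in> carrier H"
  shows "Sw W B (x \<otimes>\<^bsub>H\<^esub> y) = Sw W (\<lambda>a b. Sw W (\<lambda>c d. B (a \<otimes>\<^bsub>H\<^esub> c) (b \<otimes>\<^bsub>H\<^esub> d)) y) x"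
proof -
  let ?e = "sweedler K W (\<lambda>xs. B (xs ! 0) (xs ! 1))"
  note e = P.ext_linear[OF W multilinear2[OF B]]
  have "Sw W B (x \<otimes>\<^bsub>H\<^esub> y) = ?e (pm 2 (comult H x) (comult H y))"
    by (simp add: Sw_def comult_mult x y)
  also have "\<dots> = sweedler K W (\<lambda>xs. ?e (sweedler K (T 2) (\<lambda>ys. pure (mult2 xs ys)) (comult H y))) (comult H x)"
    unfolding power_mult_def
    by (rule P.ext_comp[OF P.T_module W pm_outer[OF comult_closed[OF y]] e comult_closed[OF x]])
  also have "\<dots> = Sw W (\<lambda>a b. Sw W (\<lambda>c d. B (a \<otimes>\<^bsub>H\<^esub> c) (b \<otimes>\<^bsub>H\<^esub> d)) y) x"
  proof -
    have bb: "bilinear K H H W (\<lambda>c d. B (a \<otimes>\<^bsub>H\<^esub> c) (b \<otimes>\<^bsub>H\<^esub> d))" if "a \<in> carrier H" "b \<in> carrier H" for a b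
      by (rule bilinear_pre[OF B bilinear_right[OF mult_bilinear that(1)] bilinear_right[OF mult_bilinear that(2)]])
    have cc: "bilinear K H H W (\<lambda>a b. B (a \<otimes>\<^bsub>H\<^esub> c) (b \<otimes>\<^bsub>H\<^esub> d))" if "c \<in> carrier H" "d \<in> carrier H" for c d
      by (rule bilinear_pre[OF B bilinear_left[OF mult_bilinear that(1)] bilinear_left[OF mult_bilinear that(2)]])
    have outer: "bilinear K H H W (\<lambda>a b. Sw W (\<lambda>c d. B (a \<otimes>\<^bsub>H\<^esub> c) (b \<otimes>\<^bsub>H\<^esub> d)) y)"
      by (rule bilinearI; rule Sw_param[OF module_H W bb _ y])
         (assumption | rule bilinear_left[OF cc] bilinear_right[OF cc])+
    have "?e (sweedler K (T 2) (\<lambda>ys. pure (mult2 [a, b] ys)) (comult H y)) = Sw W (\<lambda>c d. B (a \<otimes>\<^bsub>H\<^esub> c) (b \<otimes>\<^bsub>H\<^esub> d)) y"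
      if ab: "a \<in> carrier H" "b \<in> carrier H" for a b
    proof -
      have "?e (sweedler K (T 2) (\<lambda>ys. pure (mult2 [a, b] ys)) (comult H y)) =
          sweedler K W (\<lambda>ys. ?e (pure (mult2 [a, b] ys))) (comult H y)"
        by (rule P.ext_comp[OF P.T_module W multilinear_mult_left[OF tuples_lists(2)[OF ab]] e comult_closed[OF y]])
      also have "\<dots> = Sw W (\<lambda>c d. B (a \<otimes>\<^bsub>H\<^esub> c) (b \<otimes>\<^bsub>H\<^esub> d)) y"
        unfolding Sw_def
      proof (rule P.ext_cong[OF W multilinear2[OF bb[OF ab]] comult_closed[OF y]])
        fix ys assume "ys \<in> tuples H 2"
        then obtain c d where cd: "ys = [c, d]" "c \<in> carrier H" "d \<in> carrier H" using tuples2 by blast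
        then show "?e (pure (mult2 [a, b] ys)) = B (a \<otimes>\<^bsub>H\<^esub> ys ! 0) (b \<otimes>\<^bsub>H\<^esub> ys ! 1)"
          using P.ext_pure[OF W multilinear2[OF B], of "[a \<otimes>\<^bsub>H\<^esub> c, b \<otimes>\<^bsub>H\<^esub> d]"] ab
          by (simp add: tuples_lists mult_closed)
      qed
      finally show ?thesis .
    qed
    then show ?thesis
      unfolding Sw_def[of W "\<lambda>a b. Sw W (\<lambda>c d. B (a \<otimes>\<^bsub>H\<^esub> c) (b \<otimes>\<^bsub>H\<^esub> d)) y"]
      by (intro P.ext_cong[OF W multilinear2[OF outer] comult_closed[OF x]]) (auto dest!: tuples2)
  qed
  finally show ?thesis .
qed

subsection \<open>Coassociativity\<close>

lemma comult_at_multilinear: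
  assumes i: "i < n"
  shows "multilinear K H n (T (Suc n)) (comult_at K H i)"
proof (rule multilinearI)
  fix xs assume xs: "xs \<in> tuples H n"
  have len: "length xs = n" using xs by (rule tuples_length)
  have emb: "multilinear K H 2 (T (Suc n)) (\<lambda>ys. pure (take i ys' @ ys @ drop (Suc i) ys'))"
    if "ys' \<in> tuples H n" for ys'
    by (rule P.pure_embed[OF tuples_take[OF that] tuples_drop[OF that]]) (use i in simp_all)
  have ca: "comult_at K H i ys' = sweedler K (T (Suc n)) (\<lambda>ys. pure (take i ys' @ ys @ drop (Suc i) ys')) (comult H (ys' ! i))"
    if "ys' \<in> tuples H n" for ys'
    using that by (simp add: comult_at_def tuples_length)
  show "comult_at K H i xs \<in> carrier (T (Suc n))"
    unfolding ca[OF xs]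
    by (rule linear_closed[OF P.ext_linear[OF P.T_module emb[OF xs]] comult_closed[OF tuples_nth[OF xs i]]])
  fix j assume j: "j < n"
  show "(\<lambda>x. comult_at K H i (xs[j := x])) \<in> linear_maps K H (T (Suc n))"
  proof (cases "j = i")
    case True
    have "comult_at K H i (xs[j := x]) = sweedler K (T (Suc n)) (\<lambda>ys. pure (take i xs @ ys @ drop (Suc i) xs)) (comult H x)"
      if "x \<in> carrier H" for x
      using ca[OF tuples_update[OF xs that]] True len j by simp
    then show ?thesis
      by (rule linear_cong[OF module_H _ linear_comp[OF comult_linear P.ext_linear[OF P.T_module emb[OF xs]]]])
  next
    case False
    have "(\<lambda>x. sweedler K (T (Suc n)) (\<lambda>ys. pure (take i (xs[j := x]) @ ys @ drop (Suc i) (xs[j := x]))) (comult H (xs ! i)))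
        \<in> linear_maps K H (T (Suc n))"
    proof (rule P.ext_param[OF module_H P.T_module emb[OF tuples_update[OF xs]] _ comult_closed[OF tuples_nth[OF xs i]]])
      fix ys assume ys: "ys \<in> tuples H 2"
      let ?z = "take i xs @ ys @ drop (Suc i) xs"
      have z: "?z \<in> tuples H (Suc n)"
        using tuples_append[OF tuples_take[OF xs, of i] tuples_append[OF ys tuples_drop[OF xs, of "Suc i"]]] i by simp
      define k where "k = (if j < i then j else Suc j)"
      have k: "k < Suc n" using j i by (simp add: k_def)
      have "take i (xs[j := x]) @ ys @ drop (Suc i) (xs[j := x]) = ?z[k := x]" for x
      proof (cases "j < i")
        case True
        then show ?thesis using len i by (simp add: k_def list_update_append take_update_swap)
      next
        case F: False
        then have "i < j" using False by simp
        then show ?thesis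
          using len i j tuples_length[OF ys] by (auto simp: k_def list_update_append drop_update_swap Suc_diff_Suc)
      qed
      then show "(\<lambda>x. pure (take i (xs[j := x]) @ ys @ drop (Suc i) (xs[j := x]))) \<in> linear_maps K H (T (Suc n))"
        using multilinear_slot[OF P.pure_multilinear z k] by simp
    qed
    then show ?thesis
      by (rule linear_cong[OF module_H, rotated]) (use ca[OF tuples_update[OF xs]] False in simp)
  qed
qed

definition trilinear :: "('k, 'w, 'b) module_scheme \<Rightarrow> ('h \<Rightarrow> 'h \<Rightarrow> 'h \<Rightarrow> 'w) \<Rightarrow> bool" where
  "trilinear W B \<longleftrightarrow> (\<forall>x \<in> carrier H. bilinear K H H W (B x)) \<and>
     (\<forall>y \<in> carrier H. \<forall>z \<in> carrier H. (\<lambda>x. B x y z) \<in> linear_maps K H W)"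

lemma trilinearD:
  assumes "trilinear W B"
  shows "x \<in> carrier H \<Longrightarrow> bilinear K H H W (B x)"
    "y \<in> carrier H \<Longrightarrow> z \<in> carrier H \<Longrightarrow> (\<lambda>x. B x y z) \<in> linear_maps K H W"
    "z \<in> carrier H \<Longrightarrow> bilinear K H H W (\<lambda>x y. B x y z)"
    "y \<in> carrier H \<Longrightarrow> bilinear K H H W (\<lambda>x z. B x y z)"
proof -
  show 1: "x \<in> carrier H \<Longrightarrow> bilinear K H H W (B x)" for x
    using assms by (simp add: trilinear_def)
  show 2: "y \<in> carrier H \<Longrightarrow> z \<in> carrier H \<Longrightarrow> (\<lambda>x. B x y z) \<in> linear_maps K H W" for y z
    using assms by (simp add: trilinear_def)
  show "z \<in> carrier H \<Longrightarrow> bilinear K H H W (\<lambda>x y. B x y z)"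
    by (rule bilinearI) (rule bilinear_left[OF 1] 2; assumption)+
  show "y \<in> carrier H \<Longrightarrow> bilinear K H H W (\<lambda>x z. B x y z)"
    by (rule bilinearI) (rule bilinear_right[OF 1] 2; assumption)+
qed

lemma
  assumes W: "module K W" and B: "trilinear W B"
  shows bilinear_Sw_left: "bilinear K H H W (\<lambda>x z. Sw W (\<lambda>a b. B a b z) x)"
    and bilinear_Sw_right: "bilinear K H H W (\<lambda>x y. Sw W (\<lambda>b c. B x b c) y)"
proof -
  show "bilinear K H H W (\<lambda>x z. Sw W (\<lambda>a b. B a b z) x)"
  proof (rule bilinearI)
    show "(\<lambda>z. Sw W (\<lambda>a b. B a b z) x) \<in> linear_maps K H W" if "x \<in> carrier H" for x
      by (rule Sw_param[OF module_H W trilinearD(3)[OF B] bilinear_right[OF trilinearD(1)[OF B]] that])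
    show "(\<lambda>x. Sw W (\<lambda>a b. B a b z) x) \<in> linear_maps K H W" if "z \<in> carrier H" for z
      by (rule Sw_linear[OF W trilinearD(3)[OF B that]])
  qed
  show "bilinear K H H W (\<lambda>x y. Sw W (\<lambda>b c. B x b c) y)"
  proof (rule bilinearI)
    show "(\<lambda>x. Sw W (\<lambda>b c. B x b c) y) \<in> linear_maps K H W" if "y \<in> carrier H" for y
      by (rule Sw_param[OF module_H W trilinearD(1)[OF B] trilinearD(2)[OF B] that])
    show "(\<lambda>y. Sw W (\<lambda>b c. B x b c) y) \<in> linear_maps K H W" if "x \<in> carrier H" for x
      by (rule Sw_linear[OF W trilinearD(1)[OF B that]])
  qed
qed

text \<open>
  Both sides are values of the linear map induced by \<open>B\<close> on the third tensor power, at the two expressions that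
  coassociativity identifies.
\<close>

lemma Sw_coassoc:
  assumes W: "module K W" and B: "trilinear W B" and h: "h \<in> carrier H"
  shows "Sw W (\<lambda>x z. Sw W (\<lambda>a b. B a b z) x) h = Sw W (\<lambda>x y. Sw W (\<lambda>b c. B x b c) y) h"
proof -
  let ?F = "\<lambda>xs. B (xs ! 0) (xs ! 1) (xs ! 2)"
  have m: "multilinear K H 3 W ?F"
  proof (rule multilinearI)
    fix xs assume "xs \<in> tuples H 3"
    then obtain a b c where abc: "xs = [a, b, c]" "a \<in> carrier H" "b \<in> carrier H" "c \<in> carrier H"
      using tuples3 by blast
    then show "?F xs \<in> carrier W" using bilinear_closed[OF trilinearD(1)[OF B]] by simp
    fix i :: nat assume "i < 3"
    then have "i = 0 \<or> i = 1 \<or> i = 2" by linarith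
    then show "(\<lambda>x. ?F (xs[i := x])) \<in> linear_maps K H W"
      using abc trilinearD(2)[OF B, of b c] bilinear_left[OF trilinearD(1)[OF B, of a], of c]
        bilinear_right[OF trilinearD(1)[OF B, of a], of b] by auto
  qed
  let ?e = "sweedler K W ?F"
  note e = P.ext_linear[OF W m]
  have c3: "multilinear K H 2 (T 3) (comult_at K H i)" if "i < 2" for i
    using comult_at_multilinear[OF that] by simp
  have 0: "?e (comult_at K H 0 [x, z]) = Sw W (\<lambda>a b. B a b z) x" if xz: "x \<in> carrier H" "z \<in> carrier H" for x z
  proof -
    have emb: "multilinear K H 2 (T 3) (\<lambda>ys. pure (ys @ [z]))"
      using P.pure_embed[of "[]" 0 "[z]" 1 3 2] xz by (simp add: tuples_def)
    have "?e (comult_at K H 0 [x, z]) = sweedler K W (\<lambda>ys. ?e (pure (ys @ [z]))) (comult H x)"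
      using P.ext_comp[OF P.T_module W emb e comult_closed[OF xz(1)]] by (simp add: comult_at_def eval_nat_numeral)
    also have "\<dots> = Sw W (\<lambda>a b. B a b z) x"
      unfolding Sw_def
      by (rule P.ext_cong[OF W multilinear2[OF trilinearD(3)[OF B xz(2)]] comult_closed[OF xz(1)]])
        (use xz in \<open>auto dest!: tuples2 simp: P.ext_pure[OF W m, simplified One_nat_def] tuples_lists\<close>)
    finally show ?thesis .
  qed
  have 1: "?e (comult_at K H 1 [x, y]) = Sw W (\<lambda>b c. B x b c) y" if xy: "x \<in> carrier H" "y \<in> carrier H" for x y
  proof -
    have emb: "multilinear K H 2 (T 3) (\<lambda>ys. pure (x # ys))"
      using P.pure_embed[of "[x]" 1 "[]" 0 3 2] xy by (simp add: tuples_def)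
    have "?e (comult_at K H 1 [x, y]) = sweedler K W (\<lambda>ys. ?e (pure (x # ys))) (comult H y)"
      using P.ext_comp[OF P.T_module W emb e comult_closed[OF xy(2)]] by (simp add: comult_at_def eval_nat_numeral)
    also have "\<dots> = Sw W (\<lambda>b c. B x b c) y"
      unfolding Sw_def
      by (rule P.ext_cong[OF W multilinear2[OF trilinearD(1)[OF B xy(1)]] comult_closed[OF xy(2)]])
        (use xy in \<open>auto dest!: tuples2 simp: P.ext_pure[OF W m, simplified One_nat_def] tuples_lists\<close>)
    finally show ?thesis .
  qed
  have "Sw W (\<lambda>x z. Sw W (\<lambda>a b. B a b z) x) h = sweedler K W (\<lambda>xs. ?e (comult_at K H 0 xs)) (comult H h)"
    unfolding Sw_def[of W "\<lambda>x z. Sw W (\<lambda>a b. B a b z) x"]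
    by (rule P.ext_cong[OF W multilinear_comp[OF c3 e] comult_closed[OF h]]) (auto dest!: tuples2 simp: 0[simplified])
  also have "\<dots> = ?e (sweedler K (T 3) (comult_at K H 0) (comult H h))"
    by (rule P.ext_comp[OF P.T_module W c3 e comult_closed[OF h], symmetric]) simp
  also have "\<dots> = ?e (sweedler K (T 3) (comult_at K H 1) (comult H h))"
    by (simp add: coassociative h)
  also have "\<dots> = sweedler K W (\<lambda>xs. ?e (comult_at K H 1 xs)) (comult H h)"
    by (rule P.ext_comp[OF P.T_module W c3 e comult_closed[OF h]]) simp
  also have "\<dots> = Sw W (\<lambda>x y. Sw W (\<lambda>b c. B x b c) y) h"
    unfolding Sw_def[of W "\<lambda>x y. Sw W (\<lambda>b c. B x b c) y"]
    by (rule P.ext_cong[OF W multilinear2[OF bilinear_Sw_right[OF W B]] comult_closed[OF h]])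
      (auto dest!: tuples2 simp: 1[simplified])
  finally show ?thesis .
qed

end

section \<open>Iterated coproducts\<close>

context hopf_algebra
begin

lemma tuples1: "xs \<in> tuples H (Suc 0) \<Longrightarrow> \<exists>a. xs = [a] \<and> a \<in> carrier H"
  by (auto simp: tuples_def length_Suc_conv)

text \<open>
  Comultiplying the first factor does not affect the last one, which allows \<open>iter_Suc\<close> to turn the definition of
  the iterated coproduct, an expansion at the front, into an expansion at the end: \<open>\<Sum> \<Delta>\<^sup>n(h\<^sub>1) \<otimes> h\<^sub>2\<close>.
  The inductions below all use the latter.
\<close>

lemma comult_first_app:
  assumes t: "t \<in> carrier (T (Suc n))" and y: "y \<in> carrier H"
  shows "sweedler K (T (Suc (Suc (Suc n)))) (comult_at K H 0) (P.app (Suc n) t y) =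
    P.app (Suc (Suc n)) (sweedler K (T (Suc (Suc n))) (comult_at K H 0) t) y"
proof -
  have m: "multilinear K H (Suc m) (T (Suc (Suc m))) (comult_at K H 0)" for m
    by (rule comult_at_multilinear) simp
  note e = P.ext_linear[OF P.T_module m]
  note al = bilinear_left[OF P.app_bilinear y]
  show ?thesis
  proof (rule P.T_eqI[OF P.T_module linear_comp[OF al e] linear_comp[OF e al] _ t])
    fix xs assume xs: "xs \<in> tuples H (Suc n)"
    then obtain x zs where x: "xs = x # zs" "x \<in> carrier H" and zs: "zs \<in> tuples H n"
      by (auto simp: tuples_def length_Suc_conv)
    have xsy: "xs @ [y] \<in> tuples H (Suc (Suc n))" "zs @ [y] \<in> tuples H (Suc n)"
      using tuples_append[OF xs tuples_lists(1)[OF y]] tuples_append[OF zs tuples_lists(1)[OF y]] by simp_all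
    have emb: "multilinear K H 2 (T (Suc (Suc m))) (\<lambda>ys. pure (ys @ zs))" if "zs \<in> tuples H m" for zs m
      using P.pure_embed[of "[]" 0 zs m "Suc (Suc m)" 2] that by (simp add: tuples_def)
    have "sweedler K (T (Suc (Suc (Suc n)))) (comult_at K H 0) (P.app (Suc n) (pure xs) y) = comult_at K H 0 (xs @ [y])"
      using P.ext_pure[OF P.T_module m xsy(1)] by (simp add: P.app_pure[OF xs y])
    also have "\<dots> = sweedler K (T (Suc (Suc (Suc n)))) (\<lambda>ys. pure (ys @ zs @ [y])) (comult H x)"
      using zs by (simp add: comult_at_def x tuples_length)
    also have "\<dots> = sweedler K (T (Suc (Suc (Suc n)))) (\<lambda>ys. P.app (Suc (Suc n)) (pure (ys @ zs)) y) (comult H x)"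
    proof (rule P.ext_cong[OF P.T_module multilinear_comp[OF emb[OF zs] al] comult_closed[OF x(2)]])
      fix ys assume "ys \<in> tuples H 2"
      from tuples_append[OF this zs] have "ys @ zs \<in> tuples H (Suc (Suc n))" by simp
      then show "pure (ys @ zs @ [y]) = P.app (Suc (Suc n)) (pure (ys @ zs)) y" by (simp add: P.app_pure y)
    qed
    also have "\<dots> = P.app (Suc (Suc n)) (sweedler K (T (Suc (Suc n))) (\<lambda>ys. pure (ys @ zs)) (comult H x)) y"
      by (rule P.ext_comp[OF P.T_module P.T_module emb[OF zs] al comult_closed[OF x(2)], symmetric])
    also have "sweedler K (T (Suc (Suc n))) (\<lambda>ys. pure (ys @ zs)) (comult H x) = comult_at K H 0 xs"
      using zs by (simp add: comult_at_def x tuples_length)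
    also have "\<dots> = sweedler K (T (Suc (Suc n))) (comult_at K H 0) (pure xs)"
      by (rule P.ext_pure[OF P.T_module m xs, symmetric])
    finally show "sweedler K (T (Suc (Suc (Suc n)))) (comult_at K H 0) (P.app (Suc n) (pure xs) y) =
        P.app (Suc (Suc n)) (sweedler K (T (Suc (Suc n))) (comult_at K H 0) (pure xs)) y" .
  qed
qed

lemma pure1_linear: "(\<lambda>h. pure [h]) \<in> linear_maps K H (T (Suc 0))"
  using multilinear_slot[OF P.pure_multilinear tuples_lists(1)[OF one_H], of 0] by simp

lemma iter_linear: "iter n \<in> linear_maps K H (T (Suc n))"
proof (induction n)
  case 0
  then show ?case using pure1_linear by (simp add: fun_eq_iff[symmetric])
next
  case (Suc n)
  have "(\<lambda>h. sweedler K (T (Suc (Suc n))) (comult_at K H 0) (iter n h)) \<in> linear_maps K H (T (Suc (Suc n)))"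
    by (rule linear_comp[OF Suc P.ext_linear[OF P.T_module comult_at_multilinear]]) simp
  then show ?case by simp
qed

lemmas iter_closed = linear_closed[OF iter_linear]

lemma iter_app_bilinear: "bilinear K H H (T (Suc (Suc n))) (\<lambda>x y. P.app (Suc n) (iter n x) y)"
  by (rule bilinear_pre[OF P.app_bilinear iter_linear linear_id])

lemma iter_Suc: "h \<in> carrier H \<Longrightarrow> iter (Suc n) h = Sw (T (Suc (Suc n))) (\<lambda>x y. P.app (Suc n) (iter n x) y) h"
proof (induction n)
  case 0
  have "iter (Suc 0) h = comult_at K H 0 [h]"
    using P.ext_pure[OF P.T_module comult_at_multilinear[of 0 "Suc 0"] tuples_lists(1)[OF 0]] by simp
  also have "\<dots> = sweedler K (T 2) pure (comult H h)"
    by (simp add: comult_at_def numeral_2_eq_2)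
  also have "\<dots> = Sw (T (Suc (Suc 0))) (\<lambda>x y. P.app (Suc 0) (iter 0 x) y) h"
    unfolding Sw_def numeral_2_eq_2[symmetric]
    by (rule P.ext_cong[OF P.T_module multilinear2[OF iter_app_bilinear, of 0, folded numeral_2_eq_2] comult_closed[OF 0]])
       (auto dest!: tuples2 simp: P.app_pure tuples_lists)
  finally show ?case .
next
  case (Suc n)
  let ?D = "\<lambda>n. sweedler K (T (Suc (Suc n))) (comult_at K H 0)"
  have D: "?D n \<in> linear_maps K (T (Suc n)) (T (Suc (Suc n)))" for n
    by (rule P.ext_linear[OF P.T_module comult_at_multilinear]) simp
  have "iter (Suc (Suc n)) h = ?D (Suc n) (Sw (T (Suc (Suc n))) (\<lambda>x y. P.app (Suc n) (iter n x) y) h)"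
    using Suc by simp
  also have "\<dots> = Sw (T (Suc (Suc (Suc n)))) (\<lambda>x y. ?D (Suc n) (P.app (Suc n) (iter n x) y)) h"
    by (rule Sw_comp[OF P.T_module iter_app_bilinear P.T_module D Suc.prems])
  also have "\<dots> = Sw (T (Suc (Suc (Suc n)))) (\<lambda>x y. P.app (Suc (Suc n)) (iter (Suc n) x) y) h"
    by (rule Sw_cong[OF P.T_module iter_app_bilinear Suc.prems]) (simp add: comult_first_app iter_closed)
  finally show ?case .
qed

text \<open>
  The iterated coproduct is multiplicative because \<open>\<Delta>\<close> is. Together with \<open>iter_one\<close> it makes the
  diagonal action an action.
\<close>

lemma iter_mult:
  assumes "g \<in> carrier H" "h \<in> carrier H"
  shows "iter n (g \<otimes>\<^bsub>H\<^esub> h) = pm (Suc n) (iter n g) (iter n h)"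
  using assms
proof (induction n arbitrary: g h)
  case 0
  then show ?case by (simp add: pm_pure tuples_lists)
next
  case (Suc n)
  let ?B = "\<lambda>x y. P.app (Suc n) (iter n x) y" and ?W = "T (Suc (Suc n))"
  note B = iter_app_bilinear
  have "iter (Suc n) (g \<otimes>\<^bsub>H\<^esub> h) = Sw ?W ?B (g \<otimes>\<^bsub>H\<^esub> h)"
    using Suc.prems by (intro iter_Suc mult_closed)
  also have "\<dots> = Sw ?W (\<lambda>a b. Sw ?W (\<lambda>c d. ?B (a \<otimes>\<^bsub>H\<^esub> c) (b \<otimes>\<^bsub>H\<^esub> d)) h) g"
    by (rule Sw_mult[OF P.T_module B Suc.prems])
  also have "\<dots> = Sw ?W (\<lambda>a b. pm (Suc (Suc n)) (?B a b) (iter (Suc n) h)) g"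
  proof (rule Sw_cong[OF P.T_module bilinear_comp[OF B bilinear_left[OF pm_bilinear iter_closed[OF Suc.prems(2)]]] Suc.prems(1)])
    fix a b assume ab: "a \<in> carrier H" "b \<in> carrier H"
    note Bab = bilinear_closed[OF B ab]
    have "pm (Suc (Suc n)) (?B a b) (iter (Suc n) h) = Sw ?W (\<lambda>c d. pm (Suc (Suc n)) (?B a b) (?B c d)) h"
      unfolding iter_Suc[OF Suc.prems(2)]
      by (rule Sw_comp[OF P.T_module B P.T_module bilinear_right[OF pm_bilinear Bab] Suc.prems(2)])
    also have "\<dots> = Sw ?W (\<lambda>c d. ?B (a \<otimes>\<^bsub>H\<^esub> c) (b \<otimes>\<^bsub>H\<^esub> d)) h"
      by (rule Sw_cong[OF P.T_module bilinear_pre[OF B bilinear_right[OF mult_bilinear ab(1)] bilinear_right[OF mult_bilinear ab(2)]] Suc.prems(2)])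
         (simp add: pm_app iter_closed ab Suc.IH)
    finally show "Sw ?W (\<lambda>c d. ?B (a \<otimes>\<^bsub>H\<^esub> c) (b \<otimes>\<^bsub>H\<^esub> d)) h = pm (Suc (Suc n)) (?B a b) (iter (Suc n) h)" by simp
  qed
  also have "\<dots> = pm (Suc (Suc n)) (Sw ?W ?B g) (iter (Suc n) h)"
    by (rule Sw_comp[OF P.T_module B P.T_module bilinear_left[OF pm_bilinear iter_closed[OF Suc.prems(2)]] Suc.prems(1), symmetric])
  finally show ?case by (simp only: iter_Suc[OF Suc.prems(1)])
qed

lemma iter_one: "iter n \<one>\<^bsub>H\<^esub> = ones (Suc n)"
proof (induction n)
  case (Suc n)
  then show ?case
    by (simp only: iter_Suc[OF one_H] Sw_one[OF P.T_module iter_app_bilinear] P.app_pure[OF ones_tuples one_H])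
       (simp add: replicate_append_same)
qed simp

section \<open>The diagonal modules\<close>

abbreviation C where "C n \<equiv> diagonal_power K H n"

lemma C_simps [simp]: "carrier (C n) = carrier (T (Suc n))" "\<zero>\<^bsub>C n\<^esub> = \<zero>\<^bsub>T (Suc n)\<^esub>"
  "x \<oplus>\<^bsub>C n\<^esub> y = x \<oplus>\<^bsub>T (Suc n)\<^esub> y" "a \<odot>\<^bsub>C n\<^esub> x = a \<odot>\<^bsub>T (Suc n)\<^esub> x"
  "ract (C n) t h = pm (Suc n) t (iter n h)"
  by (simp_all add: diagonal_power_def module.defs)

lemma linear_C [simp]: "linear_maps K (C n) W = linear_maps K (T (Suc n)) W"
  "linear_maps K W (C n) = linear_maps K W (T (Suc n))"
  by (simp_all add: linear_maps_def)

lemma C_module: "module K (C n)"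
proof -
  interpret X: module K "T (Suc n)" by (rule P.T_module)
  have g: "abelian_group (C n)"
    by (rule abelian_groupI) (use X.l_neg in \<open>auto simp: X.a_ac\<close>)
  show ?thesis
    by (rule moduleI[OF cring_K g])
      (simp_all add: X.smult_l_distr X.smult_r_distr X.smult_assoc1)
qed

lemma C_right_hmodule: "right_hmodule K H (C n)"
proof (intro right_hmodule.intro right_hmodule_axioms.intro C_module)
  show "(\<lambda>x. ract (C n) x h) \<in> linear_maps K (C n) (C n)" if "h \<in> carrier H" for h
    using bilinear_left[OF pm_bilinear iter_closed[OF that]] by simp
  show "ract (C n) x \<in> linear_maps K H (C n)" if "x \<in> carrier (C n)" for x
    using linear_comp[OF iter_linear bilinear_right[OF pm_bilinear]] that by (simp add: C_simps(5)[abs_def])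
  show "ract (C n) x \<one>\<^bsub>H\<^esub> = x" if "x \<in> carrier (C n)" for x
    using that pm_one[of x "Suc n"] by (simp only: C_simps iter_one)
  show "ract (C n) x (g \<otimes>\<^bsub>H\<^esub> h) = ract (C n) (ract (C n) x g) h"
    if "x \<in> carrier (C n)" "g \<in> carrier H" "h \<in> carrier H" for x g h
    using that by (simp add: iter_mult pm_assoc iter_closed)
qed

subsection \<open>Faces\<close>

abbreviation del where "del i xs \<equiv> take i xs @ drop (Suc i) xs"
abbreviation fc where "fc n i t \<equiv> power_face K H n i t"

lemma del_tuples: "xs \<in> tuples H (Suc n) \<Longrightarrow> i \<le> n \<Longrightarrow> del i xs \<in> tuples H n"
  using tuples_append[OF tuples_take[of xs H "Suc n" i] tuples_drop[of xs H "Suc n" "Suc i"]] by simp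

lemma nth_del: "i < length xs \<Longrightarrow> k < length xs - 1 \<Longrightarrow> del i xs ! k = (if k < i then xs ! k else xs ! Suc k)"
  by (auto simp: nth_append)

lemma del_update:
  assumes "i < length xs" "j < length xs"
  shows "del i (xs[j := x]) = (if j < i then (del i xs)[j := x] else if j = i then del i xs else (del i xs)[j - 1 := x])"
  using assms by (intro nth_equalityI) (auto simp: nth_del nth_list_update)

lemma face_multilinear:
  assumes i: "i \<le> n"
  shows "multilinear K H (Suc n) (T n) (\<lambda>hs. counit H (hs ! i) \<odot>\<^bsub>T n\<^esub> pure (del i hs))"
proof (rule multilinearI)
  interpret X: module K "T n" by (rule P.T_module)
  fix xs assume xs: "xs \<in> tuples H (Suc n)"
  note d = del_tuples[OF xs i] and len = tuples_length[OF xs]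
  note pd = P.pure_closed[OF d]
  have xi: "xs ! i \<in> carrier H" using tuples_nth[OF xs] i by simp
  show "counit H (xs ! i) \<odot>\<^bsub>T n\<^esub> pure (del i xs) \<in> carrier (T n)"
    using pd xi by (simp add: counit_closed)
  fix j assume j: "j < Suc n"
  show "(\<lambda>x. counit H (xs[j := x] ! i) \<odot>\<^bsub>T n\<^esub> pure (del i (xs[j := x]))) \<in> linear_maps K H (T n)"
  proof (cases "j = i")
    case True
    then show ?thesis
      using counit_scale_linear[OF P.T_module pd] j len by (simp add: del_update del: take_update_cancel drop_update_cancel)
  next
    case False
    define k where "k = (if j < i then j else j - 1)"
    have k: "k < n" using False i j by (auto simp: k_def)
    have "del i (xs[j := x]) = (del i xs)[k := x]" for x
      using del_update[of i xs j x] False i j len by (simp add: k_def)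
    moreover have "xs[j := x] ! i = xs ! i" for x using False by simp
    ultimately show ?thesis
      using linear_scale[OF P.T_module multilinear_slot[OF P.pure_multilinear d k] counit_closed[OF xi]] by simp
  qed
qed

lemma face_pure: "xs \<in> tuples H (Suc n) \<Longrightarrow> i \<le> n \<Longrightarrow> fc n i (pure xs) = counit H (xs ! i) \<odot>\<^bsub>T n\<^esub> pure (del i xs)"
  unfolding power_face_def by (rule P.ext_pure[OF P.T_module face_multilinear])

lemma face_linear: "i \<le> n \<Longrightarrow> power_face K H n i \<in> linear_maps K (T (Suc n)) (T n)"
  unfolding power_face_def by (rule P.ext_linear[OF P.T_module face_multilinear])

lemma face_mult:
  assumes s: "s \<in> carrier (T (Suc n))" and t: "t \<in> carrier (T (Suc n))" and i: "i \<le> n"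
  shows "fc n i (pm (Suc n) s t) = pm n (fc n i s) (fc n i t)"
proof (rule T_eqI2[OF P.T_module bilinear_comp[OF pm_bilinear face_linear[OF i]]
      bilinear_pre[OF pm_bilinear face_linear[OF i] face_linear[OF i]] _ s t])
  interpret X: module K "T n" by (rule P.T_module)
  fix xs ys assume xs: "xs \<in> tuples H (Suc n)" and ys: "ys \<in> tuples H (Suc n)"
  note dx = del_tuples[OF xs i] and dy = del_tuples[OF ys i]
  have "del i (mult2 xs ys) = mult2 (del i xs) (del i ys)"
    using xs ys by (simp add: take_map take_zip drop_map drop_zip tuples_length)
  moreover have "counit H (mult2 xs ys ! i) = counit H (ys ! i) \<otimes>\<^bsub>K\<^esub> counit H (xs ! i)"
    using xs ys i by (simp add: tuples_length tuples_nth counit_mult counit_closed m_comm)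
  moreover have "xs ! i \<in> carrier H" "ys ! i \<in> carrier H" using tuples_nth[OF xs] tuples_nth[OF ys] i by auto
  ultimately show "fc n i (pm (Suc n) (pure xs) (pure ys)) = pm n (fc n i (pure xs)) (fc n i (pure ys))"
    using P.pure_closed[OF dx] P.pure_closed[OF dy] pm_closed[OF P.pure_closed[OF dx] P.pure_closed[OF dy]]
    by (simp add: pm_pure xs ys face_pure tuples_map2 i dx dy counit_closed X.smult_assoc1
        linear_smult[OF bilinear_left[OF pm_bilinear]] linear_smult[OF bilinear_right[OF pm_bilinear]])
qed

lemma face_app:
  assumes t: "t \<in> carrier (T (Suc n))" and y: "y \<in> carrier H" and i: "i \<le> n"
  shows "fc (Suc n) i (P.app (Suc n) t y) = P.app n (fc n i t) y"
proof (rule P.T_eqI[OF P.T_module linear_comp[OF bilinear_left[OF P.app_bilinear y] face_linear]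
      linear_comp[OF face_linear[OF i] bilinear_left[OF P.app_bilinear y]] _ t])
  fix xs assume xs: "xs \<in> tuples H (Suc n)"
  have xsy: "xs @ [y] \<in> tuples H (Suc (Suc n))"
    using tuples_append[OF xs tuples_lists(1)[OF y]] by simp
  have "xs ! i \<in> carrier H" using tuples_nth[OF xs] i by auto
  then show "fc (Suc n) i (P.app (Suc n) (pure xs) y) = P.app n (fc n i (pure xs)) y"
    using i tuples_length[OF xs] P.app_pure[OF del_tuples[OF xs i] y]
    by (simp add: P.app_pure[OF xs y] face_pure[OF xsy] face_pure[OF xs] nth_append
        linear_smult[OF bilinear_left[OF P.app_bilinear y]] counit_closed P.pure_closed[OF del_tuples[OF xs i]])
qed (use i in simp)

lemma face_app_last:
  assumes t: "t \<in> carrier (T n)" and y: "y \<in> carrier H"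
  shows "fc n n (P.app n t y) = counit H y \<odot>\<^bsub>T n\<^esub> t"
proof (rule P.T_eqI[OF P.T_module linear_comp[OF bilinear_left[OF P.app_bilinear y] face_linear]
      linear_scale[OF P.T_module linear_id] _ t])
  fix xs assume xs: "xs \<in> tuples H n"
  have xsy: "xs @ [y] \<in> tuples H (Suc n)"
    using tuples_append[OF xs tuples_lists(1)[OF y]] by simp
  show "fc n n (P.app n (pure xs) y) = counit H y \<odot>\<^bsub>T n\<^esub> pure xs"
    using tuples_length[OF xs] by (simp add: P.app_pure[OF xs y] face_pure[OF xsy] nth_append)
qed (simp_all add: counit_closed y)

text \<open>
  Applying the counit to one factor of an iterated coproduct removes that factor. Hence the faces, which are
  multiplicative, are linear for the diagonal action (\<open>face_right_linear\<close>).
\<close>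

lemma face_iter:
  assumes "h \<in> carrier H" "i \<le> Suc n"
  shows "fc (Suc n) i (iter (Suc n) h) = iter n h"
  using assms
proof (induction n arbitrary: h i)
  case 0
  have "fc (Suc 0) i (iter (Suc 0) h) = Sw (T (Suc 0)) (\<lambda>x y. fc (Suc 0) i (P.app (Suc 0) (iter 0 x) y)) h"
    unfolding iter_Suc[OF 0(1)]
    by (rule Sw_comp[OF P.T_module iter_app_bilinear P.T_module face_linear[OF 0(2)] 0(1)])
  also have "\<dots> = iter 0 h"
  proof (cases "i = 0")
    case True
    have "Sw (T (Suc 0)) (\<lambda>x y. fc (Suc 0) i (P.app (Suc 0) (iter 0 x) y)) h =
        Sw (T (Suc 0)) (\<lambda>x y. counit H x \<odot>\<^bsub>T (Suc 0)\<^esub> iter 0 y) h"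
      by (rule Sw_cong[OF P.T_module counit_bilinear(1)[OF P.T_module iter_linear] 0(1)])
        (simp add: P.app_pure tuples_lists face_pure[of _ "Suc 0"] True tuples_lists(2)[unfolded numeral_2_eq_2])
    then show ?thesis by (simp only: Sw_counit_left[OF P.T_module iter_linear 0(1)])
  next
    case False
    then have i: "i = Suc 0" using 0 by simp
    have "Sw (T (Suc 0)) (\<lambda>x y. fc (Suc 0) i (P.app (Suc 0) (iter 0 x) y)) h =
        Sw (T (Suc 0)) (\<lambda>x y. counit H y \<odot>\<^bsub>T (Suc 0)\<^esub> iter 0 x) h"
      by (rule Sw_cong[OF P.T_module counit_bilinear(2)[OF P.T_module iter_linear] 0(1)])
        (simp only: i face_app_last[OF iter_closed])
    then show ?thesis by (simp only: Sw_counit_right[OF P.T_module iter_linear 0(1)])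
  qed
  finally show ?case .
next
  case (Suc n)
  let ?W = "T (Suc (Suc n))"
  have "fc (Suc (Suc n)) i (iter (Suc (Suc n)) h) = Sw ?W (\<lambda>x y. fc (Suc (Suc n)) i (P.app (Suc (Suc n)) (iter (Suc n) x) y)) h"
    unfolding iter_Suc[OF Suc.prems(1), of "Suc n"]
    by (rule Sw_comp[OF P.T_module iter_app_bilinear P.T_module face_linear[OF Suc.prems(2)] Suc.prems(1)])
  also have "\<dots> = iter (Suc n) h"
  proof (cases "i \<le> Suc n")
    case True
    have "Sw ?W (\<lambda>x y. fc (Suc (Suc n)) i (P.app (Suc (Suc n)) (iter (Suc n) x) y)) h = Sw ?W (\<lambda>x y. P.app (Suc n) (iter n x) y) h"
      by (rule Sw_cong[OF P.T_module iter_app_bilinear Suc.prems(1)])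
         (simp only: face_app[OF iter_closed _ True] Suc.IH[OF _ True])
    then show ?thesis by (simp only: iter_Suc[OF Suc.prems(1)])
  next
    case False
    then have i: "i = Suc (Suc n)" using Suc.prems by simp
    have "Sw ?W (\<lambda>x y. fc (Suc (Suc n)) i (P.app (Suc (Suc n)) (iter (Suc n) x) y)) h =
        Sw ?W (\<lambda>x y. counit H y \<odot>\<^bsub>?W\<^esub> iter (Suc n) x) h"
      by (rule Sw_cong[OF P.T_module counit_bilinear(2)[OF P.T_module iter_linear] Suc.prems(1)])
         (simp only: i face_app_last[OF iter_closed])
    then show ?thesis by (simp only: Sw_counit_right[OF P.T_module iter_linear Suc.prems(1)])
  qed
  finally show ?case .
qed

lemma face_right_linear: "i \<le> Suc n \<Longrightarrow> power_face K H (Suc n) i \<in> right_linear_maps K H (C (Suc n)) (C n)"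
  by (intro right_linear_mapsI) (simp_all only: linear_C C_simps face_linear face_mult iter_closed face_iter)

lemma face_face:
  assumes t: "t \<in> carrier (T (Suc (Suc n)))" and ij: "i < j" "j \<le> Suc n"
  shows "fc n i (fc (Suc n) j t) = fc n (j - 1) (fc (Suc n) i t)"
proof -
  have le: "i \<le> n" "j - 1 \<le> n" "i \<le> Suc n" using ij by simp_all
  show ?thesis
  proof (rule P.T_eqI[OF P.T_module linear_comp[OF face_linear[OF ij(2)] face_linear[OF le(1)]]
      linear_comp[OF face_linear[OF le(3)] face_linear[OF le(2)]] _ t])
    interpret X: module K "T n" by (rule P.T_module)
    interpret K: cring K by (rule cring_K)
    fix xs assume xs: "xs \<in> tuples H (Suc (Suc n))"
    note len = tuples_length[OF xs]
    note di = del_tuples[OF xs le(3)] and dj = del_tuples[OF xs ij(2)]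
    have "del i (del j xs) = del (j - 1) (del i xs)"
      by (rule nth_equalityI) (use ij len in \<open>auto simp: nth_append\<close>)
    moreover have "del j xs ! i = xs ! i" "del i xs ! (j - 1) = xs ! j" using ij len by (auto simp: nth_append)
    moreover have "xs ! i \<in> carrier H" "xs ! j \<in> carrier H" using tuples_nth[OF xs] ij by auto
    moreover note P.pure_closed[OF di] P.pure_closed[OF dj] P.pure_closed[OF del_tuples[OF dj le(1)]]
    ultimately show "fc n i (fc (Suc n) j (pure xs)) = fc n (j - 1) (fc (Suc n) i (pure xs))"
      by (simp only: face_pure[OF xs ij(2)] face_pure[OF xs le(3)] face_pure[OF di le(2)] face_pure[OF dj le(1)]
          linear_smult[OF face_linear[OF le(1)] counit_closed] linear_smult[OF face_linear[OF le(2)] counit_closed]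
          X.smult_assoc1[symmetric] counit_closed m_comm)
  qed
qed

subsection \<open>Permutations of the tensor factors\<close>

text \<open>
  The operator moves entry \<open>p k\<close> to position \<open>k\<close>, so it is contravariant in \<open>p\<close>; see \<open>perm_perm\<close>.
\<close>

definition perm :: "nat \<Rightarrow> (nat \<Rightarrow> nat) \<Rightarrow> ('h list \<Rightarrow> 'k) set \<Rightarrow> ('h list \<Rightarrow> 'k) set" where
  "perm n p = sweedler K (T n) (\<lambda>xs. pure (map (\<lambda>k. xs ! p k) [0..<n]))"

lemma perm_tuples: "xs \<in> tuples H n \<Longrightarrow> bij_betw p {..<n} {..<n} \<Longrightarrow> map (\<lambda>k. xs ! p k) [0..<n] \<in> tuples H n"
  by (auto simp: tuples_def dest: bij_betwE intro!: subsetD[OF _ nth_mem])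

lemma perm_multilinear:
  assumes p: "bij_betw p {..<n} {..<n}"
  shows "multilinear K H n (T n) (\<lambda>xs. pure (map (\<lambda>k. xs ! p k) [0..<n]))"
proof (rule multilinearI)
  fix xs assume xs: "xs \<in> tuples H n"
  note t = perm_tuples[OF xs p]
  then show "pure (map (\<lambda>k. xs ! p k) [0..<n]) \<in> carrier (T n)" by (rule P.pure_closed)
  fix i assume i: "i < n"
  then obtain k where k: "k < n" "p k = i"
    using p unfolding bij_betw_def by (metis imageE lessThan_iff)
  have "map (\<lambda>k. xs[i := x] ! p k) [0..<n] = (map (\<lambda>k. xs ! p k) [0..<n])[k := x]" for x
  proof (rule nth_equalityI)
    fix l assume "l < length (map (\<lambda>k. xs[i := x] ! p k) [0..<n])"
    then have l: "l < n" by simp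
    then have "p l < n" "p l = i \<longleftrightarrow> l = k"
      using p k by (auto simp: bij_betw_def inj_on_def)
    then show "map (\<lambda>k. xs[i := x] ! p k) [0..<n] ! l = (map (\<lambda>k. xs ! p k) [0..<n])[k := x] ! l"
      using l xs by (auto simp: tuples_length nth_list_update)
  qed simp
  then show "(\<lambda>x. pure (map (\<lambda>k. xs[i := x] ! p k) [0..<n])) \<in> linear_maps K H (T n)"
    using multilinear_slot[OF P.pure_multilinear t k(1)] by simp
qed

lemma perm_linear: "bij_betw p {..<n} {..<n} \<Longrightarrow> perm n p \<in> linear_maps K (T n) (T n)"
  unfolding perm_def by (rule P.ext_linear[OF P.T_module perm_multilinear])

lemma perm_pure: "bij_betw p {..<n} {..<n} \<Longrightarrow> xs \<in> tuples H n \<Longrightarrow> perm n p (pure xs) = pure (map (\<lambda>k. xs ! p k) [0..<n])"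
  unfolding perm_def by (rule P.ext_pure[OF P.T_module perm_multilinear])

lemma perm_mult:
  assumes p: "bij_betw p {..<n} {..<n}" and s: "s \<in> carrier (T n)" and t: "t \<in> carrier (T n)"
  shows "perm n p (pm n s t) = pm n (perm n p s) (perm n p t)"
proof (rule T_eqI2[OF P.T_module bilinear_comp[OF pm_bilinear perm_linear[OF p]]
      bilinear_pre[OF pm_bilinear perm_linear[OF p] perm_linear[OF p]] _ s t])
  fix xs ys assume xs: "xs \<in> tuples H n" and ys: "ys \<in> tuples H n"
  have "map (\<lambda>k. mult2 xs ys ! p k) [0..<n] = mult2 (map (\<lambda>k. xs ! p k) [0..<n]) (map (\<lambda>k. ys ! p k) [0..<n])"
    by (rule nth_equalityI) (use xs ys p in \<open>auto simp: tuples_length dest: bij_betwE\<close>)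
  then show "perm n p (pm n (pure xs) (pure ys)) = pm n (perm n p (pure xs)) (perm n p (pure ys))"
    using xs ys by (simp add: pm_pure perm_pure[OF p] tuples_map2 perm_tuples[OF _ p])
qed

lemma perm_perm:
  assumes p: "bij_betw p {..<n} {..<n}" and q: "bij_betw q {..<n} {..<n}" and t: "t \<in> carrier (T n)"
    and r: "\<And>k. k < n \<Longrightarrow> r k = q (p k)" and r': "bij_betw r {..<n} {..<n}"
  shows "perm n p (perm n q t) = perm n r t"
proof -
  show ?thesis
  proof (rule P.T_eqI[OF P.T_module linear_comp[OF perm_linear[OF q] perm_linear[OF p]] perm_linear[OF r'] _ t])
    fix xs assume xs: "xs \<in> tuples H n"
    have "map (\<lambda>k. map (\<lambda>k. xs ! q k) [0..<n] ! p k) [0..<n] = map (\<lambda>k. xs ! r k) [0..<n]"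
      using bij_betwE[OF p] by (auto simp: r)
    then show "perm n p (perm n q (pure xs)) = perm n r (pure xs)"
      by (simp only: perm_pure[OF q xs] perm_pure[OF p perm_tuples[OF xs q]] perm_pure[OF r' xs])
  qed
qed

lemma transpose_bij: "i < n \<Longrightarrow> j < n \<Longrightarrow> bij_betw (transpose i j) {..<n} {..<n}"
  by (rule bij_betw_byWitness[where f' = "transpose i j"]) (auto simp: transpose_def)

lemma perm_app:
  assumes p: "bij_betw p {..<n} {..<n}" and p': "bij_betw p {..<Suc n} {..<Suc n}" and n: "p n = n"
    and t: "t \<in> carrier (T n)" and y: "y \<in> carrier H"
  shows "perm (Suc n) p (P.app n t y) = P.app n (perm n p t) y"
proof (rule P.T_eqI[OF P.T_module linear_comp[OF bilinear_left[OF P.app_bilinear y] perm_linear[OF p']]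
      linear_comp[OF perm_linear[OF p] bilinear_left[OF P.app_bilinear y]] _ t])
  fix xs assume xs: "xs \<in> tuples H n"
  have xsy: "xs @ [y] \<in> tuples H (Suc n)"
    using tuples_append[OF xs tuples_lists(1)[OF y]] by simp
  have "map (\<lambda>k. (xs @ [y]) ! p k) [0..<Suc n] = map (\<lambda>k. xs ! p k) [0..<n] @ [y]"
    using bij_betwE[OF p] tuples_length[OF xs] n by (auto simp: nth_append)
  then show "perm (Suc n) p (P.app n (pure xs) y) = P.app n (perm n p (pure xs)) y"
    by (simp add: P.app_pure[OF _ y] perm_pure[OF p'] perm_pure[OF p] xs xsy perm_tuples[OF xs p] del: upt_Suc)
qed

lemma perm_app_app:
  assumes t: "t \<in> carrier (T n)" and y: "y \<in> carrier H" and z: "z \<in> carrier H"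
  shows "perm (Suc (Suc n)) (transpose n (Suc n)) (P.app (Suc n) (P.app n t y) z) = P.app (Suc n) (P.app n t z) y"
proof -
  have p: "bij_betw (transpose n (Suc n)) {..<Suc (Suc n)} {..<Suc (Suc n)}"
    by (rule transpose_bij) simp_all
  note al = linear_comp[OF bilinear_left[OF P.app_bilinear] bilinear_left[OF P.app_bilinear]]
  show ?thesis
  proof (rule P.T_eqI[OF P.T_module linear_comp[OF al[OF y z] perm_linear[OF p]] al[OF z y] _ t])
    fix xs assume xs: "xs \<in> tuples H n"
    have app: "P.app (Suc n) (P.app n (pure xs) y) z = pure (xs @ [y, z])" if "y \<in> carrier H" "z \<in> carrier H" for y z
      using that xs tuples_append[OF xs tuples_lists(1)[OF that(1)]] by (simp add: P.app_pure)
    have xsyz: "xs @ [y, z] \<in> tuples H (Suc (Suc n))"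
      using tuples_append[OF xs tuples_lists(2)[OF y z]] by simp
    have "map (\<lambda>k. (xs @ [y, z]) ! transpose n (Suc n) k) [0..<Suc (Suc n)] = xs @ [z, y]"
    proof (rule nth_equalityI)
      fix i assume "i < length (map (\<lambda>k. (xs @ [y, z]) ! transpose n (Suc n) k) [0..<Suc (Suc n)])"
      then have "i < Suc (Suc n)" by simp
      then show "map (\<lambda>k. (xs @ [y, z]) ! transpose n (Suc n) k) [0..<Suc (Suc n)] ! i = (xs @ [z, y]) ! i"
        using tuples_length[OF xs]
        by (cases "i < n"; cases "i = n") (auto simp: nth_append transpose_def less_Suc_eq nth_Cons' simp del: upt_Suc)
    qed (use tuples_length[OF xs] in simp)
    then show "perm (Suc (Suc n)) (transpose n (Suc n)) (P.app (Suc n) (P.app n (pure xs) y) z) =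
        P.app (Suc n) (P.app n (pure xs) z) y"
      by (simp only: app y z perm_pure[OF p xsyz])
  qed
qed

end

locale cocommutative_hopf_algebra = hopf_algebra K H for K :: "'k ring" and H :: "('k, 'h) hopf" +
  assumes cocomm: "cocommutative K H"
begin

lemma Sw_cocomm:
  assumes W: "module K W" and B: "bilinear K H H W B" and h: "h \<in> carrier H"
  shows "Sw W (\<lambda>x y. B y x) h = Sw W B h"
proof -
  have rm: "multilinear K H 2 (T 2) (\<lambda>xs. pure (rev xs))"
  proof (rule multilinearI)
    fix xs assume xs: "xs \<in> tuples H 2"
    then have r: "rev xs \<in> tuples H 2" by (auto simp: tuples_def)
    then show "pure (rev xs) \<in> carrier (T 2)" by (rule P.pure_closed)
    fix i :: nat assume i: "i < 2"
    have "rev (xs[i := x]) = (rev xs)[1 - i := x]" for x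
      using i xs by (simp add: rev_update tuples_length)
    then show "(\<lambda>x. pure (rev (xs[i := x]))) \<in> linear_maps K H (T 2)"
      using multilinear_slot[OF P.pure_multilinear r, of "1 - i"] by simp
  qed
  note e = P.ext_linear[OF W multilinear2[OF B]]
  have "Sw W B h = sweedler K W (\<lambda>xs. B (xs ! 0) (xs ! 1)) (sweedler K (T 2) (\<lambda>xs. pure (rev xs)) (comult H h))"
    using cocomm h by (simp add: Sw_def cocommutative_def)
  also have "\<dots> = sweedler K W (\<lambda>xs. sweedler K W (\<lambda>xs. B (xs ! 0) (xs ! 1)) (pure (rev xs))) (comult H h)"
    by (rule P.ext_comp[OF P.T_module W rm e comult_closed[OF h]])
  also have "\<dots> = Sw W (\<lambda>x y. B y x) h"
    unfolding Sw_def
  proof (rule P.ext_cong[OF W _ comult_closed[OF h]])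
    show "multilinear K H 2 W (\<lambda>xs. B (xs ! 1) (xs ! 0))"
      using multilinear2[of W "\<lambda>x y. B y x"] bilinear_left[OF B] bilinear_right[OF B] by (simp add: bilinear_def)
    show "sweedler K W (\<lambda>xs. B (xs ! 0) (xs ! 1)) (pure (rev xs)) = B (xs ! 1) (xs ! 0)" if xs: "xs \<in> tuples H 2" for xs
      using tuples2[OF xs] P.ext_pure[OF W multilinear2[OF B], of "rev xs"] by (auto simp: tuples_lists)
  qed
  finally show ?thesis by simp
qed

text \<open>
  By induction on the number of factors. A transposition that fixes the last factor acts inside
  \<open>\<Delta>\<^sup>n(h\<^sub>1)\<close>, where the induction hypothesis applies. For the transposition of the last two
  factors, coassociativity collects them into one coproduct \<open>\<Delta>(h\<^sub>2)\<close>, to which cocommutativity applies.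
\<close>

lemma iter_transpose:
  assumes "h \<in> carrier H" "j \<le> n"
  shows "perm (Suc (Suc n)) (transpose j (Suc j)) (iter (Suc n) h) = iter (Suc n) h"
  using assms
proof (induction n arbitrary: h j)
  case 0
  then have j: "j = 0" by simp
  let ?W = "T (Suc (Suc 0))" and ?B = "\<lambda>x y. P.app (Suc 0) (iter 0 x) y"
  have p: "bij_betw (transpose 0 (Suc 0)) {..<Suc (Suc 0)} {..<Suc (Suc 0)}" by (rule transpose_bij) simp_all
  have b: "bilinear K H H ?W (\<lambda>x y. ?B y x)"
    using bilinear_left[OF iter_app_bilinear[of 0]] bilinear_right[OF iter_app_bilinear[of 0]] by (simp add: bilinear_def)
  have "perm (Suc (Suc 0)) (transpose 0 (Suc 0)) (iter (Suc 0) h) = Sw ?W (\<lambda>x y. perm (Suc (Suc 0)) (transpose 0 (Suc 0)) (?B x y)) h"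
    unfolding iter_Suc[OF 0(1)]
    by (rule Sw_comp[OF P.T_module iter_app_bilinear P.T_module perm_linear[OF p] 0(1)])
  also have "\<dots> = Sw ?W (\<lambda>x y. ?B y x) h"
  proof (rule Sw_cong[OF P.T_module b 0(1)])
    fix x y assume xy: "x \<in> carrier H" "y \<in> carrier H"
    have "pure [] \<in> carrier (T 0)" by (rule P.pure_closed) (simp add: tuples_def)
    moreover have "P.app 0 (pure []) x = iter 0 x" if "x \<in> carrier H" for x
      using that by (simp add: P.app_pure tuples_def)
    ultimately show "perm (Suc (Suc 0)) (transpose 0 (Suc 0)) (?B x y) = ?B y x"
      using perm_app_app[of "pure []" 0 x y] xy by simp
  qed
  also have "\<dots> = iter (Suc 0) h"
    unfolding Sw_cocomm[OF P.T_module iter_app_bilinear 0(1)] iter_Suc[OF 0(1)] ..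
  finally show ?case by (simp only: j)
next
  case (Suc n)
  let ?W = "T (Suc (Suc (Suc n)))" and ?p = "transpose j (Suc j)"
  have p: "bij_betw ?p {..<Suc (Suc (Suc n))} {..<Suc (Suc (Suc n))}"
    by (rule transpose_bij) (use Suc in simp_all)
  show ?case
  proof (cases "j \<le> n")
    case True
    have p': "bij_betw ?p {..<Suc (Suc n)} {..<Suc (Suc n)}" by (rule transpose_bij) (use True in simp_all)
    have "perm (Suc (Suc (Suc n))) ?p (iter (Suc (Suc n)) h) =
        Sw ?W (\<lambda>x y. perm (Suc (Suc (Suc n))) ?p (P.app (Suc (Suc n)) (iter (Suc n) x) y)) h"
      unfolding iter_Suc[OF Suc.prems(1), of "Suc n"]
      by (rule Sw_comp[OF P.T_module iter_app_bilinear P.T_module perm_linear[OF p] Suc.prems(1)])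
    also have "\<dots> = Sw ?W (\<lambda>x y. P.app (Suc (Suc n)) (iter (Suc n) x) y) h"
    proof (rule Sw_cong[OF P.T_module iter_app_bilinear Suc.prems(1)])
      fix x y assume xy: "x \<in> carrier H" "y \<in> carrier H"
      have "transpose j (Suc j) (Suc (Suc n)) = Suc (Suc n)" using True by (simp add: transpose_def)
      from perm_app[OF p' p this iter_closed[OF xy(1)] xy(2)]
      show "perm (Suc (Suc (Suc n))) ?p (P.app (Suc (Suc n)) (iter (Suc n) x) y) = P.app (Suc (Suc n)) (iter (Suc n) x) y"
        by (simp only: Suc.IH[OF xy(1) True])
    qed
    also have "\<dots> = iter (Suc (Suc n)) h" by (simp only: iter_Suc[OF Suc.prems(1), of "Suc n"])
    finally show ?thesis .
  next
    case False
    then have j: "j = Suc n" using Suc.prems by simp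
    let ?B = "\<lambda>a b c. P.app (Suc (Suc n)) (P.app (Suc n) (iter n a) b) c"
    have tri: "trilinear ?W ?B"
      unfolding trilinear_def
      by (intro conjI ballI bilinear_pre[OF P.app_bilinear bilinear_right[OF P.app_bilinear iter_closed] linear_id]
          linear_comp[OF linear_comp[OF iter_linear bilinear_left[OF P.app_bilinear]] bilinear_left[OF P.app_bilinear]])
    have split: "iter (Suc (Suc n)) h = Sw ?W (\<lambda>a y. Sw ?W (\<lambda>b c. ?B a b c) y) h"
    proof -
      have "Sw ?W (\<lambda>x z. P.app (Suc (Suc n)) (iter (Suc n) x) z) h = Sw ?W (\<lambda>x z. Sw ?W (\<lambda>a b. ?B a b z) x) h"
      proof (rule Sw_cong[OF P.T_module bilinear_Sw_left[OF P.T_module tri] Suc.prems(1)])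
        fix x z assume xz: "x \<in> carrier H" "z \<in> carrier H"
        show "P.app (Suc (Suc n)) (iter (Suc n) x) z = Sw ?W (\<lambda>a b. ?B a b z) x"
          unfolding iter_Suc[OF xz(1)]
          by (rule Sw_comp[OF P.T_module iter_app_bilinear P.T_module bilinear_left[OF P.app_bilinear xz(2)] xz(1)])
      qed
      then show ?thesis
        by (simp only: iter_Suc[OF Suc.prems(1), of "Suc n"] Sw_coassoc[OF P.T_module tri Suc.prems(1)])
    qed
    have "perm (Suc (Suc (Suc n))) ?p (iter (Suc (Suc n)) h) =
        Sw ?W (\<lambda>a y. perm (Suc (Suc (Suc n))) ?p (Sw ?W (\<lambda>b c. ?B a b c) y)) h"
      unfolding split
      by (rule Sw_comp[OF P.T_module bilinear_Sw_right[OF P.T_module tri] P.T_module perm_linear[OF p] Suc.prems(1)])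
    also have "\<dots> = Sw ?W (\<lambda>a y. Sw ?W (\<lambda>b c. ?B a b c) y) h"
    proof (rule Sw_cong[OF P.T_module bilinear_Sw_right[OF P.T_module tri] Suc.prems(1)])
      fix a y assume ay: "a \<in> carrier H" "y \<in> carrier H"
      note b = trilinearD(1)[OF tri ay(1)]
      have b': "bilinear K H H ?W (\<lambda>b c. ?B a c b)"
        using bilinear_left[OF b] bilinear_right[OF b] by (simp add: bilinear_def)
      have "perm (Suc (Suc (Suc n))) ?p (Sw ?W (\<lambda>b c. ?B a b c) y) = Sw ?W (\<lambda>b c. perm (Suc (Suc (Suc n))) ?p (?B a b c)) y"
        by (rule Sw_comp[OF P.T_module b P.T_module perm_linear[OF p] ay(2)])
      also have "\<dots> = Sw ?W (\<lambda>b c. ?B a c b) y"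
        by (rule Sw_cong[OF P.T_module b' ay(2)]) (simp only: j perm_app_app iter_closed[OF ay(1)])
      also have "\<dots> = Sw ?W (\<lambda>b c. ?B a b c) y" by (rule Sw_cocomm[OF P.T_module b ay(2)])
      finally show "perm (Suc (Suc (Suc n))) ?p (Sw ?W (\<lambda>b c. ?B a b c) y) = Sw ?W (\<lambda>b c. ?B a b c) y" .
    qed
    finally show ?thesis unfolding split[symmetric] .
  qed
qed

text \<open>
  The cycle that puts the entry of index \<open>j\<close> first. For the last index it is the cyclic rotation, and
  \<open>to_front (Suc j)\<close> differs from \<open>to_front j\<close> by an adjacent transposition; this is how invariance under
  the rotation follows from \<open>iter_transpose\<close>.
\<close>

definition to_front :: "nat \<Rightarrow> nat \<Rightarrow> nat" where
  "to_front j k = (if k = 0 then j else if k \<le> j then k - 1 else k)"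

lemma to_front_bij: "j < n \<Longrightarrow> bij_betw (to_front j) {..<n} {..<n}"
  by (rule bij_betw_byWitness[where f' = "\<lambda>k. if k = j then 0 else if k < j then Suc k else k"])
     (auto simp: to_front_def)

lemma iter_to_front:
  assumes h: "h \<in> carrier H" and j: "j \<le> n"
  shows "perm (Suc n) (to_front j) (iter n h) = iter n h"
  using j
proof (induction j)
  case 0
  have "perm (Suc n) (to_front 0) (iter n h) = (\<lambda>t. t) (iter n h)"
  proof (rule P.T_eqI[OF P.T_module perm_linear linear_id _ iter_closed[OF h]])
    show b: "bij_betw (to_front 0) {..<Suc n} {..<Suc n}" by (rule to_front_bij) simp
    fix xs assume xs: "xs \<in> tuples H (Suc n)"
    have "map (\<lambda>k. xs ! to_front 0 k) [0..<Suc n] = xs"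
      by (rule nth_equalityI) (use xs in \<open>auto simp: tuples_length to_front_def simp del: upt_Suc\<close>)
    then show "perm (Suc n) (to_front 0) (pure xs) = pure xs" by (simp only: perm_pure[OF b xs])
  qed
  then show ?case .
next
  case (Suc j)
  then obtain m where m: "n = Suc m" "j \<le> m" by (cases n) auto
  have b: "bij_betw (transpose j (Suc j)) {..<Suc n} {..<Suc n}" by (rule transpose_bij) (use Suc in simp_all)
  have "perm (Suc n) (to_front j) (perm (Suc n) (transpose j (Suc j)) (iter n h)) = perm (Suc n) (to_front (Suc j)) (iter n h)"
    by (rule perm_perm[OF _ b iter_closed[OF h]])
       (use Suc.prems in \<open>auto intro!: to_front_bij simp: to_front_def transpose_def\<close>)
  then show ?case using Suc iter_transpose[OF h m(2)] m(1) by simp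
qed

definition rot :: "nat \<Rightarrow> ('h list \<Rightarrow> 'k) set \<Rightarrow> ('h list \<Rightarrow> 'k) set" where
  "rot n = perm (Suc n) (to_front n)"

lemma rot_right_linear: "rot n \<in> right_linear_maps K H (C n) (C n)"
  unfolding rot_def using to_front_bij[of n "Suc n"]
  by (intro right_linear_mapsI) (simp_all add: perm_linear perm_mult iter_closed iter_to_front)

lemma rot_linear: "rot n \<in> linear_maps K (T (Suc n)) (T (Suc n))"
  using hlinear_linear[OF rot_right_linear] by simp

abbreviation rl where "rl xs \<equiv> last xs # butlast xs"

lemma rl_tuples: "xs \<in> tuples H (Suc n) \<Longrightarrow> rl xs \<in> tuples H (Suc n)"
  by (cases xs rule: rev_cases) (auto simp: tuples_def)

lemma rot_pure: 
  assumes xs: "xs \<in> tuples H (Suc n)"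
  shows "rot n (pure xs) = pure (rl xs)"
proof -
  have b: "bij_betw (to_front n) {..<Suc n} {..<Suc n}" by (rule to_front_bij) simp
  have "map (\<lambda>k. xs ! to_front n k) [0..<Suc n] = rl xs"
  proof (rule nth_equalityI)
    fix i assume "i < length (map (\<lambda>k. xs ! to_front n k) [0..<Suc n])"
    then have i: "i < Suc n" by simp
    have "xs \<noteq> []" using tuples_length[OF xs] by auto
    then show "map (\<lambda>k. xs ! to_front n k) [0..<Suc n] ! i = rl xs ! i"
      using i tuples_length[OF xs] by (cases i) (auto simp: to_front_def last_conv_nth nth_butlast simp del: upt_Suc)
  qed (use xs in \<open>simp add: tuples_length\<close>)
  then show ?thesis unfolding rot_def by (simp only: perm_pure[OF b xs])
qed

lemma rot_power:
  assumes t: "t \<in> carrier (T (Suc n))"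
  shows "(rot n ^^ Suc n) t = t"
proof -
  have lin: "(rot n ^^ k) \<in> linear_maps K (T (Suc n)) (T (Suc n))" for k
  proof (induction k)
    case 0
    show ?case using linear_id by (simp add: id_def)
  next
    case (Suc k)
    then show ?case using linear_comp[OF Suc rot_linear] by (simp add: comp_def)
  qed
  show ?thesis
  proof (rule P.T_eqI[OF P.T_module lin linear_id _ t])
    fix xs assume xs: "xs \<in> tuples H (Suc n)"
    have "(rot n ^^ k) (pure xs) = pure ((rl ^^ k) xs) \<and> (rl ^^ k) xs \<in> tuples H (Suc n)" for k
      by (induction k) (use xs rot_pure rl_tuples in auto)
    moreover have "(rl ^^ k) (rotate k ys) = ys" if "ys \<noteq> []" for k and ys :: "'h list"
    proof (induction k)
      case (Suc k)
      have "rl (rotate1 zs) = zs" if "zs \<noteq> []" for zs :: "'h list" using that by (cases zs) auto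
      then have "rl (rotate (Suc k) ys) = rotate k ys" using that by simp
      then show ?case using Suc by (simp only: funpow_Suc_right comp_def)
    qed simp
    moreover have "rotate (Suc n) xs = xs" using tuples_length[OF xs] by (metis rotate_id mod_self)
    moreover have "xs \<noteq> []" using tuples_length[OF xs] by auto
    ultimately show "(rot n ^^ Suc n) (pure xs) = pure xs" by metis
  qed
qed

lemma face_rot:
  assumes t: "t \<in> carrier (T (Suc (Suc n)))" and i: "i \<le> n"
  shows "fc (Suc n) (Suc i) (rot (Suc n) t) = rot n (fc (Suc n) i t)"
proof (rule P.T_eqI[OF P.T_module linear_comp[OF rot_linear face_linear] linear_comp[OF face_linear rot_linear] _ t])
  fix xs assume xs: "xs \<in> tuples H (Suc (Suc n))"
  have ne: "xs \<noteq> []" and len: "length xs = Suc (Suc n)" using tuples_length[OF xs] by auto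
  have d: "del i xs \<in> tuples H (Suc n)" by (rule del_tuples[OF xs]) (use i in simp)
  have xi: "xs ! i \<in> carrier H" by (rule tuples_nth[OF xs]) (use i in simp)
  obtain zs z where z: "xs = zs @ [z]" using ne by (cases xs rule: rev_cases) auto
  have "del (Suc i) (rl xs) = rl (del i xs)" "rl xs ! Suc i = xs ! i"
    using i len by (simp_all add: z nth_append butlast_append)
  then show "fc (Suc n) (Suc i) (rot (Suc n) (pure xs)) = rot n (fc (Suc n) i (pure xs))"
    using i by (simp only: rot_pure[OF xs] face_pure[OF rl_tuples[OF xs]] face_pure[OF xs] rot_pure[OF d]
        linear_smult[OF rot_linear counit_closed[OF xi] P.pure_closed[OF d]] Suc_le_mono le_SucI)
qed (use i in simp_all)

lemma face_rot_zero:
  assumes t: "t \<in> carrier (T (Suc (Suc n)))"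
  shows "fc (Suc n) 0 (rot (Suc n) t) = fc (Suc n) (Suc n) t"
proof (rule P.T_eqI[OF P.T_module linear_comp[OF rot_linear face_linear] face_linear _ t])
  fix xs assume xs: "xs \<in> tuples H (Suc (Suc n))"
  then obtain zs z where z: "xs = zs @ [z]" "length zs = Suc n" by (cases xs rule: rev_cases) (auto simp: tuples_def)
  have "rot (Suc n) (pure xs) = pure (z # zs)" using rot_pure[OF xs] z by simp
  then show "fc (Suc n) 0 (rot (Suc n) (pure xs)) = fc (Suc n) (Suc n) (pure xs)"
    using face_pure[OF rl_tuples[OF xs], of 0] face_pure[OF xs, of "Suc n"] z
    by (simp add: nth_append)
qed simp_all

subsection \<open>The contracting homotopy and the augmentation\<close>

text \<open>
  Prepending the unit is an extra degeneracy for the faces: \<open>\<delta>\<^sub>0\<close> undoes it because \<open>\<epsilon>(1) = 1\<close>, and the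
  other faces commute with it up to a shift of the index, except that in the bottom degree the face left over
  is the augmentation followed by the unit.
\<close>

definition prep :: "nat \<Rightarrow> ('h list \<Rightarrow> 'k) set \<Rightarrow> ('h list \<Rightarrow> 'k) set" where
  "prep n = sweedler K (T (Suc n)) (\<lambda>xs. pure (\<one>\<^bsub>H\<^esub> # xs))"

lemma prep_multilinear: "multilinear K H n (T (Suc n)) (\<lambda>xs. pure (\<one>\<^bsub>H\<^esub> # xs))"
  using P.pure_embed[of "[\<one>\<^bsub>H\<^esub>]" 1 "[]" 0 "Suc n" n] by (simp add: tuples_def one_H)

lemma prep_linear: "prep n \<in> linear_maps K (T n) (T (Suc n))"
  unfolding prep_def by (rule P.ext_linear[OF P.T_module prep_multilinear])

lemma prep_pure: "xs \<in> tuples H n \<Longrightarrow> prep n (pure xs) = pure (\<one>\<^bsub>H\<^esub> # xs)"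
  unfolding prep_def by (rule P.ext_pure[OF P.T_module prep_multilinear])

lemma face_zero_prep: "t \<in> carrier (T n) \<Longrightarrow> fc n 0 (prep n t) = t"
proof (rule P.T_eqI[OF P.T_module linear_comp[OF prep_linear face_linear] linear_id])
  interpret X: module K "T n" by (rule P.T_module)
  fix xs assume xs: "xs \<in> tuples H n"
  then have "\<one>\<^bsub>H\<^esub> # xs \<in> tuples H (Suc n)" by (simp add: tuples_def one_H)
  then show "fc n 0 (prep n (pure xs)) = pure xs"
    using xs by (simp add: prep_pure face_pure counit_one P.pure_closed)
qed simp_all

lemma face_Suc_prep: "t \<in> carrier (T (Suc n)) \<Longrightarrow> i \<le> n \<Longrightarrow> fc (Suc n) (Suc i) (prep (Suc n) t) = prep n (fc n i t)"
proof (rule P.T_eqI[OF P.T_module linear_comp[OF prep_linear face_linear] linear_comp[OF face_linear prep_linear]])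
  fix xs assume i: "i \<le> n" and xs: "xs \<in> tuples H (Suc n)"
  have "\<one>\<^bsub>H\<^esub> # xs \<in> tuples H (Suc (Suc n))" using xs by (simp add: tuples_def one_H)
  moreover have "xs ! i \<in> carrier H" using tuples_nth[OF xs] i by simp
  moreover note del_tuples[OF xs i]
  ultimately show "fc (Suc n) (Suc i) (prep (Suc n) (pure xs)) = prep n (fc n i (pure xs))"
    using xs i by (simp add: prep_pure face_pure linear_smult[OF prep_linear] counit_closed P.pure_closed)
qed simp_all

abbreviation KK where "KK \<equiv> trivial_right_module K H"

lemma KK_simps [simp]: "carrier KK = carrier K" "\<zero>\<^bsub>KK\<^esub> = \<zero>\<^bsub>K\<^esub>" "x \<oplus>\<^bsub>KK\<^esub> y = x \<oplus>\<^bsub>K\<^esub> y"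
  "a \<odot>\<^bsub>KK\<^esub> x = a \<otimes>\<^bsub>K\<^esub> x" "ract KK x h = x \<otimes>\<^bsub>K\<^esub> counit H h"
  by (simp_all add: trivial_right_module_def)

lemma KK_module: "module K KK"
  unfolding trivial_right_module_def by (rule cring_module[OF cring_K])

text \<open>
  The counit, on the first tensor power in place of \<open>H\<close>.
\<close>

definition aug :: "('h list \<Rightarrow> 'k) set \<Rightarrow> 'k" where
  "aug = sweedler K KK (\<lambda>xs. counit H (xs ! 0))"

lemma aug_multilinear: "multilinear K H (Suc 0) KK (\<lambda>xs. counit H (xs ! 0))"
  by (intro multilinearI linear_mapsI)
     (auto simp: tuples_def length_Suc_conv counit_closed counit_add counit_smult)

lemma aug_linear: "aug \<in> linear_maps K (T (Suc 0)) KK"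
  unfolding aug_def by (rule P.ext_linear[OF KK_module aug_multilinear])

lemma aug_pure: "x \<in> carrier H \<Longrightarrow> aug (pure [x]) = counit H x"
  unfolding aug_def using P.ext_pure[OF KK_module aug_multilinear tuples_lists(1)] by simp

lemma aug_right_linear: "aug \<in> right_linear_maps K H (C 0) KK"
proof (rule right_linear_mapsI)
  show "aug \<in> linear_maps K (C 0) KK" using aug_linear by simp
  fix t h assume t: "t \<in> carrier (C 0)" and h: "h \<in> carrier H"
  have l: "(\<lambda>x. x \<otimes>\<^bsub>K\<^esub> counit H h) \<in> linear_maps K KK KK"
    by (rule linear_mapsI) (use ringE(3)[OF cring.axioms(1)[OF cring_K]]
        monoid.m_assoc[OF ring.is_monoid[OF cring.axioms(1)[OF cring_K]]] counit_closed[OF h] in simp_all)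
  have "aug (pm (Suc 0) t (iter 0 h)) = aug t \<otimes>\<^bsub>K\<^esub> counit H h"
  proof (rule P.T_eqI[OF KK_module linear_comp[OF bilinear_left[OF pm_bilinear iter_closed[OF h]] aug_linear]
        linear_comp[OF aug_linear l]])
    show "t \<in> carrier (T (Suc 0))" using t by simp
    fix xs assume "xs \<in> tuples H (Suc 0)"
    then obtain a where "xs = [a]" "a \<in> carrier H" using tuples1 by blast
    then show "aug (pm (Suc 0) (pure xs) (iter 0 h)) = aug (pure xs) \<otimes>\<^bsub>K\<^esub> counit H h"
      using h by (simp add: pm_pure tuples_lists aug_pure mult_closed counit_mult)
  qed
  then show "aug (ract (C 0) t h) = ract KK (aug t) h" by simp
qed

lemma aug_one: "aug (pure [\<one>\<^bsub>H\<^esub>]) = \<one>\<^bsub>K\<^esub>"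
  by (simp add: aug_pure one_H counit_one)

lemma aug_face: "t \<in> carrier (T (Suc (Suc 0))) \<Longrightarrow> aug (fc (Suc 0) 0 t) = aug (fc (Suc 0) (Suc 0) t)"
proof (rule P.T_eqI[OF KK_module linear_comp[OF face_linear aug_linear] linear_comp[OF face_linear aug_linear]])
  interpret K: cring K by (rule cring_K)
  fix xs assume xs: "xs \<in> tuples H (Suc (Suc 0))"
  then obtain a b where "xs = [a, b]" "a \<in> carrier H" "b \<in> carrier H" using tuples2 by (metis numeral_2_eq_2)
  then show "aug (fc (Suc 0) 0 (pure xs)) = aug (fc (Suc 0) (Suc 0) (pure xs))"
    using face_pure[OF xs, of 0] face_pure[OF xs, of "Suc 0"]
    by (simp add: linear_smult[OF aug_linear] counit_closed P.pure_closed tuples_lists aug_pure m_comm)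
qed simp_all

lemma face_one_prep: "t \<in> carrier (T (Suc 0)) \<Longrightarrow> fc (Suc 0) (Suc 0) (prep (Suc 0) t) = aug t \<odot>\<^bsub>T (Suc 0)\<^esub> pure [\<one>\<^bsub>H\<^esub>]"
proof (rule P.T_eqI[OF P.T_module linear_comp[OF prep_linear face_linear] linear_comp[OF aug_linear, of "\<lambda>a. a \<odot>\<^bsub>T (Suc 0)\<^esub> pure [\<one>\<^bsub>H\<^esub>]"]])
  interpret X: module K "T (Suc 0)" by (rule P.T_module)
  show "(\<lambda>a. a \<odot>\<^bsub>T (Suc 0)\<^esub> pure [\<one>\<^bsub>H\<^esub>]) \<in> linear_maps K KK (T (Suc 0))"
    by (rule linear_mapsI) (simp_all add: X.smult_l_distr X.smult_assoc1 P.pure_closed tuples_lists one_H)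
  fix xs assume "xs \<in> tuples H (Suc 0)"
  then obtain a where a: "xs = [a]" "a \<in> carrier H" using tuples1 by blast
  then show "fc (Suc 0) (Suc 0) (prep (Suc 0) (pure xs)) = aug (pure xs) \<odot>\<^bsub>T (Suc 0)\<^esub> pure [\<one>\<^bsub>H\<^esub>]"
    using face_pure[of "[\<one>\<^bsub>H\<^esub>, a]" "Suc 0" "Suc 0"]
    by (simp add: prep_pure tuples_lists aug_pure) (simp add: tuples_def one_H)
qed simp_all

end

section \<open>Direct sums\<close>

lemma direct_sum_simps [simp]:
  "\<zero>\<^bsub>direct_sum I V\<^esub> = (\<lambda>i\<in>I. \<zero>\<^bsub>V i\<^esub>)"
  "f \<oplus>\<^bsub>direct_sum I V\<^esub> g = (\<lambda>i\<in>I. f i \<oplus>\<^bsub>V i\<^esub> g i)"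
  "a \<odot>\<^bsub>direct_sum I V\<^esub> f = (\<lambda>i\<in>I. a \<odot>\<^bsub>V i\<^esub> f i)"
  by (simp_all add: direct_sum_def)

lemma direct_sum_carrier: "f \<in> carrier (direct_sum I V) \<longleftrightarrow>
    f \<in> extensional I \<and> (\<forall>i\<in>I. f i \<in> carrier (V i)) \<and> finite {i \<in> I. f i \<noteq> \<zero>\<^bsub>V i\<^esub>}"
  by (auto simp: direct_sum_def PiE_def Pi_def)

lemma direct_sum_carrier_finite: "finite I \<Longrightarrow> f \<in> carrier (direct_sum I V) \<longleftrightarrow>
    f \<in> extensional I \<and> (\<forall>i\<in>I. f i \<in> carrier (V i))"
  by (auto simp: direct_sum_carrier)

lemma direct_sum_module:
  assumes K: "cring K" and V: "\<And>i. i \<in> I \<Longrightarrow> module K (V i)"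
  shows "module K (direct_sum I V)"
proof -
  let ?D = "direct_sum I V"
  have cl: "(\<lambda>i\<in>I. f i \<oplus>\<^bsub>V i\<^esub> g i) \<in> carrier ?D" if f: "f \<in> carrier ?D" and g: "g \<in> carrier ?D" for f g
  proof -
    have "f i \<oplus>\<^bsub>V i\<^esub> g i \<in> carrier (V i)" if "i \<in> I" for i
      using f g that module.axioms(2)[OF V[OF that]] by (auto simp: direct_sum_carrier abelian_groupE(1))
    moreover have "finite {i \<in> I. (\<lambda>i\<in>I. f i \<oplus>\<^bsub>V i\<^esub> g i) i \<noteq> \<zero>\<^bsub>V i\<^esub>}"
    proof (rule finite_subset[of _ "{i \<in> I. f i \<noteq> \<zero>\<^bsub>V i\<^esub>} \<union> {i \<in> I. g i \<noteq> \<zero>\<^bsub>V i\<^esub>}"])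
      show "{i \<in> I. (\<lambda>i\<in>I. f i \<oplus>\<^bsub>V i\<^esub> g i) i \<noteq> \<zero>\<^bsub>V i\<^esub>} \<subseteq> {i \<in> I. f i \<noteq> \<zero>\<^bsub>V i\<^esub>} \<union> {i \<in> I. g i \<noteq> \<zero>\<^bsub>V i\<^esub>}"
      proof
        fix i assume i: "i \<in> {i \<in> I. (\<lambda>i\<in>I. f i \<oplus>\<^bsub>V i\<^esub> g i) i \<noteq> \<zero>\<^bsub>V i\<^esub>}"
        then interpret module K "V i" using V by simp
        show "i \<in> {i \<in> I. f i \<noteq> \<zero>\<^bsub>V i\<^esub>} \<union> {i \<in> I. g i \<noteq> \<zero>\<^bsub>V i\<^esub>}" using i by auto
      qed
    qed (use f g in \<open>simp add: direct_sum_carrier\<close>)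
    ultimately show ?thesis by (simp add: direct_sum_carrier)
  qed
  have sm: "(\<lambda>i\<in>I. a \<odot>\<^bsub>V i\<^esub> f i) \<in> carrier ?D" if f: "f \<in> carrier ?D" and a: "a \<in> carrier K" for f a
  proof -
    have "a \<odot>\<^bsub>V i\<^esub> f i \<in> carrier (V i)" if "i \<in> I" for i
      using f a that module.smult_closed[OF V[OF that]] by (auto simp: direct_sum_carrier)
    moreover have "finite {i \<in> I. (\<lambda>i\<in>I. a \<odot>\<^bsub>V i\<^esub> f i) i \<noteq> \<zero>\<^bsub>V i\<^esub>}"
    proof (rule finite_subset[of _ "{i \<in> I. f i \<noteq> \<zero>\<^bsub>V i\<^esub>}"])
      show "{i \<in> I. (\<lambda>i\<in>I. a \<odot>\<^bsub>V i\<^esub> f i) i \<noteq> \<zero>\<^bsub>V i\<^esub>} \<subseteq> {i \<in> I. f i \<noteq> \<zero>\<^bsub>V i\<^esub>}"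
        using module.smult_r_null[OF V a] by auto
    qed (use f in \<open>simp add: direct_sum_carrier\<close>)
    ultimately show ?thesis by (simp add: direct_sum_carrier)
  qed
  have z: "(\<lambda>i\<in>I. \<zero>\<^bsub>V i\<^esub>) \<in> carrier ?D"
    using abelian_groupE(2)[OF module.axioms(2)[OF V]] by (simp add: direct_sum_carrier)
  have mem: "f i \<in> carrier (V i)" if "f \<in> carrier ?D" "i \<in> I" for f i
    using that by (simp add: direct_sum_carrier)
  have ext: "f = g" if "f \<in> carrier ?D" "g \<in> carrier ?D" "\<And>i. i \<in> I \<Longrightarrow> f i = g i" for f g
    using that by (auto simp: direct_sum_carrier intro: extensionalityI)
  note ab = module.axioms(2)[OF V]
  show ?thesis
  proof (rule moduleI)
    show "abelian_group ?D"
    proof (rule abelian_groupI)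
      show "x \<oplus>\<^bsub>?D\<^esub> y \<in> carrier ?D" if "x \<in> carrier ?D" "y \<in> carrier ?D" for x y
        using cl that by simp
      show "\<zero>\<^bsub>?D\<^esub> \<in> carrier ?D" using z by simp
      show "x \<oplus>\<^bsub>?D\<^esub> y \<oplus>\<^bsub>?D\<^esub> w = x \<oplus>\<^bsub>?D\<^esub> (y \<oplus>\<^bsub>?D\<^esub> w)"
        if "x \<in> carrier ?D" "y \<in> carrier ?D" "w \<in> carrier ?D" for x y w
        using that mem by (auto intro!: restrict_ext abelian_groupE(3)[OF ab])
      show "x \<oplus>\<^bsub>?D\<^esub> y = y \<oplus>\<^bsub>?D\<^esub> x" if "x \<in> carrier ?D" "y \<in> carrier ?D" for x y
        using that mem by (auto intro!: restrict_ext abelian_groupE(4)[OF ab])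
      show "\<zero>\<^bsub>?D\<^esub> \<oplus>\<^bsub>?D\<^esub> x = x" if x: "x \<in> carrier ?D" for x
        by (rule ext) (use x z cl[OF z x] mem abelian_groupE(5)[OF ab] in auto)
      show "\<exists>y\<in>carrier ?D. y \<oplus>\<^bsub>?D\<^esub> x = \<zero>\<^bsub>?D\<^esub>" if x: "x \<in> carrier ?D" for x
      proof
        interpret K: cring K by fact
        show "(\<lambda>i\<in>I. (\<ominus>\<^bsub>K\<^esub> \<one>\<^bsub>K\<^esub>) \<odot>\<^bsub>V i\<^esub> x i) \<in> carrier ?D" by (rule sm[OF x]) simp
        have "(\<ominus>\<^bsub>K\<^esub> \<one>\<^bsub>K\<^esub>) \<odot>\<^bsub>V i\<^esub> x i \<oplus>\<^bsub>V i\<^esub> x i = \<zero>\<^bsub>V i\<^esub>" if i: "i \<in> I" for i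
        proof -
          interpret Vi: module K "V i" by (rule V[OF i])
          show ?thesis using mem[OF x i] by (simp add: Vi.smult_l_minus Vi.l_neg)
        qed
        then show "(\<lambda>i\<in>I. (\<ominus>\<^bsub>K\<^esub> \<one>\<^bsub>K\<^esub>) \<odot>\<^bsub>V i\<^esub> x i) \<oplus>\<^bsub>?D\<^esub> x = \<zero>\<^bsub>?D\<^esub>" by (auto intro!: restrict_ext)
      qed
    qed
    show "a \<odot>\<^bsub>?D\<^esub> x \<in> carrier ?D" if "a \<in> carrier K" "x \<in> carrier ?D" for a x using sm that by simp
    show "(a \<oplus>\<^bsub>K\<^esub> b) \<odot>\<^bsub>?D\<^esub> x = a \<odot>\<^bsub>?D\<^esub> x \<oplus>\<^bsub>?D\<^esub> b \<odot>\<^bsub>?D\<^esub> x"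
      if "a \<in> carrier K" "b \<in> carrier K" "x \<in> carrier ?D" for a b x
      using that mem by (auto intro!: restrict_ext module.smult_l_distr[OF V])
    show "a \<odot>\<^bsub>?D\<^esub> (x \<oplus>\<^bsub>?D\<^esub> y) = a \<odot>\<^bsub>?D\<^esub> x \<oplus>\<^bsub>?D\<^esub> a \<odot>\<^bsub>?D\<^esub> y"
      if "a \<in> carrier K" "x \<in> carrier ?D" "y \<in> carrier ?D" for a x y
      using that mem by (auto intro!: restrict_ext module.smult_r_distr[OF V])
    show "(a \<otimes>\<^bsub>K\<^esub> b) \<odot>\<^bsub>?D\<^esub> x = a \<odot>\<^bsub>?D\<^esub> (b \<odot>\<^bsub>?D\<^esub> x)"
      if "a \<in> carrier K" "b \<in> carrier K" "x \<in> carrier ?D" for a b x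
      using that mem by (auto intro!: restrict_ext module.smult_assoc1[OF V])
    show "\<one>\<^bsub>K\<^esub> \<odot>\<^bsub>?D\<^esub> x = x" if x: "x \<in> carrier ?D" for x
      by (rule ext) (use x sm[OF x] mem module.smult_one[OF V] cring.cring_simprules(6)[OF K] in auto)
  qed (rule K)
qed

section \<open>The Tsygan double complex of a cyclic module\<close>

text \<open>
  The operator \<open>signed\<close> has the type of module records without further components.
\<close>

locale plain_module = module K V for K :: "'k ring" and V :: "('k, 'v) module"
begin

lemma signed_0 [simp]: "signed V 0 x = x" by (simp add: signed_def)

lemma signed_Suc: "x \<in> carrier V \<Longrightarrow> signed V (Suc i) x = \<ominus>\<^bsub>V\<^esub> signed V i x"
  by (simp add: signed_def)

lemma signed_closed [simp]: "x \<in> carrier V \<Longrightarrow> signed V i x \<in> carrier V"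
  by (simp add: signed_def)

lemma signed_signed: "x \<in> carrier V \<Longrightarrow> signed V i (signed V j x) = signed V (i + j) x"
  by (simp add: signed_def)

end

lemma signed_linear: "module K V \<Longrightarrow> signed V i \<in> linear_maps K V V"
  using linear_id linear_uminus[OF _ linear_id, of K V]
  by (cases "even i") (simp_all add: signed_def[abs_def])

locale plain_linear_map = linear_map K V W f
  for K :: "'k ring" and V :: "('k, 'v) module" and W :: "('k, 'w) module" and f
begin

lemma signed: "x \<in> carrier V \<Longrightarrow> f (signed V i x) = signed W i (f x)"
  by (simp add: signed_def)

end

lemma linear_mapI: "module K V \<Longrightarrow> module K W \<Longrightarrow> f \<in> linear_maps K V W \<Longrightarrow> linear_map K V W f"
  by (intro linear_map.intro linear_map_axioms.intro)

lemma linear_funpow: "f \<in> linear_maps K V V \<Longrightarrow> (f ^^ n) \<in> linear_maps K V V"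
proof (induction n)
  case 0
  show ?case using linear_id by (simp add: id_def)
next
  case (Suc n)
  then show ?case using linear_comp[of "f ^^ n" K V V f V] by (simp add: comp_def)
qed

lemma (in abelian_group) finsum_reverse:
  assumes "\<And>i. i \<le> m \<Longrightarrow> f i \<in> carrier G"
  shows "finsum G f {..m} = finsum G (\<lambda>i. f (m - i)) {..(m::nat)}"
proof -
  have "(\<lambda>i. m - i) ` {..m} = {..m}"
  proof (rule Set.set_eqI)
    fix x
    have "x \<in> {..m} \<Longrightarrow> x = m - (m - x)" by simp
    then show "x \<in> (\<lambda>i. m - i) ` {..m} \<longleftrightarrow> x \<in> {..m}" by (auto intro: image_eqI[of _ _ "m - x"])
  qed
  moreover have "inj_on (\<lambda>i. m - i) {..m}" by (auto simp: inj_on_def)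
  ultimately show ?thesis
    using finsum_reindex[of f "\<lambda>i. m - i" "{..m}"] assms by auto
qed

lemma plain_linear_mapI: "module K V \<Longrightarrow> module K W \<Longrightarrow> f \<in> linear_maps K V W \<Longrightarrow> plain_linear_map K V W f"
  by (intro plain_linear_map.intro linear_mapI)

locale cyclic_module = cring K for K :: "'k ring" +
  fixes Z :: "('k, 'v) cyclic_object"
  assumes mod: "module K (obj Z n)"
    and face_lin: "i \<le> Suc n \<Longrightarrow> face Z (Suc n) i \<in> linear_maps K (obj Z (Suc n)) (obj Z n)"
    and cyc_lin: "cyc Z n \<in> linear_maps K (obj Z n) (obj Z n)"
    and face_face: "x \<in> carrier (obj Z (Suc (Suc n))) \<Longrightarrow> i < j \<Longrightarrow> j \<le> Suc (Suc n) \<Longrightarrow>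
      face Z (Suc n) i (face Z (Suc (Suc n)) j x) = face Z (Suc n) (j - 1) (face Z (Suc (Suc n)) i x)"
    and face_cyc: "x \<in> carrier (obj Z (Suc n)) \<Longrightarrow> i \<le> n \<Longrightarrow>
      face Z (Suc n) (Suc i) (cyc Z (Suc n) x) = cyc Z n (face Z (Suc n) i x)"
    and face_cyc_0: "x \<in> carrier (obj Z (Suc n)) \<Longrightarrow>
      face Z (Suc n) 0 (cyc Z (Suc n) x) = face Z (Suc n) (Suc n) x"
    and cyc_power: "x \<in> carrier (obj Z n) \<Longrightarrow> (cyc Z n ^^ Suc n) x = x"
begin

abbreviation Ob where "Ob n \<equiv> obj Z n"
abbreviation t where "t n \<equiv> signed_cyc Z n"
abbreviation N where "N n \<equiv> cyclic_norm Z n"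
abbreviation b where "b n \<equiv> hochschild_b Z n"
abbreviation b' where "b' n \<equiv> hochschild_b' Z n"

text \<open>
  The signed faces and the partial sums of the Hochschild differentials: \<open>b\<close> is the full sum and \<open>b'\<close> omits the
  last face.
\<close>

definition D :: "nat \<Rightarrow> nat \<Rightarrow> 'v \<Rightarrow> 'v" where
  "D n i x = signed (Ob n) i (face Z (Suc n) i x)"

definition psum :: "nat \<Rightarrow> nat \<Rightarrow> 'v \<Rightarrow> 'v" where
  "psum n m x = (\<Oplus>\<^bsub>Ob n\<^esub>i\<in>{..m}. D n i x)"

lemma b_psum: "b (Suc n) x = psum n (Suc n) x" by (simp add: hochschild_b_def psum_def D_def)
lemma b'_psum: "b' (Suc n) x = psum n n x"
  by (simp add: hochschild_b'_def psum_def D_def lessThan_Suc_atMost)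

lemma D_lin: "i \<le> Suc n \<Longrightarrow> D n i \<in> linear_maps K (Ob (Suc n)) (Ob n)"
  unfolding D_def[abs_def] by (rule linear_comp[OF face_lin signed_linear[OF mod]])

lemmas D_closed = linear_closed[OF D_lin]

lemma psum_lin: "m \<le> Suc n \<Longrightarrow> psum n m \<in> linear_maps K (Ob (Suc n)) (Ob n)"
  unfolding psum_def[abs_def] by (rule linear_finsum[OF mod finite_atMost D_lin]) simp

lemmas psum_closed = linear_closed[OF psum_lin]

lemma psum_Suc: "Suc m \<le> Suc n \<Longrightarrow> x \<in> carrier (Ob (Suc n)) \<Longrightarrow> psum n (Suc m) x = D n (Suc m) x \<oplus>\<^bsub>Ob n\<^esub> psum n m x"
proof -
  interpret On: plain_module K "Ob n" by (rule plain_module.intro, rule mod)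
  assume "Suc m \<le> Suc n" "x \<in> carrier (Ob (Suc n))"
  then show ?thesis unfolding psum_def by (intro On.finsum_Suc funcsetI D_closed) auto
qed

lemma psum_Suc2:
  "m \<le> n \<Longrightarrow> x \<in> carrier (Ob (Suc n)) \<Longrightarrow>
    psum n (Suc m) x = (\<Oplus>\<^bsub>Ob n\<^esub>i\<in>{..m}. D n (Suc i) x) \<oplus>\<^bsub>Ob n\<^esub> D n 0 x"
proof -
  interpret On: plain_module K "Ob n" by (rule plain_module.intro, rule mod)
  assume "m \<le> n" "x \<in> carrier (Ob (Suc n))"
  then show ?thesis unfolding psum_def by (intro On.finsum_Suc2 funcsetI D_closed) auto
qed

text \<open>
  The identities \<open>b b = 0\<close> and \<open>b' b' = 0\<close> are the cases \<open>m = n + 1\<close> and \<open>m = n\<close>. In the induction on \<open>m\<close> each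
  sum receives one new face; since \<open>\<delta>\<^sub>i \<delta>\<^sub>m\<^sub>+\<^sub>2 = \<delta>\<^sub>m\<^sub>+\<^sub>1 \<delta>\<^sub>i\<close> for \<open>i \<le> m\<close>, the new terms cancel.
\<close>

lemma psum_psum:
  assumes x: "x \<in> carrier (Ob (Suc (Suc n)))" and "m \<le> Suc n"
  shows "psum n m (psum (Suc n) (Suc m) x) = \<zero>\<^bsub>Ob n\<^esub>"
  using assms(2)
proof (induction m)
  case 0
  interpret On: plain_module K "Ob n" by (rule plain_module.intro, rule mod)
  interpret O1: plain_module K "Ob (Suc n)" by (rule plain_module.intro, rule mod)
  interpret d0: plain_linear_map K "Ob (Suc n)" "Ob n" "face Z (Suc n) 0" by (rule plain_linear_mapI[OF mod mod face_lin]) simp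
  have f: "face Z (Suc (Suc n)) i x \<in> carrier (Ob (Suc n))" if "i \<le> Suc (Suc n)" for i
    by (rule linear_closed[OF face_lin[OF that] x])
  have 1: "psum (Suc n) (Suc 0) x = \<ominus>\<^bsub>Ob (Suc n)\<^esub> face Z (Suc (Suc n)) (Suc 0) x \<oplus>\<^bsub>Ob (Suc n)\<^esub> face Z (Suc (Suc n)) 0 x"
    using psum_Suc[of 0 "Suc n" x] x f by (simp add: psum_def D_def O1.finsum_insert O1.signed_Suc)
  have "psum n 0 y = face Z (Suc n) 0 y" if "y \<in> carrier (Ob (Suc n))" for y
    using that by (simp add: psum_def D_def On.finsum_insert)
  then have "psum n 0 (psum (Suc n) (Suc 0) x) = face Z (Suc n) 0 (psum (Suc n) (Suc 0) x)"
    using psum_closed[of "Suc 0" "Suc n" x] x by simp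
  then show ?case
    using face_face[OF x, of 0 "Suc 0"] f by (simp add: 1 On.l_neg)
next
  case (Suc m)
  interpret On: plain_module K "Ob n" by (rule plain_module.intro, rule mod)
  interpret O1: plain_module K "Ob (Suc n)" by (rule plain_module.intro, rule mod)
  interpret p: plain_linear_map K "Ob (Suc n)" "Ob n" "psum n m" by (rule plain_linear_mapI[OF mod mod psum_lin]) (use Suc in simp)
  interpret d: plain_linear_map K "Ob (Suc n)" "Ob n" "face Z (Suc n) (Suc m)" by (rule plain_linear_mapI[OF mod mod face_lin]) (use Suc in simp)
  have f: "face Z (Suc (Suc n)) i x \<in> carrier (Ob (Suc n))" if "i \<le> Suc (Suc n)" for i
    by (rule linear_closed[OF face_lin[OF that] x])
  let ?y = "psum (Suc n) m x" and ?u = "face Z (Suc n) (Suc m) (psum (Suc n) m x)"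
  let ?f1 = "face Z (Suc (Suc n)) (Suc m) x" and ?f2 = "face Z (Suc (Suc n)) (Suc (Suc m)) x"
  have y: "?y \<in> carrier (Ob (Suc n))" by (rule psum_closed) (use Suc x in auto)
  have f1: "?f1 \<in> carrier (Ob (Suc n))" and f2: "?f2 \<in> carrier (Ob (Suc n))" using f Suc by simp_all
  have P1: "psum (Suc n) (Suc m) x = signed (Ob (Suc n)) (Suc m) ?f1 \<oplus>\<^bsub>Ob (Suc n)\<^esub> ?y"
    using psum_Suc[of m "Suc n" x] Suc x by (simp add: D_def)
  have P2: "psum (Suc n) (Suc (Suc m)) x = \<ominus>\<^bsub>Ob (Suc n)\<^esub> signed (Ob (Suc n)) (Suc m) ?f2 \<oplus>\<^bsub>Ob (Suc n)\<^esub> psum (Suc n) (Suc m) x"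
    using psum_Suc[of "Suc m" "Suc n" x] Suc x f2 by (simp add: D_def O1.signed_Suc)
  have P1c: "psum (Suc n) (Suc m) x \<in> carrier (Ob (Suc n))" by (rule psum_closed) (use Suc x in auto)
  have P2c: "psum (Suc n) (Suc (Suc m)) x \<in> carrier (Ob (Suc n))" by (rule psum_closed) (use Suc x in auto)
  \<comment> \<open>moving the top face past the partial sum\<close>
  have pf2: "psum n m ?f2 = ?u"
  proof -
    have "psum n m ?f2 = (\<Oplus>\<^bsub>Ob n\<^esub>i\<in>{..m}. face Z (Suc n) (Suc m) (D (Suc n) i x))"
      unfolding psum_def
    proof (rule On.finsum_cong'[OF refl])
      fix i assume "i \<in> {..m}"
      then have i: "i \<le> m" by simp
      then have "face Z (Suc n) i ?f2 = face Z (Suc n) (Suc m) (face Z (Suc (Suc n)) i x)"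
        using face_face[OF x, of i "Suc (Suc m)"] Suc by simp
      then show "D n i ?f2 = face Z (Suc n) (Suc m) (D (Suc n) i x)"
        using d.signed[OF f[of i]] i Suc by (simp add: D_def)
    next
      show "(\<lambda>i. face Z (Suc n) (Suc m) (D (Suc n) i x)) \<in> {..m} \<rightarrow> carrier (Ob n)"
        by (intro funcsetI d.closed D_closed) (use Suc x in auto)
    qed
    also have "\<dots> = ?u"
      unfolding psum_def by (rule d.finsum[symmetric]) (intro funcsetI D_closed, use Suc x in auto)
    finally show ?thesis .
  qed
  have e: "face Z (Suc n) (Suc m) ?f2 = face Z (Suc n) (Suc m) ?f1"
    using face_face[OF x, of "Suc m" "Suc (Suc m)"] Suc by simp
  have "psum n (Suc m) (psum (Suc n) (Suc (Suc m)) x) =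
      signed (Ob n) (Suc m) (face Z (Suc n) (Suc m) (psum (Suc n) (Suc (Suc m)) x)) \<oplus>\<^bsub>Ob n\<^esub> psum n m (psum (Suc n) (Suc (Suc m)) x)"
    using psum_Suc[OF _ P2c, of m] Suc by (simp add: D_def)
  also have "psum n m (psum (Suc n) (Suc (Suc m)) x) = \<ominus>\<^bsub>Ob n\<^esub> signed (Ob n) (Suc m) ?u"
    unfolding P2 using Suc P1c f2 d.closed[OF y] by (simp add: p.signed pf2)
  also have "face Z (Suc n) (Suc m) (psum (Suc n) (Suc (Suc m)) x) = ?u"
    unfolding P2 P1 using f1 f2 y d.closed[OF y] d.closed[OF f1]
    by (simp add: d.signed e On.r_neg1)
  also have "signed (Ob n) (Suc m) ?u \<oplus>\<^bsub>Ob n\<^esub> \<ominus>\<^bsub>Ob n\<^esub> signed (Ob n) (Suc m) ?u = \<zero>\<^bsub>Ob n\<^esub>"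
    using d.closed[OF y] by (simp add: On.r_neg)
  finally show ?case .
qed

lemma b_b: "x \<in> carrier (Ob (Suc (Suc n))) \<Longrightarrow> b (Suc n) (b (Suc (Suc n)) x) = \<zero>\<^bsub>Ob n\<^esub>"
  unfolding b_psum by (rule psum_psum) simp_all

lemma b'_b': "x \<in> carrier (Ob (Suc (Suc n))) \<Longrightarrow> b' (Suc n) (b' (Suc (Suc n)) x) = \<zero>\<^bsub>Ob n\<^esub>"
  unfolding b'_psum by (rule psum_psum) simp_all

lemma b_lin: "b (Suc n) \<in> linear_maps K (Ob (Suc n)) (Ob n)"
  using psum_lin[of "Suc n" n] by (simp add: b_psum[abs_def])

lemma b'_lin: "b' (Suc n) \<in> linear_maps K (Ob (Suc n)) (Ob n)"
  using psum_lin[of n n] by (simp add: b'_psum[abs_def])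

lemma t_lin: "t n \<in> linear_maps K (Ob n) (Ob n)"
  unfolding signed_cyc_def[abs_def] by (rule linear_comp[OF cyc_lin signed_linear[OF mod]])

lemma N_lin: "N n \<in> linear_maps K (Ob n) (Ob n)"
  unfolding cyclic_norm_def[abs_def] by (rule linear_finsum[OF mod finite_atMost linear_funpow[OF t_lin]])

lemmas t_closed = linear_closed[OF t_lin]
lemmas tp_closed = linear_closed[OF linear_funpow[OF t_lin]]
lemmas N_closed = linear_closed[OF N_lin]
lemmas b_closed = linear_closed[OF b_lin]
lemmas b'_closed = linear_closed[OF b'_lin]

lemma t_power: assumes x: "x \<in> carrier (Ob n)" shows "(t n ^^ Suc n) x = x"
proof -
  interpret On: plain_module K "Ob n" by (rule plain_module.intro, rule mod)
  interpret c: plain_linear_map K "Ob n" "Ob n" "cyc Z n" by (rule plain_linear_mapI[OF mod mod cyc_lin])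
  have cp: "(cyc Z n ^^ k) x \<in> carrier (Ob n)" for k
    by (rule linear_closed[OF linear_funpow[OF cyc_lin] x])
  have "(t n ^^ k) x = signed (Ob n) (n * k) ((cyc Z n ^^ k) x)" for k
  proof (induction k)
    case (Suc k)
    then show ?case using cp[of k] by (simp add: signed_cyc_def c.signed On.signed_signed)
  qed simp
  from this[of "Suc n"] cyc_power[OF x] show ?thesis by (simp add: signed_def)
qed

lemma D_t: assumes x: "x \<in> carrier (Ob (Suc n))" and i: "i \<le> n"
  shows "D n (Suc i) (t (Suc n) x) = t n (D n i x)"
proof -
  interpret On: plain_module K "Ob n" by (rule plain_module.intro, rule mod)
  interpret O1: plain_module K "Ob (Suc n)" by (rule plain_module.intro, rule mod)
  interpret c: plain_linear_map K "Ob n" "Ob n" "cyc Z n" by (rule plain_linear_mapI[OF mod mod cyc_lin])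
  interpret d: plain_linear_map K "Ob (Suc n)" "Ob n" "face Z (Suc n) (Suc i)" by (rule plain_linear_mapI[OF mod mod face_lin]) (use i in simp)
  have f: "face Z (Suc n) i x \<in> carrier (Ob n)" by (rule linear_closed[OF face_lin x]) (use i in simp)
  have cx: "cyc Z (Suc n) x \<in> carrier (Ob (Suc n))" by (rule linear_closed[OF cyc_lin x])
  show ?thesis
    using f cx by (simp add: D_def signed_cyc_def d.signed c.signed face_cyc x i On.signed_signed) (simp add: signed_def)
qed

lemma D_tp: "x \<in> carrier (Ob (Suc n)) \<Longrightarrow> i \<le> Suc n \<Longrightarrow> D n i ((t (Suc n) ^^ i) x) = (t n ^^ i) (D n 0 x)"
proof (induction i)
  case (Suc i)
  then show ?case using D_t[OF tp_closed[OF Suc.prems(1)], of i i] by simp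
qed simp

text \<open>
  The relation \<open>b (1 - t) = (1 - t) b'\<close>: the operator \<open>t\<close> shifts the signed faces by one, and the face that is
  left over, \<open>D 0 t\<close>, is the last one.
\<close>

lemma b_t: assumes x: "x \<in> carrier (Ob (Suc n))"
  shows "b (Suc n) (x \<ominus>\<^bsub>Ob (Suc n)\<^esub> t (Suc n) x) = b' (Suc n) x \<ominus>\<^bsub>Ob n\<^esub> t n (b' (Suc n) x)"
proof -
  interpret On: plain_module K "Ob n" by (rule plain_module.intro, rule mod)
  interpret O1: plain_module K "Ob (Suc n)" by (rule plain_module.intro, rule mod)
  interpret b: plain_linear_map K "Ob (Suc n)" "Ob n" "b (Suc n)" by (rule plain_linear_mapI[OF mod mod b_lin])
  interpret tn: plain_linear_map K "Ob n" "Ob n" "t n" by (rule plain_linear_mapI[OF mod mod t_lin])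
  interpret d: plain_linear_map K "Ob (Suc n)" "Ob n" "face Z (Suc n) 0" by (rule plain_linear_mapI[OF mod mod face_lin]) simp
  have cx: "cyc Z (Suc n) x \<in> carrier (Ob (Suc n))" by (rule linear_closed[OF cyc_lin x])
  have D0: "D n 0 (t (Suc n) x) = D n (Suc n) x"
    using cx by (simp add: D_def signed_cyc_def d.signed face_cyc_0 x)
  have "b (Suc n) (t (Suc n) x) = (\<Oplus>\<^bsub>Ob n\<^esub>i\<in>{..n}. D n (Suc i) (t (Suc n) x)) \<oplus>\<^bsub>Ob n\<^esub> D n 0 (t (Suc n) x)"
    unfolding b_psum by (rule psum_Suc2) (simp_all add: x t_closed)
  also have "(\<Oplus>\<^bsub>Ob n\<^esub>i\<in>{..n}. D n (Suc i) (t (Suc n) x)) = (\<Oplus>\<^bsub>Ob n\<^esub>i\<in>{..n}. t n (D n i x))"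
    by (rule On.finsum_cong'[OF refl]) (auto simp: D_t x intro!: t_closed D_closed)
  also have "\<dots> = t n (b' (Suc n) x)"
    unfolding b'_psum psum_def by (rule tn.finsum[symmetric]) (auto intro!: D_closed x)
  finally have bt: "b (Suc n) (t (Suc n) x) = t n (b' (Suc n) x) \<oplus>\<^bsub>Ob n\<^esub> D n (Suc n) x" by (simp only: D0)
  have bx: "b (Suc n) x = D n (Suc n) x \<oplus>\<^bsub>Ob n\<^esub> b' (Suc n) x"
    unfolding b_psum b'_psum by (rule psum_Suc[OF _ x]) simp
  have c: "D n (Suc n) x \<in> carrier (Ob n)" "b' (Suc n) x \<in> carrier (Ob n)" by (simp_all add: D_closed b'_closed x)
  then show ?thesis
    using x t_closed[OF x] t_closed[OF c(2)]
    by (simp add: bx bt a_minus_def On.minus_add On.a_ac On.r_neg1 On.r_neg2 On.r_neg)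
qed

lemma N_t: assumes x: "x \<in> carrier (Ob n)" shows "N n (t n x) = N n x" "t n (N n x) = N n x"
proof -
  interpret On: plain_module K "Ob n" by (rule plain_module.intro, rule mod)
  interpret tn: plain_linear_map K "Ob n" "Ob n" "t n" by (rule plain_linear_mapI[OF mod mod t_lin])
  note tp = tp_closed[OF x]
  let ?S = "finsum (Ob n) (\<lambda>j. (t n ^^ Suc j) x) {..n}"
  have S: "?S \<in> carrier (Ob n)" using tp by (intro On.finsum_closed) (auto simp del: funpow.simps)
  have "finsum (Ob n) (\<lambda>j. (t n ^^ j) x) {..Suc n} = ?S \<oplus>\<^bsub>Ob n\<^esub> (t n ^^ 0) x"
    by (rule On.finsum_Suc2) (use tp in auto)
  moreover have "finsum (Ob n) (\<lambda>j. (t n ^^ j) x) {..Suc n} = (t n ^^ Suc n) x \<oplus>\<^bsub>Ob n\<^esub> N n x"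
    unfolding cyclic_norm_def by (rule On.finsum_Suc) (use tp in auto)
  ultimately have S': "?S = N n x"
    using S x N_closed[OF x] by (simp add: t_power On.a_comm del: funpow.simps)
  have "N n (t n x) = ?S"
    unfolding cyclic_norm_def by (simp only: funpow_Suc_right comp_def)
  then show "N n (t n x) = N n x" using S' by simp
  have "t n (N n x) = ?S"
    unfolding cyclic_norm_def using tn.finsum[of "\<lambda>j. (t n ^^ j) x" "{..n}"] tp by simp
  then show "t n (N n x) = N n x" using S' by simp
qed

lemma N_tp: "x \<in> carrier (Ob n) \<Longrightarrow> N n ((t n ^^ k) x) = N n x"
proof (induction k)
  case (Suc k)
  then show ?case using N_t(1)[OF tp_closed[OF Suc.prems]] by simp
qed simp

lemma tp_N: "x \<in> carrier (Ob n) \<Longrightarrow> (t n ^^ k) (N n x) = N n x"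
  by (induction k) (simp_all add: N_t)

text \<open>
  The relation \<open>N b = b' N\<close>. Every signed face is \<open>D i = t\<^sup>i (D 0) t\<^sup>-\<^sup>i\<close>, and \<open>N\<close> absorbs powers of \<open>t\<close> on both
  sides, so both sides equal \<open>N (D 0) N\<close>.
\<close>

lemma N_b: assumes x: "x \<in> carrier (Ob (Suc n))"
  shows "N n (b (Suc n) x) = b' (Suc n) (N (Suc n) x)"
proof -
  interpret On: plain_module K "Ob n" by (rule plain_module.intro, rule mod)
  interpret O1: plain_module K "Ob (Suc n)" by (rule plain_module.intro, rule mod)
  interpret Nn: plain_linear_map K "Ob n" "Ob n" "N n" by (rule plain_linear_mapI[OF mod mod N_lin])
  interpret ND: plain_linear_map K "Ob (Suc n)" "Ob n" "\<lambda>y. N n (D n 0 y)"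
    by (rule plain_linear_mapI[OF mod mod linear_comp[OF D_lin N_lin]]) simp
  note tp = tp_closed[OF x]
  have "N n (b (Suc n) x) = (\<Oplus>\<^bsub>Ob n\<^esub>i\<in>{..Suc n}. N n (D n i x))"
    unfolding b_psum psum_def by (rule Nn.finsum) (auto intro!: D_closed x)
  \<comment> \<open>the inverse of \<open>t\<^sup>i\<close> is written as \<open>t\<^sup>n\<^sup>+\<^sup>1\<^sup>-\<^sup>i t\<close>, as \<open>t\<^sup>n\<^sup>+\<^sup>2 = 1\<close>\<close>
  also have "\<dots> = (\<Oplus>\<^bsub>Ob n\<^esub>i\<in>{..Suc n}. N n (D n 0 ((t (Suc n) ^^ (Suc n - i)) (t (Suc n) x))))"
  proof (rule On.finsum_cong'[OF refl])
    show "(\<lambda>i. N n (D n 0 ((t (Suc n) ^^ (Suc n - i)) (t (Suc n) x)))) \<in> {..Suc n} \<rightarrow> carrier (Ob n)"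
      by (intro funcsetI ND.closed tp_closed t_closed x)
    fix i assume "i \<in> {..Suc n}"
    then have i: "i \<le> Suc n" by simp
    let ?y = "(t (Suc n) ^^ (Suc n - i)) (t (Suc n) x)"
    have y: "?y \<in> carrier (Ob (Suc n))" by (intro tp_closed t_closed x)
    have "(t (Suc n) ^^ i) ?y = (t (Suc n) ^^ (i + (Suc n - i))) (t (Suc n) x)"
      by (simp only: funpow_add comp_def)
    also have "\<dots> = (t (Suc n) ^^ Suc (Suc n)) x"
      using i by (simp only: le_add_diff_inverse funpow_Suc_right comp_def)
    also have "\<dots> = x" by (rule t_power[OF x])
    finally have "D n i x = (t n ^^ i) (D n 0 ?y)" using D_tp[OF y i] by simp
    then show "N n (D n i x) = N n (D n 0 ?y)"
      using N_tp[OF D_closed[OF _ y]] by simp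
  qed
  also have "\<dots> = N n (D n 0 (\<Oplus>\<^bsub>Ob (Suc n)\<^esub>i\<in>{..Suc n}. (t (Suc n) ^^ (Suc n - i)) (t (Suc n) x)))"
    by (rule ND.finsum[symmetric]) (intro funcsetI tp_closed t_closed x)
  also have "(\<Oplus>\<^bsub>Ob (Suc n)\<^esub>i\<in>{..Suc n}. (t (Suc n) ^^ (Suc n - i)) (t (Suc n) x)) = N (Suc n) (t (Suc n) x)"
    unfolding cyclic_norm_def by (rule O1.finsum_reverse[symmetric]) (intro tp_closed t_closed x)
  also have "\<dots> = N (Suc n) x" by (rule N_t(1)[OF x])
  also have "N n (D n 0 (N (Suc n) x)) = (\<Oplus>\<^bsub>Ob n\<^esub>i\<in>{..n}. D n i (N (Suc n) x))"
    unfolding cyclic_norm_def[of Z n]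
  proof (rule On.finsum_cong'[OF refl])
    show "(\<lambda>i. D n i (N (Suc n) x)) \<in> {..n} \<rightarrow> carrier (Ob n)" by (auto intro!: D_closed N_closed x)
    fix i assume "i \<in> {..n}"
    then show "(t n ^^ i) (D n 0 (N (Suc n) x)) = D n i (N (Suc n) x)"
      using D_tp[OF N_closed[OF x], of i] tp_N[OF x, of i] by simp
  qed
  also have "\<dots> = b' (Suc n) (N (Suc n) x)" by (simp add: b'_psum psum_def)
  finally show ?thesis .
qed

subsection \<open>The total complex\<close>

abbreviation v where "v p q \<equiv> tsygan_vertical Z p q"
abbreviation h where "h p q \<equiv> tsygan_horizontal Z p q"
abbreviation Tot where "Tot n \<equiv> tsygan_total Z n"
abbreviation d where "d n \<equiv> tsygan_differential Z n"

lemma v_lin: "v p (Suc q) \<in> linear_maps K (Ob (Suc q)) (Ob q)"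
  using b_lin linear_uminus[OF mod b'_lin] by (cases "even p") (simp_all add: tsygan_vertical_def[abs_def])

lemma h_lin: "h p q \<in> linear_maps K (Ob q) (Ob q)"
  using N_lin linear_minus[OF mod linear_id t_lin]
  by (cases "even p") (simp_all add: tsygan_horizontal_def[abs_def])

lemmas v_closed = linear_closed[OF v_lin]
lemmas h_closed = linear_closed[OF h_lin]

lemma v_v: assumes x: "x \<in> carrier (Ob (Suc (Suc q)))" shows "v p (Suc q) (v p (Suc (Suc q)) x) = \<zero>\<^bsub>Ob q\<^esub>"
proof -
  interpret Oq: plain_module K "Ob q" by (rule plain_module.intro, rule mod)
  interpret b': plain_linear_map K "Ob (Suc q)" "Ob q" "b' (Suc q)" by (rule plain_linear_mapI[OF mod mod b'_lin])
  show ?thesis using x by (simp add: tsygan_vertical_def b_b b'_b' b'_closed)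
qed

lemma h_h: assumes x: "x \<in> carrier (Ob q)" shows "h p q (h (Suc p) q x) = \<zero>\<^bsub>Ob q\<^esub>"
proof -
  interpret Oq: plain_module K "Ob q" by (rule plain_module.intro, rule mod)
  interpret Nq: plain_linear_map K "Ob q" "Ob q" "N q" by (rule plain_linear_mapI[OF mod mod N_lin])
  show ?thesis using x by (simp add: tsygan_horizontal_def N_t t_closed N_closed)
qed

lemma v_h: assumes x: "x \<in> carrier (Ob (Suc q))"
  shows "v p (Suc q) (h (Suc p) (Suc q) x) \<oplus>\<^bsub>Ob q\<^esub> h (Suc p) q (v (Suc p) (Suc q) x) = \<zero>\<^bsub>Ob q\<^esub>"
proof -
  interpret Oq: plain_module K "Ob q" by (rule plain_module.intro, rule mod)
  interpret tq: plain_linear_map K "Ob q" "Ob q" "t q" by (rule plain_linear_mapI[OF mod mod t_lin])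
  note c = b'_closed[OF x] t_closed[OF b'_closed[OF x]] b_closed[OF x] N_closed[OF b_closed[OF x]]
  show ?thesis
  proof (cases "even p")
    case True
    then show ?thesis
      using x c by (simp add: tsygan_horizontal_def tsygan_vertical_def b_t)
        (simp add: a_minus_def Oq.minus_add Oq.a_ac Oq.r_neg1 Oq.r_neg2 Oq.r_neg Oq.l_neg)
  next
    case False
    then show ?thesis
      using x c by (simp add: tsygan_horizontal_def tsygan_vertical_def N_b[symmetric] Oq.l_neg)
  qed
qed

lemma Tot_carrier: "f \<in> carrier (Tot n) \<longleftrightarrow> f \<in> extensional {..n} \<and> (\<forall>p\<le>n. f p \<in> carrier (Ob (n - p)))"
  by (auto simp: tsygan_total_def direct_sum_carrier_finite)

lemma Tot_module: "module K (Tot n)"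
  unfolding tsygan_total_def by (rule direct_sum_module[OF cring_axioms mod])

lemma d_apply: "p \<le> n \<Longrightarrow> d (Suc n) f p = v p (Suc (n - p)) (f p) \<oplus>\<^bsub>Ob (n - p)\<^esub> h (Suc p) (n - p) (f (Suc p))"
  by (simp add: tsygan_differential_def Suc_diff_le)

lemma Tot_comp: "f \<in> carrier (Tot (Suc n)) \<Longrightarrow> p \<le> n \<Longrightarrow> f p \<in> carrier (Ob (Suc (n - p)))"
  "f \<in> carrier (Tot (Suc n)) \<Longrightarrow> p \<le> n \<Longrightarrow> f (Suc p) \<in> carrier (Ob (n - p))"
  by (auto simp: Tot_carrier Suc_diff_le dest: spec[of _ p] spec[of _ "Suc p"])

lemma d_closed: assumes f: "f \<in> carrier (Tot (Suc n))" shows "d (Suc n) f \<in> carrier (Tot n)"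
  unfolding Tot_carrier
proof (intro conjI allI impI)
  show "d (Suc n) f \<in> extensional {..n}" by (simp add: tsygan_differential_def)
  fix p assume p: "p \<le> n"
  interpret Op: plain_module K "Ob (n - p)" by (rule plain_module.intro, rule mod)
  show "d (Suc n) f p \<in> carrier (Ob (n - p))"
    using Tot_comp[OF f p] by (simp add: d_apply p v_closed h_closed)
qed

lemma Tot_eqI: "f \<in> carrier (Tot n) \<Longrightarrow> g \<in> carrier (Tot n) \<Longrightarrow> (\<And>p. p \<le> n \<Longrightarrow> f p = g p) \<Longrightarrow> f = g"
  by (rule extensionalityI[of _ "{..n}"]) (auto simp: Tot_carrier)

lemma Tot_simps: "p \<le> n \<Longrightarrow> (f \<oplus>\<^bsub>Tot n\<^esub> g) p = f p \<oplus>\<^bsub>Ob (n - p)\<^esub> g p"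
  "p \<le> n \<Longrightarrow> (a \<odot>\<^bsub>Tot n\<^esub> g) p = a \<odot>\<^bsub>Ob (n - p)\<^esub> g p"
  "p \<le> n \<Longrightarrow> \<zero>\<^bsub>Tot n\<^esub> p = \<zero>\<^bsub>Ob (n - p)\<^esub>"
  by (simp_all add: tsygan_total_def)

lemma d_lin: "d (Suc n) \<in> linear_maps K (Tot (Suc n)) (Tot n)"
proof (rule linear_mapsI)
  interpret T1: module K "Tot (Suc n)" by (rule Tot_module)
  interpret T0: module K "Tot n" by (rule Tot_module)
  show "d (Suc n) f \<in> carrier (Tot n)" if "f \<in> carrier (Tot (Suc n))" for f by (rule d_closed[OF that])
  fix f assume f: "f \<in> carrier (Tot (Suc n))"
  show "d (Suc n) (f \<oplus>\<^bsub>Tot (Suc n)\<^esub> g) = d (Suc n) f \<oplus>\<^bsub>Tot n\<^esub> d (Suc n) g" if g: "g \<in> carrier (Tot (Suc n))" for g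
  proof (rule Tot_eqI[OF d_closed])
    show "f \<oplus>\<^bsub>Tot (Suc n)\<^esub> g \<in> carrier (Tot (Suc n))" using f g by (rule T1.a_closed)
    show "d (Suc n) f \<oplus>\<^bsub>Tot n\<^esub> d (Suc n) g \<in> carrier (Tot n)" by (intro T0.a_closed d_closed f g)
    fix p assume p: "p \<le> n"
    interpret Op: plain_module K "Ob (n - p)" by (rule plain_module.intro, rule mod)
    note c = Tot_comp[OF f p] Tot_comp[OF g p]
    show "d (Suc n) (f \<oplus>\<^bsub>Tot (Suc n)\<^esub> g) p = (d (Suc n) f \<oplus>\<^bsub>Tot n\<^esub> d (Suc n) g) p"
      using p c v_closed[OF c(1)] v_closed[OF c(3)] h_closed[OF c(2)] h_closed[OF c(4)]
        linear_add[OF v_lin c(1,3)] linear_add[OF h_lin c(2,4)]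
      by (simp add: d_apply Tot_simps Suc_diff_le Op.a_ac)
  qed
  show "d (Suc n) (a \<odot>\<^bsub>Tot (Suc n)\<^esub> f) = a \<odot>\<^bsub>Tot n\<^esub> d (Suc n) f" if a: "a \<in> carrier K" for a
  proof (rule Tot_eqI[OF d_closed])
    show "a \<odot>\<^bsub>Tot (Suc n)\<^esub> f \<in> carrier (Tot (Suc n))" using f a by simp
    show "a \<odot>\<^bsub>Tot n\<^esub> d (Suc n) f \<in> carrier (Tot n)" by (intro T0.smult_closed d_closed f a)
    fix p assume p: "p \<le> n"
    interpret Op: plain_module K "Ob (n - p)" by (rule plain_module.intro, rule mod)
    note c = Tot_comp[OF f p]
    show "d (Suc n) (a \<odot>\<^bsub>Tot (Suc n)\<^esub> f) p = (a \<odot>\<^bsub>Tot n\<^esub> d (Suc n) f) p"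
      using p c v_closed[OF c(1)] h_closed[OF c(2)] a
        linear_smult[OF v_lin a c(1)] linear_smult[OF h_lin a c(2)]
      by (simp add: d_apply Tot_simps Suc_diff_le Op.smult_r_distr)
  qed
qed

lemma d_d: assumes f: "f \<in> carrier (Tot (Suc (Suc n)))" shows "d (Suc n) (d (Suc (Suc n)) f) = \<zero>\<^bsub>Tot n\<^esub>"
proof (rule Tot_eqI)
  interpret T0: module K "Tot n" by (rule Tot_module)
  show "d (Suc n) (d (Suc (Suc n)) f) \<in> carrier (Tot n)" by (intro d_closed f)
  show "\<zero>\<^bsub>Tot n\<^esub> \<in> carrier (Tot n)" by simp
  fix p assume p: "p \<le> n"
  define q where "q = n - p"
  have q: "Suc n - p = Suc q" "n - p = q" "Suc n - Suc p = q" using p by (auto simp: q_def)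
  interpret Oq: plain_module K "Ob q" by (rule plain_module.intro, rule mod)
  interpret O1: plain_module K "Ob (Suc q)" by (rule plain_module.intro, rule mod)
  interpret v0: plain_linear_map K "Ob (Suc q)" "Ob q" "v p (Suc q)" by (rule plain_linear_mapI[OF mod mod v_lin])
  interpret h0: plain_linear_map K "Ob q" "Ob q" "h (Suc p) q" by (rule plain_linear_mapI[OF mod mod h_lin])
  have c: "f p \<in> carrier (Ob (Suc (Suc q)))" "f (Suc p) \<in> carrier (Ob (Suc q))" "f (Suc (Suc p)) \<in> carrier (Ob q)"
    using Tot_comp(1)[OF f, of p] Tot_comp(1)[OF f, of "Suc p"] Tot_comp(2)[OF f, of "Suc p"] p q by simp_all
  note cc = v_closed[OF c(1)] v_closed[OF c(2)] h_closed[OF c(2)] h_closed[OF c(3)]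
  have "d (Suc n) (d (Suc (Suc n)) f) p =
      v p (Suc q) (h (Suc p) (Suc q) (f (Suc p))) \<oplus>\<^bsub>Ob q\<^esub> h (Suc p) q (v (Suc p) (Suc q) (f (Suc p)))"
    using p c cc by (simp add: d_apply q v_v h_h)
  then show "d (Suc n) (d (Suc (Suc n)) f) p = \<zero>\<^bsub>Tot n\<^esub> p"
    using p by (simp add: v_h[OF c(2)] Tot_simps q)
qed

end

text \<open>
  The operator \<open>s\<close> is an extra degeneracy, which contracts the underlying semi-simplicial module onto the
  augmentation \<open>a\<close>; the element \<open>u\<close> spans a section of \<open>a\<close>.
  The module \<open>A\<close> is the ground ring as a module over itself, in an arbitrary record type so that a right module
  structure may be present.
\<close>

locale contractible_cyclic_module = cyclic_module K Z for K :: "'k ring" and Z :: "('k, 'v) cyclic_object" +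
  fixes s :: "nat \<Rightarrow> 'v \<Rightarrow> 'v" and A :: "('k, 'k, 'c) module_scheme" and a :: "'v \<Rightarrow> 'k" and u :: 'v
  assumes s_lin: "s n \<in> linear_maps K (obj Z n) (obj Z (Suc n))"
    and face_0_s: "x \<in> carrier (obj Z n) \<Longrightarrow> face Z (Suc n) 0 (s n x) = x"
    and face_Suc_s: "x \<in> carrier (obj Z (Suc n)) \<Longrightarrow> i \<le> Suc n \<Longrightarrow>
      face Z (Suc (Suc n)) (Suc i) (s (Suc n) x) = s n (face Z (Suc n) i x)"
    and face_1_s: "x \<in> carrier (obj Z 0) \<Longrightarrow> face Z (Suc 0) (Suc 0) (s 0 x) = a x \<odot>\<^bsub>obj Z 0\<^esub> u"
    and A: "module K A" "carrier A = carrier K" "\<zero>\<^bsub>A\<^esub> = \<zero>\<^bsub>K\<^esub>" "\<And>x y. x \<odot>\<^bsub>A\<^esub> y = x \<otimes>\<^bsub>K\<^esub> y"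
    and a_lin: "a \<in> linear_maps K (obj Z 0) A"
    and a_face: "x \<in> carrier (obj Z (Suc 0)) \<Longrightarrow> a (face Z (Suc 0) 0 x) = a (face Z (Suc 0) (Suc 0) x)"
    and u: "u \<in> carrier (obj Z 0)" "a u = \<one>\<^bsub>K\<^esub>"
begin

lemmas s_closed = linear_closed[OF s_lin]

text \<open>
  The contraction identity \<open>d s + s d = 1\<close>, for \<open>b\<close> and \<open>b'\<close> at once.
\<close>

lemma psum_s: assumes x: "x \<in> carrier (Ob (Suc n))" and m: "m \<le> Suc n"
  shows "psum (Suc n) (Suc m) (s (Suc n) x) = x \<ominus>\<^bsub>Ob (Suc n)\<^esub> s n (psum n m x)"
proof -
  interpret O0: plain_module K "Ob n" by (rule plain_module.intro, rule mod)
  interpret O1: plain_module K "Ob (Suc n)" by (rule plain_module.intro, rule mod)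
  interpret sn: plain_linear_map K "Ob n" "Ob (Suc n)" "\<lambda>y. \<ominus>\<^bsub>Ob (Suc n)\<^esub> s n y"
    by (rule plain_linear_mapI[OF mod mod linear_uminus[OF mod s_lin]])
  interpret s': plain_linear_map K "Ob n" "Ob (Suc n)" "s n" by (rule plain_linear_mapI[OF mod mod s_lin])
  have fx: "face Z (Suc n) i x \<in> carrier (Ob n)" if "i \<le> m" for i
    by (rule linear_closed[OF face_lin x]) (use that m in simp)
  have "psum (Suc n) (Suc m) (s (Suc n) x) =
      (\<Oplus>\<^bsub>Ob (Suc n)\<^esub>i\<in>{..m}. D (Suc n) (Suc i) (s (Suc n) x)) \<oplus>\<^bsub>Ob (Suc n)\<^esub> D (Suc n) 0 (s (Suc n) x)"
    by (rule psum_Suc2[OF m s_closed[OF x]])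
  also have "(\<Oplus>\<^bsub>Ob (Suc n)\<^esub>i\<in>{..m}. D (Suc n) (Suc i) (s (Suc n) x)) = (\<Oplus>\<^bsub>Ob (Suc n)\<^esub>i\<in>{..m}. \<ominus>\<^bsub>Ob (Suc n)\<^esub> s n (D n i x))"
  proof (rule O1.finsum_cong'[OF refl])
    show "(\<lambda>i. \<ominus>\<^bsub>Ob (Suc n)\<^esub> s n (D n i x)) \<in> {..m} \<rightarrow> carrier (Ob (Suc n))"
      using fx by (auto simp: D_def)
    fix i assume "i \<in> {..m}"
    then show "D (Suc n) (Suc i) (s (Suc n) x) = \<ominus>\<^bsub>Ob (Suc n)\<^esub> s n (D n i x)"
      using fx[of i] m by (simp add: D_def face_Suc_s[OF x] s'.signed O1.signed_Suc)
  qed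
  also have "\<dots> = \<ominus>\<^bsub>Ob (Suc n)\<^esub> s n (psum n m x)"
    unfolding psum_def by (rule sn.finsum[symmetric]) (use fx in \<open>auto simp: D_def\<close>)
  also have "D (Suc n) 0 (s (Suc n) x) = x" by (simp add: D_def face_0_s[OF x])
  finally show ?thesis
    using x psum_closed[OF m x] by (simp add: a_minus_def O1.a_comm)
qed

text \<open>
  Above the bottom row \<open>s\<close> contracts even and odd columns alike, although their differentials differ by the
  last face.
\<close>

lemma column_exact:
  assumes x: "x \<in> carrier (Ob (Suc q))" and vx: "v p (Suc q) x = \<zero>\<^bsub>Ob q\<^esub>"
  shows "\<exists>y \<in> carrier (Ob (Suc (Suc q))). v p (Suc (Suc q)) y = x"
proof -
  interpret O0: plain_module K "Ob q" by (rule plain_module.intro, rule mod)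
  interpret O1: plain_module K "Ob (Suc q)" by (rule plain_module.intro, rule mod)
  interpret O2: plain_module K "Ob (Suc (Suc q))" by (rule plain_module.intro, rule mod)
  interpret s0: plain_linear_map K "Ob q" "Ob (Suc q)" "s q" by (rule plain_linear_mapI[OF mod mod s_lin])
  interpret b': plain_linear_map K "Ob (Suc (Suc q))" "Ob (Suc q)" "b' (Suc (Suc q))" by (rule plain_linear_mapI[OF mod mod b'_lin])
  note sx = s_closed[OF x]
  show ?thesis
  proof (cases "even p")
    case True
    then have "b (Suc q) x = \<zero>\<^bsub>Ob q\<^esub>" using vx by (simp add: tsygan_vertical_def)
    then have "b (Suc (Suc q)) (s (Suc q) x) = x"
      using psum_s[OF x, of "Suc q"] x by (simp add: b_psum)
    then show ?thesis using True sx by (auto simp: tsygan_vertical_def)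
  next
    case False
    then have "\<ominus>\<^bsub>Ob q\<^esub> b' (Suc q) x = \<zero>\<^bsub>Ob q\<^esub>" using vx by (simp add: tsygan_vertical_def)
    then have "b' (Suc q) x = \<zero>\<^bsub>Ob q\<^esub>" using b'_closed[OF x] O0.minus_minus by force
    then have "b' (Suc (Suc q)) (s (Suc q) x) = x"
      using psum_s[OF x, of q] x by (simp add: b'_psum)
    then have "v p (Suc (Suc q)) (\<ominus>\<^bsub>Ob (Suc (Suc q))\<^esub> s (Suc q) x) = x"
      using False sx x by (simp add: tsygan_vertical_def)
    then show ?thesis using sx by blast
  qed
qed

text \<open>
  In the bottom row only \<open>b\<close> involves the face that \<open>s\<close> turns into the augmentation. Hence the odd columns
  are exact there as well, and the even ones up to the augmentation.
\<close>

lemma column_exact_0: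
  assumes x: "x \<in> carrier (Ob 0)" and ax: "even p \<Longrightarrow> a x = \<zero>\<^bsub>K\<^esub>"
  shows "\<exists>y \<in> carrier (Ob (Suc 0)). v p (Suc 0) y = x"
proof -
  interpret O0: plain_module K "Ob 0" by (rule plain_module.intro, rule mod)
  interpret O1: plain_module K "Ob (Suc 0)" by (rule plain_module.intro, rule mod)
  interpret b': plain_linear_map K "Ob (Suc 0)" "Ob 0" "b' (Suc 0)" by (rule plain_linear_mapI[OF mod mod b'_lin])
  note sx = s_closed[OF x]
  have f0: "D 0 0 (s 0 x) = x" by (simp add: D_def face_0_s[OF x])
  have b's: "b' (Suc 0) (s 0 x) = x"
    using f0 x by (simp add: b'_psum psum_def O0.finsum_insert)
  show ?thesis
  proof (cases "even p")
    case True
    have "b (Suc 0) (s 0 x) = D 0 (Suc 0) (s 0 x) \<oplus>\<^bsub>Ob 0\<^esub> psum 0 0 (s 0 x)"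
      unfolding b_psum by (rule psum_Suc[OF _ sx]) simp
    also have "\<dots> = x"
      using b's x u ax[OF True] by (simp add: b'_psum D_def face_1_s[OF x] O0.signed_Suc)
    finally show ?thesis using True sx by (auto simp: tsygan_vertical_def)
  next
    case False
    then have "v p (Suc 0) (\<ominus>\<^bsub>Ob (Suc 0)\<^esub> s 0 x) = x"
      using sx x b's by (simp add: tsygan_vertical_def)
    then show ?thesis using sx by blast
  qed
qed

text \<open>
  The homology of the total complex comes from the bottom entries of the even columns; column \<open>n\<close> meets the
  total degree \<open>n\<close> in its bottom entry.
\<close>

definition phi :: "nat \<Rightarrow> (nat \<Rightarrow> 'v) \<Rightarrow> 'k" where
  "phi n f = (if even n then a (f n) else \<zero>\<^bsub>K\<^esub>)"

lemma phi_lin: "phi n \<in> linear_maps K (Tot n) A"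
proof -
  interpret A: module K A by (rule A)
  show ?thesis
  proof (cases "even n")
    case True
    then show ?thesis
      by (intro linear_mapsI)
        (auto simp: phi_def[abs_def] Tot_simps Tot_carrier linear_add[OF a_lin] linear_smult[OF a_lin]
          intro!: linear_closed[OF a_lin] dest!: spec[of _ n])
  next
    case False
    then show ?thesis using linear_zero[OF A(1)] by (simp add: phi_def[abs_def] A)
  qed
qed

lemma phi_d: assumes f: "f \<in> carrier (Tot (Suc n))" shows "phi n (d (Suc n) f) = \<zero>\<^bsub>K\<^esub>"
proof (cases "even n")
  case True
  interpret A: module K A by (rule A)
  interpret O0: plain_module K "Ob 0" by (rule plain_module.intro, rule mod)
  interpret a: linear_map K "Ob 0" A a by (rule linear_mapI[OF mod A(1) a_lin])
  have c: "f n \<in> carrier (Ob (Suc 0))" "f (Suc n) \<in> carrier (Ob 0)"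
    using Tot_comp[OF f, of n] by simp_all
  have fc: "face Z (Suc 0) i (f n) \<in> carrier (Ob 0)" if "i \<le> Suc 0" for i
    by (rule linear_closed[OF face_lin c(1)]) (use that in simp)
  have h: "h (Suc n) 0 (f (Suc n)) = \<zero>\<^bsub>Ob 0\<^esub>"
    using True c cyc_power[OF c(2)] by (simp add: tsygan_horizontal_def signed_cyc_def)
  have "a (b (Suc 0) (f n)) = a (D 0 (Suc 0) (f n) \<oplus>\<^bsub>Ob 0\<^esub> psum 0 0 (f n))"
    unfolding b_psum by (subst psum_Suc[OF _ c(1)]) simp_all
  also have "\<dots> = \<zero>\<^bsub>A\<^esub>"
    using fc a_face[OF c(1)] by (simp add: psum_def D_def O0.finsum_insert O0.signed_Suc A.l_neg)
  finally show ?thesis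
    using True c b_closed[OF c(1)] by (simp add: phi_def d_apply h tsygan_vertical_def A)
qed (simp add: phi_def)

text \<open>
  The preimage \<open>w\<close> is built one column at a time, from column \<open>n + 1\<close> down to column \<open>0\<close>. In column \<open>p\<close> its entry has
  to solve \<open>v (w p) = z p - h (w (p + 1))\<close>, and the right-hand side is a vertical cycle because the
  two differentials anticommute and the equation for column \<open>p + 1\<close> already holds. Exactness of the columns
  provides the solution.
\<close>

theorem Tot_exact:
  assumes z: "z \<in> carrier (Tot n)" and dz: "n > 0 \<Longrightarrow> d n z = \<zero>\<^bsub>Tot (n - 1)\<^esub>"
    and phiz: "phi n z = \<zero>\<^bsub>K\<^esub>" and c: "c \<in> carrier K" and c0: "odd (Suc n) \<Longrightarrow> c = \<zero>\<^bsub>K\<^esub>"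
  shows "\<exists>w \<in> carrier (Tot (Suc n)). d (Suc n) w = z \<and> phi (Suc n) w = c"
proof -
  \<comment> \<open>the bottom entry of column \<open>n + 1\<close> is free, and carries the prescribed augmentation\<close>
  define e where "e = (if even (Suc n) then c \<odot>\<^bsub>Ob 0\<^esub> u else \<zero>\<^bsub>Ob 0\<^esub>)"
  interpret O0: plain_module K "Ob 0" by (rule plain_module.intro, rule mod)
  have e: "e \<in> carrier (Ob 0)" using c u by (simp add: e_def)
  have zp: "z p \<in> carrier (Ob (n - p))" if "p \<le> n" for p using z that by (simp add: Tot_carrier)
  define eqn where "eqn w p \<longleftrightarrow> v p (Suc (n - p)) (w p) \<oplus>\<^bsub>Ob (n - p)\<^esub> h (Suc p) (n - p) (w (Suc p)) = z p" for w p
  have "k \<le> Suc n \<Longrightarrow> \<exists>w. (\<forall>p. p \<le> Suc n \<and> Suc n \<le> p + k \<longrightarrow> w p \<in> carrier (Ob (Suc n - p))) \<and>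
      (\<forall>p. p \<le> n \<and> Suc n \<le> p + k \<longrightarrow> eqn w p) \<and> w (Suc n) = e" for k
  proof (induction k)
    case 0
    show ?case by (rule exI[of _ "\<lambda>_. e"]) (use e in auto)
  next
    case (Suc k)
    then obtain w where w: "\<And>p. p \<le> Suc n \<Longrightarrow> Suc n \<le> p + k \<Longrightarrow> w p \<in> carrier (Ob (Suc n - p))"
      and eq: "\<And>p. p \<le> n \<Longrightarrow> Suc n \<le> p + k \<Longrightarrow> eqn w p" and we: "w (Suc n) = e" by auto
    define p where "p = n - k"
    have p: "p \<le> n" "p + k = n" using Suc.prems by (simp_all add: p_def)
    interpret Op: plain_module K "Ob (n - p)" by (rule plain_module.intro, rule mod)
    have w1: "w (Suc p) \<in> carrier (Ob (n - p))" using w[of "Suc p"] p by simp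
    let ?r = "z p \<ominus>\<^bsub>Ob (n - p)\<^esub> h (Suc p) (n - p) (w (Suc p))"
    have r: "?r \<in> carrier (Ob (n - p))" using zp[OF p(1)] h_closed[OF w1] by simp
    have "\<exists>y \<in> carrier (Ob (Suc (n - p))). v p (Suc (n - p)) y = ?r"
    proof (cases k)
      case 0
      then have pn: "p = n" using p by simp
      have "even n \<Longrightarrow> a ?r = \<zero>\<^bsub>K\<^esub>"
      proof -
        assume n: "even n"
        interpret h0: plain_linear_map K "Ob 0" "Ob 0" "h (Suc n) 0" by (rule plain_linear_mapI[OF mod mod h_lin])
        \<comment> \<open>for even \<open>n\<close> the entry \<open>e\<close> is zero, so the obstruction is the augmentation of \<open>z\<close>\<close>
        have "?r = z n" using zp[of n] n by (simp add: pn we e_def)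
        then show ?thesis using phiz n by (simp add: phi_def)
      qed
      then show ?thesis using column_exact_0[of ?r n] r by (simp add: pn)
    next
      case (Suc l)
      then have pn: "p < n" using p by simp
      define q where "q = n - Suc p"
      have q: "n - p = Suc q" "n - Suc p = q" "Suc n - Suc (Suc p) = q" using pn by (auto simp: q_def)
      interpret Oq: plain_module K "Ob q" by (rule plain_module.intro, rule mod)
      interpret v0: plain_linear_map K "Ob (Suc q)" "Ob q" "v p (Suc q)" by (rule plain_linear_mapI[OF mod mod v_lin])
      interpret h0: plain_linear_map K "Ob q" "Ob q" "h (Suc p) q" by (rule plain_linear_mapI[OF mod mod h_lin])
      have w2: "w (Suc (Suc p)) \<in> carrier (Ob q)" using w[of "Suc (Suc p)"] p pn q Suc by simp
      have w1': "w (Suc p) \<in> carrier (Ob (Suc q))" using w1 q by simp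
      have z1: "z (Suc p) \<in> carrier (Ob q)" using zp[of "Suc p"] pn q by simp
      have z0: "z p \<in> carrier (Ob (Suc q))" using zp[of p] pn q by simp
      have "eqn w (Suc p)" using eq[of "Suc p"] pn p Suc by simp
      then have e1: "z (Suc p) = v (Suc p) (Suc q) (w (Suc p)) \<oplus>\<^bsub>Ob q\<^esub> h (Suc (Suc p)) q (w (Suc (Suc p)))"
        by (simp add: eqn_def q)
      note cl = v_closed[OF w1', of "Suc p"] h_closed[OF w2, of "Suc (Suc p)"] v_closed[OF z0, of p]
        h_closed[OF w1', of "Suc p"] v_closed[OF h_closed[OF w1'], of p "Suc p"] h_closed[OF v_closed[OF w1'], of "Suc p" "Suc p"]
      \<comment> \<open>apply \<open>h\<close> to the equation for column \<open>p + 1\<close>; the term with \<open>h h\<close> vanishes\<close>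
      have hz: "h (Suc p) q (z (Suc p)) = h (Suc p) q (v (Suc p) (Suc q) (w (Suc p)))"
        unfolding e1 using cl by (simp add: h_h[OF w2])
      obtain m where m: "n = Suc m" using pn by (cases n) auto
      then have mp: "m - p = q" "p \<le> m" using q pn by auto
      have "d (Suc m) z p = \<zero>\<^bsub>Tot m\<^esub> p" using dz m by simp
      then have "v p (Suc q) (z p) \<oplus>\<^bsub>Ob q\<^esub> h (Suc p) q (z (Suc p)) = \<zero>\<^bsub>Ob q\<^esub>"
        by (simp only: d_apply[OF mp(2)] Tot_simps(3)[OF mp(2)] mp(1))
      then have dz': "v p (Suc q) (z p) = \<ominus>\<^bsub>Ob q\<^esub> h (Suc p) q (v (Suc p) (Suc q) (w (Suc p)))"
        using cl unfolding hz by (intro Oq.minus_equality[symmetric]) auto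
      have "v p (Suc q) ?r = \<zero>\<^bsub>Ob q\<^esub>"
      proof -
        have "v p (Suc q) (h (Suc p) (Suc q) (w (Suc p))) = \<ominus>\<^bsub>Ob q\<^esub> h (Suc p) q (v (Suc p) (Suc q) (w (Suc p)))"
          using v_h[OF w1', of p] cl by (intro Oq.minus_equality[symmetric]) auto
        then show ?thesis using z0 cl by (simp add: q dz')
      qed
      then show ?thesis using column_exact[of ?r q p] r q by simp
    qed
    then obtain y where y: "y \<in> carrier (Ob (Suc (n - p)))" "v p (Suc (n - p)) y = ?r" by blast
    show ?case
    proof (intro exI[of _ "w(p := y)"] conjI allI impI)
      fix p' assume p': "p' \<le> Suc n \<and> Suc n \<le> p' + Suc k"
      show "(w(p := y)) p' \<in> carrier (Ob (Suc n - p'))"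
      proof (cases "p' = p")
        case True
        then show ?thesis using y p by (simp add: Suc_diff_le)
      next
        case False
        then show ?thesis using w[of p'] p' p by simp
      qed
    next
      fix p' assume p': "p' \<le> n \<and> Suc n \<le> p' + Suc k"
      show "eqn (w(p := y)) p'"
      proof (cases "p' = p")
        case True
        have "?r \<oplus>\<^bsub>Ob (n - p)\<^esub> h (Suc p) (n - p) (w (Suc p)) = z p"
          using zp[OF p(1)] h_closed[OF w1] by (simp add: a_minus_def Op.a_assoc Op.l_neg)
        then show ?thesis using True y by (simp add: eqn_def)
      next
        case False
        then have "p < p'" "Suc n \<le> p' + k" using p' p by auto
        then show ?thesis using eq[of p'] p' by (simp add: eqn_def)
      qed
    next
      show "(w(p := y)) (Suc n) = e" using we p by simp
    qed
  qed
  from this[of "Suc n"] obtain w where w: "\<And>p. p \<le> Suc n \<Longrightarrow> w p \<in> carrier (Ob (Suc n - p))"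
    and eq: "\<And>p. p \<le> n \<Longrightarrow> eqn w p" and we: "w (Suc n) = e" by auto
  define w' where "w' = restrict w {..Suc n}"
  have w': "w' \<in> carrier (Tot (Suc n))" using w by (simp add: Tot_carrier w'_def)
  have "d (Suc n) w' = z"
  proof (rule Tot_eqI[OF d_closed[OF w'] z])
    show "d (Suc n) w' p = z p" if "p \<le> n" for p
      using eq[OF that] that by (simp add: d_apply w'_def eqn_def)
  qed
  moreover have "phi (Suc n) w' = c"
    using we c c0 u linear_smult[OF a_lin c u(1)] by (auto simp: phi_def w'_def e_def A)
  ultimately show ?thesis using w' by blast
qed

lemma Tot_exact_0:
  assumes c: "c \<in> carrier K" shows "\<exists>w \<in> carrier (Tot 0). phi 0 w = c"
proof -
  interpret O0: plain_module K "Ob 0" by (rule plain_module.intro, rule mod)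
  have "(\<lambda>p\<in>{..0}. c \<odot>\<^bsub>Ob 0\<^esub> u) \<in> carrier (Tot 0)" using c u by (simp add: Tot_carrier)
  moreover have "phi 0 (\<lambda>p\<in>{..0}. c \<odot>\<^bsub>Ob 0\<^esub> u) = c"
    using c u linear_smult[OF a_lin c u(1)] by (simp add: phi_def A)
  ultimately show ?thesis by blast
qed

end

lemma (in tensor_powers) T_induct:
  assumes "u \<in> carrier (T n)" and "\<And>xs. xs \<in> tuples V n \<Longrightarrow> Q (pure xs)"
    and "\<And>u v. u \<in> carrier (T n) \<Longrightarrow> v \<in> carrier (T n) \<Longrightarrow> Q u \<Longrightarrow> Q v \<Longrightarrow> Q (u \<oplus>\<^bsub>T n\<^esub> v)"
    and "\<And>a u. a \<in> carrier K \<Longrightarrow> u \<in> carrier (T n) \<Longrightarrow> Q u \<Longrightarrow> Q (a \<odot>\<^bsub>T n\<^esub> u)"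
    and "Q \<zero>\<^bsub>T n\<^esub>"
  shows "Q u"
proof -
  interpret P: presentation K "tuples V n" "multilinear_relations K V n" by (rule presentation_power)
  show ?thesis
    by (rule P.pres_induct[OF assms(1)[unfolded T_pres]])
       (use assms(2-5) pure_cls in \<open>auto simp: T_pres tuples_def\<close>)
qed

text \<open>
  Used to verify that a map which is only known on generators selects values of a given relation: a Sweedler sum
  of related elements is related.
\<close>

lemma (in tensor_powers) ext_related:
  assumes W: "module K W" and Y: "module K Y" and F: "multilinear K V n W F" and f: "f \<in> linear_maps K W Y"
    and add: "\<And>x y x' y'. R x y \<Longrightarrow> R x' y' \<Longrightarrow> R (x \<oplus>\<^bsub>W\<^esub> x') (y \<oplus>\<^bsub>Y\<^esub> y')"
    and smult: "\<And>a x y. a \<in> carrier K \<Longrightarrow> R x y \<Longrightarrow> R (a \<odot>\<^bsub>W\<^esub> x) (a \<odot>\<^bsub>Y\<^esub> y)" and zero: "R \<zero>\<^bsub>W\<^esub> \<zero>\<^bsub>Y\<^esub>"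
    and R: "\<And>xs. xs \<in> tuples V n \<Longrightarrow> R (F xs) (f (F xs))" and u: "u \<in> carrier (T n)"
  shows "R (sweedler K W F u) (f (sweedler K W F u))"
  using u
proof (rule T_induct)
  interpret f: linear_map K W Y f by (rule linear_mapI[OF W Y f])
  interpret e: linear_map K "T n" W "sweedler K W F" by (rule linear_mapI[OF T_module W ext_linear[OF W F]])
  show "R (sweedler K W F (pure xs)) (f (sweedler K W F (pure xs)))" if "xs \<in> tuples V n" for xs
    using R[OF that] by (simp only: ext_pure[OF W F that])
  show "R (sweedler K W F (v \<oplus>\<^bsub>T n\<^esub> w)) (f (sweedler K W F (v \<oplus>\<^bsub>T n\<^esub> w)))"
    if "v \<in> carrier (T n)" "w \<in> carrier (T n)" "R (sweedler K W F v) (f (sweedler K W F v))"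
      "R (sweedler K W F w) (f (sweedler K W F w))" for v w
    using add[OF that(3,4)] that(1,2) by simp
  show "R (sweedler K W F (a \<odot>\<^bsub>T n\<^esub> v)) (f (sweedler K W F (a \<odot>\<^bsub>T n\<^esub> v)))"
    if "a \<in> carrier K" "v \<in> carrier (T n)" "R (sweedler K W F v) (f (sweedler K W F v))" for a v
    using smult[OF that(1,3)] that(1,2) by simp
  show "R (sweedler K W F \<zero>\<^bsub>T n\<^esub>) (f (sweedler K W F \<zero>\<^bsub>T n\<^esub>))" using zero by simp
qed

section \<open>Finite direct sums of right modules\<close>

lemma truncate_simps [simp]: "carrier (module.truncate X) = carrier X" "zero (module.truncate X) = zero X"
  "add (module.truncate X) = add X" "smult (module.truncate X) = smult X"
  by (simp_all add: module.defs)

text \<open>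
  Truncating or extending a record changes its type but none of the components on which sums and negatives
  depend.
\<close>

lemma module_same_structure:
  assumes "module K V" "carrier W = carrier V" "zero W = zero V" "add W = add V" "smult W = smult V"
  shows "module K W"
proof -
  interpret V: module K V by fact
  have "abelian_group W"
    by (rule abelian_groupI) (use assms V.l_neg in \<open>auto simp: V.a_ac\<close>)
  then show ?thesis
    by (rule moduleI[OF module.axioms(1)[OF assms(1)]])
      (simp_all add: assms V.smult_l_distr V.smult_r_distr V.smult_assoc1)
qed

lemma finsum_same_structure:
  "carrier W = carrier V \<Longrightarrow> zero W = zero V \<Longrightarrow> add W = add V \<Longrightarrow> finsum W f A = finsum V f A"
  by (simp add: finsum_def finprod_def)

lemma a_inv_same_structure:
  "carrier W = carrier V \<Longrightarrow> zero W = zero V \<Longrightarrow> add W = add V \<Longrightarrow> a_inv W x = a_inv V x"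
  by (simp add: a_inv_def m_inv_def)

definition rsum :: "'i set \<Rightarrow> ('i \<Rightarrow> ('k, 'h, 'x) right_module) \<Rightarrow> ('k, 'h, 'i \<Rightarrow> 'x) right_module" where
  "rsum I X = module.extend (direct_sum I (\<lambda>i. module.truncate (X i)))
     \<lparr>ract = (\<lambda>f h. \<lambda>i\<in>I. ract (X i) (f i) h)\<rparr>"

definition inj :: "'i set \<Rightarrow> ('i \<Rightarrow> ('k, 'h, 'x) right_module) \<Rightarrow> 'i \<Rightarrow> 'x \<Rightarrow> 'i \<Rightarrow> 'x" where
  "inj I X i x = (\<lambda>j\<in>I. if j = i then x else \<zero>\<^bsub>X j\<^esub>)"

lemma rsum_simps [simp]: "\<zero>\<^bsub>rsum I X\<^esub> = (\<lambda>i\<in>I. \<zero>\<^bsub>X i\<^esub>)"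
  "f \<oplus>\<^bsub>rsum I X\<^esub> g = (\<lambda>i\<in>I. f i \<oplus>\<^bsub>X i\<^esub> g i)" "a \<odot>\<^bsub>rsum I X\<^esub> f = (\<lambda>i\<in>I. a \<odot>\<^bsub>X i\<^esub> f i)"
  "ract (rsum I X) f h = (\<lambda>i\<in>I. ract (X i) (f i) h)"
  by (simp_all add: rsum_def module.extend_def)

lemma rsum_carrier_eq: "carrier (rsum I X) = carrier (direct_sum I (\<lambda>i. module.truncate (X i)))"
  by (simp add: rsum_def module.extend_def)

lemma rsum_carrier: "finite I \<Longrightarrow> f \<in> carrier (rsum I X) \<longleftrightarrow> f \<in> extensional I \<and> (\<forall>i\<in>I. f i \<in> carrier (X i))"
  by (simp add: rsum_carrier_eq direct_sum_carrier_finite)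

lemma rsum_eqI: "finite I \<Longrightarrow> f \<in> carrier (rsum I X) \<Longrightarrow> g \<in> carrier (rsum I X) \<Longrightarrow> (\<And>i. i \<in> I \<Longrightarrow> f i = g i) \<Longrightarrow> f = g"
  by (rule extensionalityI[of _ I]) (auto simp: rsum_carrier)

locale right_module_sum =
  fixes K :: "'k ring" and H :: "('k, 'h) hopf" and I :: "'i set" and X :: "'i \<Rightarrow> ('k, 'h, 'x) right_module"
  assumes cring_K: "cring K" and fin: "finite I" and X: "\<And>i. i \<in> I \<Longrightarrow> right_hmodule K H (X i)"
begin

abbreviation S where "S \<equiv> rsum I X"

lemma S_module: "module K S"
  by (rule module_same_structure[OF direct_sum_module[of K I "\<lambda>i. module.truncate (X i)"]])
     (auto simp: cring_K rsum_def module.extend_def fun_eq_iff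
       intro!: module_same_structure[OF right_hmodule.axioms(1)[OF X]])

lemma comp_closed: "f \<in> carrier S \<Longrightarrow> i \<in> I \<Longrightarrow> f i \<in> carrier (X i)"
  by (simp add: rsum_carrier fin)

lemma S_right_hmodule: "right_hmodule K H S"
proof (intro right_hmodule.intro right_hmodule_axioms.intro S_module)
  note lin = linear_add[OF right_hmodule.ract_linear_left[OF X]]
    linear_smult[OF right_hmodule.ract_linear_left[OF X]]
    linear_add[OF right_hmodule.ract_linear_right[OF X]]
    linear_smult[OF right_hmodule.ract_linear_right[OF X]]
  have cl: "ract S f h \<in> carrier S" if "f \<in> carrier S" "h \<in> carrier H" for f h
    using that by (simp add: rsum_carrier fin right_hmodule.ract_closed[OF X])
  show "(\<lambda>x. ract S x h) \<in> linear_maps K S S" if h: "h \<in> carrier H" for h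
    by (rule linear_mapsI) (use h cl comp_closed in \<open>auto intro!: restrict_ext simp: lin\<close>)
  show "ract S x \<in> linear_maps K H S" if x: "x \<in> carrier S" for x
    by (rule linear_mapsI) (use x cl comp_closed in \<open>auto intro!: restrict_ext simp: lin\<close>)
  show "ract S x \<one>\<^bsub>H\<^esub> = x" if x: "x \<in> carrier S" for x
  proof -
    have "x \<in> extensional I" using x by (simp add: rsum_carrier fin)
    then show ?thesis
      by (intro extensionalityI[of _ I]) (simp_all add: right_hmodule.ract_one[OF X] comp_closed[OF x])
  qed
  show "ract S x (g \<otimes>\<^bsub>H\<^esub> h) = ract S (ract S x g) h"
    if "x \<in> carrier S" "g \<in> carrier H" "h \<in> carrier H" for x g h
    using that comp_closed by (auto intro!: restrict_ext simp: right_hmodule.ract_mult[OF X])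
qed

lemma inj_closed: "i \<in> I \<Longrightarrow> x \<in> carrier (X i) \<Longrightarrow> inj I X i x \<in> carrier S"
  using abelian_groupE(2)[OF module.axioms(2)[OF right_hmodule.axioms(1)[OF X]]]
  by (auto simp: inj_def rsum_carrier fin)

lemma inj_right_linear: "i \<in> I \<Longrightarrow> inj I X i \<in> right_linear_maps K H (X i) S"
proof (intro right_linear_mapsI linear_mapsI)
  assume i: "i \<in> I"
  note z = linear_map.zero[OF right_hmodule.ract_map[OF X]]
  have m: "module K (X j)" if "j \<in> I" for j by (rule right_hmodule.axioms(1)[OF X[OF that]])
  show "inj I X i x \<in> carrier S" if "x \<in> carrier (X i)" for x by (rule inj_closed[OF i that])
  show "inj I X i (x \<oplus>\<^bsub>X i\<^esub> y) = inj I X i x \<oplus>\<^bsub>S\<^esub> inj I X i y" if "x \<in> carrier (X i)" "y \<in> carrier (X i)" for x y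
    unfolding inj_def rsum_simps using abelian_groupE(2,5)[OF module.axioms(2)[OF m]]
    by (intro restrict_ext) auto
  show "inj I X i (a \<odot>\<^bsub>X i\<^esub> x) = a \<odot>\<^bsub>S\<^esub> inj I X i x" if "a \<in> carrier K" for a x
    unfolding inj_def rsum_simps using module.smult_r_null[OF m that]
    by (intro restrict_ext) auto
  show "inj I X i (ract (X i) x h) = ract S (inj I X i x) h" if "h \<in> carrier H" for x h
    unfolding inj_def rsum_simps using z[OF _ that]
    by (intro restrict_ext) auto
qed

lemma proj_right_linear: "i \<in> I \<Longrightarrow> (\<lambda>f. f i) \<in> right_linear_maps K H S (X i)"
  by (intro right_linear_mapsI linear_mapsI) (simp_all add: comp_closed)

lemma proj_inj: "i \<in> I \<Longrightarrow> j \<in> I \<Longrightarrow> inj I X i x j = (if j = i then x else \<zero>\<^bsub>X j\<^esub>)"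
  by (simp add: inj_def)

lemma finsum_inj:
  assumes g: "\<And>i. i \<in> I \<Longrightarrow> g i \<in> carrier (X i)" and k: "k \<in> I"
  shows "(\<Oplus>\<^bsub>S\<^esub>i\<in>I. inj I X i (g i)) k = g k"
proof -
  interpret Xk: module K "X k" by (rule right_hmodule.axioms(1)[OF X[OF k]])
  interpret p: linear_map K S "X k" "\<lambda>f. f k"
    by (rule linear_mapI[OF S_module Xk.module_axioms hlinear_linear[OF proj_right_linear[OF k]]])
  have "(\<Oplus>\<^bsub>S\<^esub>i\<in>I. inj I X i (g i)) k = (\<Oplus>\<^bsub>X k\<^esub>i\<in>I. inj I X i (g i) k)"
    by (rule p.finsum) (simp add: inj_closed g)
  also have "\<dots> = (\<Oplus>\<^bsub>X k\<^esub>i\<in>I. if k = i then g k else \<zero>\<^bsub>X k\<^esub>)"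
    by (rule Xk.finsum_cong'[OF refl]) (auto simp: proj_inj k g)
  also have "\<dots> = g k" by (rule Xk.finsum_singleton[OF k fin]) (simp add: g k)
  finally show ?thesis .
qed

lemma decomposition:
  assumes f: "f \<in> carrier S" shows "(\<Oplus>\<^bsub>S\<^esub>i\<in>I. inj I X i (f i)) = f"
proof (rule rsum_eqI[OF fin _ f])
  interpret S: module K S by (rule S_module)
  show "(\<Oplus>\<^bsub>S\<^esub>i\<in>I. inj I X i (f i)) \<in> carrier S"
    by (rule S.finsum_closed) (simp add: inj_closed comp_closed[OF f])
  show "(\<Oplus>\<^bsub>S\<^esub>i\<in>I. inj I X i (f i)) k = f k" if "k \<in> I" for k
    by (rule finsum_inj[OF comp_closed[OF f] that])
qed

end

section \<open>Selecting linear maps from linear relations\<close>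

definition linear_relation ::
    "'k ring \<Rightarrow> ('k, 'v, 'a) module_scheme \<Rightarrow> ('k, 'w, 'b) module_scheme \<Rightarrow> ('v \<Rightarrow> 'w \<Rightarrow> bool) \<Rightarrow> bool" where
  "linear_relation K V W R \<longleftrightarrow>
     (\<forall>x y. R x y \<longrightarrow> x \<in> carrier V \<and> y \<in> carrier W) \<and>
     (\<forall>x y x' y'. R x y \<longrightarrow> R x' y' \<longrightarrow> R (x \<oplus>\<^bsub>V\<^esub> x') (y \<oplus>\<^bsub>W\<^esub> y')) \<and>
     (\<forall>a x y. a \<in> carrier K \<longrightarrow> R x y \<longrightarrow> R (a \<odot>\<^bsub>V\<^esub> x) (a \<odot>\<^bsub>W\<^esub> y)) \<and>
     (\<forall>x \<in> carrier V. \<exists>y. R x y)"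

lemma linear_relationD:
  assumes "linear_relation K V W R"
  shows "R x y \<Longrightarrow> x \<in> carrier V" "R x y \<Longrightarrow> y \<in> carrier W"
    "R x y \<Longrightarrow> R x' y' \<Longrightarrow> R (x \<oplus>\<^bsub>V\<^esub> x') (y \<oplus>\<^bsub>W\<^esub> y')"
    "a \<in> carrier K \<Longrightarrow> R x y \<Longrightarrow> R (a \<odot>\<^bsub>V\<^esub> x) (a \<odot>\<^bsub>W\<^esub> y)"
    "x \<in> carrier V \<Longrightarrow> \<exists>y. R x y"
  using assms by (simp_all add: linear_relation_def)

lemma linear_relation_zero:
  assumes V: "module K V" and W: "module K W" and R: "linear_relation K V W R"
  shows "R \<zero>\<^bsub>V\<^esub> \<zero>\<^bsub>W\<^esub>"
proof -
  interpret V: module K V by fact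
  interpret W: module K W by fact
  obtain y where y: "R \<zero>\<^bsub>V\<^esub> y" using linear_relationD(5)[OF R] by blast
  then have "R (\<zero>\<^bsub>K\<^esub> \<odot>\<^bsub>V\<^esub> \<zero>\<^bsub>V\<^esub>) (\<zero>\<^bsub>K\<^esub> \<odot>\<^bsub>W\<^esub> y)" by (intro linear_relationD(4)[OF R]) simp
  then show ?thesis using linear_relationD(2)[OF R y] by simp
qed

lemma linear_relation_finsum:
  assumes V: "module K V" and W: "module K W" and R: "linear_relation K V W R" and J: "finite J"
    and xy: "\<And>i. i \<in> J \<Longrightarrow> R (x i) (y i)"
  shows "R (\<Oplus>\<^bsub>V\<^esub>i\<in>J. x i) (\<Oplus>\<^bsub>W\<^esub>i\<in>J. y i)"
  using J xy
proof (induction J)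
  case empty
  interpret V: module K V by fact
  interpret W: module K W by fact
  show ?case using linear_relation_zero[OF V W R] by simp
next
  case (insert j J)
  interpret V: module K V by fact
  interpret W: module K W by fact
  have c: "i \<in> insert j J \<Longrightarrow> x i \<in> carrier V" "i \<in> insert j J \<Longrightarrow> y i \<in> carrier W" for i
    using linear_relationD(1,2)[OF R insert.prems] by blast+
  have "R (x j \<oplus>\<^bsub>V\<^esub> (\<Oplus>\<^bsub>V\<^esub>i\<in>J. x i)) (y j \<oplus>\<^bsub>W\<^esub> (\<Oplus>\<^bsub>W\<^esub>i\<in>J. y i))"
    by (rule linear_relationD(3)[OF R]) (use insert in simp_all)
  moreover have "(\<Oplus>\<^bsub>V\<^esub>i\<in>insert j J. x i) = x j \<oplus>\<^bsub>V\<^esub> (\<Oplus>\<^bsub>V\<^esub>i\<in>J. x i)"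
    by (rule V.finsum_insert) (use insert.hyps c in auto)
  moreover have "(\<Oplus>\<^bsub>W\<^esub>i\<in>insert j J. y i) = y j \<oplus>\<^bsub>W\<^esub> (\<Oplus>\<^bsub>W\<^esub>i\<in>J. y i)"
    by (rule W.finsum_insert) (use insert.hyps c in auto)
  ultimately show ?case by simp
qed

text \<open>
  By Zorn's lemma there is a maximal linear subspace of \<open>R\<close> whose fibre over \<open>0\<close> is trivial. Such a subspace is the
  graph of a linear map, and its domain is everything: for \<open>x\<close> outside the domain and \<open>y\<close> with \<open>R x y\<close>, the line
  through \<open>(x, y)\<close> could be added, because a nonzero multiple of \<open>x\<close> lies outside the domain as well. That last point
  needs division by scalars.
\<close>

lemma linear_selection:
  assumes K: "field K" and V: "module K V" and W: "module K W" and R: "linear_relation K V W R"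
  shows "\<exists>f \<in> linear_maps K V W. \<forall>x \<in> carrier V. R x (f x)"
proof -
  interpret K: field K by fact
  interpret V: module K V by fact
  interpret W: module K W by fact
  note RD = linear_relationD[OF R]
  define good where "good G \<longleftrightarrow> (\<forall>x y. (x, y) \<in> G \<longrightarrow> R x y) \<and> (\<zero>\<^bsub>V\<^esub>, \<zero>\<^bsub>W\<^esub>) \<in> G \<and>
    (\<forall>x y x' y'. (x, y) \<in> G \<longrightarrow> (x', y') \<in> G \<longrightarrow> (x \<oplus>\<^bsub>V\<^esub> x', y \<oplus>\<^bsub>W\<^esub> y') \<in> G) \<and>
    (\<forall>a x y. a \<in> carrier K \<longrightarrow> (x, y) \<in> G \<longrightarrow> (a \<odot>\<^bsub>V\<^esub> x, a \<odot>\<^bsub>W\<^esub> y) \<in> G) \<and>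
    (\<forall>y. (\<zero>\<^bsub>V\<^esub>, y) \<in> G \<longrightarrow> y = \<zero>\<^bsub>W\<^esub>)" for G
  have goodD: "(x, y) \<in> G \<Longrightarrow> R x y" "(\<zero>\<^bsub>V\<^esub>, \<zero>\<^bsub>W\<^esub>) \<in> G"
    "(x, y) \<in> G \<Longrightarrow> (x', y') \<in> G \<Longrightarrow> (x \<oplus>\<^bsub>V\<^esub> x', y \<oplus>\<^bsub>W\<^esub> y') \<in> G"
    "a \<in> carrier K \<Longrightarrow> (x, y) \<in> G \<Longrightarrow> (a \<odot>\<^bsub>V\<^esub> x, a \<odot>\<^bsub>W\<^esub> y) \<in> G"
    "(\<zero>\<^bsub>V\<^esub>, y) \<in> G \<Longrightarrow> y = \<zero>\<^bsub>W\<^esub>" if "good G" for G x y x' y' a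
    using that unfolding good_def by blast+
  have "\<exists>M\<in>{G. good G}. \<forall>X\<in>{G. good G}. M \<subseteq> X \<longrightarrow> X = M"
  proof (rule subset_Zorn_nonempty)
    have "good {(\<zero>\<^bsub>V\<^esub>, \<zero>\<^bsub>W\<^esub>)}"
      unfolding good_def using linear_relation_zero[OF V W R] by simp
    then show "{G. good G} \<noteq> {}" by blast
  next
    fix \<C> assume ne: "\<C> \<noteq> {}" and ch: "subset.chain {G. good G} \<C>"
    have g: "G \<in> \<C> \<Longrightarrow> good G" for G using ch by (auto simp: subset_chain_def)
    have "good (\<Union>\<C>)"
      unfolding good_def
    proof (intro conjI allI impI)
      show "R x y" if "(x, y) \<in> \<Union>\<C>" for x y using that goodD(1)[OF g] by blast
      show "(\<zero>\<^bsub>V\<^esub>, \<zero>\<^bsub>W\<^esub>) \<in> \<Union>\<C>" using ne goodD(2)[OF g] by blast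
      show "(a \<odot>\<^bsub>V\<^esub> x, a \<odot>\<^bsub>W\<^esub> y) \<in> \<Union>\<C>" if "a \<in> carrier K" "(x, y) \<in> \<Union>\<C>" for a x y
        using that goodD(4)[OF g] by blast
      show "y = \<zero>\<^bsub>W\<^esub>" if "(\<zero>\<^bsub>V\<^esub>, y) \<in> \<Union>\<C>" for y using that goodD(5)[OF g] by blast
      fix x y x' y' assume "(x, y) \<in> \<Union>\<C>" "(x', y') \<in> \<Union>\<C>"
      then obtain G G' where G: "G \<in> \<C>" "(x, y) \<in> G" "G' \<in> \<C>" "(x', y') \<in> G'" by blast
      then have "G \<subseteq> G' \<or> G' \<subseteq> G" using ch by (auto simp: subset_chain_def)
      then show "(x \<oplus>\<^bsub>V\<^esub> x', y \<oplus>\<^bsub>W\<^esub> y') \<in> \<Union>\<C>"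
        using G goodD(3)[OF g] by (meson UnionI subsetD)
    qed
    then show "\<Union>\<C> \<in> {G. good G}" by simp
  qed
  then obtain G where G: "good G" and max: "\<And>X. good X \<Longrightarrow> G \<subseteq> X \<Longrightarrow> X = G" by auto
  note GD = goodD[OF G]
  have GV: "(x, y) \<in> G \<Longrightarrow> x \<in> carrier V" and GW: "(x, y) \<in> G \<Longrightarrow> y \<in> carrier W" for x y
    using GD(1) RD(1,2) by blast+
  have total: "\<exists>y. (x, y) \<in> G" if x: "x \<in> carrier V" for x
  proof (rule ccontr)
    assume nx: "\<nexists>y. (x, y) \<in> G"
    obtain y where y: "R x y" using RD(5)[OF x] by blast
    have yW: "y \<in> carrier W" by (rule RD(2)[OF y])
    define G' where "G' = {(v \<oplus>\<^bsub>V\<^esub> a \<odot>\<^bsub>V\<^esub> x, w \<oplus>\<^bsub>W\<^esub> a \<odot>\<^bsub>W\<^esub> y) | v w a. (v, w) \<in> G \<and> a \<in> carrier K}"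
    have sub: "G \<subseteq> G'"
    proof
      fix p assume p: "p \<in> G"
      obtain v w where vw: "p = (v, w)" by (cases p)
      then have eq: "p = (v \<oplus>\<^bsub>V\<^esub> \<zero>\<^bsub>K\<^esub> \<odot>\<^bsub>V\<^esub> x, w \<oplus>\<^bsub>W\<^esub> \<zero>\<^bsub>K\<^esub> \<odot>\<^bsub>W\<^esub> y)"
        using p GV GW x yW by simp
      have "(v, w) \<in> G" using p vw by simp
      then show "p \<in> G'" unfolding G'_def eq using K.zero_closed by blast
    qed
    have "good G'"
      unfolding good_def
    proof (intro conjI allI impI)
      show "R x' y'" if xy': "(x', y') \<in> G'" for x' y'
      proof -
        obtain v w a where 1: "x' = v \<oplus>\<^bsub>V\<^esub> a \<odot>\<^bsub>V\<^esub> x" "y' = w \<oplus>\<^bsub>W\<^esub> a \<odot>\<^bsub>W\<^esub> y" "(v, w) \<in> G" "a \<in> carrier K"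
          using xy' unfolding G'_def by blast
        show ?thesis unfolding 1 by (rule RD(3)[OF GD(1)[OF 1(3)] RD(4)[OF 1(4) y]])
      qed
      show "(\<zero>\<^bsub>V\<^esub>, \<zero>\<^bsub>W\<^esub>) \<in> G'" using sub GD(2) by blast
    next
      fix x1 y1 x2 y2 assume "(x1, y1) \<in> G'" "(x2, y2) \<in> G'"
      then obtain v1 w1 a1 v2 w2 a2 where 1: "x1 = v1 \<oplus>\<^bsub>V\<^esub> a1 \<odot>\<^bsub>V\<^esub> x" "y1 = w1 \<oplus>\<^bsub>W\<^esub> a1 \<odot>\<^bsub>W\<^esub> y" "(v1, w1) \<in> G" "a1 \<in> carrier K"
        and 2: "x2 = v2 \<oplus>\<^bsub>V\<^esub> a2 \<odot>\<^bsub>V\<^esub> x" "y2 = w2 \<oplus>\<^bsub>W\<^esub> a2 \<odot>\<^bsub>W\<^esub> y" "(v2, w2) \<in> G" "a2 \<in> carrier K"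
        unfolding G'_def by blast
      have "x1 \<oplus>\<^bsub>V\<^esub> x2 = (v1 \<oplus>\<^bsub>V\<^esub> v2) \<oplus>\<^bsub>V\<^esub> (a1 \<oplus>\<^bsub>K\<^esub> a2) \<odot>\<^bsub>V\<^esub> x"
        using GV[OF 1(3)] GV[OF 2(3)] 1 2 x by (simp add: V.smult_l_distr V.a_ac)
      moreover have "y1 \<oplus>\<^bsub>W\<^esub> y2 = (w1 \<oplus>\<^bsub>W\<^esub> w2) \<oplus>\<^bsub>W\<^esub> (a1 \<oplus>\<^bsub>K\<^esub> a2) \<odot>\<^bsub>W\<^esub> y"
        using GW[OF 1(3)] GW[OF 2(3)] 1 2 yW by (simp add: W.smult_l_distr W.a_ac)
      ultimately show "(x1 \<oplus>\<^bsub>V\<^esub> x2, y1 \<oplus>\<^bsub>W\<^esub> y2) \<in> G'"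
        unfolding G'_def using GD(3)[OF 1(3) 2(3)] 1(4) 2(4) K.a_closed by blast
    next
      fix b x1 y1 assume b: "b \<in> carrier K" and "(x1, y1) \<in> G'"
      then obtain v1 w1 a1 where 1: "x1 = v1 \<oplus>\<^bsub>V\<^esub> a1 \<odot>\<^bsub>V\<^esub> x" "y1 = w1 \<oplus>\<^bsub>W\<^esub> a1 \<odot>\<^bsub>W\<^esub> y" "(v1, w1) \<in> G" "a1 \<in> carrier K"
        unfolding G'_def by blast
      have "b \<odot>\<^bsub>V\<^esub> x1 = b \<odot>\<^bsub>V\<^esub> v1 \<oplus>\<^bsub>V\<^esub> (b \<otimes>\<^bsub>K\<^esub> a1) \<odot>\<^bsub>V\<^esub> x"
        using GV[OF 1(3)] 1 x b by (simp add: V.smult_r_distr V.smult_assoc1)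
      moreover have "b \<odot>\<^bsub>W\<^esub> y1 = b \<odot>\<^bsub>W\<^esub> w1 \<oplus>\<^bsub>W\<^esub> (b \<otimes>\<^bsub>K\<^esub> a1) \<odot>\<^bsub>W\<^esub> y"
        using GW[OF 1(3)] 1 yW b by (simp add: W.smult_r_distr W.smult_assoc1)
      ultimately show "(b \<odot>\<^bsub>V\<^esub> x1, b \<odot>\<^bsub>W\<^esub> y1) \<in> G'"
        unfolding G'_def using GD(4)[OF b 1(3)] b 1(4) K.m_closed by blast
    next
      fix z assume "(\<zero>\<^bsub>V\<^esub>, z) \<in> G'"
      then obtain v w a where 1: "v \<oplus>\<^bsub>V\<^esub> a \<odot>\<^bsub>V\<^esub> x = \<zero>\<^bsub>V\<^esub>" "z = w \<oplus>\<^bsub>W\<^esub> a \<odot>\<^bsub>W\<^esub> y" "(v, w) \<in> G" "a \<in> carrier K"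
        unfolding G'_def by force
      have "a = \<zero>\<^bsub>K\<^esub>"
      proof (rule ccontr)
        assume "a \<noteq> \<zero>\<^bsub>K\<^esub>"
        then have "a \<in> Units K" using 1(4) K.field_Units by blast
        then have ia: "inv\<^bsub>K\<^esub> a \<in> carrier K" "inv\<^bsub>K\<^esub> a \<otimes>\<^bsub>K\<^esub> a = \<one>\<^bsub>K\<^esub>" by simp_all
        have "\<ominus>\<^bsub>V\<^esub> (a \<odot>\<^bsub>V\<^esub> x) = v"
          using V.minus_equality[OF 1(1)] 1(4) x GV[OF 1(3)] by simp
        then have "a \<odot>\<^bsub>V\<^esub> x = (\<ominus>\<^bsub>K\<^esub> \<one>\<^bsub>K\<^esub>) \<odot>\<^bsub>V\<^esub> v"
          using 1(4) x by (auto simp: V.smult_l_minus)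
        then have "inv\<^bsub>K\<^esub> a \<odot>\<^bsub>V\<^esub> (a \<odot>\<^bsub>V\<^esub> x) = inv\<^bsub>K\<^esub> a \<odot>\<^bsub>V\<^esub> ((\<ominus>\<^bsub>K\<^esub> \<one>\<^bsub>K\<^esub>) \<odot>\<^bsub>V\<^esub> v)" by simp
        moreover have "inv\<^bsub>K\<^esub> a \<odot>\<^bsub>V\<^esub> (a \<odot>\<^bsub>V\<^esub> x) = x"
          using ia 1(4) x by (simp add: V.smult_assoc1[symmetric])
        moreover have "(inv\<^bsub>K\<^esub> a \<odot>\<^bsub>V\<^esub> ((\<ominus>\<^bsub>K\<^esub> \<one>\<^bsub>K\<^esub>) \<odot>\<^bsub>V\<^esub> v), inv\<^bsub>K\<^esub> a \<odot>\<^bsub>W\<^esub> ((\<ominus>\<^bsub>K\<^esub> \<one>\<^bsub>K\<^esub>) \<odot>\<^bsub>W\<^esub> w)) \<in> G"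
          by (intro GD(4) ia 1(3)) simp
        ultimately show False using nx by auto
      qed
      then have "v = \<zero>\<^bsub>V\<^esub>" using 1(1) x GV[OF 1(3)] by simp
      then have "w = \<zero>\<^bsub>W\<^esub>" using GD(5) 1(3) by blast
      then show "z = \<zero>\<^bsub>W\<^esub>" using 1(2) \<open>a = \<zero>\<^bsub>K\<^esub>\<close> yW by simp
    qed
    then have "G' = G" using max sub by blast
    moreover have "(x, y) \<in> G'"
    proof -
      have "(x, y) = (\<zero>\<^bsub>V\<^esub> \<oplus>\<^bsub>V\<^esub> \<one>\<^bsub>K\<^esub> \<odot>\<^bsub>V\<^esub> x, \<zero>\<^bsub>W\<^esub> \<oplus>\<^bsub>W\<^esub> \<one>\<^bsub>K\<^esub> \<odot>\<^bsub>W\<^esub> y)"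
        using x yW by simp
      then show ?thesis unfolding G'_def using GD(2) K.one_closed by blast
    qed
    ultimately show False using nx by blast
  qed
  have unique: "y = y'" if "(x, y) \<in> G" "(x, y') \<in> G" for x y y'
  proof -
    have "(x \<oplus>\<^bsub>V\<^esub> (\<ominus>\<^bsub>K\<^esub> \<one>\<^bsub>K\<^esub>) \<odot>\<^bsub>V\<^esub> x, y \<oplus>\<^bsub>W\<^esub> (\<ominus>\<^bsub>K\<^esub> \<one>\<^bsub>K\<^esub>) \<odot>\<^bsub>W\<^esub> y') \<in> G"
      by (intro GD(3,4) that) simp
    then have "y \<oplus>\<^bsub>W\<^esub> (\<ominus>\<^bsub>K\<^esub> \<one>\<^bsub>K\<^esub>) \<odot>\<^bsub>W\<^esub> y' = \<zero>\<^bsub>W\<^esub>"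
      using GV[OF that(1)] by (intro GD(5)) (simp add: V.smult_l_minus V.r_neg)
    then have "y \<ominus>\<^bsub>W\<^esub> y' = \<zero>\<^bsub>W\<^esub>" using GW[OF that(2)] by (simp add: W.smult_l_minus a_minus_def)
    then show ?thesis using GW[OF that(1)] GW[OF that(2)] by simp
  qed
  define f where "f x = (SOME y. (x, y) \<in> G)" for x
  have f: "(x, f x) \<in> G" if "x \<in> carrier V" for x unfolding f_def using total[OF that] by (rule someI_ex)
  have "f \<in> linear_maps K V W"
  proof (rule linear_mapsI)
    show "f x \<in> carrier W" if "x \<in> carrier V" for x by (rule GW[OF f[OF that]])
    show "f (x \<oplus>\<^bsub>V\<^esub> y) = f x \<oplus>\<^bsub>W\<^esub> f y" if "x \<in> carrier V" "y \<in> carrier V" for x y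
      by (rule unique[OF f GD(3)[OF f[OF that(1)] f[OF that(2)]]]) (use that in simp)
    show "f (a \<odot>\<^bsub>V\<^esub> x) = a \<odot>\<^bsub>W\<^esub> f x" if "a \<in> carrier K" "x \<in> carrier V" for a x
      by (rule unique[OF f GD(4)[OF that(1) f[OF that(2)]]]) (use that in simp)
  qed
  then show ?thesis using f GD(1) by blast
qed

section \<open>Projectivity as a selection property\<close>

definition hlinear_relation ::
    "'k ring \<Rightarrow> ('k, 'h) hopf \<Rightarrow> ('k, 'h, 'x) right_module \<Rightarrow> ('k, 'h, 'y) right_module \<Rightarrow> ('x \<Rightarrow> 'y \<Rightarrow> bool) \<Rightarrow> bool" where
  "hlinear_relation K H X Y R \<longleftrightarrow> linear_relation K X Y R \<and>
     (\<forall>x y. \<forall>h \<in> carrier H. R x y \<longrightarrow> R (ract X x h) (ract Y y h))"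

text \<open>
  For varying \<open>Y\<close> this expresses projectivity of \<open>X\<close>: lifting \<open>h\<close> along a surjection \<open>g\<close> is the case
  \<open>R x y \<longleftrightarrow> g y = h x\<close>. Relations also cover simultaneous equations, which is how chain maps and homotopies are
  constructed below.
\<close>

definition liftable ::
    "'k ring \<Rightarrow> ('k, 'h) hopf \<Rightarrow> ('k, 'h, 'x) right_module \<Rightarrow> ('k, 'h, 'y) right_module \<Rightarrow> bool" where
  "liftable K H X Y \<longleftrightarrow> (\<forall>R. hlinear_relation K H X Y R \<longrightarrow>
     (\<exists>f \<in> right_linear_maps K H X Y. \<forall>x \<in> carrier X. R x (f x)))"

lemma hlinear_relationD: "hlinear_relation K H X Y R \<Longrightarrow> linear_relation K X Y R"
  "hlinear_relation K H X Y R \<Longrightarrow> h \<in> carrier H \<Longrightarrow> R x y \<Longrightarrow> R (ract X x h) (ract Y y h)"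
  by (simp_all add: hlinear_relation_def)

text \<open>
  Along an inclusion this reduces the selection problem on a sum to its summands; along a retraction it
  moves the problem from a direct summand to the ambient module.
\<close>

lemma hlinear_relation_pullback:
  assumes R: "hlinear_relation K H X Y R" and f: "f \<in> right_linear_maps K H X' X"
    and X': "right_hmodule K H X'"
  shows "hlinear_relation K H X' Y (\<lambda>x y. x \<in> carrier X' \<and> R (f x) y)"
proof -
  interpret X': right_hmodule K H X' by fact
  note RL = hlinear_relationD(1)[OF R] note RD = linear_relationD[OF RL]
  note fl = hlinear_linear[OF f]
  show ?thesis
    unfolding hlinear_relation_def linear_relation_def
    using RD(2) linear_relationD(5)[OF RL hlinear_closed[OF f]] X'.ract_closed
    by (auto simp: linear_add[OF fl] linear_smult[OF fl] hlinear_ract[OF f]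
        intro!: RD(3,4) hlinear_relationD(2)[OF R])
qed

lemma liftable_sum:
  assumes X: "right_module_sum K H I X" and Y: "right_hmodule K H Y"
    and l: "\<And>i. i \<in> I \<Longrightarrow> liftable K H (X i) Y"
  shows "liftable K H (rsum I X) Y"
  unfolding liftable_def
proof (intro allI impI)
  interpret S: right_module_sum K H I X by fact
  interpret Y: right_hmodule K H Y by fact
  fix R assume R: "hlinear_relation K H (rsum I X) Y R"
  have "\<exists>f \<in> right_linear_maps K H (X i) Y. \<forall>x \<in> carrier (X i). R (inj I X i x) (f x)" if i: "i \<in> I" for i
    using l[OF i] hlinear_relation_pullback[OF R S.inj_right_linear[OF i] S.X[OF i]] unfolding liftable_def by blast
  then obtain f where f: "\<And>i. i \<in> I \<Longrightarrow> f i \<in> right_linear_maps K H (X i) Y"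
    and Rf: "\<And>i x. i \<in> I \<Longrightarrow> x \<in> carrier (X i) \<Longrightarrow> R (inj I X i x) (f i x)" by metis
  let ?g = "\<lambda>x. \<Oplus>\<^bsub>Y\<^esub>i\<in>I. f i (x i)"
  have "?g \<in> right_linear_maps K H (rsum I X) Y"
    by (rule hlinear_finsum[OF Y S.fin hlinear_comp[OF S.proj_right_linear f]])
  moreover have "R x (?g x)" if x: "x \<in> carrier (rsum I X)" for x
  proof -
    have "R (\<Oplus>\<^bsub>rsum I X\<^esub>i\<in>I. inj I X i (x i)) (?g x)"
      by (rule linear_relation_finsum[OF S.S_module Y.module_axioms hlinear_relationD(1)[OF R] S.fin])
         (simp add: Rf S.comp_closed[OF x])
    then show ?thesis by (simp only: S.decomposition[OF x])
  qed
  ultimately show "\<exists>f\<in>right_linear_maps K H (rsum I X) Y. \<forall>x\<in>carrier (rsum I X). R x (f x)"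
    by (intro bexI[of _ ?g] ballI)
qed

lemma (in hopf_algebra) free_right_hmodule: "right_hmodule K H (free_right_module H X)"
proof -
  interpret R: ring H by (rule ring_H)
  interpret V: module K H by (rule module_H)
  have cl: "u \<in> fin_supp H X \<Longrightarrow> u x \<in> carrier H" for u x
    by (rule fin_supp_value[OF _ abelian_groupE(2)[OF module.axioms(2)[OF module_H]]])
  have img: "(\<lambda>x. f (u x)) \<in> fin_supp H X"
    if u: "u \<in> fin_supp H X" and f: "\<And>h. h \<in> carrier H \<Longrightarrow> f h \<in> carrier H" "f \<zero>\<^bsub>H\<^esub> = \<zero>\<^bsub>H\<^esub>" for u f
  proof -
    have "finite {x. f (u x) \<noteq> \<zero>\<^bsub>H\<^esub>}"
      by (rule finite_subset[of _ "{x. u x \<noteq> \<zero>\<^bsub>H\<^esub>}"]) (use u f in \<open>auto simp: fin_supp_def\<close>)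
    then show ?thesis using u f by (auto simp: fin_supp_def)
  qed
  note ab = module.axioms(2)[OF module_H]
  note abE = abelian_groupE[OF ab]
  note sm = module.smult_closed[OF module_H] module.smult_r_null[OF module_H]
  have s: "(\<lambda>x. a \<odot>\<^bsub>H\<^esub> u x) \<in> fin_supp H X" if "a \<in> carrier K" "u \<in> fin_supp H X" for a u
    by (rule img) (use that sm in auto)
  have null: "\<zero>\<^bsub>H\<^esub> \<otimes>\<^bsub>H\<^esub> h = \<zero>\<^bsub>H\<^esub>" if "h \<in> carrier H" for h
    using linear_map.zero[OF linear_mapI[OF module_H module_H bilinear_left[OF mult_bilinear that]]] .
  have r: "(\<lambda>x. u x \<otimes>\<^bsub>H\<^esub> h) \<in> fin_supp H X" if "h \<in> carrier H" "u \<in> fin_supp H X" for h u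
    by (rule img) (use that mult_closed null in auto)
  have ad: "(\<lambda>x. u x \<oplus>\<^bsub>H\<^esub> v x) \<in> fin_supp H X" if "u \<in> fin_supp H X" "v \<in> fin_supp H X" for u v
    using that by (rule abelian_group.fin_supp_plus[OF ab])
  have z: "(\<lambda>_. \<zero>\<^bsub>H\<^esub>) \<in> fin_supp H X" using abE(2) by (simp add: fin_supp_def)
  let ?F = "free_right_module H X"
  have F: "carrier ?F = fin_supp H X" "\<zero>\<^bsub>?F\<^esub> = (\<lambda>_. \<zero>\<^bsub>H\<^esub>)" "\<And>f g. f \<oplus>\<^bsub>?F\<^esub> g = (\<lambda>x. f x \<oplus>\<^bsub>H\<^esub> g x)"
    "\<And>a f. a \<odot>\<^bsub>?F\<^esub> f = (\<lambda>x. a \<odot>\<^bsub>H\<^esub> f x)" "\<And>f h. ract ?F f h = (\<lambda>x. f x \<otimes>\<^bsub>H\<^esub> h)"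
    by (simp_all add: free_right_module_def)
  have neg: "\<exists>v\<in>fin_supp H X. (\<lambda>x. v x \<oplus>\<^bsub>H\<^esub> u x) = (\<lambda>_. \<zero>\<^bsub>H\<^esub>)" if u: "u \<in> fin_supp H X" for u
    by (intro bexI[of _ "\<lambda>x. \<ominus>\<^bsub>H\<^esub> u x"] img[OF u])
       (use cl[OF u] abelian_group.l_neg[OF ab] abelian_group.a_inv_closed[OF ab] abelian_group.a_inv_zero[OF ab] in auto)
  have "module K ?F"
  proof (rule moduleI[OF cring_K])
    show "abelian_group ?F"
      by (rule abelian_groupI) (simp_all add: F ad z neg cl abE(3,5), simp add: cl abE(4))
  qed (simp_all add: F s cl module.smult_l_distr[OF module_H] module.smult_r_distr[OF module_H]
      module.smult_assoc1[OF module_H] module.smult_one[OF module_H])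
  then show ?thesis
  proof (intro right_hmodule.intro right_hmodule_axioms.intro)
    note l = linear_add[OF bilinear_left[OF mult_bilinear]] linear_smult[OF bilinear_left[OF mult_bilinear]]
      linear_add[OF bilinear_right[OF mult_bilinear]] linear_smult[OF bilinear_right[OF mult_bilinear]]
    show "(\<lambda>x. ract ?F x h) \<in> linear_maps K ?F ?F" if "h \<in> carrier H" for h
      by (rule linear_mapsI) (simp_all add: F r that l cl)
    show "ract ?F x \<in> linear_maps K H ?F" if "x \<in> carrier ?F" for x
      by (rule linear_mapsI) (use that in \<open>simp_all add: F r l cl\<close>)
  qed (simp_all add: F cl mult_one mult_assoc)
qed

text \<open>
  It is enough to choose related values \<open>y x\<close> on the basis: every element is a finite sum of \<open>H\<close>-multiples of basis
  elements, and the relation is closed under these operations.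
\<close>

lemma (in hopf_algebra) liftable_free:
  assumes Y: "right_hmodule K H Y" shows "liftable K H (free_right_module H X) Y"
  unfolding liftable_def
proof (intro allI impI)
  interpret Y: right_hmodule K H Y by fact
  let ?F = "free_right_module H X"
  have F: "carrier ?F = fin_supp H X" "\<zero>\<^bsub>?F\<^esub> = (\<lambda>_. \<zero>\<^bsub>H\<^esub>)" "\<And>f g. f \<oplus>\<^bsub>?F\<^esub> g = (\<lambda>x. f x \<oplus>\<^bsub>H\<^esub> g x)"
    "\<And>a f. a \<odot>\<^bsub>?F\<^esub> f = (\<lambda>x. a \<odot>\<^bsub>H\<^esub> f x)" "\<And>f h. ract ?F f h = (\<lambda>x. f x \<otimes>\<^bsub>H\<^esub> h)"
    by (simp_all add: free_right_module_def)
  interpret F: right_hmodule K H ?F by (rule free_right_hmodule)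
  fix R assume R: "hlinear_relation K H ?F Y R"
  note RL = hlinear_relationD(1)[OF R]
  note ab = module.axioms(2)[OF module_H]
  note z = abelian_groupE(2)[OF ab]
  have g: "single H x a \<in> fin_supp H X" if "x \<in> X" "a \<in> carrier H" for x a
    using single_fin_supp[OF that z] .
  have "\<exists>y. R (single H x \<one>\<^bsub>H\<^esub>) y" if "x \<in> X" for x
    using linear_relationD(5)[OF RL] g[OF that one_H] by (simp add: F)
  then obtain y where y: "\<And>x. x \<in> X \<Longrightarrow> R (single H x \<one>\<^bsub>H\<^esub>) (y x)" by metis
  have yY: "x \<in> X \<Longrightarrow> y x \<in> carrier Y" for x using linear_relationD(2)[OF RL, OF y] by simp
  note l = Y.ract_linear_right[OF yY]
  interpret E: fin_ext_loc H Y X "\<lambda>x a. ract Y (y x) a"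
    by (intro fin_ext_loc.intro fin_ext_loc_axioms.intro ab module.axioms(2)[OF Y.module_axioms]
        linear_closed[OF l] linear_add[OF l])
  let ?f = "fin_ext H Y (\<lambda>x a. ract Y (y x) a)"
  have single_ract: "ract ?F (single H x a) h = single H x (a \<otimes>\<^bsub>H\<^esub> h)" if "h \<in> carrier H" for x a h
    using linear_map.zero[OF linear_mapI[OF module_H module_H bilinear_left[OF mult_bilinear that]]]
    by (auto simp: F single_def)
  have single_smult: "c \<odot>\<^bsub>?F\<^esub> single H x a = single H x (c \<odot>\<^bsub>H\<^esub> a)" if "c \<in> carrier K" for x a c
    using module.smult_r_null[OF module_H that] by (auto simp: F single_def)
  have cl: "?f u \<in> carrier Y" if "u \<in> carrier ?F" for u using E.fin_ext_closed that by (simp add: F)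
  have add: "?f (u \<oplus>\<^bsub>?F\<^esub> v) = ?f u \<oplus>\<^bsub>Y\<^esub> ?f v" if "u \<in> carrier ?F" "v \<in> carrier ?F" for u v
    using E.fin_ext_add that by (simp add: F)
  have zero: "?f \<zero>\<^bsub>?F\<^esub> = \<zero>\<^bsub>Y\<^esub>"
    by (simp add: F fin_ext_def)
  have all: "(\<forall>c \<in> carrier K. ?f (c \<odot>\<^bsub>?F\<^esub> u) = c \<odot>\<^bsub>Y\<^esub> ?f u) \<and>
      (\<forall>h \<in> carrier H. ?f (ract ?F u h) = ract Y (?f u) h) \<and> R u (?f u)" if u: "u \<in> carrier ?F" for u
    using ab u[unfolded F(1)]
  proof (induction rule: fin_supp_induct)
    case zero
    have "linear_map K ?F ?F (\<lambda>x. ract ?F x h)" if "h \<in> carrier H" for h by (rule F.ract_map[OF that])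
    then show ?case
      using \<open>?f \<zero>\<^bsub>?F\<^esub> = \<zero>\<^bsub>Y\<^esub>\<close> linear_relation_zero[OF F.module_axioms Y.module_axioms RL]
        linear_map.zero[OF F.ract_map] linear_map.zero[OF Y.ract_map] F.smult_r_null Y.smult_r_null
      unfolding F(2)[symmetric] by auto
  next
    case (single x a)
    have "R (ract ?F (single H x \<one>\<^bsub>H\<^esub>) a) (ract Y (y x) a)"
      by (rule hlinear_relationD(2)[OF R single(2), OF y[OF single(1)]])
    then have "R (single H x a) (ract Y (y x) a)" using single by (simp add: single_ract mult_one)
    then show ?case
      using single by (simp add: single_smult single_ract E.fin_ext_single mult_closed
          module.smult_closed[OF module_H] linear_smult[OF l] Y.ract_mult yY)
  next
    case (add u v)
    then have uv: "u \<in> carrier ?F" "v \<in> carrier ?F" by (simp_all add: F)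
    show ?case unfolding F(3)[symmetric]
      using add(3,4) uv cl[OF uv(1)] cl[OF uv(2)]
      by (simp add: \<open>\<And>v u. \<lbrakk>u \<in> carrier ?F; v \<in> carrier ?F\<rbrakk> \<Longrightarrow> ?f (u \<oplus>\<^bsub>?F\<^esub> v) = ?f u \<oplus>\<^bsub>Y\<^esub> ?f v\<close>
        F.smult_r_distr Y.smult_r_distr linear_map.add[OF F.ract_map] linear_map.add[OF Y.ract_map]
        F.ract_closed linear_relationD(3)[OF RL] del: free_module_simps)
  qed
  have "?f \<in> right_linear_maps K H ?F Y"
    by (intro right_linear_mapsI linear_mapsI cl add) (use all in auto)
  then show "\<exists>f\<in>right_linear_maps K H ?F Y. \<forall>x\<in>carrier ?F. R x (f x)"
    using all by (intro bexI[of _ ?f] ballI) simp_all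
qed

lemma (in hopf_algebra) liftable_projective:
  fixes P :: "('k, 'h, 'p) right_module"
  assumes P: "projective_right K H P" and Y: "right_hmodule K H Y" shows "liftable K H P Y"
  unfolding liftable_def
proof (intro allI impI)
  fix R assume R: "hlinear_relation K H P Y R"
  obtain X :: "'p set" and i r where i: "i \<in> right_linear_maps K H P (free_right_module H X)"
    and r: "r \<in> right_linear_maps K H (free_right_module H X) P" and ri: "\<And>x. x \<in> carrier P \<Longrightarrow> r (i x) = x"
    using P unfolding projective_right_def by blast
  obtain f where f: "f \<in> right_linear_maps K H (free_right_module H X) Y"
    and Rf: "\<And>x. x \<in> carrier (free_right_module H X) \<Longrightarrow> R (r x) (f x)"
    using liftable_free[OF Y, of X] hlinear_relation_pullback[OF R r free_right_hmodule] unfolding liftable_def by blast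
  have "R x (f (i x))" if "x \<in> carrier P" for x
    using Rf[OF hlinear_closed[OF i that]] ri[OF that] by simp
  then show "\<exists>f\<in>right_linear_maps K H P Y. \<forall>x\<in>carrier P. R x (f x)"
    using hlinear_comp[OF i f] by (intro bexI[of _ "\<lambda>x. f (i x)"] ballI)
qed

context hopf_algebra
begin

text \<open>
  The diagonal module \<open>C 0\<close> is \<open>H\<close> itself, free on \<open>1\<close>.
\<close>

lemma liftable_C_0:
  assumes Y: "right_hmodule K H Y" shows "liftable K H (C 0) Y"
  unfolding liftable_def
proof (intro allI impI)
  interpret Y: right_hmodule K H Y by fact
  fix R assume R: "hlinear_relation K H (C 0) Y R"
  note RL = hlinear_relationD(1)[OF R]
  have p1: "pure [\<one>\<^bsub>H\<^esub>] \<in> carrier (T (Suc 0))" by (intro P.pure_closed tuples_lists one_H)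
  then obtain y where y: "R (pure [\<one>\<^bsub>H\<^esub>]) y" using linear_relationD(5)[OF RL] by auto
  then have yY: "y \<in> carrier Y" by (rule linear_relationD(2)[OF RL])
  note l = Y.ract_linear_right[OF yY]
  have m: "multilinear K H (Suc 0) Y (\<lambda>xs. ract Y y (xs ! 0))"
    by (intro multilinearI) (auto dest!: tuples1 simp: linear_closed[OF l] l)
  let ?f = "sweedler K Y (\<lambda>xs. ract Y y (xs ! 0))"
  note e = P.ext_linear[OF Y.module_axioms m]
  have fh: "?f (iter 0 h) = ract Y y h" if "h \<in> carrier H" for h
    using P.ext_pure[OF Y.module_axioms m tuples_lists(1)[OF that]] by simp
  have ex: "\<exists>h\<in>carrier H. t = iter 0 h" if "t \<in> carrier (T (Suc 0))" for t
  proof -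
    have "multilinear K H (Suc 0) H (\<lambda>xs. xs ! 0)"
      by (intro multilinearI) (auto dest!: tuples1 simp: linear_id)
    note e1 = P.ext_linear[OF module_H this] P.ext_pure[OF module_H this]
    have "iter 0 (sweedler K H (\<lambda>xs. xs ! 0) t) = t"
      by (rule P.T_eqI[OF P.T_module linear_comp[OF e1(1) iter_linear] linear_id _ that])
         (auto dest!: tuples1 simp: e1(2) tuples_lists)
    then show ?thesis using linear_closed[OF e1(1) that] by metis
  qed
  have "?f \<in> right_linear_maps K H (C 0) Y"
  proof (rule right_linear_mapsI)
    show "?f \<in> linear_maps K (C 0) Y" using e by simp
    fix t g assume "t \<in> carrier (C 0)" and g: "g \<in> carrier H"
    then obtain h where h: "t = iter 0 h" "h \<in> carrier H" using ex by auto
    show "?f (ract (C 0) t g) = ract Y (?f t) g"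
      using h g by (simp only: C_simps iter_mult[symmetric] fh mult_closed Y.ract_mult yY)
  qed
  moreover have "R t (?f t)" if t: "t \<in> carrier (C 0)" for t
  proof -
    obtain h where h: "t = iter 0 h" "h \<in> carrier H" using t ex by auto
    have "R (ract (C 0) (pure [\<one>\<^bsub>H\<^esub>]) h) (ract Y y h)" by (rule hlinear_relationD(2)[OF R h(2), OF y])
    moreover have "ract (C 0) (pure [\<one>\<^bsub>H\<^esub>]) h = iter 0 h"
      using h by (simp add: pm_pure tuples_lists one_H mult_one)
    ultimately show ?thesis by (simp only: h(1) fh[OF h(2)])
  qed
  ultimately show "\<exists>f\<in>right_linear_maps K H (C 0) Y. \<forall>x\<in>carrier (C 0). R x (f x)"
    by (intro bexI[of _ ?f] ballI)
qed

text \<open>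
  The identity \<open>v \<otimes> h = \<Sum> (v S(h\<^sub>1) \<otimes> 1) h\<^sub>2\<close>, with the diagonal action on both sides. It exhibits \<open>V \<otimes> H\<close>, for
  \<open>V = H\<^sup>\<otimes>\<^sup>n\<^sup>+\<^sup>1\<close>, as generated by \<open>V \<otimes> 1\<close>. The right-hand side expands to
  \<open>\<Sum> v S(h\<^sub>1) h\<^sub>2 \<otimes> h\<^sub>3\<close>, where the antipode axiom applies.
\<close>

lemma untwist:
  assumes v: "v \<in> carrier (T (Suc n))" and h: "h \<in> carrier H"
  shows "Sw (T (Suc (Suc n))) (\<lambda>a b. ract (C (Suc n)) (P.app (Suc n) (ract (C n) v (antipode H a)) \<one>\<^bsub>H\<^esub>) b) h =
    P.app (Suc n) v h"
proof -
  let ?W = "T (Suc (Suc n))"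
  let ?S = "antipode H"
  note S = antipode_linear note Sc = linear_closed[OF antipode_linear]
  have vS: "ract (C n) v (?S a) \<in> carrier (T (Suc n))" if "a \<in> carrier H" for a
    using v Sc[OF that] by (simp add: pm_closed iter_closed)
  let ?g = "\<lambda>a. ract (C n) v a"
  have gl: "?g \<in> linear_maps K H (T (Suc n))"
    using right_hmodule.ract_linear_right[OF C_right_hmodule, of v n] v
    by (simp add: C_simps(5)[abs_def])
  let ?B = "\<lambda>a b c. P.app (Suc n) (?g (?S a \<otimes>\<^bsub>H\<^esub> b)) c"
  have tri: "trilinear ?W ?B"
    unfolding trilinear_def
  proof (intro conjI ballI)
    show "bilinear K H H ?W (?B a)" if "a \<in> carrier H" for a
      by (rule bilinear_pre[OF P.app_bilinear linear_comp[OF bilinear_right[OF mult_bilinear Sc[OF that]] gl] linear_id])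
    show "(\<lambda>a. ?B a b c) \<in> linear_maps K H ?W" if "b \<in> carrier H" "c \<in> carrier H" for b c
      by (rule linear_comp[OF linear_comp[OF linear_comp[OF S bilinear_left[OF mult_bilinear that(1)]] gl]
            bilinear_left[OF P.app_bilinear that(2)]])
  qed
  have 1: "ract (C (Suc n)) (P.app (Suc n) (?g (?S a)) \<one>\<^bsub>H\<^esub>) b = Sw ?W (?B a) b"
    if ab: "a \<in> carrier H" "b \<in> carrier H" for a b
  proof -
    have c: "P.app (Suc n) (?g (?S a)) \<one>\<^bsub>H\<^esub> \<in> carrier ?W" by (rule P.app_closed[OF vS[OF ab(1)] one_H])
    have "ract (C (Suc n)) (P.app (Suc n) (?g (?S a)) \<one>\<^bsub>H\<^esub>) b =
        Sw ?W (\<lambda>x y. pm (Suc (Suc n)) (P.app (Suc n) (?g (?S a)) \<one>\<^bsub>H\<^esub>) (P.app (Suc n) (iter n x) y)) b"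
      unfolding C_simps(5) iter_Suc[OF ab(2)]
      by (rule Sw_comp[OF P.T_module iter_app_bilinear P.T_module bilinear_right[OF pm_bilinear c[unfolded C_simps(5)]] ab(2)])
    also have "\<dots> = Sw ?W (?B a) b"
    proof (rule Sw_cong[OF P.T_module trilinearD(1)[OF tri ab(1)] ab(2)])
      fix x y assume xy: "x \<in> carrier H" "y \<in> carrier H"
      have "pm (Suc n) (?g (?S a)) (iter n x) = ?g (?S a \<otimes>\<^bsub>H\<^esub> x)"
        using right_hmodule.ract_mult[OF C_right_hmodule, of v n "?S a" x] v Sc[OF ab(1)] xy by simp
      then show "pm (Suc (Suc n)) (P.app (Suc n) (?g (?S a)) \<one>\<^bsub>H\<^esub>) (P.app (Suc n) (iter n x) y) = ?B a x y"
        by (simp only: pm_app[OF vS[OF ab(1)] iter_closed[OF xy(1)] one_H xy(2)] mult_one(1)[OF xy(2)])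
    qed
    finally show ?thesis .
  qed
  have "Sw ?W (\<lambda>a b. ract (C (Suc n)) (P.app (Suc n) (?g (?S a)) \<one>\<^bsub>H\<^esub>) b) h = Sw ?W (\<lambda>a b. Sw ?W (?B a) b) h"
    by (rule Sw_cong[OF P.T_module bilinear_Sw_right[OF P.T_module tri] h]) (rule 1)
  also have "\<dots> = Sw ?W (\<lambda>x c. Sw ?W (\<lambda>a b. ?B a b c) x) h"
    by (rule Sw_coassoc[OF P.T_module tri h, symmetric])
  also have "\<dots> = Sw ?W (\<lambda>x c. counit H x \<odot>\<^bsub>?W\<^esub> P.app (Suc n) v c) h"
  proof (rule Sw_cong[OF P.T_module counit_bilinear(1)[OF P.T_module bilinear_right[OF P.app_bilinear v]] h])
    fix x c assume xc: "x \<in> carrier H" "c \<in> carrier H"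
    have "Sw ?W (\<lambda>a b. ?B a b c) x = counit H x \<odot>\<^bsub>?W\<^esub> P.app (Suc n) (?g \<one>\<^bsub>H\<^esub>) c"
      by (rule Sw_antipode_left[OF P.T_module linear_comp[OF gl bilinear_left[OF P.app_bilinear xc(2)]] xc(1)])
    also have "?g \<one>\<^bsub>H\<^esub> = v" by (rule right_hmodule.ract_one[OF C_right_hmodule]) (use v in simp)
    finally show "Sw ?W (\<lambda>a b. ?B a b c) x = counit H x \<odot>\<^bsub>?W\<^esub> P.app (Suc n) v c" .
  qed
  also have "\<dots> = P.app (Suc n) v h"
    by (rule Sw_counit_left[OF P.T_module bilinear_right[OF P.app_bilinear v] h])
  finally show ?thesis .
qed

text \<open>
  By \<open>untwist\<close> the module is generated by \<open>V \<otimes> 1\<close>. Over a field, values \<open>q v\<close> related to \<open>v \<otimes> 1\<close> can be chosen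
  linearly in \<open>v\<close>, and \<open>v \<otimes> h \<mapsto> \<Sum> q(v S(h\<^sub>1)) h\<^sub>2\<close> extends the choice. It is a map of \<open>H\<close>-modules because it sends
  \<open>(v \<otimes> 1) g\<close> to \<open>q(v) g\<close>, again by the antipode axiom; this is freeness on \<open>V \<otimes> 1\<close>.
\<close>

lemma liftable_C_Suc:
  assumes Y: "right_hmodule K H Y" shows "liftable K H (C (Suc n)) Y"
  unfolding liftable_def
proof (intro allI impI)
  interpret Y: right_hmodule K H Y by fact
  let ?V = "T (Suc n)" and ?W = "T (Suc (Suc n))"
  let ?S = "antipode H"
  note S = antipode_linear note Sc = linear_closed[OF antipode_linear]
  fix R assume R: "hlinear_relation K H (C (Suc n)) Y R"
  note RL = hlinear_relationD(1)[OF R]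
  let ?j = "\<lambda>v. P.app (Suc n) v \<one>\<^bsub>H\<^esub>"
  have j: "?j \<in> linear_maps K ?V ?W" by (rule bilinear_left[OF P.app_bilinear one_H])
  note jc = linear_closed[OF j]
  have "linear_relation K ?V Y (\<lambda>v y. v \<in> carrier ?V \<and> R (?j v) y)"
  proof -
    interpret V: module K ?V by (rule P.T_module)
    show ?thesis
      unfolding linear_relation_def
      using linear_relationD[OF RL] jc by (auto simp: linear_add[OF j] linear_smult[OF j])
  qed
  from linear_selection[OF field_axioms P.T_module Y.module_axioms this]
  obtain q where l: "q \<in> linear_maps K ?V Y" and Rl: "\<And>v. v \<in> carrier ?V \<Longrightarrow> R (?j v) (q v)" by blast
  have ract_bilinear: "bilinear K Y H Y (ract Y)"
    by (intro bilinearI Y.ract_linear_left Y.ract_linear_right)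
  have vS: "(\<lambda>a. pm (Suc n) v (iter n (?S a))) \<in> linear_maps K H ?V" if "v \<in> carrier ?V" for v
    by (rule linear_comp[OF linear_comp[OF S iter_linear] bilinear_right[OF pm_bilinear that]])
  have Sv: "(\<lambda>v. pm (Suc n) v (iter n (?S a))) \<in> linear_maps K ?V ?V" if "a \<in> carrier H" for a
    by (rule bilinear_left[OF pm_bilinear iter_closed[OF Sc[OF that]]])
  define B where "B v h = Sw Y (\<lambda>a b. ract Y (q (pm (Suc n) v (iter n (?S a)))) b) h" for v h
  have inner: "bilinear K H H Y (\<lambda>a b. ract Y (q (pm (Suc n) v (iter n (?S a)))) b)" if "v \<in> carrier ?V" for v
    by (rule bilinear_pre[OF ract_bilinear linear_comp[OF vS[OF that] l] linear_id])
  have B: "bilinear K ?V H Y B"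
  proof (rule bilinearI)
    show "B v \<in> linear_maps K H Y" if "v \<in> carrier ?V" for v
      unfolding B_def[abs_def] by (rule Sw_linear[OF Y.module_axioms inner[OF that]])
    show "(\<lambda>v. B v h) \<in> linear_maps K ?V Y" if "h \<in> carrier H" for h
      unfolding B_def
      by (rule Sw_param[OF P.T_module Y.module_axioms inner _ that])
         (assumption, rule linear_comp[OF linear_comp[OF Sv l] bilinear_left[OF ract_bilinear]])
  qed
  let ?f = "P.split (Suc n) Y B"
  have fl: "?f \<in> linear_maps K ?W Y" by (rule P.split_linear[OF Y.module_axioms B])
  have fapp: "?f (P.app (Suc n) v h) = B v h" if "v \<in> carrier ?V" "h \<in> carrier H" for v h
    by (rule P.split_app[OF Y.module_axioms B that])
  \<comment> \<open>on the generating elements \<open>(v \<otimes> 1) g\<close> the map is \<open>q(v) g\<close>\<close>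
  have gen: "?f (pm (Suc (Suc n)) (?j v) (iter (Suc n) g)) = ract Y (q v) g"
    if v: "v \<in> carrier ?V" and g: "g \<in> carrier H" for v g
  proof -
    let ?A = "\<lambda>x y. P.app (Suc n) (pm (Suc n) v (iter n x)) y"
    let ?D = "\<lambda>x a b. ract Y (q (pm (Suc n) v (iter n (x \<otimes>\<^bsub>H\<^esub> ?S a)))) b"
    have gl: "(\<lambda>x. pm (Suc n) v (iter n x)) \<in> linear_maps K H ?V"
      by (rule linear_comp[OF iter_linear bilinear_right[OF pm_bilinear v]])
    have vx: "pm (Suc n) v (iter n x) \<in> carrier ?V" if "x \<in> carrier H" for x by (rule linear_closed[OF gl that])
    have A: "bilinear K H H ?W ?A" by (rule bilinear_pre[OF P.app_bilinear gl linear_id])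
    have tri: "trilinear Y ?D"
      unfolding trilinear_def
    proof (intro conjI ballI)
      show "bilinear K H H Y (?D x)" if "x \<in> carrier H" for x
        by (rule bilinear_pre[OF ract_bilinear linear_comp[OF linear_comp[OF linear_comp[OF S bilinear_right[OF mult_bilinear that]] gl] l] linear_id])
      show "(\<lambda>x. ?D x a b) \<in> linear_maps K H Y" if "a \<in> carrier H" "b \<in> carrier H" for a b
        by (rule linear_comp[OF linear_comp[OF linear_comp[OF bilinear_left[OF mult_bilinear Sc[OF that(1)]] gl] l]
            bilinear_left[OF ract_bilinear that(2)]])
    qed
    have "pm (Suc (Suc n)) (?j v) (iter (Suc n) g) = Sw ?W (\<lambda>x y. pm (Suc (Suc n)) (?j v) (P.app (Suc n) (iter n x) y)) g"
      unfolding iter_Suc[OF g]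
      by (rule Sw_comp[OF P.T_module iter_app_bilinear P.T_module bilinear_right[OF pm_bilinear jc[OF v]] g])
    also have "\<dots> = Sw ?W ?A g"
      by (rule Sw_cong[OF P.T_module A g]) (simp only: pm_app[OF v iter_closed one_H] mult_one)
    finally have "?f (pm (Suc (Suc n)) (?j v) (iter (Suc n) g)) = Sw Y (\<lambda>x y. ?f (?A x y)) g"
      using Sw_comp[OF P.T_module A Y.module_axioms fl g] by simp
    also have "\<dots> = Sw Y (\<lambda>x y. Sw Y (\<lambda>a b. ?D x a b) y) g"
    proof (rule Sw_cong[OF Y.module_axioms bilinear_Sw_right[OF Y.module_axioms tri] g])
      fix x y assume xy: "x \<in> carrier H" "y \<in> carrier H"
      show "?f (?A x y) = Sw Y (\<lambda>a b. ?D x a b) y"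
        unfolding fapp[OF vx[OF xy(1)] xy(2)] B_def
        by (rule Sw_cong[OF Y.module_axioms trilinearD(1)[OF tri xy(1)] xy(2)])
          (simp only: iter_mult[OF xy(1) Sc] pm_assoc[OF v iter_closed[OF xy(1)] iter_closed[OF Sc]])
    qed
    also have "\<dots> = Sw Y (\<lambda>z b. Sw Y (\<lambda>x a. ?D x a b) z) g"
      by (rule Sw_coassoc[OF Y.module_axioms tri g, symmetric])
    also have "\<dots> = Sw Y (\<lambda>z b. counit H z \<odot>\<^bsub>Y\<^esub> ract Y (q v) b) g"
    proof (rule Sw_cong[OF Y.module_axioms counit_bilinear(1)[OF Y.module_axioms bilinear_right[OF ract_bilinear linear_closed[OF l v]]] g])
      fix z b assume zb: "z \<in> carrier H" "b \<in> carrier H"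
      have "Sw Y (\<lambda>x a. ?D x a b) z = counit H z \<odot>\<^bsub>Y\<^esub> ract Y (q (pm (Suc n) v (iter n \<one>\<^bsub>H\<^esub>))) b"
        by (rule Sw_antipode_right[OF Y.module_axioms linear_comp[OF linear_comp[OF gl l] bilinear_left[OF ract_bilinear zb(2)]] zb(1)])
      then show "Sw Y (\<lambda>x a. ?D x a b) z = counit H z \<odot>\<^bsub>Y\<^esub> ract Y (q v) b"
        by (simp only: iter_one pm_one[OF v])
    qed
    also have "\<dots> = ract Y (q v) g"
      by (rule Sw_counit_left[OF Y.module_axioms bilinear_right[OF ract_bilinear linear_closed[OF l v]] g])
    finally show ?thesis .
  qed
  have untw: "P.app (Suc n) v h = Sw ?W (\<lambda>a b. pm (Suc (Suc n)) (?j (pm (Suc n) v (iter n (?S a)))) (iter (Suc n) b)) h"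
    if "v \<in> carrier ?V" "h \<in> carrier H" for v h
    using untwist[OF that] by (simp only: C_simps(5))
  have bil: "bilinear K H H ?W (\<lambda>a b. pm (Suc (Suc n)) (?j (pm (Suc n) v (iter n (?S a)))) (iter (Suc n) b))" if "v \<in> carrier ?V" for v
    by (rule bilinear_pre[OF pm_bilinear linear_comp[OF vS[OF that] j] iter_linear])
  have pmg: "(\<lambda>t. pm (Suc (Suc n)) t (iter (Suc n) g)) \<in> linear_maps K ?W ?W" if "g \<in> carrier H" for g
    by (rule bilinear_left[OF pm_bilinear iter_closed[OF that]])
  have "?f \<in> right_linear_maps K H (C (Suc n)) Y"
  proof (rule right_linear_mapsI)
    show "?f \<in> linear_maps K (C (Suc n)) Y" using fl by simp
    fix t g assume "t \<in> carrier (C (Suc n))" and g: "g \<in> carrier H"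
    then have t: "t \<in> carrier ?W" by simp
    have "?f (pm (Suc (Suc n)) t (iter (Suc n) g)) = ract Y (?f t) g"
    proof (rule P.T_Suc_eqI[OF Y.module_axioms linear_comp[OF pmg[OF g] fl] linear_comp[OF fl Y.ract_linear_left[OF g]] _ t])
      fix v h assume v: "v \<in> carrier ?V" and h: "h \<in> carrier H"
      note b = bil[OF v]
      have wa: "pm (Suc n) v (iter n (?S a)) \<in> carrier ?V" if "a \<in> carrier H" for a by (rule linear_closed[OF vS[OF v] that])
      let ?G = "\<lambda>a b. pm (Suc (Suc n)) (?j (pm (Suc n) v (iter n (?S a)))) (iter (Suc n) b)"
      have "?f (pm (Suc (Suc n)) (P.app (Suc n) v h) (iter (Suc n) g)) = Sw Y (\<lambda>a b. ?f (pm (Suc (Suc n)) (?G a b) (iter (Suc n) g))) h"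
        unfolding untw[OF v h] by (rule Sw_comp[OF P.T_module b Y.module_axioms linear_comp[OF pmg[OF g] fl] h])
      also have "\<dots> = Sw Y (\<lambda>a b. ract Y (?f (?G a b)) g) h"
      proof (rule Sw_cong[OF Y.module_axioms bilinear_comp[OF b linear_comp[OF fl Y.ract_linear_left[OF g]]] h])
        fix a b assume ab: "a \<in> carrier H" "b \<in> carrier H"
        have "pm (Suc (Suc n)) (?G a b) (iter (Suc n) g) =
            pm (Suc (Suc n)) (?j (pm (Suc n) v (iter n (?S a)))) (iter (Suc n) (b \<otimes>\<^bsub>H\<^esub> g))"
          by (simp only: pm_assoc[OF jc[OF wa[OF ab(1)]] iter_closed[OF ab(2)] iter_closed[OF g]] iter_mult[OF ab(2) g])
        then show "?f (pm (Suc (Suc n)) (?G a b) (iter (Suc n) g)) = ract Y (?f (?G a b)) g"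
          by (simp only: gen[OF wa[OF ab(1)] mult_closed[OF ab(2) g]] gen[OF wa[OF ab(1)] ab(2)]
              Y.ract_mult[OF linear_closed[OF l wa[OF ab(1)]] ab(2) g])
      qed
      also have "\<dots> = ract Y (?f (P.app (Suc n) v h)) g"
        unfolding untw[OF v h] by (rule Sw_comp[OF P.T_module b Y.module_axioms linear_comp[OF fl Y.ract_linear_left[OF g]] h, symmetric])
      finally show "?f (pm (Suc (Suc n)) (P.app (Suc n) v h) (iter (Suc n) g)) = ract Y (?f (P.app (Suc n) v h)) g" .
    qed
    then show "?f (ract (C (Suc n)) t g) = ract Y (?f t) g" by (simp only: C_simps(5))
  qed
  moreover have "R t (?f t)" if "t \<in> carrier (C (Suc n))" for t
  proof -
    have t: "t \<in> carrier ?W" using that by simp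
    interpret W: module K ?W by (rule P.T_module)
    interpret fm: linear_map K ?W Y ?f by (rule linear_mapI[OF P.T_module Y.module_axioms fl])
    have R0: "R \<zero>\<^bsub>?W\<^esub> \<zero>\<^bsub>Y\<^esub>" using linear_relation_zero[OF C_module Y.module_axioms RL] by simp
    have Radd: "R (x \<oplus>\<^bsub>?W\<^esub> x') (y \<oplus>\<^bsub>Y\<^esub> y')" if "R x y" "R x' y'" for x y x' y'
      using linear_relationD(3)[OF RL, OF that] by simp
    have Rsm: "R (a \<odot>\<^bsub>?W\<^esub> x) (a \<odot>\<^bsub>Y\<^esub> y)" if "a \<in> carrier K" "R x y" for a x y
      using linear_relationD(4)[OF RL, OF that] by simp
    have app: "R (P.app (Suc n) v h) (?f (P.app (Suc n) v h))" if v: "v \<in> carrier ?V" and h: "h \<in> carrier H" for v h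
      unfolding untw[OF v h] Sw_def
    proof (rule P.ext_related[OF P.T_module Y.module_axioms multilinear2[OF bil[OF v]] fl Radd Rsm R0 _ comult_closed[OF h]])
      fix xs assume "xs \<in> tuples H 2"
      then have x: "xs ! 0 \<in> carrier H" "xs ! 1 \<in> carrier H" by (simp_all add: tuples_nth)
      let ?w = "pm (Suc n) v (iter n (?S (xs ! 0)))"
      have w: "?w \<in> carrier ?V" by (rule linear_closed[OF vS[OF v] x(1)])
      have "R (ract (C (Suc n)) (?j ?w) (xs ! 1)) (ract Y (q ?w) (xs ! 1))"
        by (rule hlinear_relationD(2)[OF R x(2), OF Rl[OF w]])
      then show "R (pm (Suc (Suc n)) (?j ?w) (iter (Suc n) (xs ! 1))) (?f (pm (Suc (Suc n)) (?j ?w) (iter (Suc n) (xs ! 1))))"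
        by (simp only: C_simps(5) gen[OF w x(2)])
    qed
    show ?thesis
      using t
    proof (rule P.T_induct)
      fix xs assume xs: "xs \<in> tuples H (Suc (Suc n))"
      then obtain ys y where y: "xs = ys @ [y]" "ys \<in> tuples H (Suc n)" "y \<in> carrier H"
        by (cases xs rule: rev_cases) (auto simp: tuples_def)
      show "R (pure xs) (?f (pure xs))"
        using app[OF P.pure_closed[OF y(2)] y(3)] by (simp only: y(1) P.app_pure[OF y(2,3)])
    qed (use R0 Radd Rsm in auto)
  qed
  ultimately show "\<exists>f\<in>right_linear_maps K H (C (Suc n)) Y. \<forall>x\<in>carrier (C (Suc n)). R x (f x)"
    by (intro bexI[of _ ?f] ballI)
qed

end

section \<open>Comparison of augmented complexes\<close>

text \<open>
  A lift through \<open>g\<close> and \<open>g'\<close> simultaneously exists as soon as it exists pointwise.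
\<close>

lemma liftable_equations:
  assumes l: "liftable K H X Y" and X: "right_hmodule K H X" and Y: "right_hmodule K H Y"
    and g: "g \<in> right_linear_maps K H Y Y'" and h: "h \<in> right_linear_maps K H X Y'"
    and g': "g' \<in> right_linear_maps K H Y B" and h': "h' \<in> right_linear_maps K H X B"
    and ex: "\<And>x. x \<in> carrier X \<Longrightarrow> \<exists>y \<in> carrier Y. g y = h x \<and> g' y = h' x"
  shows "\<exists>f \<in> right_linear_maps K H X Y. \<forall>x \<in> carrier X. g (f x) = h x \<and> g' (f x) = h' x"
proof -
  interpret X: right_hmodule K H X by fact
  interpret Y: right_hmodule K H Y by fact
  let ?R = "\<lambda>x y. x \<in> carrier X \<and> y \<in> carrier Y \<and> g y = h x \<and> g' y = h' x"
  note lin = hlinear_linear[OF g] hlinear_linear[OF h]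
    hlinear_linear[OF g'] hlinear_linear[OF h']
  have "hlinear_relation K H X Y ?R"
    unfolding hlinear_relation_def linear_relation_def
  proof (intro conjI allI impI ballI)
    fix x assume "x \<in> carrier X"
    then show "\<exists>y. ?R x y" using ex by blast
  qed (simp_all add: X.ract_closed Y.ract_closed lin[THEN linear_add] lin[THEN linear_smult]
      hlinear_ract[OF g] hlinear_ract[OF g'] hlinear_ract[OF h] hlinear_ract[OF h'])
  then obtain f where "f \<in> right_linear_maps K H X Y" "\<forall>x \<in> carrier X. ?R x (f x)"
    using l unfolding liftable_def by blast
  then show ?thesis by (intro bexI[of _ f]) auto
qed

text \<open>
  A chain map \<open>phi\<close> from \<open>X\<close> to a complex with zero differential, whose term of degree \<open>n\<close> is \<open>A n\<close>. The terms all
  sit inside one module \<open>B\<close>.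
\<close>

locale augmented_complex =
  fixes K :: "'k ring" and H :: "('k, 'h) hopf" and B :: "('k, 'h, 'k) right_module" and A :: "nat \<Rightarrow> 'k set"
    and X :: "nat \<Rightarrow> ('k, 'h, 'x) right_module" and d :: "nat \<Rightarrow> 'x \<Rightarrow> 'x" and phi :: "nat \<Rightarrow> 'x \<Rightarrow> 'k"
  assumes B: "right_hmodule K H B" and X: "right_hmodule K H (X n)"
    and d: "d (Suc n) \<in> right_linear_maps K H (X (Suc n)) (X n)"
    and dd: "x \<in> carrier (X (Suc (Suc n))) \<Longrightarrow> d (Suc n) (d (Suc (Suc n)) x) = \<zero>\<^bsub>X n\<^esub>"
    and phi: "phi n \<in> right_linear_maps K H (X n) B"
    and phi_A: "x \<in> carrier (X n) \<Longrightarrow> phi n x \<in> A n"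
    and phi_d: "x \<in> carrier (X (Suc n)) \<Longrightarrow> phi n (d (Suc n) x) = \<zero>\<^bsub>B\<^esub>"
begin

lemmas X_module = right_hmodule.axioms(1)[OF X]
lemmas d_closed = hlinear_closed[OF d]

end

text \<open>
  The chain map \<open>phi\<close> is a quasi-isomorphism onto \<open>A\<close>. Injectivity in degree \<open>n\<close> and surjectivity in degree
  \<open>n + 1\<close> are combined into one statement, since in the constructions below an element with prescribed
  boundary and prescribed augmentation has to be found.
\<close>

locale augmented_resolution = augmented_complex +
  assumes A_zero: "\<zero>\<^bsub>B\<^esub> \<in> A n"
    and exact_0: "c \<in> A 0 \<Longrightarrow> \<exists>w \<in> carrier (X 0). phi 0 w = c"
    and exact: "z \<in> carrier (X n) \<Longrightarrow> (n > 0 \<Longrightarrow> d n z = \<zero>\<^bsub>X (n - 1)\<^esub>) \<Longrightarrow> phi n z = \<zero>\<^bsub>B\<^esub> \<Longrightarrow> c \<in> A (Suc n) \<Longrightarrow>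
      \<exists>w \<in> carrier (X (Suc n)). d (Suc n) w = z \<and> phi (Suc n) w = c"

text \<open>
  The usual construction by induction on the degree, except that the lift is asked to be compatible with the
  augmentations in every degree, as the complex that is resolved does not live in degree \<open>0\<close> alone.
\<close>

lemma comparison_map:
  assumes X: "augmented_complex K H B A X d phi" and Y: "augmented_resolution K H B A Y e psi"
    and l: "\<And>n. liftable K H (X n) (Y n)"
  shows "\<exists>f. \<forall>n. f n \<in> right_linear_maps K H (X n) (Y n) \<and>
      (\<forall>x \<in> carrier (X n). psi n (f n x) = phi n x) \<and>
      (\<forall>x \<in> carrier (X (Suc n)). e (Suc n) (f (Suc n) x) = f n (d (Suc n) x))"
proof -
  interpret X: augmented_complex K H B A X d phi by fact
  interpret Y: augmented_resolution K H B A Y e psi by fact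
  \<comment> \<open>the last clause, that cycles go to cycles, stands in for the chain map condition in the previous degree\<close>
  define Q where "Q n f \<longleftrightarrow> f \<in> right_linear_maps K H (X n) (Y n) \<and>
      (\<forall>x \<in> carrier (X n). psi n (f x) = phi n x) \<and>
      (\<forall>x \<in> carrier (X n). n > 0 \<longrightarrow> d n x = \<zero>\<^bsub>X (n - 1)\<^esub> \<longrightarrow> e n (f x) = \<zero>\<^bsub>Y (n - 1)\<^esub>)" for n f
  have "\<exists>f. \<forall>n. Q n (f n) \<and> (\<forall>x \<in> carrier (X (Suc n)). e (Suc n) (f (Suc n) x) = f n (d (Suc n) x))"
  proof (rule dependent_nat_choice)
    have "\<exists>f \<in> right_linear_maps K H (X 0) (Y 0). \<forall>x \<in> carrier (X 0). psi 0 (f x) = phi 0 x \<and> psi 0 (f x) = phi 0 x"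
      by (rule liftable_equations[OF l X.X Y.X Y.phi X.phi Y.phi X.phi]) (use Y.exact_0 X.phi_A in blast)
    then show "\<exists>f. Q 0 f" by (auto simp: Q_def)
  next
    fix f n assume f: "Q n f"
    then have fl: "f \<in> right_linear_maps K H (X n) (Y n)" by (simp add: Q_def)
    interpret fm: linear_map K "X n" "Y n" f
      by (rule linear_mapI[OF X.X_module Y.X_module hlinear_linear[OF fl]])
    have "\<exists>g \<in> right_linear_maps K H (X (Suc n)) (Y (Suc n)). \<forall>x \<in> carrier (X (Suc n)).
        e (Suc n) (g x) = f (d (Suc n) x) \<and> psi (Suc n) (g x) = phi (Suc n) x"
    proof (rule liftable_equations[OF l X.X Y.X Y.d hlinear_comp[OF X.d fl] Y.phi X.phi])
      fix x assume x: "x \<in> carrier (X (Suc n))"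
      note dx = X.d_closed[OF x]
      have dd: "n > 0 \<Longrightarrow> d n (d (Suc n) x) = \<zero>\<^bsub>X (n - 1)\<^esub>" using X.dd[of x "n - 1"] x by simp
      show "\<exists>y \<in> carrier (Y (Suc n)). e (Suc n) y = f (d (Suc n) x) \<and> psi (Suc n) y = phi (Suc n) x"
        by (rule Y.exact) (use f dx x dd X.phi_d[OF x] X.phi_A[OF x] in \<open>auto simp: Q_def\<close>)
    qed
    then obtain g where g: "g \<in> right_linear_maps K H (X (Suc n)) (Y (Suc n))"
      "\<And>x. x \<in> carrier (X (Suc n)) \<Longrightarrow> e (Suc n) (g x) = f (d (Suc n) x) \<and> psi (Suc n) (g x) = phi (Suc n) x" by blast
    then have "Q (Suc n) g" by (auto simp: Q_def)
    then show "\<exists>g. Q (Suc n) g \<and> (\<forall>x \<in> carrier (X (Suc n)). e (Suc n) (g x) = f (d (Suc n) x))"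
      using g by (intro exI[of _ g]) simp
  qed
  then obtain f where "\<forall>n. Q n (f n) \<and> (\<forall>x \<in> carrier (X (Suc n)). e (Suc n) (f (Suc n) x) = f n (d (Suc n) x))" ..
  then show ?thesis by (intro exI[of _ f]) (simp add: Q_def)
qed

text \<open>
  The homotopy is required to have augmentation zero. Then \<open>k - s d\<close> is a cycle of augmentation zero in each
  degree, hence a boundary, and the next component of the homotopy can be chosen.
\<close>

lemma null_homotopy:
  assumes X: "augmented_complex K H B A X d phi" and Y: "augmented_resolution K H B A Y e psi"
    and l: "\<And>n. liftable K H (X n) (Y (Suc n))"
    and k: "\<And>n. k n \<in> right_linear_maps K H (X n) (Y n)"
    and chain: "\<And>n x. x \<in> carrier (X (Suc n)) \<Longrightarrow> e (Suc n) (k (Suc n) x) = k n (d (Suc n) x)"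
    and aug: "\<And>n x. x \<in> carrier (X n) \<Longrightarrow> psi n (k n x) = \<zero>\<^bsub>B\<^esub>"
  shows "\<exists>s. (\<forall>n. s n \<in> right_linear_maps K H (X n) (Y (Suc n))) \<and>
      (\<forall>x \<in> carrier (X 0). k 0 x = e (Suc 0) (s 0 x)) \<and>
      (\<forall>n. \<forall>x \<in> carrier (X (Suc n)). k (Suc n) x = e (Suc (Suc n)) (s (Suc n) x) \<oplus>\<^bsub>Y (Suc n)\<^esub> s n (d (Suc n) x))"
proof -
  interpret X: augmented_complex K H B A X d phi by fact
  interpret Y: augmented_resolution K H B A Y e psi by fact
  define Q where "Q n s \<longleftrightarrow> s \<in> right_linear_maps K H (X n) (Y (Suc n)) \<and>
      (\<forall>x \<in> carrier (X n). psi (Suc n) (s x) = \<zero>\<^bsub>B\<^esub>) \<and>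
      (\<forall>x \<in> carrier (X n). (n > 0 \<longrightarrow> d n x = \<zero>\<^bsub>X (n - 1)\<^esub>) \<longrightarrow> k n x = e (Suc n) (s x))" for n s
  note zB = hlinear_zero[OF Y.B]
  note kc = hlinear_closed[OF k]
  have "\<exists>s. \<forall>n. Q n (s n) \<and> (\<forall>x \<in> carrier (X (Suc n)).
      k (Suc n) x = e (Suc (Suc n)) (s (Suc n) x) \<oplus>\<^bsub>Y (Suc n)\<^esub> s n (d (Suc n) x))"
  proof (rule dependent_nat_choice)
    have "\<exists>s \<in> right_linear_maps K H (X 0) (Y (Suc 0)). \<forall>x \<in> carrier (X 0). e (Suc 0) (s x) = k 0 x \<and> psi (Suc 0) (s x) = \<zero>\<^bsub>B\<^esub>"
    proof (rule liftable_equations[OF l X.X Y.X Y.d k Y.phi zB])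
      show "\<exists>y \<in> carrier (Y (Suc 0)). e (Suc 0) y = k 0 x \<and> psi (Suc 0) y = \<zero>\<^bsub>B\<^esub>" if "x \<in> carrier (X 0)" for x
        by (rule Y.exact) (use that kc aug Y.A_zero in auto)
    qed
    then show "\<exists>s. Q 0 s" by (auto simp: Q_def)
  next
    fix s n assume s: "Q n s"
    then have sl: "s \<in> right_linear_maps K H (X n) (Y (Suc n))" by (simp add: Q_def)
    interpret s: linear_map K "X n" "Y (Suc n)" s
      by (rule linear_mapI[OF X.X_module Y.X_module hlinear_linear[OF sl]])
    interpret en: linear_map K "Y (Suc n)" "Y n" "e (Suc n)"
      by (rule linear_mapI[OF Y.X_module Y.X_module hlinear_linear[OF Y.d]])
    interpret psi: linear_map K "Y (Suc n)" B "psi (Suc n)"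
      by (rule linear_mapI[OF Y.X_module right_hmodule.axioms(1)[OF Y.B] hlinear_linear[OF Y.phi]])
    let ?z = "\<lambda>x. k (Suc n) x \<oplus>\<^bsub>Y (Suc n)\<^esub> \<ominus>\<^bsub>Y (Suc n)\<^esub> s (d (Suc n) x)"
    have z: "?z \<in> right_linear_maps K H (X (Suc n)) (Y (Suc n))"
      by (intro hlinear_plus[OF Y.X] hlinear_uminus[OF Y.X] k hlinear_comp[OF X.d sl])
    have "\<exists>g \<in> right_linear_maps K H (X (Suc n)) (Y (Suc (Suc n))). \<forall>x \<in> carrier (X (Suc n)).
        e (Suc (Suc n)) (g x) = ?z x \<and> psi (Suc (Suc n)) (g x) = \<zero>\<^bsub>B\<^esub>"
    proof (rule liftable_equations[OF l X.X Y.X Y.d z Y.phi zB])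
      fix x assume x: "x \<in> carrier (X (Suc n))"
      note dx = X.d_closed[OF x]
      have dd: "n > 0 \<Longrightarrow> d n (d (Suc n) x) = \<zero>\<^bsub>X (n - 1)\<^esub>" using X.dd[of x "n - 1"] x by simp
      have ks: "k n (d (Suc n) x) = e (Suc n) (s (d (Suc n) x))" using s dx dd unfolding Q_def by blast
      have sdx: "s (d (Suc n) x) \<in> carrier (Y (Suc n))" using dx by simp
      have ez: "e (Suc n) (?z x) = \<zero>\<^bsub>Y n\<^esub>"
        using kc[OF x] sdx en.closed[OF sdx] chain[OF x] ks by (simp add: en.W.r_neg)
      have "psi (Suc n) (s (d (Suc n) x)) = \<zero>\<^bsub>B\<^esub>" using s dx by (simp add: Q_def)
      then have pz: "psi (Suc n) (?z x) = \<zero>\<^bsub>B\<^esub>"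
        using kc[OF x] sdx aug[OF x] by simp
      show "\<exists>y \<in> carrier (Y (Suc (Suc n))). e (Suc (Suc n)) y = ?z x \<and> psi (Suc (Suc n)) y = \<zero>\<^bsub>B\<^esub>"
        by (rule Y.exact[OF hlinear_closed[OF z x] _ pz Y.A_zero]) (simp add: ez)
    qed
    then obtain g where gl: "g \<in> right_linear_maps K H (X (Suc n)) (Y (Suc (Suc n)))"
      and g: "\<And>x. x \<in> carrier (X (Suc n)) \<Longrightarrow> e (Suc (Suc n)) (g x) = ?z x \<and> psi (Suc (Suc n)) (g x) = \<zero>\<^bsub>B\<^esub>" by blast
    have "Q (Suc n) g"
      unfolding Q_def
    proof (intro conjI ballI impI gl)
      show "psi (Suc (Suc n)) (g x) = \<zero>\<^bsub>B\<^esub>" if "x \<in> carrier (X (Suc n))" for x using g[OF that] by simp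
      show "k (Suc n) x = e (Suc (Suc n)) (g x)" if "x \<in> carrier (X (Suc n))" "0 < Suc n \<longrightarrow> d (Suc n) x = \<zero>\<^bsub>X (Suc n - 1)\<^esub>" for x
        using g[OF that(1)] that(2) kc[OF that(1)] by simp
    qed
    moreover have "k (Suc n) x = e (Suc (Suc n)) (g x) \<oplus>\<^bsub>Y (Suc n)\<^esub> s (d (Suc n) x)" if x: "x \<in> carrier (X (Suc n))" for x
      using g[OF x] kc[OF x] X.d_closed[OF x] by (simp add: s.W.a_assoc s.W.l_neg)
    ultimately show "\<exists>g. Q (Suc n) g \<and> (\<forall>x \<in> carrier (X (Suc n)).
        k (Suc n) x = e (Suc (Suc n)) (g x) \<oplus>\<^bsub>Y (Suc n)\<^esub> s (d (Suc n) x))" by (intro exI[of _ g]) simp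
  qed
  then obtain s where s: "\<And>n. Q n (s n)" "\<And>n x. x \<in> carrier (X (Suc n)) \<Longrightarrow>
      k (Suc n) x = e (Suc (Suc n)) (s (Suc n) x) \<oplus>\<^bsub>Y (Suc n)\<^esub> s n (d (Suc n) x)" by blast
  have "s n \<in> right_linear_maps K H (X n) (Y (Suc n))" for n using s(1)[of n] by (simp add: Q_def)
  moreover have "k 0 x = e (Suc 0) (s 0 x)" if "x \<in> carrier (X 0)" for x
    using s(1)[of 0] that by (simp add: Q_def)
  ultimately show ?thesis using s(2) by (intro exI[of _ s]) simp
qed

section \<open>Homology\<close>

locale kcomplex =
  fixes K :: "'k ring" and C :: "nat \<Rightarrow> ('k, 'v) module" and d :: "nat \<Rightarrow> 'v \<Rightarrow> 'v"
  assumes C: "module K (C n)" and d: "d (Suc n) \<in> linear_maps K (C (Suc n)) (C n)"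
    and dd: "x \<in> carrier (C (Suc (Suc n))) \<Longrightarrow> d (Suc n) (d (Suc (Suc n)) x) = \<zero>\<^bsub>C n\<^esub>"
begin

abbreviation Z where "Z n \<equiv> (C n)\<lparr>carrier := cycles C d n\<rparr>"
abbreviation bd where "bd n \<equiv> d (Suc n) ` carrier (C (Suc n))"

lemma cycles_submodule: "submodule (cycles C d n) K (C n)"
proof (cases n)
  case 0
  interpret module K "C 0" by (rule C)
  show ?thesis using carrier_is_submodule by (simp add: cycles_def 0)
next
  case (Suc m)
  then show ?thesis using linear_eq_kernel[OF C C d[of m]] by (simp add: cycles_def)
qed

lemma Z_module: "module K (Z n)"
  by (rule submodule.submodule_is_module[OF cycles_submodule C])

lemma cyclesD: "x \<in> cycles C d n \<Longrightarrow> x \<in> carrier (C n)"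
  "x \<in> cycles C d (Suc n) \<Longrightarrow> d (Suc n) x = \<zero>\<^bsub>C n\<^esub>"
  by (simp_all add: cycles_def)

lemma bd_cycles: "x \<in> bd n \<Longrightarrow> x \<in> cycles C d n"
  using linear_closed[OF d] dd by (cases n) (auto simp: cycles_def)

lemma Z_a_inv: assumes x: "x \<in> cycles C d n" shows "\<ominus>\<^bsub>Z n\<^esub> x = \<ominus>\<^bsub>C n\<^esub> x"
proof -
  interpret C: module K "C n" by (rule C)
  interpret Z: module K "Z n" by (rule Z_module)
  have "\<ominus>\<^bsub>C n\<^esub> x \<in> cycles C d n" using C.submoduleE(3)[OF cycles_submodule x] .
  then show ?thesis
    using Z.minus_equality[of "\<ominus>\<^bsub>C n\<^esub> x" x] x cyclesD(1)[OF x] by (simp add: C.l_neg)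
qed

lemma homology_quotient: "quotient_space K (Z n) (bd n)"
proof (intro quotient_space.intro Z_module)
  interpret C: module K "C n" by (rule C)
  interpret C1: module K "C (Suc n)" by (rule C)
  interpret d: linear_map K "C (Suc n)" "C n" "d (Suc n)" by (rule linear_mapI[OF C C d])
  interpret Z: module K "Z n" by (rule Z_module)
  show "submodule (bd n) K (Z n)"
  proof (rule Z.submoduleI)
    show "bd n \<subseteq> carrier (Z n)" using bd_cycles by auto
    show "\<zero>\<^bsub>Z n\<^esub> \<in> bd n" using d.zero[symmetric] by (intro image_eqI[of _ _ "\<zero>\<^bsub>C (Suc n)\<^esub>"]) simp_all
    show "\<ominus>\<^bsub>Z n\<^esub> x \<in> bd n" if bx: "x \<in> bd n" for x
    proof -
      obtain y where y: "x = d (Suc n) y" "y \<in> carrier (C (Suc n))" using bx by blast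
      then have "\<ominus>\<^bsub>Z n\<^esub> x = d (Suc n) (\<ominus>\<^bsub>C (Suc n)\<^esub> y)" using Z_a_inv[OF bd_cycles[OF bx]] by simp
      then show ?thesis using y by (intro image_eqI[of _ _ "\<ominus>\<^bsub>C (Suc n)\<^esub> y"]) simp_all
    qed
    show "x \<oplus>\<^bsub>Z n\<^esub> y \<in> bd n" if "x \<in> bd n" "y \<in> bd n" for x y
    proof -
      obtain x' y' where "x = d (Suc n) x'" "x' \<in> carrier (C (Suc n))" "y = d (Suc n) y'" "y' \<in> carrier (C (Suc n))"
        using \<open>x \<in> bd n\<close> \<open>y \<in> bd n\<close> by blast
      then show ?thesis by (intro image_eqI[of _ _ "x' \<oplus>\<^bsub>C (Suc n)\<^esub> y'"]) simp_all
    qed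
    show "a \<odot>\<^bsub>Z n\<^esub> x \<in> bd n" if ax: "a \<in> carrier K" "x \<in> bd n" for a x
    proof -
      obtain x' where "x = d (Suc n) x'" "x' \<in> carrier (C (Suc n))" using ax by blast
      then show ?thesis using ax by (intro image_eqI[of _ _ "a \<odot>\<^bsub>C (Suc n)\<^esub> x'"]) simp_all
    qed
  qed
qed

lemma homology_eq: "homology C d n = quotient_module (Z n) (bd n)"
  by (simp add: homology_def)

end

text \<open>
  A homotopy equivalence enters only through its effect on cycles, where both composites change a
  cycle by a boundary: \<open>fg\<close> gives surjectivity and \<open>gf\<close> gives injectivity on homology.
\<close>

theorem homology_iso:
  assumes C: "kcomplex K C d" and C': "kcomplex K C' d'"
    and f: "\<And>n. f n \<in> linear_maps K (C n) (C' n)" and g: "\<And>n. g n \<in> linear_maps K (C' n) (C n)"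
    and fd: "\<And>n x. x \<in> carrier (C (Suc n)) \<Longrightarrow> d' (Suc n) (f (Suc n) x) = f n (d (Suc n) x)"
    and gd: "\<And>n x. x \<in> carrier (C' (Suc n)) \<Longrightarrow> d (Suc n) (g (Suc n) x) = g n (d' (Suc n) x)"
    and gf: "\<And>n x. x \<in> cycles C d n \<Longrightarrow> g n (f n x) \<ominus>\<^bsub>C n\<^esub> x \<in> d (Suc n) ` carrier (C (Suc n))"
    and fg: "\<And>n x. x \<in> cycles C' d' n \<Longrightarrow> f n (g n x) \<ominus>\<^bsub>C' n\<^esub> x \<in> d' (Suc n) ` carrier (C' (Suc n))"
  shows "linearly_isomorphic K (homology C d n) (homology C' d' n)"
proof -
  interpret C: kcomplex K C d by fact
  interpret C': kcomplex K C' d' by fact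
  interpret Cn: module K "C n" by (rule C.C)
  interpret C'n: module K "C' n" by (rule C'.C)
  interpret fn: linear_map K "C n" "C' n" "f n" by (rule linear_mapI[OF C.C C'.C f])
  interpret gn: linear_map K "C' n" "C n" "g n" by (rule linear_mapI[OF C'.C C.C g])
  interpret q': quotient_space K "C'.Z n" "C'.bd n" by (rule C'.homology_quotient)
  have fc: "f n x \<in> cycles C' d' n" if "x \<in> cycles C d n" for x
  proof (cases n)
    case 0
    then show ?thesis using C.cyclesD(1)[OF that] fn.closed by (simp add: cycles_def)
  next
    case (Suc m)
    interpret fm: linear_map K "C m" "C' m" "f m" by (rule linear_mapI[OF C.C C'.C f])
    show ?thesis using that fd[of x m] fn.closed[of x] by (simp add: cycles_def Suc)
  qed
  have gc: "g n x \<in> cycles C d n" if "x \<in> cycles C' d' n" for x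
  proof (cases n)
    case 0
    then show ?thesis using C'.cyclesD(1)[OF that] gn.closed by (simp add: cycles_def)
  next
    case (Suc m)
    interpret gm: linear_map K "C' m" "C m" "g m" by (rule linear_mapI[OF C'.C C.C g])
    show ?thesis using that gd[of x m] gn.closed[of x] by (simp add: cycles_def Suc)
  qed
  have fl: "f n \<in> linear_maps K (C.Z n) (C'.Z n)"
    using fc C.cyclesD(1) by (intro linear_mapsI) simp_all
  have pl: "(\<lambda>x. q'.proj (f n x)) \<in> linear_maps K (C.Z n) (homology C' d' n)"
    unfolding C'.homology_eq by (rule linear_comp[OF fl q'.proj_linear])
  have surj: "(\<lambda>x. q'.proj (f n x)) ` carrier (C.Z n) = carrier (homology C' d' n)"
  proof
    show "(\<lambda>x. q'.proj (f n x)) ` carrier (C.Z n) \<subseteq> carrier (homology C' d' n)"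
      using linear_closed[OF pl] by blast
    show "carrier (homology C' d' n) \<subseteq> (\<lambda>x. q'.proj (f n x)) ` carrier (C.Z n)"
    proof
      fix y assume "y \<in> carrier (homology C' d' n)"
      then obtain z where z: "y = q'.proj z" "z \<in> cycles C' d' n" by (auto simp: C'.homology_eq q'.carrier_Q)
      have "f n (g n z) \<ominus>\<^bsub>C'.Z n\<^esub> z = f n (g n z) \<ominus>\<^bsub>C' n\<^esub> z"
        using C'.Z_a_inv[OF z(2)] by (simp add: a_minus_def)
      then have "q'.proj (f n (g n z)) = q'.proj z"
        using q'.proj_eq_iff[of "f n (g n z)" z] fc[OF gc[OF z(2)]] z(2) fg[OF z(2)] by simp
      then show "y \<in> (\<lambda>x. q'.proj (f n x)) ` carrier (C.Z n)" using z gc[OF z(2)] by (intro image_eqI[of _ _ "g n z"]) simp_all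
    qed
  qed
  have ker: "C.bd n = {x \<in> carrier (C.Z n). q'.proj (f n x) = \<zero>\<^bsub>homology C' d' n\<^esub>}"
  proof (intro equalityI subsetI)
    fix x assume x: "x \<in> C.bd n"
    then obtain w where w: "x = d (Suc n) w" "w \<in> carrier (C (Suc n))" by blast
    have xc: "x \<in> cycles C d n" by (rule C.bd_cycles[OF x])
    have "f n x = d' (Suc n) (f (Suc n) w)" using fd[OF w(2)] w by simp
    then have "f n x \<in> C'.bd n" using linear_closed[OF f w(2)] by simp
    then show "x \<in> {x \<in> carrier (C.Z n). q'.proj (f n x) = \<zero>\<^bsub>homology C' d' n\<^esub>}"
      using xc q'.proj_zero_iff[of "f n x"] fc[OF xc] by (simp add: C'.homology_eq)
  next
    fix x assume "x \<in> {x \<in> carrier (C.Z n). q'.proj (f n x) = \<zero>\<^bsub>homology C' d' n\<^esub>}"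
    then have xc: "x \<in> cycles C d n" and "f n x \<in> C'.bd n"
      using q'.proj_zero_iff[of "f n x"] fc by (auto simp: C'.homology_eq)
    then obtain w where w: "f n x = d' (Suc n) w" "w \<in> carrier (C' (Suc n))" by blast
    interpret d: linear_map K "C (Suc n)" "C n" "d (Suc n)" by (rule linear_mapI[OF C.C C.C C.d])
    obtain y where y: "y \<in> carrier (C (Suc n))" "g n (f n x) \<ominus>\<^bsub>C n\<^esub> x = d (Suc n) y" using gf[OF xc] by blast
    have x: "x \<in> carrier (C n)" by (rule C.cyclesD(1)[OF xc])
    have gw: "g (Suc n) w \<in> carrier (C (Suc n))" by (rule linear_closed[OF g w(2)])
    have gfx: "g n (f n x) = d (Suc n) (g (Suc n) w)" using gd[OF w(2)] w by simp
    have gx: "g n (f n x) \<in> carrier (C n)" using x by simp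
    have "x = g n (f n x) \<ominus>\<^bsub>C n\<^esub> (g n (f n x) \<ominus>\<^bsub>C n\<^esub> x)"
      using x gx by (simp add: a_minus_def Cn.minus_add Cn.r_neg2)
    also have "\<dots> = g n (f n x) \<ominus>\<^bsub>C n\<^esub> d (Suc n) y" by (simp only: y(2))
    also have "\<dots> = d (Suc n) (g (Suc n) w \<ominus>\<^bsub>C (Suc n)\<^esub> y)"
      unfolding gfx using gw y(1) by simp
    finally show "x \<in> C.bd n"
      by (rule image_eqI) (rule d.V.minus_closed[OF gw y(1)])
  qed
  have "linearly_isomorphic K (quotient_module (C.Z n) (C.bd n)) (homology C' d' n)"
    by (rule linearly_isomorphic_quotient[OF C.Z_module _ pl surj ker]) (simp add: C'.homology_eq q'.module_Q)
  then show ?thesis by (simp add: C.homology_eq)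
qed

text \<open>
  The differential \<open>d'\<close> is determined by \<open>d\<close> and the isomorphisms, so that it inherits linearity and square zero.
\<close>

lemma complex_transport:
  assumes C: "kcomplex K C d" and C': "\<And>n. module K (C' n)"
    and f: "\<And>n. f n \<in> linear_maps K (C n) (C' n)" and g: "\<And>n. g n \<in> linear_maps K (C' n) (C n)"
    and fg: "\<And>n y. y \<in> carrier (C' n) \<Longrightarrow> f n (g n y) = y" and gf: "\<And>n x. x \<in> carrier (C n) \<Longrightarrow> g n (f n x) = x"
    and fd: "\<And>n x. x \<in> carrier (C (Suc n)) \<Longrightarrow> d' (Suc n) (f (Suc n) x) = f n (d (Suc n) x)"
  shows "kcomplex K C' d'" and "linearly_isomorphic K (homology C d n) (homology C' d' n)"
proof -
  interpret C: kcomplex K C d by fact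
  note gcl = linear_closed[OF g]
  have d': "d' (Suc n) y = f n (d (Suc n) (g (Suc n) y))" if "y \<in> carrier (C' (Suc n))" for n y
    using fd[OF gcl[OF that]] fg[OF that] by simp
  have dcl: "d (Suc n) x \<in> carrier (C n)" if "x \<in> carrier (C (Suc n))" for n x by (rule linear_closed[OF C.d that])
  show K': "kcomplex K C' d'"
  proof (rule kcomplex.intro)
    show "module K (C' n)" for n by (rule C')
    show "d' (Suc n) \<in> linear_maps K (C' (Suc n)) (C' n)" for n
      by (rule linear_cong[OF C' d' linear_comp[OF linear_comp[OF g C.d] f]])
    fix n y assume y: "y \<in> carrier (C' (Suc (Suc n)))"
    interpret fn: linear_map K "C n" "C' n" "f n" by (rule linear_mapI[OF C.C C' f])
    show "d' (Suc n) (d' (Suc (Suc n)) y) = \<zero>\<^bsub>C' n\<^esub>"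
      by (simp only: d'[OF y] fd[OF dcl[OF gcl[OF y]]] C.dd[OF gcl[OF y]] fn.zero)
  qed
  interpret C': kcomplex K C' d' by (rule K')
  show "linearly_isomorphic K (homology C d n) (homology C' d' n)"
  proof (rule homology_iso[where f = f and g = g, OF C K' f g fd])
    show "d (Suc n) (g (Suc n) x) = g n (d' (Suc n) x)" if "x \<in> carrier (C' (Suc n))" for n x
      using gf[OF dcl[OF gcl[OF that]]] d'[OF that] by simp
    show "g n (f n x) \<ominus>\<^bsub>C n\<^esub> x \<in> d (Suc n) ` carrier (C (Suc n))" if "x \<in> cycles C d n" for n x
    proof -
      interpret d: linear_map K "C (Suc n)" "C n" "d (Suc n)" by (rule linear_mapI[OF C.C C.C C.d])
      show ?thesis using C.cyclesD(1)[OF that] d.zero[symmetric]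
        by (intro image_eqI[of _ _ "\<zero>\<^bsub>C (Suc n)\<^esub>"]) (simp_all add: gf)
    qed
    show "f n (g n x) \<ominus>\<^bsub>C' n\<^esub> x \<in> d' (Suc n) ` carrier (C' (Suc n))" if "x \<in> cycles C' d' n" for n x
    proof -
      interpret d: linear_map K "C' (Suc n)" "C' n" "d' (Suc n)" by (rule linear_mapI[OF C' C' C'.d])
      show ?thesis using C'.cyclesD(1)[OF that] d.zero[symmetric]
        by (intro image_eqI[of _ _ "\<zero>\<^bsub>C' (Suc n)\<^esub>"]) (simp_all add: fg)
    qed
  qed
qed

section \<open>Tensoring complexes\<close>

context crossed_module
begin

abbreviation balC where "balC X n \<equiv> bal (X n)"
abbreviation bald where "bald X d n \<equiv> bmap (X (n - 1)) (d n)"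

lemma bal_complex:
  assumes X: "augmented_complex K H B A X d phi"
  shows "kcomplex K (balC X) (bald X d)"
proof -
  interpret X: augmented_complex K H B A X d phi by fact
  show ?thesis
  proof (rule kcomplex.intro)
    show "module K (bal (X n))" for n by (rule bal_module[OF X.X])
    show "bmap (X (Suc n - 1)) (d (Suc n)) \<in> linear_maps K (bal (X (Suc n))) (bal (X n))" for n
      using bmap_linear[OF X.X X.X X.d] by simp
    fix n u assume u: "u \<in> carrier (bal (X (Suc (Suc n))))"
    have "bmap (X n) (d (Suc n)) (bmap (X (Suc n)) (d (Suc (Suc n))) u) = bmap (X n) (\<lambda>x. d (Suc n) (d (Suc (Suc n)) x)) u"
      by (rule bmap_comp[OF X.X X.X X.X X.d X.d u, symmetric])
    also have "\<dots> = bmap (X n) (\<lambda>x. \<zero>\<^bsub>X n\<^esub>) u"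
      by (rule bmap_cong[OF X.X X.X hlinear_comp[OF X.d X.d] hlinear_zero[OF X.X] X.dd u])
    also have "\<dots> = \<zero>\<^bsub>bal (X n)\<^esub>" by (rule bmap_zero[OF X.X X.X u])
    finally show "bmap (X (Suc n - 1)) (d (Suc n)) (bmap (X (Suc (Suc n) - 1)) (d (Suc (Suc n))) u) = \<zero>\<^bsub>bal (X n)\<^esub>" by simp
  qed
qed

text \<open>
  Tensoring preserves the homotopy formula, and on a cycle the summand with \<open>s d\<close> vanishes.
\<close>

lemma bal_homotopy:
  assumes X: "augmented_complex K H B A X d phi"
    and m: "\<And>n. m n \<in> right_linear_maps K H (X n) (X n)"
    and s: "\<And>n. s n \<in> right_linear_maps K H (X n) (X (Suc n))"
    and h0: "\<And>x. x \<in> carrier (X 0) \<Longrightarrow> m 0 x \<oplus>\<^bsub>X 0\<^esub> \<ominus>\<^bsub>X 0\<^esub> x = d (Suc 0) (s 0 x)"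
    and h: "\<And>n x. x \<in> carrier (X (Suc n)) \<Longrightarrow>
      m (Suc n) x \<oplus>\<^bsub>X (Suc n)\<^esub> \<ominus>\<^bsub>X (Suc n)\<^esub> x = d (Suc (Suc n)) (s (Suc n) x) \<oplus>\<^bsub>X (Suc n)\<^esub> s n (d (Suc n) x)"
    and u: "u \<in> cycles (balC X) (bald X d) n"
  shows "bmap (X n) (m n) u \<ominus>\<^bsub>bal (X n)\<^esub> u \<in> bald X d (Suc n) ` carrier (balC X (Suc n))"
proof -
  interpret X: augmented_complex K H B A X d phi by fact
  have uc: "u \<in> carrier (bal (X n))" using u by (simp add: cycles_def)
  note id = hlinear_id[of K H "X n"]
  have "bmap (X n) (m n) u \<ominus>\<^bsub>bal (X n)\<^esub> u = bmap (X n) (m n) u \<oplus>\<^bsub>bal (X n)\<^esub> bmap (X n) (\<lambda>x. \<ominus>\<^bsub>X n\<^esub> x) u"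
    using bmap_uminus[OF X.X X.X id uc] bmap_id[OF X.X uc] by (simp add: a_minus_def)
  also have "\<dots> = bmap (X n) (\<lambda>x. m n x \<oplus>\<^bsub>X n\<^esub> \<ominus>\<^bsub>X n\<^esub> x) u"
    by (rule bmap_plus[OF X.X X.X m hlinear_uminus[OF X.X id] uc, symmetric])
  also have "\<dots> = bmap (X n) (d (Suc n)) (bmap (X (Suc n)) (s n) u)"
  proof (cases n)
    case 0
    have u0: "u \<in> carrier (bal (X 0))" using uc 0 by simp
    have "bmap (X 0) (\<lambda>x. m 0 x \<oplus>\<^bsub>X 0\<^esub> \<ominus>\<^bsub>X 0\<^esub> x) u = bmap (X 0) (\<lambda>x. d (Suc 0) (s 0 x)) u"
      by (rule bmap_cong[OF X.X X.X hlinear_plus[OF X.X m hlinear_uminus[OF X.X hlinear_id]]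
            hlinear_comp[OF s X.d] h0 u0])
    also have "\<dots> = bmap (X 0) (d (Suc 0)) (bmap (X (Suc 0)) (s 0) u)" by (rule bmap_comp[OF X.X X.X X.X s X.d u0])
    finally show ?thesis by (simp only: 0)
  next
    case (Suc l)
    have u1: "u \<in> carrier (bal (X (Suc l)))" using uc Suc by simp
    have du: "bmap (X l) (d (Suc l)) u = \<zero>\<^bsub>bal (X l)\<^esub>" using u Suc by (simp add: cycles_def)
    interpret b: module K "bal (X (Suc l))" by (rule bal_module[OF X.X])
    interpret sl: linear_map K "bal (X l)" "bal (X (Suc l))" "bmap (X (Suc l)) (s l)"
      by (rule linear_mapI[OF bal_module[OF X.X] bal_module[OF X.X] bmap_linear[OF X.X X.X s]])
    have cl: "bmap (X (Suc l)) (d (Suc (Suc l))) (bmap (X (Suc (Suc l))) (s (Suc l)) u) \<in> carrier (bal (X (Suc l)))"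
      by (rule bmap_closed[OF X.X X.X X.d bmap_closed[OF X.X X.X s u1]])
    have "bmap (X (Suc l)) (\<lambda>x. m (Suc l) x \<oplus>\<^bsub>X (Suc l)\<^esub> \<ominus>\<^bsub>X (Suc l)\<^esub> x) u =
        bmap (X (Suc l)) (\<lambda>x. d (Suc (Suc l)) (s (Suc l) x) \<oplus>\<^bsub>X (Suc l)\<^esub> s l (d (Suc l) x)) u"
      by (rule bmap_cong[OF X.X X.X hlinear_plus[OF X.X m hlinear_uminus[OF X.X hlinear_id]]
            hlinear_plus[OF X.X hlinear_comp[OF s X.d] hlinear_comp[OF X.d s]] h u1])
    also have "\<dots> = bmap (X (Suc l)) (\<lambda>x. d (Suc (Suc l)) (s (Suc l) x)) u \<oplus>\<^bsub>bal (X (Suc l))\<^esub> bmap (X (Suc l)) (\<lambda>x. s l (d (Suc l) x)) u"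
      by (rule bmap_plus[OF X.X X.X hlinear_comp[OF s X.d] hlinear_comp[OF X.d s] u1])
    also have "bmap (X (Suc l)) (\<lambda>x. s l (d (Suc l) x)) u = \<zero>\<^bsub>bal (X (Suc l))\<^esub>"
      unfolding bmap_comp[OF X.X X.X X.X X.d s u1] du by (rule sl.zero)
    also have "bmap (X (Suc l)) (\<lambda>x. d (Suc (Suc l)) (s (Suc l) x)) u =
        bmap (X (Suc l)) (d (Suc (Suc l))) (bmap (X (Suc (Suc l))) (s (Suc l)) u)"
      by (rule bmap_comp[OF X.X X.X X.X s X.d u1])
    finally show ?thesis using cl by (simp add: Suc)
  qed
  finally show ?thesis using bmap_closed[OF X.X X.X s uc] by (intro image_eqI) simp_all
qed

text \<open>
  Comparison maps in both directions exist since the modules of both complexes are projective. Their composites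
  lie over the identity of \<open>A\<close>, so they differ from the identity by a map of augmentation zero, which is
  null-homotopic.
\<close>

theorem bal_resolutions_iso:
  assumes X: "augmented_resolution K H B A X d phi" and Y: "augmented_resolution K H B A Y e psi"
    and XX: "\<And>m n. liftable K H (X m) (X n)" and XY: "\<And>m n. liftable K H (X m) (Y n)"
    and YX: "\<And>m n. liftable K H (Y m) (X n)" and YY: "\<And>m n. liftable K H (Y m) (Y n)"
  shows "linearly_isomorphic K (homology (balC X) (bald X d) n) (homology (balC Y) (bald Y e) n)"
proof -
  interpret X: augmented_resolution K H B A X d phi by fact
  interpret Y: augmented_resolution K H B A Y e psi by fact
  note Xc = X.augmented_complex_axioms and Yc = Y.augmented_complex_axioms
  obtain f where f: "\<And>n. f n \<in> right_linear_maps K H (X n) (Y n)"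
    and fpsi: "\<And>n x. x \<in> carrier (X n) \<Longrightarrow> psi n (f n x) = phi n x"
    and fd: "\<And>n x. x \<in> carrier (X (Suc n)) \<Longrightarrow> e (Suc n) (f (Suc n) x) = f n (d (Suc n) x)"
    using comparison_map[OF Xc Y XY] by blast
  obtain g where g: "\<And>n. g n \<in> right_linear_maps K H (Y n) (X n)"
    and gpsi: "\<And>n x. x \<in> carrier (Y n) \<Longrightarrow> phi n (g n x) = psi n x"
    and gd: "\<And>n x. x \<in> carrier (Y (Suc n)) \<Longrightarrow> d (Suc n) (g (Suc n) x) = g n (e (Suc n) x)"
    using comparison_map[OF Yc X YX] by blast
  have chain: "bmap (Y (Suc n - 1)) (e (Suc n)) (bmap (Y (Suc n)) (f (Suc n)) u) = bmap (Y n) (f n) (bmap (X (Suc n - 1)) (d (Suc n)) u)"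
    if Xr: "augmented_resolution K H B A X d phi" and Yr: "augmented_resolution K H B A Y e psi"
      and f: "\<And>n. f n \<in> right_linear_maps K H (X n) (Y n)"
      and fd: "\<And>n x. x \<in> carrier (X (Suc n)) \<Longrightarrow> e (Suc n) (f (Suc n) x) = f n (d (Suc n) x)"
      and u: "u \<in> carrier (bal (X (Suc n)))"
    for X :: "nat \<Rightarrow> ('k, 'h, 'y) right_module" and d phi and Y :: "nat \<Rightarrow> ('k, 'h, 'z) right_module" and e psi f n u
  proof -
    interpret X: augmented_resolution K H B A X d phi by (rule Xr)
    interpret Y: augmented_resolution K H B A Y e psi by (rule Yr)
    show ?thesis
      using bmap_comp[OF X.X Y.X Y.X f Y.d u] bmap_comp[OF X.X X.X Y.X X.d f u]
        bmap_cong[OF X.X Y.X hlinear_comp[OF f Y.d] hlinear_comp[OF X.d f] fd u] by simp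
  qed
  have inv: "bmap (X n) (g n) (bmap (Y n) (f n) u) \<ominus>\<^bsub>bal (X n)\<^esub> u \<in> bald X d (Suc n) ` carrier (balC X (Suc n))"
    if Xr: "augmented_resolution K H B A X d phi" and Yr: "augmented_resolution K H B A Y e psi"
      and l: "\<And>m n. liftable K H (X m) (X n)"
      and f: "\<And>n. f n \<in> right_linear_maps K H (X n) (Y n)" and g: "\<And>n. g n \<in> right_linear_maps K H (Y n) (X n)"
      and fd: "\<And>n x. x \<in> carrier (X (Suc n)) \<Longrightarrow> e (Suc n) (f (Suc n) x) = f n (d (Suc n) x)"
      and gd: "\<And>n x. x \<in> carrier (Y (Suc n)) \<Longrightarrow> d (Suc n) (g (Suc n) x) = g n (e (Suc n) x)"
      and fpsi: "\<And>n x. x \<in> carrier (X n) \<Longrightarrow> psi n (f n x) = phi n x"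
      and gpsi: "\<And>n x. x \<in> carrier (Y n) \<Longrightarrow> phi n (g n x) = psi n x"
      and u: "u \<in> cycles (balC X) (bald X d) n"
    for X :: "nat \<Rightarrow> ('k, 'h, 'y) right_module" and d phi and Y :: "nat \<Rightarrow> ('k, 'h, 'z) right_module" and e psi f g n u
  proof -
    interpret X: augmented_resolution K H B A X d phi by (rule Xr)
    interpret Y: augmented_resolution K H B A Y e psi by (rule Yr)
    have gf: "(\<lambda>x. g n (f n x)) \<in> right_linear_maps K H (X n) (X n)" for n by (rule hlinear_comp[OF f g])
    let ?k = "\<lambda>n x. g n (f n x) \<oplus>\<^bsub>X n\<^esub> \<ominus>\<^bsub>X n\<^esub> x"
    have "\<exists>s. (\<forall>n. s n \<in> right_linear_maps K H (X n) (X (Suc n))) \<and>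
      (\<forall>x \<in> carrier (X 0). ?k 0 x = d (Suc 0) (s 0 x)) \<and>
      (\<forall>n. \<forall>x \<in> carrier (X (Suc n)). ?k (Suc n) x = d (Suc (Suc n)) (s (Suc n) x) \<oplus>\<^bsub>X (Suc n)\<^esub> s n (d (Suc n) x))"
    proof (rule null_homotopy[where k = ?k, OF X.augmented_complex_axioms Xr l])
      show "?k n \<in> right_linear_maps K H (X n) (X n)" for n
        by (rule hlinear_plus[OF X.X gf hlinear_uminus[OF X.X hlinear_id]])
      show "d (Suc n) (?k (Suc n) x) = ?k n (d (Suc n) x)" if x: "x \<in> carrier (X (Suc n))" for n x
      proof -
        interpret dn: linear_map K "X (Suc n)" "X n" "d (Suc n)"
          by (rule linear_mapI[OF X.X_module X.X_module hlinear_linear[OF X.d]])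
        have fx: "f (Suc n) x \<in> carrier (Y (Suc n))" by (rule hlinear_closed[OF f x])
        have "g (Suc n) (f (Suc n) x) \<in> carrier (X (Suc n))" by (rule hlinear_closed[OF g fx])
        then show ?thesis using x by (simp add: gd[OF fx] fd[OF x])
      qed
      show "phi n (?k n x) = \<zero>\<^bsub>B\<^esub>" if x: "x \<in> carrier (X n)" for n x
      proof -
        interpret ph: linear_map K "X n" B "phi n"
          by (rule linear_mapI[OF X.X_module right_hmodule.axioms(1)[OF X.B] hlinear_linear[OF X.phi]])
        have fx: "f n x \<in> carrier (Y n)" by (rule hlinear_closed[OF f x])
        have "g n (f n x) \<in> carrier (X n)" by (rule hlinear_closed[OF g fx])
        then show ?thesis using x by (simp add: gpsi[OF fx] fpsi[OF x] ph.W.r_neg)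
      qed
    qed
    then obtain s where s: "\<And>n. s n \<in> right_linear_maps K H (X n) (X (Suc n))"
      and h0: "\<And>x. x \<in> carrier (X 0) \<Longrightarrow> ?k 0 x = d (Suc 0) (s 0 x)"
      and h: "\<And>n x. x \<in> carrier (X (Suc n)) \<Longrightarrow>
        ?k (Suc n) x = d (Suc (Suc n)) (s (Suc n) x) \<oplus>\<^bsub>X (Suc n)\<^esub> s n (d (Suc n) x)" by blast
    have "u \<in> carrier (bal (X n))" using u by (simp add: cycles_def)
    from bmap_comp[OF X.X Y.X X.X f g this] bal_homotopy[where m = "\<lambda>n x. g n (f n x)" and s = s, OF X.augmented_complex_axioms gf s h0 h u]
    show ?thesis by simp
  qed
  show ?thesis
  proof (rule homology_iso[where f = "\<lambda>n. bmap (Y n) (f n)" and g = "\<lambda>n. bmap (X n) (g n)", OF bal_complex[OF Xc] bal_complex[OF Yc]])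
    show "bmap (Y n) (f n) \<in> linear_maps K (bal (X n)) (bal (Y n))" for n by (rule bmap_linear[OF X.X Y.X f])
    show "bmap (X n) (g n) \<in> linear_maps K (bal (Y n)) (bal (X n))" for n by (rule bmap_linear[OF Y.X X.X g])
    show "bmap (Y (Suc n - 1)) (e (Suc n)) (bmap (Y (Suc n)) (f (Suc n)) u) = bmap (Y n) (f n) (bmap (X (Suc n - 1)) (d (Suc n)) u)"
      if "u \<in> carrier (bal (X (Suc n)))" for n u
      by (rule chain[of X d phi Y e psi f, OF X Y f fd that])
    show "bmap (X (Suc n - 1)) (d (Suc n)) (bmap (X (Suc n)) (g (Suc n)) u) = bmap (X n) (g n) (bmap (Y (Suc n - 1)) (e (Suc n)) u)"
      if "u \<in> carrier (bal (Y (Suc n)))" for n u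
      by (rule chain[of Y e psi X d phi g, OF Y X g gd that])
    show "bmap (X n) (g n) (bmap (Y n) (f n) u) \<ominus>\<^bsub>bal (X n)\<^esub> u \<in> bald X d (Suc n) ` carrier (balC X (Suc n))"
      if "u \<in> cycles (balC X) (bald X d) n" for n u
      by (rule inv[of X d phi Y e psi f g, OF X Y XX f g fd gd fpsi gpsi that])
    show "bmap (Y n) (f n) (bmap (X n) (g n) u) \<ominus>\<^bsub>bal (Y n)\<^esub> u \<in> bald Y e (Suc n) ` carrier (balC Y (Suc n))"
      if "u \<in> cycles (balC Y) (bald Y e) n" for n u
      by (rule inv[of Y e psi X d phi g f, OF Y X YY g f gd fd gpsi fpsi that])
  qed
qed

subsection \<open>Tensoring finite direct sums\<close>

text \<open>
  Tensoring commutes with finite direct sums: projections and inclusions induce mutually inverse maps.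
\<close>

definition bal_split where "bal_split I X u = (\<lambda>i\<in>I. bmap (X i) (\<lambda>f. f i) u)"
definition bal_join where "bal_join I X w = (\<Oplus>\<^bsub>bal (rsum I X)\<^esub>i\<in>I. bmap (rsum I X) (inj I X i) (w i))"

lemma
  assumes "right_module_sum K H I X"
  shows bal_split_linear: "bal_split I X \<in> linear_maps K (bal (rsum I X)) (direct_sum I (\<lambda>i. bal (X i)))"
    and bal_join_linear: "bal_join I X \<in> linear_maps K (direct_sum I (\<lambda>i. bal (X i))) (bal (rsum I X))"
    and bal_split_join: "w \<in> carrier (direct_sum I (\<lambda>i. bal (X i))) \<Longrightarrow> bal_split I X (bal_join I X w) = w"
    and bal_join_split: "u \<in> carrier (bal (rsum I X)) \<Longrightarrow> bal_join I X (bal_split I X u) = u"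
proof -
  interpret S: right_module_sum K H I X by fact
  let ?S = "rsum I X" and ?D = "direct_sum I (\<lambda>i. bal (X i))"
  note SX = S.S_right_hmodule note X = S.X
  interpret bS: module K "bal ?S" by (rule bal_module[OF SX])
  note pl = bmap_linear[OF SX X S.proj_right_linear] note il = bmap_linear[OF X SX S.inj_right_linear]
  show "bal_split I X \<in> linear_maps K (bal ?S) ?D"
  proof (rule linear_mapsI)
    show "bal_split I X u \<in> carrier ?D" if "u \<in> carrier (bal ?S)" for u
      using linear_closed[OF pl that] by (simp add: bal_split_def direct_sum_carrier_finite S.fin)
    show "bal_split I X (u \<oplus>\<^bsub>bal ?S\<^esub> v) = bal_split I X u \<oplus>\<^bsub>?D\<^esub> bal_split I X v"
      if "u \<in> carrier (bal ?S)" "v \<in> carrier (bal ?S)" for u v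
      using that unfolding bal_split_def direct_sum_simps by (intro restrict_ext) (simp add: linear_add[OF pl])
    show "bal_split I X (a \<odot>\<^bsub>bal ?S\<^esub> u) = a \<odot>\<^bsub>?D\<^esub> bal_split I X u" if "a \<in> carrier K" "u \<in> carrier (bal ?S)" for a u
      using that unfolding bal_split_def direct_sum_simps by (intro restrict_ext) (simp add: linear_smult[OF pl])
  qed
  have D: "w i \<in> carrier (bal (X i))" if "w \<in> carrier ?D" "i \<in> I" for w i
    using that by (simp add: direct_sum_carrier)
  have projD: "(\<lambda>w. w i) \<in> linear_maps K ?D (bal (X i))" if "i \<in> I" for i
    using that by (intro linear_mapsI) (simp_all add: D)
  show "bal_join I X \<in> linear_maps K ?D (bal ?S)"
    unfolding bal_join_def[abs_def]
    by (rule linear_finsum[OF bal_module[OF SX] S.fin linear_comp[OF projD il]])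
  show "bal_split I X (bal_join I X w) = w" if w: "w \<in> carrier ?D"
  proof (rule extensionalityI[of _ I])
    show "bal_split I X (bal_join I X w) \<in> extensional I" by (simp add: bal_split_def)
    show "w \<in> extensional I" using w by (simp add: direct_sum_carrier)
    fix k assume k: "k \<in> I"
    interpret bk: module K "bal (X k)" by (rule bal_module[OF X[OF k]])
    have "bmap (X k) (\<lambda>f. f k) (bal_join I X w) = (\<Oplus>\<^bsub>bal (X k)\<^esub>i\<in>I. bmap (X k) (\<lambda>f. f k) (bmap ?S (inj I X i) (w i)))"
      unfolding bal_join_def
      by (rule linear_map.finsum[OF linear_mapI[OF bal_module[OF SX] bal_module[OF X[OF k]] pl[OF k k]]])
        (simp add: linear_closed[OF il] D[OF w])
    also have "\<dots> = (\<Oplus>\<^bsub>bal (X k)\<^esub>i\<in>I. if k = i then w k else \<zero>\<^bsub>bal (X k)\<^esub>)"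
    proof (rule bk.finsum_cong'[OF refl])
      show "(\<lambda>i. if k = i then w k else \<zero>\<^bsub>bal (X k)\<^esub>) \<in> I \<rightarrow> carrier (bal (X k))"
        using D[OF w k] by (auto intro!: funcsetI)
      fix i assume i: "i \<in> I"
      have pi: "(\<lambda>x. inj I X i x k) \<in> right_linear_maps K H (X i) (X k)"
        by (rule hlinear_comp[OF S.inj_right_linear[OF i] S.proj_right_linear[OF k]])
      have "bmap (X k) (\<lambda>f. f k) (bmap ?S (inj I X i) (w i)) = bmap (X k) (\<lambda>x. inj I X i x k) (w i)"
        by (rule bmap_comp[OF X[OF i] SX X[OF k] S.inj_right_linear[OF i] S.proj_right_linear[OF k] D[OF w i], symmetric])
      also have "\<dots> = (if k = i then w k else \<zero>\<^bsub>bal (X k)\<^esub>)"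
      proof (cases "k = i")
        case True
        have "bmap (X k) (\<lambda>x. inj I X i x k) (w i) = bmap (X k) (\<lambda>x. x) (w i)"
          using pi D[OF w i] by (intro bmap_cong) (simp_all add: True X[OF i] hlinear_id S.proj_inj i)
        then show ?thesis using bmap_id[OF X[OF i] D[OF w i]] True by simp
      next
        case False
        have "bmap (X k) (\<lambda>x. inj I X i x k) (w i) = bmap (X k) (\<lambda>x. \<zero>\<^bsub>X k\<^esub>) (w i)"
          by (rule bmap_cong[OF X[OF i] X[OF k] pi hlinear_zero[OF X[OF k]] _ D[OF w i]])
             (simp add: S.proj_inj i k False)
        then show ?thesis using bmap_zero[OF X[OF i] X[OF k] D[OF w i]] False by simp
      qed
      finally show "bmap (X k) (\<lambda>f. f k) (bmap ?S (inj I X i) (w i)) = (if k = i then w k else \<zero>\<^bsub>bal (X k)\<^esub>)" .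
    qed
    also have "\<dots> = w k" by (rule bk.finsum_singleton[OF k S.fin]) (simp add: D[OF w k])
    finally show "bal_split I X (bal_join I X w) k = w k" using k by (simp add: bal_split_def)
  qed
  show "bal_join I X (bal_split I X u) = u" if u: "u \<in> carrier (bal ?S)"
  proof -
    have ip: "(\<lambda>f. inj I X i (f i)) \<in> right_linear_maps K H ?S ?S" if "i \<in> I" for i
      by (rule hlinear_comp[OF S.proj_right_linear[OF that] S.inj_right_linear[OF that]])
    have "bal_join I X (bal_split I X u) = (\<Oplus>\<^bsub>bal ?S\<^esub>i\<in>I. bmap ?S (\<lambda>f. inj I X i (f i)) u)"
      unfolding bal_join_def
      by (rule bS.finsum_cong'[OF refl])
        (simp_all add: bal_split_def bmap_comp[OF SX X SX S.proj_right_linear S.inj_right_linear u]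
          linear_closed[OF il] linear_closed[OF pl u])
    also have "\<dots> = bmap ?S (\<lambda>f. \<Oplus>\<^bsub>?S\<^esub>i\<in>I. inj I X i (f i)) u"
      by (rule bmap_finsum[OF SX SX S.fin ip u, symmetric])
    also have "\<dots> = bmap ?S (\<lambda>f. f) u"
      by (rule bmap_cong[OF SX SX hlinear_finsum[OF SX S.fin ip] hlinear_id S.decomposition u])
    also have "\<dots> = u" by (rule bmap_id[OF SX u])
    finally show ?thesis .
  qed
qed

end

section \<open>The cyclic module of tensor powers\<close>

lemma linearly_isomorphic_sym:
  assumes V: "module K V" and iso: "linearly_isomorphic K V W"
  shows "linearly_isomorphic K W V"
proof -
  interpret V: module K V by fact
  obtain f where f: "f \<in> linear_maps K V W" and bij: "bij_betw f (carrier V) (carrier W)"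
    using iso by (auto simp: linearly_isomorphic_def)
  let ?g = "inv_into (carrier V) f"
  have gc: "?g y \<in> carrier V" and fg: "f (?g y) = y" if "y \<in> carrier W" for y
    using bij_betwE[OF bij_betw_inv_into[OF bij]] bij_betw_inv_into_right[OF bij] that by auto
  have gf: "?g (f x) = x" if "x \<in> carrier V" for x by (rule bij_betw_inv_into_left[OF bij that])
  have "?g \<in> linear_maps K W V"
  proof (rule linear_mapsI)
    show "?g (x \<oplus>\<^bsub>W\<^esub> y) = ?g x \<oplus>\<^bsub>V\<^esub> ?g y" if "x \<in> carrier W" "y \<in> carrier W" for x y
      using gf[OF V.a_closed[OF gc[OF that(1)] gc[OF that(2)]]] linear_add[OF f gc[OF that(1)] gc[OF that(2)]]
      by (simp add: fg that)
    show "?g (a \<odot>\<^bsub>W\<^esub> x) = a \<odot>\<^bsub>V\<^esub> ?g x" if "a \<in> carrier K" "x \<in> carrier W" for a x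
      using gf[OF V.smult_closed[OF that(1) gc[OF that(2)]]] linear_smult[OF f that(1) gc[OF that(2)]]
      by (simp add: fg that)
  qed (rule gc)
  then show ?thesis unfolding linearly_isomorphic_def using bij_betw_inv_into[OF bij] by blast
qed

context hopf_algebra
begin

lemma truncate_C: "module.truncate (C n) = T (Suc n)"
  unfolding diagonal_power_def by (cases "T (Suc n)") (simp add: module.defs)

lemma C_finsum: "finsum (C n) f A = finsum (T (Suc n)) f A"
  by (rule finsum_same_structure) (simp_all add: fun_eq_iff)

lemma C_a_inv: "a_inv (C n) x = a_inv (T (Suc n)) x"
  by (rule a_inv_same_structure) (simp_all add: fun_eq_iff)

lemma liftable_C: "right_hmodule K H Y \<Longrightarrow> liftable K H (C n) Y"
  by (cases n) (simp_all add: liftable_C_0 liftable_C_Suc)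

lemma signed_right_linear: "f \<in> right_linear_maps K H X (C n) \<Longrightarrow> (\<lambda>x. signed (T (Suc n)) i (f x)) \<in> right_linear_maps K H X (C n)"
  using hlinear_uminus[OF C_right_hmodule, of f X n]
  by (cases "even i") (simp_all add: signed_def[abs_def] C_a_inv)

end

context cocommutative_hopf_algebra
begin

lemma KK_right_hmodule: "right_hmodule K H KK"
proof (intro right_hmodule.intro right_hmodule_axioms.intro KK_module)
  interpret KK: module K KK by (rule KK_module)
  have assoc: "a \<otimes>\<^bsub>K\<^esub> b \<otimes>\<^bsub>K\<^esub> c = a \<otimes>\<^bsub>K\<^esub> (b \<otimes>\<^bsub>K\<^esub> c)" if "a \<in> carrier K" "b \<in> carrier K" "c \<in> carrier K" for a b c
    using KK.smult_assoc1[of a b c] that by simp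
  have distr: "a \<otimes>\<^bsub>K\<^esub> (b \<oplus>\<^bsub>K\<^esub> c) = a \<otimes>\<^bsub>K\<^esub> b \<oplus>\<^bsub>K\<^esub> a \<otimes>\<^bsub>K\<^esub> c"
    "(b \<oplus>\<^bsub>K\<^esub> c) \<otimes>\<^bsub>K\<^esub> a = b \<otimes>\<^bsub>K\<^esub> a \<oplus>\<^bsub>K\<^esub> c \<otimes>\<^bsub>K\<^esub> a"
    if "a \<in> carrier K" "b \<in> carrier K" "c \<in> carrier K" for a b c
    using KK.smult_r_distr[of a b c] KK.smult_l_distr[of b c a] that by simp_all
  have comm: "a \<otimes>\<^bsub>K\<^esub> b = b \<otimes>\<^bsub>K\<^esub> a" if "a \<in> carrier K" "b \<in> carrier K" for a b
    using that by (rule m_comm)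
  have cl: "a \<otimes>\<^bsub>K\<^esub> b \<in> carrier K" if "a \<in> carrier K" "b \<in> carrier K" for a b
    using KK.smult_closed[of a b] that by simp
  show "(\<lambda>x. ract KK x h) \<in> linear_maps K KK KK" if "h \<in> carrier H" for h
    by (rule linear_mapsI) (simp_all add: cl counit_closed that distr assoc)
  show "ract KK x \<in> linear_maps K H KK" if x: "x \<in> carrier KK" for x
  proof (rule linear_mapsI)
    have x: "x \<in> carrier K" using x by simp
    show "ract KK x (a \<odot>\<^bsub>H\<^esub> h) = a \<odot>\<^bsub>KK\<^esub> ract KK x h" if "a \<in> carrier K" "h \<in> carrier H" for a h
      using assoc[OF x that(1) counit_closed[OF that(2)]] assoc[OF that(1) x counit_closed[OF that(2)]] comm[OF x that(1)]
      by (simp add: counit_smult that)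
  qed (use x in \<open>simp_all add: cl counit_closed counit_add distr\<close>)
  show "ract KK x \<one>\<^bsub>H\<^esub> = x" if "x \<in> carrier KK" for x
    using comm[of x "\<one>\<^bsub>K\<^esub>"] KK.smult_one[OF that] that counit_closed[OF one_H] by (simp add: counit_one)
  show "ract KK x (g \<otimes>\<^bsub>H\<^esub> h) = ract KK (ract KK x g) h" if "x \<in> carrier KK" "g \<in> carrier H" "h \<in> carrier H" for x g h
    using that by (simp add: counit_mult counit_closed assoc)
qed

definition CH :: "('k, ('h list \<Rightarrow> 'k) set) cyclic_object" where
  "CH = \<lparr>obj = (\<lambda>n. T (Suc n)), face = (\<lambda>n i. power_face K H n i), degen = (\<lambda>n i. power_degen K H n i), cyc = rot\<rparr>"

lemma CH_simps [simp]: "obj CH n = T (Suc n)" "face CH n i = power_face K H n i" "cyc CH n = rot n"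
  by (simp_all add: CH_def)

sublocale CH: contractible_cyclic_module K CH "\<lambda>n. prep (Suc n)" KK aug "pure [\<one>\<^bsub>H\<^esub>]"
proof (intro contractible_cyclic_module.intro cyclic_module.intro cyclic_module_axioms.intro
    contractible_cyclic_module_axioms.intro; (rule cring_K)?; (simp only: CH_simps)?)
  show "power_face K H (Suc n) i \<in> linear_maps K (T (Suc (Suc n))) (T (Suc n))" if "i \<le> Suc n" for i n
    by (rule face_linear[OF that])
  show "fc (Suc n) i (fc (Suc (Suc n)) j x) = fc (Suc n) (j - 1) (fc (Suc (Suc n)) i x)"
    if "x \<in> carrier (T (Suc (Suc (Suc n))))" "i < j" "j \<le> Suc (Suc n)" for x n i j
    by (rule face_face[OF that])
  show "fc (Suc n) (Suc i) (rot (Suc n) x) = rot n (fc (Suc n) i x)"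
    if "x \<in> carrier (T (Suc (Suc n)))" "i \<le> n" for x n i by (rule face_rot[OF that])
  show "fc (Suc n) 0 (rot (Suc n) x) = fc (Suc n) (Suc n) x"
    if "x \<in> carrier (T (Suc (Suc n)))" for x n by (rule face_rot_zero[OF that])
  show "(rot n ^^ Suc n) x = x" if "x \<in> carrier (T (Suc n))" for x n by (rule rot_power[OF that])
  show "fc (Suc n) 0 (prep (Suc n) x) = x" if "x \<in> carrier (T (Suc n))" for x n by (rule face_zero_prep[OF that])
  show "fc (Suc (Suc n)) (Suc i) (prep (Suc (Suc n)) x) = prep (Suc n) (fc (Suc n) i x)"
    if "x \<in> carrier (T (Suc (Suc n)))" "i \<le> Suc n" for x n i by (rule face_Suc_prep[OF that])
  show "fc (Suc 0) (Suc 0) (prep (Suc 0) x) = aug x \<odot>\<^bsub>T (Suc 0)\<^esub> pure [\<one>\<^bsub>H\<^esub>]"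
    if "x \<in> carrier (T (Suc 0))" for x by (rule face_one_prep[OF that])
  show "aug (fc (Suc 0) 0 x) = aug (fc (Suc 0) (Suc 0) x)" if "x \<in> carrier (T (Suc (Suc 0)))" for x
    by (rule aug_face[OF that])
qed (simp_all add: P.T_module rot_linear prep_linear KK_module aug_linear aug_one P.pure_closed tuples_lists one_H)

lemma b_right_linear: "hochschild_b CH (Suc q) \<in> right_linear_maps K H (C (Suc q)) (C q)"
proof -
  have "(\<lambda>x. \<Oplus>\<^bsub>C q\<^esub>i\<in>{..Suc q}. signed (T (Suc q)) i (power_face K H (Suc q) i x)) \<in> right_linear_maps K H (C (Suc q)) (C q)"
    by (rule hlinear_finsum[OF C_right_hmodule finite_atMost signed_right_linear[OF face_right_linear]]) simp
  then show ?thesis by (simp add: hochschild_b_def[abs_def] C_finsum)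
qed

lemma b'_right_linear: "hochschild_b' CH (Suc q) \<in> right_linear_maps K H (C (Suc q)) (C q)"
proof -
  have "(\<lambda>x. \<Oplus>\<^bsub>C q\<^esub>i\<in>{..<Suc q}. signed (T (Suc q)) i (power_face K H (Suc q) i x)) \<in> right_linear_maps K H (C (Suc q)) (C q)"
    by (rule hlinear_finsum[OF C_right_hmodule finite_lessThan signed_right_linear[OF face_right_linear]]) simp
  then show ?thesis by (simp add: hochschild_b'_def[abs_def] C_finsum)
qed

lemma t_right_linear: "signed_cyc CH q \<in> right_linear_maps K H (C q) (C q)"
  using signed_right_linear[OF rot_right_linear] by (simp add: signed_cyc_def[abs_def])

lemma hlinear_funpow: "f \<in> right_linear_maps K H X X \<Longrightarrow> (f ^^ n) \<in> right_linear_maps K H X X"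
proof (induction n)
  case 0
  show ?case using hlinear_id by (simp add: id_def)
next
  case (Suc n)
  then show ?case using hlinear_comp[of "f ^^ n" K H X X f X] by (simp add: comp_def)
qed

lemma N_right_linear: "cyclic_norm CH q \<in> right_linear_maps K H (C q) (C q)"
  using hlinear_finsum[OF C_right_hmodule finite_atMost hlinear_funpow[OF t_right_linear], of q "\<lambda>i. i"]
  by (simp add: cyclic_norm_def[abs_def] C_finsum)

lemma v_right_linear: "tsygan_vertical CH p (Suc q) \<in> right_linear_maps K H (C (Suc q)) (C q)"
  using b_right_linear hlinear_uminus[OF C_right_hmodule b'_right_linear]
  by (cases "even p") (simp_all add: tsygan_vertical_def[abs_def] C_a_inv)

lemma h_right_linear: "tsygan_horizontal CH p q \<in> right_linear_maps K H (C q) (C q)"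
  using N_right_linear hlinear_plus[OF C_right_hmodule hlinear_id hlinear_uminus[OF C_right_hmodule t_right_linear]]
  by (cases "even p") (simp_all add: tsygan_horizontal_def[abs_def] a_minus_def C_a_inv)

section \<open>The two resolutions\<close>

text \<open>
  The homology of the total complex of \<open>CH\<close>, which both resolutions below resolve.
\<close>

definition degrees :: "nat \<Rightarrow> 'k set" where
  "degrees n = (if even n then carrier K else {\<zero>\<^bsub>K\<^esub>})"

text \<open>
  The total complex of \<open>CH\<close> with the action of \<open>H\<close> on each summand.
\<close>

definition TR :: "nat \<Rightarrow> ('k, 'h, nat \<Rightarrow> ('h list \<Rightarrow> 'k) set) right_module" where
  "TR n = rsum {..n} (\<lambda>p. C (n - p))"

lemma TR_sum: "right_module_sum K H {..n} (\<lambda>p. C (n - p))"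
  by (intro right_module_sum.intro cring_K finite_atMost C_right_hmodule)

lemma TR_carrier: "carrier (TR n) = carrier (tsygan_total CH n)"
  by (simp add: TR_def rsum_carrier_eq tsygan_total_def truncate_C)

lemma TR_simps: "\<zero>\<^bsub>TR n\<^esub> = \<zero>\<^bsub>tsygan_total CH n\<^esub>" "x \<oplus>\<^bsub>TR n\<^esub> y = x \<oplus>\<^bsub>tsygan_total CH n\<^esub> y"
  "a \<odot>\<^bsub>TR n\<^esub> x = a \<odot>\<^bsub>tsygan_total CH n\<^esub> x"
  by (simp_all add: TR_def tsygan_total_def)

lemma TR_linear_maps: "linear_maps K (TR m) (TR n) = linear_maps K (tsygan_total CH m) (tsygan_total CH n)"
  "linear_maps K (TR m) W = linear_maps K (tsygan_total CH m) W"
  by (simp_all add: linear_maps_def TR_carrier TR_simps)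

lemma TR_ract: "ract (TR n) f h = (\<lambda>p\<in>{..n}. ract (C (n - p)) (f p) h)"
  by (simp add: TR_def)

lemma TR_right_hmodule: "right_hmodule K H (TR n)"
  unfolding TR_def by (rule right_module_sum.S_right_hmodule[OF TR_sum])

lemma TR_d: "tsygan_differential CH (Suc n) \<in> right_linear_maps K H (TR (Suc n)) (TR n)"
proof (rule right_linear_mapsI)
  show "tsygan_differential CH (Suc n) \<in> linear_maps K (TR (Suc n)) (TR n)"
    unfolding TR_linear_maps(1) by (rule CH.d_lin)
  fix f h assume f: "f \<in> carrier (TR (Suc n))" and h: "h \<in> carrier H"
  show "tsygan_differential CH (Suc n) (ract (TR (Suc n)) f h) = ract (TR n) (tsygan_differential CH (Suc n) f) h"
  proof (rule extensionalityI[of _ "{..n}"])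
    show "tsygan_differential CH (Suc n) (ract (TR (Suc n)) f h) \<in> extensional {..n}"
      by (simp add: tsygan_differential_def)
    show "ract (TR n) (tsygan_differential CH (Suc n) f) h \<in> extensional {..n}" by (simp add: TR_ract)
    fix p assume "p \<in> {..n}"
    then have p: "p \<le> n" by simp
    define q where "q = n - p"
    have q: "Suc n - p = Suc q" "n - p = q" "Suc n - Suc p = q" using p by (auto simp: q_def)
    have c: "f p \<in> carrier (C (Suc q))" "f (Suc p) \<in> carrier (C q)"
      using CH.Tot_comp[of f n p] f p q by (simp_all add: TR_carrier)
    note v = hlinear_closed[OF v_right_linear c(1)] and hc = hlinear_closed[OF h_right_linear c(2)]
    have "tsygan_differential CH (Suc n) (ract (TR (Suc n)) f h) p =
        tsygan_vertical CH p (Suc q) (ract (C (Suc q)) (f p) h) \<oplus>\<^bsub>C q\<^esub> tsygan_horizontal CH (Suc p) q (ract (C q) (f (Suc p)) h)"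
      using p by (simp add: CH.d_apply TR_ract q del: C_simps(5))
    also have "\<dots> = ract (C q) (tsygan_vertical CH p (Suc q) (f p) \<oplus>\<^bsub>C q\<^esub> tsygan_horizontal CH (Suc p) q (f (Suc p))) h"
      unfolding hlinear_ract[OF v_right_linear c(1) h] hlinear_ract[OF h_right_linear c(2) h]
      by (rule linear_map.add[OF right_hmodule.ract_map[OF C_right_hmodule h] v hc, symmetric])
    also have "\<dots> = ract (TR n) (tsygan_differential CH (Suc n) f) h p"
      using p by (simp add: CH.d_apply TR_ract q del: C_simps(5))
    finally show "tsygan_differential CH (Suc n) (ract (TR (Suc n)) f h) p = ract (TR n) (tsygan_differential CH (Suc n) f) h p" .
  qed
qed

lemma TR_phi: "CH.phi n \<in> right_linear_maps K H (TR n) KK"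
proof (rule right_linear_mapsI)
  show "CH.phi n \<in> linear_maps K (TR n) KK" unfolding TR_linear_maps(2) by (rule CH.phi_lin)
  fix f h assume f: "f \<in> carrier (TR n)" and h: "h \<in> carrier H"
  show "CH.phi n (ract (TR n) f h) = ract KK (CH.phi n f) h"
  proof (cases "even n")
    case True
    have "f n \<in> carrier (C 0)" using f CH.Tot_carrier[of f n] by (auto simp: TR_carrier)
    then show ?thesis
      using True hlinear_ract[OF aug_right_linear _ h]
      by (simp add: CH.phi_def TR_ract del: C_simps(5) KK_simps(5))
  next
    case False
    have "\<zero>\<^bsub>KK\<^esub> = ract KK \<zero>\<^bsub>KK\<^esub> h"
      by (rule linear_map.zero[OF right_hmodule.ract_map[OF KK_right_hmodule h], symmetric])
    then show ?thesis using False by (simp add: CH.phi_def)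
  qed
qed

lemma TR_resolution: "augmented_resolution K H KK degrees TR (tsygan_differential CH) CH.phi"
proof (intro augmented_resolution.intro augmented_complex.intro augmented_resolution_axioms.intro
    KK_right_hmodule TR_right_hmodule TR_d TR_phi)
  show "tsygan_differential CH (Suc n) (tsygan_differential CH (Suc (Suc n)) x) = \<zero>\<^bsub>TR n\<^esub>"
    if "x \<in> carrier (TR (Suc (Suc n)))" for n x
    using CH.d_d[of x n] that by (simp add: TR_carrier TR_simps)
  show "CH.phi n x \<in> degrees n" if "x \<in> carrier (TR n)" for n x
    using hlinear_closed[OF TR_phi that] by (simp add: degrees_def) (simp add: CH.phi_def)
  show "CH.phi n (tsygan_differential CH (Suc n) x) = \<zero>\<^bsub>KK\<^esub>" if "x \<in> carrier (TR (Suc n))" for n x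
    using CH.phi_d[of x n] that by (simp add: TR_carrier)
  show "\<zero>\<^bsub>KK\<^esub> \<in> degrees n" for n
    using module.axioms(1)[OF KK_module] by (simp add: degrees_def cring.cring_simprules(2))
  show "\<exists>w\<in>carrier (TR 0). CH.phi 0 w = c" if "c \<in> degrees 0" for c
    using CH.Tot_exact_0[of c] that by (simp add: TR_carrier degrees_def)
  show "\<exists>w\<in>carrier (TR (Suc n)). tsygan_differential CH (Suc n) w = z \<and> CH.phi (Suc n) w = c"
    if z: "z \<in> carrier (TR n)" and dz: "0 < n \<Longrightarrow> tsygan_differential CH n z = \<zero>\<^bsub>TR (n - 1)\<^esub>"
      and pz: "CH.phi n z = \<zero>\<^bsub>KK\<^esub>" and c: "c \<in> degrees (Suc n)" for z n c
  proof -
    have cK: "c \<in> carrier K"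
      using c cring.cring_simprules(2)[OF cring_K] by (auto simp: degrees_def split: if_splits)
    show ?thesis
      unfolding TR_carrier
      by (rule CH.Tot_exact) (use z dz pz c cK in \<open>auto simp: TR_carrier TR_simps degrees_def\<close>)
  qed
qed

text \<open>
  Sums of the diagonal modules, which are free.
\<close>

lemma TR_liftable: "right_hmodule K H Y \<Longrightarrow> liftable K H (TR n) Y"
  unfolding TR_def by (rule liftable_sum[OF TR_sum _ liftable_C])

end

lemma half: "i \<le> n div 2 \<Longrightarrow> Suc n - 2 * i = Suc (n - 2 * i)" "i \<le> n div 2 \<Longrightarrow> i \<le> Suc n div 2" for i n :: nat
  by linarith+

locale resolved = cocommutative_hopf_algebra K H for K :: "'k ring" and H :: "('k, 'h) hopf" +
  fixes P :: "nat \<Rightarrow> ('k, 'h, 'p) right_module" and dP :: "nat \<Rightarrow> 'p \<Rightarrow> 'p" and e :: "'p \<Rightarrow> 'k"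
  assumes res: "projective_resolution K H (trivial_right_module K H) P dP e"
begin

lemma proj: "projective_right K H (P n)" using res by (simp add: projective_resolution_def)
lemma P_right_hmodule: "right_hmodule K H (P n)" using proj by (simp add: projective_right_def)
lemma P_d: "dP (Suc n) \<in> right_linear_maps K H (P (Suc n)) (P n)" using res by (simp add: projective_resolution_def)
lemma P_e: "e \<in> right_linear_maps K H (P 0) KK" using res by (simp add: projective_resolution_def)
lemma P_surj: "c \<in> carrier K \<Longrightarrow> \<exists>x \<in> carrier (P 0). e x = c"
proof -
  assume "c \<in> carrier K"
  moreover have "e ` carrier (P 0) = carrier KK" using res by (simp add: projective_resolution_def)
  ultimately have "c \<in> e ` carrier (P 0)" by simp
  then show ?thesis by blast
qed

lemma P_exact_0: "{x \<in> carrier (P 0). e x = \<zero>\<^bsub>KK\<^esub>} = dP (Suc 0) ` carrier (P (Suc 0))"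
  using res by (simp add: projective_resolution_def)
lemma P_exact: "{x \<in> carrier (P (Suc n)). dP (Suc n) x = \<zero>\<^bsub>P n\<^esub>} = dP (Suc (Suc n)) ` carrier (P (Suc (Suc n)))"
  using res by (simp add: projective_resolution_def)

lemma P_dd: "x \<in> carrier (P (Suc (Suc n))) \<Longrightarrow> dP (Suc n) (dP (Suc (Suc n)) x) = \<zero>\<^bsub>P n\<^esub>"
  using P_exact[of n] by blast

lemma P_ed: "x \<in> carrier (P (Suc 0)) \<Longrightarrow> e (dP (Suc 0) x) = \<zero>\<^bsub>KK\<^esub>"
  using P_exact_0 by blast

lemma P_complex: "augmented_complex K H KK (\<lambda>_. carrier K) P dP (\<lambda>n. if n = 0 then e else (\<lambda>_. \<zero>\<^bsub>KK\<^esub>))"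
proof (intro augmented_complex.intro KK_right_hmodule P_right_hmodule P_d P_dd)
  show "(if n = 0 then e else (\<lambda>_. \<zero>\<^bsub>KK\<^esub>)) \<in> right_linear_maps K H (P n) KK" for n
    using P_e hlinear_zero[OF KK_right_hmodule] P_right_hmodule by (cases n) auto
  then show "(if n = 0 then e else (\<lambda>_. \<zero>\<^bsub>KK\<^esub>)) x \<in> carrier K" if "x \<in> carrier (P n)" for n x
    using hlinear_closed[of _ K H "P n" KK x] that by (metis KK_simps(1))
qed (auto simp: P_ed)

text \<open>
  The sum of the shifts of \<open>P\<close> by \<open>2 i\<close>. In an even degree the last summand, \<open>P 0\<close>, carries the augmentation.
\<close>

definition QR :: "nat \<Rightarrow> ('k, 'h, nat \<Rightarrow> 'p) right_module" where
  "QR n = rsum {..n div 2} (\<lambda>i. P (n - 2 * i))"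

definition QR_d :: "nat \<Rightarrow> (nat \<Rightarrow> 'p) \<Rightarrow> nat \<Rightarrow> 'p" where
  "QR_d n f = (\<lambda>i\<in>{..(n - 1) div 2}. dP (n - 2 * i) (f i))"

definition QR_phi :: "nat \<Rightarrow> (nat \<Rightarrow> 'p) \<Rightarrow> 'k" where
  "QR_phi n f = (if even n then e (f (n div 2)) else \<zero>\<^bsub>KK\<^esub>)"

lemma QR_sum: "right_module_sum K H {..n div 2} (\<lambda>i. P (n - 2 * i))"
  by (intro right_module_sum.intro cring_K finite_atMost P_right_hmodule)

lemma QR_right_hmodule: "right_hmodule K H (QR n)"
  unfolding QR_def by (rule right_module_sum.S_right_hmodule[OF QR_sum])

lemma QR_carrier: "f \<in> carrier (QR n) \<longleftrightarrow> f \<in> extensional {..n div 2} \<and> (\<forall>i\<le>n div 2. f i \<in> carrier (P (n - 2 * i)))"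
  by (auto simp: QR_def rsum_carrier)

lemma QR_comp: "f \<in> carrier (QR (Suc n)) \<Longrightarrow> i \<le> n div 2 \<Longrightarrow> f i \<in> carrier (P (Suc (n - 2 * i)))"
  using half[of i n] by (auto simp: QR_carrier)

lemma QR_d_apply: "i \<le> n div 2 \<Longrightarrow> QR_d (Suc n) f i = dP (Suc (n - 2 * i)) (f i)"
  using half[of i n] by (simp add: QR_d_def)

lemma QR_d_right_linear: "QR_d (Suc n) \<in> right_linear_maps K H (QR (Suc n)) (QR n)"
proof (intro right_linear_mapsI linear_mapsI)
  note dl = hlinear_linear[OF P_d]
  show "QR_d (Suc n) f \<in> carrier (QR n)" if "f \<in> carrier (QR (Suc n))" for f
    unfolding QR_carrier using hlinear_closed[OF P_d QR_comp[OF that]]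
    by (simp add: QR_d_apply) (simp add: QR_d_def)
  show "QR_d (Suc n) (f \<oplus>\<^bsub>QR (Suc n)\<^esub> g) = QR_d (Suc n) f \<oplus>\<^bsub>QR n\<^esub> QR_d (Suc n) g"
    if "f \<in> carrier (QR (Suc n))" "g \<in> carrier (QR (Suc n))" for f g
    by (rule extensionalityI[of _ "{..n div 2}"])
      (simp_all add: QR_d_apply QR_def half linear_add[OF dl] QR_comp[OF that(1)] QR_comp[OF that(2)], simp add: QR_d_def)
  show "QR_d (Suc n) (a \<odot>\<^bsub>QR (Suc n)\<^esub> f) = a \<odot>\<^bsub>QR n\<^esub> QR_d (Suc n) f"
    if "a \<in> carrier K" "f \<in> carrier (QR (Suc n))" for a f
    by (rule extensionalityI[of _ "{..n div 2}"])
      (simp_all add: QR_d_apply QR_def half linear_smult[OF dl] QR_comp[OF that(2)] that(1), simp add: QR_d_def)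
  show "QR_d (Suc n) (ract (QR (Suc n)) f h) = ract (QR n) (QR_d (Suc n) f) h"
    if "f \<in> carrier (QR (Suc n))" "h \<in> carrier H" for f h
    by (rule extensionalityI[of _ "{..n div 2}"])
      (simp_all add: QR_d_apply QR_def half hlinear_ract[OF P_d] QR_comp[OF that(1)] that(2), simp add: QR_d_def)
qed

lemma QR_phi_right_linear: "QR_phi n \<in> right_linear_maps K H (QR n) KK"
proof (cases "even n")
  case True
  then have n: "n - 2 * (n div 2) = 0" by simp
  have "(\<lambda>f. f (n div 2)) \<in> right_linear_maps K H (QR n) (P (n - 2 * (n div 2)))"
    unfolding QR_def by (rule right_module_sum.proj_right_linear[OF QR_sum]) simp
  then have "(\<lambda>f. e (f (n div 2))) \<in> right_linear_maps K H (QR n) KK"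
    unfolding n by (rule hlinear_comp[OF _ P_e])
  then show ?thesis using True by (simp add: QR_phi_def[abs_def])
next
  case False
  then show ?thesis using hlinear_zero[OF KK_right_hmodule] by (simp add: QR_phi_def[abs_def])
qed

text \<open>
  Exactness holds summand by summand. The passage from degree \<open>n\<close> to an even degree \<open>n + 1\<close> introduces a new
  summand \<open>P 0\<close>, on which the differential is zero and the augmentation is that of \<open>P\<close>.
\<close>

lemma QR_resolution: "augmented_resolution K H KK degrees QR QR_d QR_phi"
proof (intro augmented_resolution.intro augmented_complex.intro augmented_resolution_axioms.intro
    KK_right_hmodule QR_right_hmodule QR_d_right_linear QR_phi_right_linear)
  have z: "\<zero>\<^bsub>K\<^esub> \<in> carrier K" by (rule cring.cring_simprules(2)[OF cring_K])
  fix n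
  show "QR_d (Suc n) (QR_d (Suc (Suc n)) f) = \<zero>\<^bsub>QR n\<^esub>" if f: "f \<in> carrier (QR (Suc (Suc n)))" for f
  proof (rule extensionalityI[of _ "{..n div 2}"])
    show "QR_d (Suc n) (QR_d (Suc (Suc n)) f) \<in> extensional {..n div 2}" by (simp add: QR_d_def)
    show "\<zero>\<^bsub>QR n\<^esub> \<in> extensional {..n div 2}" by (simp add: QR_def)
    fix i assume "i \<in> {..n div 2}"
    then have i: "i \<le> n div 2" by simp
    then have i': "i \<le> Suc n div 2" "Suc n - 2 * i = Suc (n - 2 * i)" by (simp_all add: half)
    have "f i \<in> carrier (P (Suc (Suc (n - 2 * i))))" using QR_comp[OF f i'(1)] i'(2) by simp
    then show "QR_d (Suc n) (QR_d (Suc (Suc n)) f) i = \<zero>\<^bsub>QR n\<^esub> i"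
      using i i' by (simp add: QR_d_apply P_dd) (simp add: QR_def)
  qed
  show "QR_phi n f \<in> degrees n" if "f \<in> carrier (QR n)" for f
    using hlinear_closed[OF QR_phi_right_linear that] by (simp add: degrees_def) (simp add: QR_phi_def)
  show "QR_phi n (QR_d (Suc n) f) = \<zero>\<^bsub>KK\<^esub>" if f: "f \<in> carrier (QR (Suc n))" for f
  proof (cases "even n")
    case True
    then have "f (n div 2) \<in> carrier (P (Suc 0))" using QR_comp[OF f, of "n div 2"] by simp
    then show ?thesis using True P_ed by (simp add: QR_phi_def QR_d_apply)
  qed (simp add: QR_phi_def)
  show "\<zero>\<^bsub>KK\<^esub> \<in> degrees n" using z by (simp add: degrees_def)
  show "\<exists>w\<in>carrier (QR 0). QR_phi 0 w = c" if c0: "c \<in> degrees 0" for c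
  proof -
    obtain x where "x \<in> carrier (P 0)" "e x = c" using P_surj[of c] c0 by (auto simp: degrees_def)
    then show ?thesis by (intro bexI[of _ "\<lambda>i\<in>{..0}. x"]) (simp_all add: QR_carrier QR_phi_def)
  qed
  show "\<exists>w\<in>carrier (QR (Suc n)). QR_d (Suc n) w = f \<and> QR_phi (Suc n) w = c"
    if f: "f \<in> carrier (QR n)" and df: "0 < n \<Longrightarrow> QR_d n f = \<zero>\<^bsub>QR (n - 1)\<^esub>"
      and pf: "QR_phi n f = \<zero>\<^bsub>KK\<^esub>" and c: "c \<in> degrees (Suc n)" for f c
  proof -
    have "\<exists>x. x \<in> carrier (P (Suc (n - 2 * i))) \<and> dP (Suc (n - 2 * i)) x = f i" if i: "i \<le> n div 2" for i
    proof (cases "n - 2 * i")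
      case 0
      then have "even n" "i = n div 2" using i by presburger+
      then have "f i \<in> {x \<in> carrier (P 0). e x = \<zero>\<^bsub>KK\<^esub>}"
        using f pf i 0 by (auto simp: QR_carrier QR_phi_def)
      then show ?thesis unfolding P_exact_0 0 by auto
    next
      case (Suc m)
      then obtain l where n: "n = Suc l" by (cases n) auto
      have il: "i \<le> l div 2" "l - 2 * i = m" using Suc n by (simp_all add: less_eq_div_iff_mult_less_eq)
      have "f i \<in> carrier (P (Suc m))" using f i Suc by (auto simp: QR_carrier)
      moreover have "dP (Suc m) (f i) = \<zero>\<^bsub>P m\<^esub>"
        using fun_cong[OF df, of i] n il by (simp add: QR_d_apply) (simp add: QR_def)
      ultimately have "f i \<in> {x \<in> carrier (P (Suc m)). dP (Suc m) x = \<zero>\<^bsub>P m\<^esub>}" by simp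
      then show ?thesis unfolding P_exact Suc by auto
    qed
    then obtain w where w: "\<And>i. i \<le> n div 2 \<Longrightarrow> w i \<in> carrier (P (Suc (n - 2 * i))) \<and> dP (Suc (n - 2 * i)) (w i) = f i"
      by metis
    have "\<exists>x. even (Suc n) \<longrightarrow> x \<in> carrier (P 0) \<and> e x = c"
      using P_surj[of c] c by (auto simp: degrees_def)
    then obtain x where x: "even (Suc n) \<Longrightarrow> x \<in> carrier (P 0) \<and> e x = c" by blast
    \<comment> \<open>the index outside the range of \<open>w\<close>, present for odd \<open>n\<close> only, belongs to the new summand \<open>P 0\<close>\<close>
    define w' where "w' = (\<lambda>i\<in>{..Suc n div 2}. if i \<le> n div 2 then w i else x)"
    have top: "even (Suc n)" "Suc n - 2 * i = 0" "i = Suc n div 2" if "i \<le> Suc n div 2" "\<not> i \<le> n div 2" for i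
      using that by presburger+
    have w': "w' \<in> carrier (QR (Suc n))"
      unfolding QR_carrier
    proof (intro conjI allI impI)
      show "w' \<in> extensional {..Suc n div 2}" by (simp add: w'_def)
      fix i assume i: "i \<le> Suc n div 2"
      show "w' i \<in> carrier (P (Suc n - 2 * i))"
      proof (cases "i \<le> n div 2")
        case True
        then show ?thesis using w[OF True] i by (simp add: w'_def half)
      next
        case False
        then show ?thesis using top[OF i False] x i by (simp add: w'_def)
      qed
    qed
    moreover have "QR_d (Suc n) w' = f"
    proof (rule extensionalityI[of _ "{..n div 2}"])
      show "f \<in> extensional {..n div 2}" using f by (simp add: QR_carrier)
      show "QR_d (Suc n) w' i = f i" if "i \<in> {..n div 2}" for i
        using that w[of i] by (simp add: QR_d_apply w'_def half)
    qed (simp add: QR_d_def)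
    moreover have "QR_phi (Suc n) w' = c"
    proof (cases "even (Suc n)")
      case True
      then have "\<not> Suc n div 2 \<le> n div 2" by presburger
      then show ?thesis using True x by (simp add: QR_phi_def w'_def)
    next
      case False
      then show ?thesis using c by (simp add: QR_phi_def degrees_def)
    qed
    ultimately show ?thesis by blast
  qed
qed

lemma QR_liftable: "right_hmodule K H Y \<Longrightarrow> liftable K H (QR n) Y"
  unfolding QR_def by (rule liftable_sum[OF QR_sum _ liftable_projective[OF proj]])

end

section \<open>Tensoring the cyclic module\<close>

lemma (in crossed_module) bal_ext_cong:
  assumes X: "right_hmodule K H X" and W: "module K W" and u: "u \<in> carrier (bal X)"
    and G: "\<And>x m. x \<in> carrier X \<Longrightarrow> m \<in> carrier M \<Longrightarrow> G x m \<in> carrier W"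
    and eq: "\<And>x m. x \<in> carrier X \<Longrightarrow> m \<in> carrier M \<Longrightarrow> F x m = G x m"
  shows "sweedler K W (\<lambda>(x, m). F x m) u = sweedler K W (\<lambda>(x, m). G x m) u"
proof -
  interpret B: bilinear_presentation K X M "brel X" by (rule bilinear_presentation_bal[OF X])
  show ?thesis
    by (rule B.P.sweedler_cong[OF W _ u[unfolded bal_pres]]) (auto simp: G eq)
qed

locale trivial_crossed_module = cocommutative_hopf_algebra K H + CM: crossed_module K H M
  for K :: "'k ring" and H :: "('k, 'h) hopf" and M :: "('k, 'h, 'm) crossed" +
  assumes coact: "m \<in> carrier M \<Longrightarrow> coact M m = pure_tensor K M H m \<one>\<^bsub>H\<^esub>"
begin

abbreviation ZM where "ZM \<equiv> crossed_cyclic_object K H M"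
abbreviation BC where "BC n \<equiv> CM.bal (C n)"

lemma ZM_simps [simp]: "obj ZM n = BC n" "face ZM n i = CM.bmap (C (n - 1)) (power_face K H n i)"
  "cyc ZM n = crossed_cyc K H M n"
  by (simp_all add: crossed_cyclic_object_def)

lemmas BC_module = CM.bal_module[OF C_right_hmodule]

text \<open>
  The trivial coaction puts \<open>m\<^sub>1 = 1\<close> in the definition of the cyclic operator, which leaves the rotation of the tensor
  power. As the rotation is \<open>H\<close>-linear, the functor \<open>- \<otimes>\<^sub>H M\<close> applies to it.
\<close>

lemma crossed_cyc_eq:
  assumes u: "u \<in> carrier (BC n)"
  shows "crossed_cyc K H M n u = CM.bmap (C n) (rot n) u"
  unfolding crossed_cyc_def balanced_map_def Let_def
proof (rule CM.bal_ext_cong[OF C_right_hmodule BC_module u])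
  have pl: "(\<lambda>t. CM.pb (C n) t m) \<in> linear_maps K (T (Suc n)) (BC n)" if "m \<in> carrier M" for m
    using bilinear_left[OF CM.pb_bilinear[OF C_right_hmodule] that] by simp
  fix t m assume t: "t \<in> carrier (C n)" and m: "m \<in> carrier M"
  have rt: "rot n t \<in> carrier (C n)" using t by (intro hlinear_closed[OF rot_right_linear])
  show "CM.pb (C n) (rot n t) m \<in> carrier (BC n)" by (rule CM.pb_closed[OF C_right_hmodule rt m])
  have inner: "sweedler K (BC n) (\<lambda>(m0, m1). CM.pb (C n) (pure ((last hs \<otimes>\<^bsub>H\<^esub> m1) # butlast hs)) m0) (coact M m)
      = CM.pb (C n) (rot n (pure hs)) m" if hs: "hs \<in> tuples H (Suc n)" for hs
  proof -
    have l: "last hs \<in> carrier H" using rl_tuples[OF hs] by (simp add: tuples_def)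
    have sl: "(\<lambda>x. pure (x # butlast hs)) \<in> linear_maps K H (T (Suc n))"
      using multilinear_slot[OF P.pure_multilinear rl_tuples[OF hs], of 0] by simp
    have b: "bilinear K M H (BC n) (\<lambda>m0 m1. CM.pb (C n) (pure ((last hs \<otimes>\<^bsub>H\<^esub> m1) # butlast hs)) m0)"
    proof (rule bilinearI)
      show "(\<lambda>m1. CM.pb (C n) (pure ((last hs \<otimes>\<^bsub>H\<^esub> m1) # butlast hs)) m0) \<in> linear_maps K H (BC n)" if "m0 \<in> carrier M" for m0
        by (rule linear_comp[OF linear_comp[OF bilinear_right[OF mult_bilinear l] sl] pl[OF that]])
      show "(\<lambda>m0. CM.pb (C n) (pure ((last hs \<otimes>\<^bsub>H\<^esub> m1) # butlast hs)) m0) \<in> linear_maps K M (BC n)" if "m1 \<in> carrier H" for m1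
        by (rule bilinear_right[OF CM.pb_bilinear[OF C_right_hmodule]])
          (simp add: linear_closed[OF sl mult_closed[OF l that]])
    qed
    have "sweedler K (BC n) (\<lambda>(m0, m1). CM.pb (C n) (pure ((last hs \<otimes>\<^bsub>H\<^esub> m1) # butlast hs)) m0) (coact M m)
        = CM.pb (C n) (pure ((last hs \<otimes>\<^bsub>H\<^esub> \<one>\<^bsub>H\<^esub>) # butlast hs)) m"
      unfolding coact[OF m] by (rule tensor_ext[OF CM.module_axioms module_H BC_module b m one_H])
    then show ?thesis using mult_one(2)[OF l] by (simp add: rot_pure[OF hs] mult_one l)
  qed
  note rl = linear_comp[OF rot_linear pl[OF m]]
  note ml = multilinear_comp[OF P.pure_multilinear rl]
  have t': "t \<in> carrier (T (Suc n))" using t by simp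
  have "sweedler K (BC n) (\<lambda>hs. CM.pb (C n) (rot n (pure hs)) m) t = CM.pb (C n) (rot n t) m"
    by (rule P.T_eqI[OF BC_module P.ext_linear[OF BC_module ml] rl _ t']) (rule P.ext_pure[OF BC_module ml])
  with P.ext_cong[OF BC_module ml t' inner]
  show "sweedler K (BC n) (\<lambda>hs. sweedler K (BC n) (\<lambda>(m0, m1). CM.pb (C n) (pure ((last hs \<otimes>\<^bsub>H\<^esub> m1) # butlast hs)) m0) (coact M m)) t
      = CM.pb (C n) (rot n t) m" by simp
qed

lemma signed_bmap:
  assumes X: "right_hmodule K H X" and f: "f \<in> right_linear_maps K H X (C q)" and u: "u \<in> carrier (CM.bal X)"
  shows "signed (BC q) i (CM.bmap (C q) f u) = CM.bmap (C q) (\<lambda>x. signed (T (Suc q)) i (f x)) u"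
  using CM.bmap_uminus[OF X C_right_hmodule f u] by (cases "even i") (simp_all add: signed_def[abs_def] C_a_inv)

text \<open>
  The faces of \<open>Z\<^sub>*(H, M)\<close> are those of \<open>C\<close> tensored with \<open>M\<close>, and the functor is additive. The same
  argument transports every operator of the Tsygan double complex.
\<close>

lemma alternating_bmap:
  assumes u: "u \<in> carrier (BC (Suc q))" and A: "finite A" "A \<subseteq> {..Suc q}"
  shows "(\<Oplus>\<^bsub>BC q\<^esub>i\<in>A. signed (BC q) i (CM.bmap (C q) (power_face K H (Suc q) i) u)) =
    CM.bmap (C q) (\<lambda>x. \<Oplus>\<^bsub>T (Suc q)\<^esub>i\<in>A. signed (T (Suc q)) i (power_face K H (Suc q) i x)) u"
proof -
  interpret B: module K "BC q" by (rule BC_module)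
  have f: "(\<lambda>x. signed (T (Suc q)) i (power_face K H (Suc q) i x)) \<in> right_linear_maps K H (C (Suc q)) (C q)" if "i \<in> A" for i
    using that A by (intro signed_right_linear face_right_linear) auto
  have "(\<Oplus>\<^bsub>BC q\<^esub>i\<in>A. signed (BC q) i (CM.bmap (C q) (power_face K H (Suc q) i) u)) =
      (\<Oplus>\<^bsub>BC q\<^esub>i\<in>A. CM.bmap (C q) (\<lambda>x. signed (T (Suc q)) i (power_face K H (Suc q) i x)) u)"
  proof (rule B.finsum_cong'[OF refl])
    show "(\<lambda>i. CM.bmap (C q) (\<lambda>x. signed (T (Suc q)) i (power_face K H (Suc q) i x)) u) \<in> A \<rightarrow> carrier (BC q)"
      by (intro funcsetI CM.bmap_closed[OF C_right_hmodule C_right_hmodule f u])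
    show "signed (BC q) i (CM.bmap (C q) (power_face K H (Suc q) i) u) =
        CM.bmap (C q) (\<lambda>x. signed (T (Suc q)) i (power_face K H (Suc q) i x)) u" if "i \<in> A" for i
      using that A by (intro signed_bmap[OF C_right_hmodule face_right_linear u]) auto
  qed
  also have "\<dots> = CM.bmap (C q) (\<lambda>x. \<Oplus>\<^bsub>C q\<^esub>i\<in>A. signed (T (Suc q)) i (power_face K H (Suc q) i x)) u"
    by (rule CM.bmap_finsum[OF C_right_hmodule C_right_hmodule A(1) f u, symmetric])
  finally show ?thesis by (simp only: C_finsum)
qed

lemma b_bmap:
  assumes u: "u \<in> carrier (BC (Suc q))"
  shows "hochschild_b ZM (Suc q) u = CM.bmap (C q) (hochschild_b CH (Suc q)) u"
    and "hochschild_b' ZM (Suc q) u = CM.bmap (C q) (hochschild_b' CH (Suc q)) u"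
proof -
  have "{..<Suc q} \<subseteq> {..Suc q}" by auto
  from alternating_bmap[OF u finite_lessThan this]
  show "hochschild_b' ZM (Suc q) u = CM.bmap (C q) (hochschild_b' CH (Suc q)) u" by (simp add: hochschild_b'_def[abs_def])
  from alternating_bmap[OF u finite_atMost order_refl]
  show "hochschild_b ZM (Suc q) u = CM.bmap (C q) (hochschild_b CH (Suc q)) u" by (simp add: hochschild_b_def[abs_def])
qed

lemma t_bmap: "u \<in> carrier (BC q) \<Longrightarrow> signed_cyc ZM q u = CM.bmap (C q) (signed_cyc CH q) u"
  using signed_bmap[OF C_right_hmodule rot_right_linear] by (simp add: signed_cyc_def[abs_def] crossed_cyc_eq)

lemma t_pow_bmap:
  assumes u: "u \<in> carrier (BC q)"
  shows "(signed_cyc ZM q ^^ j) u = CM.bmap (C q) (signed_cyc CH q ^^ j) u"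
proof (induction j)
  case 0
  show ?case using CM.bmap_id[OF C_right_hmodule u] by (simp add: id_def)
next
  case (Suc j)
  note p = hlinear_funpow[OF t_right_linear]
  have "(signed_cyc ZM q ^^ Suc j) u = CM.bmap (C q) (signed_cyc CH q) (CM.bmap (C q) (signed_cyc CH q ^^ j) u)"
    using t_bmap[OF CM.bmap_closed[OF C_right_hmodule C_right_hmodule p u]] Suc.IH by simp
  also have "\<dots> = CM.bmap (C q) (signed_cyc CH q ^^ Suc j) u"
    using CM.bmap_comp[OF C_right_hmodule C_right_hmodule C_right_hmodule p t_right_linear u, symmetric] by (simp add: comp_def)
  finally show ?case .
qed

lemma N_bmap:
  assumes u: "u \<in> carrier (BC q)"
  shows "cyclic_norm ZM q u = CM.bmap (C q) (cyclic_norm CH q) u"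
proof -
  have "cyclic_norm ZM q u = (\<Oplus>\<^bsub>BC q\<^esub>j\<in>{..q}. CM.bmap (C q) (signed_cyc CH q ^^ j) u)"
    by (simp add: cyclic_norm_def t_pow_bmap[OF u])
  also have "\<dots> = CM.bmap (C q) (\<lambda>x. \<Oplus>\<^bsub>C q\<^esub>j\<in>{..q}. (signed_cyc CH q ^^ j) x) u"
    by (rule CM.bmap_finsum[OF C_right_hmodule C_right_hmodule finite_atMost hlinear_funpow[OF t_right_linear] u, symmetric])
  finally show ?thesis by (simp add: cyclic_norm_def[abs_def] C_finsum)
qed

lemma vertical_bmap:
  assumes u: "u \<in> carrier (BC (Suc q))"
  shows "tsygan_vertical ZM p (Suc q) u = CM.bmap (C q) (tsygan_vertical CH p (Suc q)) u"
  using CM.bmap_uminus[OF C_right_hmodule C_right_hmodule b'_right_linear u]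
  by (cases "even p") (simp_all add: tsygan_vertical_def[abs_def] b_bmap[OF u] C_a_inv)

lemma horizontal_bmap:
  assumes u: "u \<in> carrier (BC q)"
  shows "tsygan_horizontal ZM p q u = CM.bmap (C q) (tsygan_horizontal CH p q) u"
proof (cases "even p")
  case True
  then show ?thesis by (simp add: tsygan_horizontal_def[abs_def] N_bmap[OF u])
next
  case False
  note id = hlinear_id[of K H "C q"]
  have "CM.bmap (C q) (\<lambda>x. x \<oplus>\<^bsub>C q\<^esub> \<ominus>\<^bsub>C q\<^esub> signed_cyc CH q x) u =
      CM.bmap (C q) (\<lambda>x. x) u \<oplus>\<^bsub>BC q\<^esub> CM.bmap (C q) (\<lambda>x. \<ominus>\<^bsub>C q\<^esub> signed_cyc CH q x) u"
    by (rule CM.bmap_plus[OF C_right_hmodule C_right_hmodule id hlinear_uminus[OF C_right_hmodule t_right_linear] u])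
  then show ?thesis
    using False CM.bmap_uminus[OF C_right_hmodule C_right_hmodule t_right_linear u] CM.bmap_id[OF C_right_hmodule u]
    by (simp add: tsygan_horizontal_def[abs_def] t_bmap[OF u] a_minus_def C_a_inv)
qed

lemma TR_proj: "p \<le> n \<Longrightarrow> (\<lambda>f. f p) \<in> right_linear_maps K H (TR n) (C (n - p))"
  unfolding TR_def by (rule right_module_sum.proj_right_linear[OF TR_sum]) simp

text \<open>
  The left-hand side tensors the total complex with \<open>M\<close>, the right-hand side forms the total complex of the tensored
  cyclic object. The two complexes are isomorphic since tensoring commutes with finite direct sums.
\<close>

lemma TR_homology:
  "linearly_isomorphic K (homology (CM.balC TR) (CM.bald TR (tsygan_differential CH)) n) (HC K H M n)"
proof -
  let ?s = "\<lambda>n. CM.bal_split {..n} (\<lambda>p. C (n - p))" and ?j = "\<lambda>n. CM.bal_join {..n} (\<lambda>p. C (n - p))"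
  have tot: "tsygan_total ZM n = direct_sum {..n} (\<lambda>p. BC (n - p))" for n by (simp add: tsygan_total_def)
  have X: "augmented_complex K H KK degrees TR (tsygan_differential CH) CH.phi"
    using TR_resolution by (rule augmented_resolution.axioms(1))
  show ?thesis
    unfolding HC_def cyclic_homology_def
  proof (rule complex_transport(2)[where f = ?s and g = ?j, OF CM.bal_complex[OF X]])
    show "module K (tsygan_total ZM n)" for n
      unfolding tot by (rule direct_sum_module[OF cring_K BC_module])
    show "?s n \<in> linear_maps K (CM.bal (TR n)) (tsygan_total ZM n)" for n
      unfolding tot TR_def by (rule CM.bal_split_linear[OF TR_sum])
    show "?j n \<in> linear_maps K (tsygan_total ZM n) (CM.bal (TR n))" for n
      unfolding tot TR_def by (rule CM.bal_join_linear[OF TR_sum])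
    show "?s n (?j n w) = w" if "w \<in> carrier (tsygan_total ZM n)" for n w
      using that unfolding tot by (rule CM.bal_split_join[OF TR_sum])
    show "?j n (?s n u) = u" if "u \<in> carrier (CM.bal (TR n))" for n u
      using that unfolding TR_def by (rule CM.bal_join_split[OF TR_sum])
    fix n u assume u: "u \<in> carrier (CM.bal (TR (Suc n)))"
    show "tsygan_differential ZM (Suc n) (?s (Suc n) u) = ?s n (CM.bmap (TR (Suc n - 1)) (tsygan_differential CH (Suc n)) u)"
    proof (rule extensionalityI[of _ "{..n}"])
      fix p assume "p \<in> {..n}"
      then have p: "p \<le> n" by simp
      define q where "q = n - p"
      have q: "Suc n - p = Suc q" "n - p = q" using p by (auto simp: q_def)
      note v = v_right_linear[of p q] and h = h_right_linear[of "Suc p" q]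
      have p0: "(\<lambda>f. f p) \<in> right_linear_maps K H (TR (Suc n)) (C (Suc q))"
        and p1: "(\<lambda>f. f (Suc p)) \<in> right_linear_maps K H (TR (Suc n)) (C q)"
        and pn: "(\<lambda>f. f p) \<in> right_linear_maps K H (TR n) (C q)"
        using TR_proj[of p "Suc n"] TR_proj[of "Suc p" "Suc n"] TR_proj[of p n] p q by simp_all
      note TRm = TR_right_hmodule and Cm = C_right_hmodule
      note vp = hlinear_comp[OF p0 v] and hp = hlinear_comp[OF p1 h]
      have "tsygan_differential ZM (Suc n) (?s (Suc n) u) p =
          tsygan_vertical ZM p (Suc q) (CM.bmap (C (Suc q)) (\<lambda>f. f p) u)
            \<oplus>\<^bsub>BC q\<^esub> tsygan_horizontal ZM (Suc p) q (CM.bmap (C q) (\<lambda>f. f (Suc p)) u)"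
        using p by (simp add: tsygan_differential_def CM.bal_split_def q)
      also have "\<dots> = CM.bmap (C q) (\<lambda>f. tsygan_vertical CH p (Suc q) (f p)) u
            \<oplus>\<^bsub>BC q\<^esub> CM.bmap (C q) (\<lambda>f. tsygan_horizontal CH (Suc p) q (f (Suc p))) u"
        using CM.bmap_comp[OF TRm Cm Cm p0 v u] CM.bmap_comp[OF TRm Cm Cm p1 h u]
        by (simp add: vertical_bmap[OF CM.bmap_closed[OF TRm Cm p0 u]] horizontal_bmap[OF CM.bmap_closed[OF TRm Cm p1 u]])
      also have "\<dots> = CM.bmap (C q) (\<lambda>f. tsygan_vertical CH p (Suc q) (f p) \<oplus>\<^bsub>C q\<^esub> tsygan_horizontal CH (Suc p) q (f (Suc p))) u"
        by (rule CM.bmap_plus[OF TRm Cm vp hp u, symmetric])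
      also have "\<dots> = CM.bmap (C q) (\<lambda>f. tsygan_differential CH (Suc n) f p) u"
      proof (rule CM.bmap_cong[OF TRm Cm hlinear_plus[OF Cm vp hp] hlinear_comp[OF TR_d pn] _ u])
        show "tsygan_vertical CH p (Suc q) (f p) \<oplus>\<^bsub>C q\<^esub> tsygan_horizontal CH (Suc p) q (f (Suc p))
            = tsygan_differential CH (Suc n) f p" for f
          using p by (simp add: tsygan_differential_def q)
      qed
      also have "\<dots> = CM.bmap (C q) (\<lambda>f. f p) (CM.bmap (TR n) (tsygan_differential CH (Suc n)) u)"
        by (rule CM.bmap_comp[OF TRm TRm Cm TR_d pn u])
      also have "\<dots> = ?s n (CM.bmap (TR (Suc n - 1)) (tsygan_differential CH (Suc n)) u) p"
        using p by (simp add: CM.bal_split_def q)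
      finally show "tsygan_differential ZM (Suc n) (?s (Suc n) u) p =
        ?s n (CM.bmap (TR (Suc n - 1)) (tsygan_differential CH (Suc n)) u) p" .
    qed (simp_all add: tsygan_differential_def CM.bal_split_def)
  qed
qed

end

section \<open>The sum of the even shifts of a complex\<close>

lemma zero_module_module: "cring K \<Longrightarrow> module K zero_module"
  by (intro moduleI abelian_groupI) (auto simp: zero_module_def)

context kcomplex
begin

definition shifts :: "nat \<Rightarrow> ('k, nat \<Rightarrow> 'v) module" where
  "shifts n = direct_sum {..n div 2} (\<lambda>i. C (n - 2 * i))"

definition shifts_d :: "nat \<Rightarrow> (nat \<Rightarrow> 'v) \<Rightarrow> nat \<Rightarrow> 'v" where
  "shifts_d n w = (\<lambda>i\<in>{..(n - 1) div 2}. d (n - 2 * i) (w i))"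

lemma shifts_carrier: "w \<in> carrier (shifts n) \<longleftrightarrow> w \<in> extensional {..n div 2} \<and> (\<forall>i\<le>n div 2. w i \<in> carrier (C (n - 2 * i)))"
  by (auto simp: shifts_def direct_sum_carrier_finite)

lemma shifts_cycles: "w \<in> cycles shifts shifts_d n \<longleftrightarrow>
    w \<in> extensional {..n div 2} \<and> (\<forall>i\<le>n div 2. w i \<in> cycles C d (n - 2 * i))"
proof (cases n)
  case 0
  then show ?thesis by (auto simp: cycles_def shifts_carrier)
next
  case (Suc m)
  have "shifts_d n w = \<zero>\<^bsub>shifts m\<^esub> \<longleftrightarrow> (\<forall>i\<le>m div 2. d (n - 2 * i) (w i) = \<zero>\<^bsub>C (m - 2 * i)\<^esub>)"
    unfolding shifts_d_def shifts_def direct_sum_simps Suc by (auto simp: fun_eq_iff)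
  also have "\<dots> \<longleftrightarrow> (\<forall>i\<le>n div 2. n - 2 * i > 0 \<longrightarrow> d (n - 2 * i) (w i) = \<zero>\<^bsub>C (n - 2 * i - 1)\<^esub>)"
  proof -
    have "i \<le> m div 2 \<longleftrightarrow> i \<le> n div 2 \<and> n - 2 * i > 0" for i using Suc by presburger
    moreover have "m - 2 * i = n - 2 * i - 1" for i using Suc by simp
    ultimately show ?thesis by metis
  qed
  finally show ?thesis using Suc by (auto simp: cycles_def shifts_carrier)
qed

lemma shifts_boundaries: "w \<in> shifts_d (Suc n) ` carrier (shifts (Suc n)) \<longleftrightarrow>
    w \<in> extensional {..n div 2} \<and> (\<forall>i\<le>n div 2. w i \<in> bd (n - 2 * i))"
proof (intro iffI conjI allI impI)
  assume "w \<in> shifts_d (Suc n) ` carrier (shifts (Suc n))"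
  then obtain v where v: "w = shifts_d (Suc n) v" "v \<in> carrier (shifts (Suc n))" by blast
  show "w \<in> extensional {..n div 2}" by (simp add: v shifts_d_def)
  fix i assume i: "i \<le> n div 2"
  then have "Suc n - 2 * i = Suc (n - 2 * i)" "i \<le> Suc n div 2" by (simp_all add: half)
  then show "w i \<in> bd (n - 2 * i)" using v i by (auto simp: shifts_d_def shifts_carrier)
next
  assume a: "w \<in> extensional {..n div 2} \<and> (\<forall>i\<le>n div 2. w i \<in> bd (n - 2 * i))"
  then have "\<forall>i. \<exists>v. i \<le> n div 2 \<longrightarrow> v \<in> carrier (C (Suc (n - 2 * i))) \<and> w i = d (Suc (n - 2 * i)) v" by blast
  then obtain v where v: "\<And>i. i \<le> n div 2 \<Longrightarrow> v i \<in> carrier (C (Suc (n - 2 * i))) \<and> w i = d (Suc (n - 2 * i)) (v i)" by metis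
  let ?v = "\<lambda>i\<in>{..Suc n div 2}. if i \<le> n div 2 then v i else \<zero>\<^bsub>C (Suc n - 2 * i)\<^esub>"
  have "?v \<in> carrier (shifts (Suc n))"
    unfolding shifts_carrier
  proof (intro conjI allI impI)
    fix i assume i: "i \<le> Suc n div 2"
    show "?v i \<in> carrier (C (Suc n - 2 * i))"
      using i v[of i] module.axioms(2)[OF C, of "Suc n - 2 * i"] half(1)[of i n]
      by (cases "i \<le> n div 2") (simp_all add: abelian_groupE(2))
  qed simp
  moreover have "shifts_d (Suc n) ?v = w"
  proof (rule extensionalityI[of _ "{..n div 2}"])
    show "shifts_d (Suc n) ?v i = w i" if "i \<in> {..n div 2}" for i
      using that v[of i] by (simp add: shifts_d_def half)
  qed (use a in \<open>simp_all add: shifts_d_def\<close>)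
  ultimately show "w \<in> shifts_d (Suc n) ` carrier (shifts (Suc n))" by blast
qed

text \<open>
  Cycles and boundaries of the sum are those of the summands (\<open>shifts_cycles\<close>, \<open>shifts_boundaries\<close>). The right-hand side is
  indexed by all natural numbers, with the zero module wherever the shift exceeds the degree.
\<close>

lemma homology_shifts:
  assumes S: "kcomplex K shifts shifts_d"
  shows "linearly_isomorphic K (homology shifts shifts_d n)
    (direct_sum (UNIV :: nat set) (\<lambda>i. if 2 * i \<le> n then homology C d (n - 2 * i) else zero_module))"
proof -
  interpret S: kcomplex K shifts shifts_d by fact
  let ?H = "\<lambda>i. if 2 * i \<le> n then homology C d (n - 2 * i) else zero_module"
  let ?p = "\<lambda>i. quotient_space.proj (Z (n - 2 * i)) (bd (n - 2 * i))"
  \<comment> \<open>\<open>undefined\<close> is the only element of the zero module\<close>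
  let ?F = "\<lambda>w i. if 2 * i \<le> n then ?p i (w i) else undefined"
  note q = homology_quotient
  have le: "2 * i \<le> n \<longleftrightarrow> i \<le> n div 2" for i by presburger
  have K: "cring K" by (rule module.axioms(1)[OF C])
  have hom: "module K (homology C d k)" for k unfolding homology_eq by (rule quotient_space.module_Q[OF q])
  have H: "module K (?H i)" for i using hom by (simp add: zero_module_module[OF K])
  have carr: "carrier (homology C d (n - 2 * i)) = ?p i ` cycles C d (n - 2 * i)" for i
    unfolding homology_eq quotient_space.carrier_Q[OF q] by simp
  have W: "y \<in> carrier (direct_sum UNIV ?H) \<longleftrightarrow> (\<forall>i. y i \<in> carrier (?H i))" for y
  proof -
    have fin: "finite {i. y i \<noteq> \<zero>\<^bsub>?H i\<^esub>}" if y: "\<forall>i. y i \<in> carrier (?H i)"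
    proof (rule finite_subset[OF _ finite_atMost[of n]])
      have "y i = \<zero>\<^bsub>?H i\<^esub>" if "\<not> 2 * i \<le> n" for i
        using spec[OF y, of i] that by (simp add: zero_module_def)
      then show "{i. y i \<noteq> \<zero>\<^bsub>?H i\<^esub>} \<subseteq> {..n}" by fastforce
    qed
    show ?thesis
      unfolding direct_sum_carrier
    proof (intro iffI conjI)
      assume "\<forall>i. y i \<in> carrier (?H i)"
      from fin[OF this] show "finite {i \<in> UNIV. y i \<noteq> \<zero>\<^bsub>?H i\<^esub>}" by (simp only: UNIV_I simp_thms)
    qed (simp_all only: extensional_UNIV UNIV_I ball_UNIV simp_thms)
  qed
  show ?thesis
    unfolding S.homology_eq
  proof (rule linearly_isomorphic_quotient[where f = ?F])
    show "module K (S.Z n)" by (rule S.Z_module)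
    show "module K (direct_sum UNIV ?H)" by (rule direct_sum_module[OF K H])
    have Fc: "?F w \<in> carrier (direct_sum UNIV ?H)" if w: "w \<in> cycles shifts shifts_d n" for w
      using w unfolding W by (auto simp: shifts_cycles le carr zero_module_def)
    show "?F \<in> linear_maps K (S.Z n) (direct_sum UNIV ?H)"
    proof (rule linear_mapsI)
      show "?F w \<in> carrier (direct_sum UNIV ?H)" if "w \<in> carrier (S.Z n)" for w using Fc that by simp
      show "?F (w \<oplus>\<^bsub>S.Z n\<^esub> w') = ?F w \<oplus>\<^bsub>direct_sum UNIV ?H\<^esub> ?F w'"
        if w: "w \<in> carrier (S.Z n)" and w': "w' \<in> carrier (S.Z n)" for w w'
      proof
        fix i
        show "?F (w \<oplus>\<^bsub>S.Z n\<^esub> w') i = (?F w \<oplus>\<^bsub>direct_sum UNIV ?H\<^esub> ?F w') i"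
        proof (cases "2 * i \<le> n")
          case True
          have c: "w i \<in> cycles C d (n - 2 * i)" "w' i \<in> cycles C d (n - 2 * i)"
            using w w' True by (simp_all add: shifts_cycles le)
          have "?p i (w i) \<oplus>\<^bsub>homology C d (n - 2 * i)\<^esub> ?p i (w' i) = ?p i (w i \<oplus>\<^bsub>C (n - 2 * i)\<^esub> w' i)"
            using quotient_space.add_Q[OF q, of "w i" "n - 2 * i" "w' i"] c by (simp add: homology_eq)
          then show ?thesis using True by (simp add: shifts_def) (simp add: le)
        qed (simp add: zero_module_def)
      qed
      show "?F (a \<odot>\<^bsub>S.Z n\<^esub> w) = a \<odot>\<^bsub>direct_sum UNIV ?H\<^esub> ?F w"
        if a: "a \<in> carrier K" and w: "w \<in> carrier (S.Z n)" for a w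
      proof
        fix i
        show "?F (a \<odot>\<^bsub>S.Z n\<^esub> w) i = (a \<odot>\<^bsub>direct_sum UNIV ?H\<^esub> ?F w) i"
        proof (cases "2 * i \<le> n")
          case True
          have c: "w i \<in> cycles C d (n - 2 * i)" using w True by (simp add: shifts_cycles le)
          have "a \<odot>\<^bsub>homology C d (n - 2 * i)\<^esub> ?p i (w i) = ?p i (a \<odot>\<^bsub>C (n - 2 * i)\<^esub> w i)"
            using quotient_space.smult_Q[OF q a, of "w i" "n - 2 * i"] c by (simp add: homology_eq)
          then show ?thesis using True by (simp add: shifts_def) (simp add: le)
        qed (simp add: zero_module_def)
      qed
    qed
    show "?F ` carrier (S.Z n) = carrier (direct_sum UNIV ?H)"
    proof
      show "?F ` carrier (S.Z n) \<subseteq> carrier (direct_sum UNIV ?H)" using Fc by auto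
      show "carrier (direct_sum UNIV ?H) \<subseteq> ?F ` carrier (S.Z n)"
      proof
        fix y assume "y \<in> carrier (direct_sum UNIV ?H)"
        then have y: "\<And>i. y i \<in> carrier (?H i)" by (simp only: W)
        have "\<exists>x. 2 * i \<le> n \<longrightarrow> x \<in> cycles C d (n - 2 * i) \<and> y i = ?p i x" for i
          using y[of i] carr[of i] by auto
        then obtain x where x: "\<And>i. 2 * i \<le> n \<Longrightarrow> x i \<in> cycles C d (n - 2 * i) \<and> y i = ?p i (x i)" by metis
        have "restrict x {..n div 2} \<in> carrier (S.Z n)" using x by (simp add: shifts_cycles le)
        moreover have "y = ?F (restrict x {..n div 2})"
        proof
          show "y i = ?F (restrict x {..n div 2}) i" for i
            using x[of i] y[of i] by (cases "2 * i \<le> n") (simp add: le, simp add: zero_module_def)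
        qed
        ultimately show "y \<in> ?F ` carrier (S.Z n)" by blast
      qed
    qed
    show "S.bd n = {w \<in> carrier (S.Z n). ?F w = \<zero>\<^bsub>direct_sum UNIV ?H\<^esub>}"
    proof (rule Set.set_eqI)
      fix w
      have pz: "?p i (w i) = \<zero>\<^bsub>homology C d (n - 2 * i)\<^esub> \<longleftrightarrow> w i \<in> bd (n - 2 * i)"
        if "w i \<in> cycles C d (n - 2 * i)" for i
        using quotient_space.proj_zero_iff[OF q, of "w i" "n - 2 * i"] that by (simp add: homology_eq)
      have Fz: "?F w = \<zero>\<^bsub>direct_sum UNIV ?H\<^esub> \<longleftrightarrow> (\<forall>i\<le>n div 2. ?p i (w i) = \<zero>\<^bsub>homology C d (n - 2 * i)\<^esub>)"
        unfolding le[symmetric] by (simp add: fun_eq_iff zero_module_def)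
      have "w \<in> cycles shifts shifts_d n \<and> ?F w = \<zero>\<^bsub>direct_sum UNIV ?H\<^esub> \<longleftrightarrow>
          w \<in> extensional {..n div 2} \<and> (\<forall>i\<le>n div 2. w i \<in> cycles C d (n - 2 * i)) \<and> (\<forall>i\<le>n div 2. w i \<in> bd (n - 2 * i))"
        unfolding Fz shifts_cycles by (metis pz)
      also have "\<dots> \<longleftrightarrow> w \<in> S.bd n" unfolding shifts_boundaries using bd_cycles by blast
      finally show "w \<in> S.bd n \<longleftrightarrow> w \<in> {w \<in> carrier (S.Z n). ?F w = \<zero>\<^bsub>direct_sum UNIV ?H\<^esub>}" by simp
    qed
  qed
qed

end

section \<open>Cyclic homology and Tor\<close>

locale resolved_crossed_module = trivial_crossed_module K H M + resolved K H P dP e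
  for K :: "'k ring" and H :: "('k, 'h) hopf" and M :: "('k, 'h, 'm) crossed"
    and P :: "nat \<Rightarrow> ('k, 'h, 'p) right_module" and dP e
begin

lemma PM_complex: "kcomplex K (CM.balC P) (CM.bald P dP)" by (rule CM.bal_complex[OF P_complex])

sublocale PM: kcomplex K "CM.balC P" "CM.bald P dP" by (rule PM_complex)

lemma QR_proj: "i \<le> n div 2 \<Longrightarrow> (\<lambda>f. f i) \<in> right_linear_maps K H (QR n) (P (n - 2 * i))"
  unfolding QR_def by (rule right_module_sum.proj_right_linear[OF QR_sum]) simp

lemma
  shows PM_shifts: "kcomplex K PM.shifts PM.shifts_d"
    and QR_homology: "linearly_isomorphic K (homology (CM.balC QR) (CM.bald QR QR_d) n) (homology PM.shifts PM.shifts_d n)"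
proof -
  let ?s = "\<lambda>n. CM.bal_split {..n div 2} (\<lambda>i. P (n - 2 * i))" and ?j = "\<lambda>n. CM.bal_join {..n div 2} (\<lambda>i. P (n - 2 * i))"
  have Y: "augmented_complex K H KK degrees QR QR_d QR_phi"
    using QR_resolution by (rule augmented_resolution.axioms(1))
  have m: "module K (PM.shifts n)" for n
    unfolding PM.shifts_def by (rule direct_sum_module[OF cring_K PM.C])
  have s: "?s n \<in> linear_maps K (CM.bal (QR n)) (PM.shifts n)" for n
    unfolding PM.shifts_def QR_def by (rule CM.bal_split_linear[OF QR_sum])
  have j: "?j n \<in> linear_maps K (PM.shifts n) (CM.bal (QR n))" for n
    unfolding PM.shifts_def QR_def by (rule CM.bal_join_linear[OF QR_sum])
  have sj: "?s n (?j n w) = w" if "w \<in> carrier (PM.shifts n)" for n w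
    using that unfolding PM.shifts_def by (rule CM.bal_split_join[OF QR_sum])
  have js: "?j n (?s n u) = u" if "u \<in> carrier (CM.bal (QR n))" for n u
    using that unfolding QR_def by (rule CM.bal_join_split[OF QR_sum])
  have sd: "PM.shifts_d (Suc n) (?s (Suc n) u) = ?s n (CM.bmap (QR (Suc n - 1)) (QR_d (Suc n)) u)"
    if u: "u \<in> carrier (CM.bal (QR (Suc n)))" for n u
  proof (rule extensionalityI[of _ "{..n div 2}"])
    fix i assume "i \<in> {..n div 2}"
    then have i: "i \<le> n div 2" by simp
    define q where "q = n - 2 * i"
    have q: "Suc n - 2 * i = Suc q" "n - 2 * i = q" using i by (simp_all add: half q_def)
    note Qm = QR_right_hmodule and Pm = P_right_hmodule
    have p0: "(\<lambda>f. f i) \<in> right_linear_maps K H (QR (Suc n)) (P (Suc q))"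
      and p1: "(\<lambda>f. f i) \<in> right_linear_maps K H (QR n) (P q)"
      using QR_proj[of i "Suc n"] QR_proj[of i n] i half(2)[OF i] q by simp_all
    have "PM.shifts_d (Suc n) (?s (Suc n) u) i = CM.bmap (P q) (dP (Suc q)) (CM.bmap (P (Suc q)) (\<lambda>f. f i) u)"
      unfolding PM.shifts_d_def CM.bal_split_def using i half(2)[OF i] by (simp add: q)
    also have "\<dots> = CM.bmap (P q) (\<lambda>f. dP (Suc q) (f i)) u"
      by (rule CM.bmap_comp[OF Qm Pm Pm p0 P_d u, symmetric])
    also have "\<dots> = CM.bmap (P q) (\<lambda>f. QR_d (Suc n) f i) u"
      by (rule CM.bmap_cong[OF Qm Pm hlinear_comp[OF p0 P_d] hlinear_comp[OF QR_d_right_linear p1] _ u])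
        (simp add: QR_d_apply[OF i] q)
    also have "\<dots> = CM.bmap (P q) (\<lambda>f. f i) (CM.bmap (QR n) (QR_d (Suc n)) u)"
      by (rule CM.bmap_comp[OF Qm Qm Pm QR_d_right_linear p1 u])
    also have "\<dots> = ?s n (CM.bmap (QR (Suc n - 1)) (QR_d (Suc n)) u) i"
      using i by (simp add: CM.bal_split_def q)
    finally show "PM.shifts_d (Suc n) (?s (Suc n) u) i = ?s n (CM.bmap (QR (Suc n - 1)) (QR_d (Suc n)) u) i" .
  qed (unfold PM.shifts_d_def CM.bal_split_def, simp_all)
  note tr = complex_transport[where f = ?s and g = ?j, OF CM.bal_complex[OF Y] m s j sj js sd]
  show "kcomplex K PM.shifts PM.shifts_d" by (rule tr(1))
  show "linearly_isomorphic K (homology (CM.balC QR) (CM.bald QR QR_d) n) (homology PM.shifts PM.shifts_d n)" by (rule tr(2))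
qed

lemma Tor_eq: "Tor K H P dP M (int n - 2 * int i) =
    (if 2 * i \<le> n then homology (CM.balC P) (CM.bald P dP) (n - 2 * i) else zero_module)"
proof (cases "2 * i \<le> n")
  case True
  then have "nat (int n - 2 * int i) = n - 2 * i" by linarith
  then show ?thesis using True by (simp add: Tor_def)
qed (simp add: Tor_def)

text \<open>
  Both complexes of projective modules resolve \<open>degrees\<close>; tensored with \<open>M\<close>, one computes cyclic homology
  and the other the sum of the Tor modules.
\<close>

theorem cyclic_homology_iso:
  "linearly_isomorphic K (HC K H M n) (direct_sum (UNIV :: nat set) (\<lambda>i. Tor K H P dP M (int n - 2 * int i)))"
proof -
  note [trans] = linearly_isomorphic_trans
  have X: "augmented_complex K H KK degrees TR (tsygan_differential CH) CH.phi"
    using TR_resolution by (rule augmented_resolution.axioms(1))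
  interpret TM: kcomplex K "CM.balC TR" "CM.bald TR (tsygan_differential CH)" by (rule CM.bal_complex[OF X])
  have "module K (homology (CM.balC TR) (CM.bald TR (tsygan_differential CH)) n)"
    unfolding TM.homology_eq by (rule quotient_space.module_Q[OF TM.homology_quotient])
  then have "linearly_isomorphic K (HC K H M n) (homology (CM.balC TR) (CM.bald TR (tsygan_differential CH)) n)"
    by (rule linearly_isomorphic_sym[OF _ TR_homology])
  also have "linearly_isomorphic K \<dots> (homology (CM.balC QR) (CM.bald QR QR_d) n)"
    by (rule CM.bal_resolutions_iso[OF TR_resolution QR_resolution])
      (simp_all add: TR_liftable QR_liftable TR_right_hmodule QR_right_hmodule)
  also have "linearly_isomorphic K \<dots> (homology PM.shifts PM.shifts_d n)" by (rule QR_homology)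
  also have "linearly_isomorphic K \<dots> (direct_sum UNIV (\<lambda>i. Tor K H P dP M (int n - 2 * int i)))"
    unfolding Tor_eq by (rule PM.homology_shifts[OF PM_shifts])
  finally show ?thesis .
qed

end

theorem theorem5p2:
  fixes K :: "'k ring" and H :: "('k, 'h) hopf" and M :: "('k, 'h, 'm) crossed"
    and P :: "nat \<Rightarrow> ('k, 'h, 'p) right_module"
    and d :: "nat \<Rightarrow> 'p \<Rightarrow> 'p" and e :: "'p \<Rightarrow> 'k" and n :: nat
  assumes "field K"
    and "\<And>j::nat. j > 0 \<Longrightarrow> [j] \<cdot>\<^bsub>K\<^esub> \<one>\<^bsub>K\<^esub> \<noteq> \<zero>\<^bsub>K\<^esub>"
    and "hopf_algebra K H"
    and "cocommutative K H"
    and "crossed_module K H M"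
    and "modular K M"
    and "trivial_coaction K H M"
    and "projective_resolution K H (trivial_right_module K H) P d e"
  shows "linearly_isomorphic K (HC K H M n)
           (direct_sum (UNIV :: nat set) (\<lambda>i. Tor K H P d M (int n - 2 * int i)))"
proof -
  have cH: "cocommutative_hopf_algebra K H"
    by (intro cocommutative_hopf_algebra.intro cocommutative_hopf_algebra_axioms.intro assms(3,4))
  have "trivial_crossed_module K H M"
    using assms(7) by (intro trivial_crossed_module.intro trivial_crossed_module_axioms.intro cH assms(5))
      (simp add: trivial_coaction_def)
  moreover have "resolved K H P d e" by (intro resolved.intro resolved_axioms.intro cH assms(8))
  ultimately have "resolved_crossed_module K H M P d e" by (rule resolved_crossed_module.intro)
  then show ?thesis by (rule resolved_crossed_module.cyclic_homology_iso)
qed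

end
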